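(* Let $\boldsymbol\varphi_\star\in \mathrm{St}(p,\boldsymbol H)$ be a ground state of the Kohn-Sham energy functional $\mathcal E$ that satisfies the Aufbau principle, and let the associated Lagrange multiplier $\Lambda_\star=\langle\!\langle \mathcal H_{\boldsymbol\varphi_\star}\boldsymbol\varphi_\star,\boldsymbol\varphi_\star\rangle\!\rangle\in\mathrm{Herm}(p)$ have the eigenvalues $\lambda_1\le\dots\le\lambda_p$. Then for all $\mu>0$, except for $\mu=\lambda_l-\lambda_m$ with $1\le m<l\le p$, there exists an open neighborhood $U_{\boldsymbol\varphi_\star}\subset \mathrm{St}(p,\boldsymbol H)$ of $\boldsymbol\varphi_\star$ such that for all $\boldsymbol\varphi\in U_{\boldsymbol\varphi_\star}$ the shift $$\Sigma_{\boldsymbol\varphi,\mu}=\Lambda_{\boldsymbol\varphi}-\mu I_p,\qquad \Lambda_{\boldsymbol\varphi}=\langle\!\langle \mathcal H_{\boldsymbol\varphi}\,\boldsymbol\varphi,\boldsymbol\varphi\rangle\!\rangle,$$ has the following property: the shifted Hamiltonian $\mathcal H_{\boldsymbol\varphi,\Sigma_{\boldsymbol\varphi,\mu}}:\boldsymbol H\to\boldsymbol H'$, $\mathcal H_{\boldsymbol\varphi,\Sigma_{\boldsymbol\varphi,\mu}}(\boldsymbol v)=\mathcal H_{\boldsymbol\varphi}\boldsymbol v-\boldsymbol v\,\Sigma_{\boldsymbol\varphi,\mu}$, is coercive with respect to $\|\cdot\|_{\boldsymbol H}$ on the tangent space $\mathrm T_{\boldsymbol\varphi}\mathrm{St}(p,\boldsymbol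 H)$ (i.e. there is $c>0$ with $\langle \mathcal H_{\boldsymbol\varphi,\Sigma_{\boldsymbol\varphi,\mu}}(\boldsymbol\eta),\boldsymbol\eta\rangle\ge c\|\boldsymbol\eta\|_{\boldsymbol H}^2$ for all $\boldsymbol\eta\in\mathrm T_{\boldsymbol\varphi}\mathrm{St}(p,\boldsymbol H)$) and is invertible on $\boldsymbol H$ (as an operator $\boldsymbol H\to\boldsymbol H'$).
   Context: Spaces. $\Omega\subset\mathbb R^3$ is a bounded convex Lipschitz domain, $p\in\mathbb N$. $L_{\mathbb C}=L^2(\Omega,\mathbb C)$ with $\langle v,w\rangle_{L_{\mathbb C}}=\int_\Omega \overline v\,w\,dx$; $H_{\mathbb C}\subset H^1(\Omega,\mathbb C)$ is a closed subspace, dense in $L_{\mathbb C}$, with $\langle v,w\rangle_{H_{\mathbb C}}=\int_\Omega (\nabla v)^*\nabla w+\overline v\,w\,dx$. $L_{\mathbb R},H_{\mathbb R}$ denote the same spaces regarded as real Hilbert spaces with the real parts of these inner products. $H_{\mathbb K}\subset L_{\mathbb K}\subset H_{\mathbb K}'$ is a Gelfand triple ($\mathbb K\in\{\mathbb R,\mathbb C\}$); the complex duality pairing $\langle\cdot,\cdot\rangle_{H_{\mathbb C}'\times H_{\mathbb C}}$ extends $\langle\cdot,\cdot\rangle_{L_{\mathbb C}}$ and is conjugate-linear in the first and linear in the second argument. $\boldsymbol H=H_{\mathbb R}^p$, $\boldsymbol L=L_{\mathbb R}^p$ (real Hilbert spaces of $p$-frames), $\boldsymbol H'=(H_{\mathbb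 R}')^p$. For a frame $\boldsymbol v=(v_1,\dots,v_p)$ and $M\in\mathbb C^{p\times p}$, $\boldsymbol vM$ is the frame with $j$-th component $\sum_i v_iM_{ij}$. Products. For $\boldsymbol v,\boldsymbol w\in\boldsymbol H$: $[\![\boldsymbol v,\boldsymbol w]\!]=[\langle v_i,w_j\rangle_{L_{\mathbb C}}]_{i,j=1}^p\in\mathbb C^{p\times p}$. For $\boldsymbol v'\in\boldsymbol H'$, $\boldsymbol w\in\boldsymbol H$: $\langle\!\langle\boldsymbol v',\boldsymbol w\rangle\!\rangle=[\langle v_i',w_j\rangle_{H_{\mathbb C}'\times H_{\mathbb C}}]_{i,j=1}^p$ and $\langle\boldsymbol v',\boldsymbol w\rangle=\mathrm{Re}\,\mathrm{tr}\,\langle\!\langle\boldsymbol v',\boldsymbol w\rangle\!\rangle$. Also $\langle\boldsymbol v,\boldsymbol w\rangle_{\boldsymbol L}=\mathrm{Re}\,\mathrm{tr}[\![\boldsymbol v,\boldsymbol w]\!]$ and $\langle\boldsymbol v,\boldsymbol w\rangle_{\boldsymbol H}=\sum_j\langle v_j,w_j\rangle_{H_{\mathbb R}}$, with induced norms. $\mathrm{Herm}(p)$ is the set of Hermitian $p\times p$ matrices, $I_p$ and $0_p$ the identity and zero matrices. Stiefel manifold. $\mathrm{St}(p,\boldsymbol H)=\{\boldsymbol\varphi\in\boldsymbol H:[\![\boldsymbol\varphi,\boldsymbol\varphi]\!]=I_p\}$ with the topology of $\boldsymbol H$, and $\mathrm T_{\boldsymbol\varphi}\mathrm{St}(p,\boldsymbol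 H)=\{\boldsymbol\eta\in\boldsymbol H:[\![\boldsymbol\varphi,\boldsymbol\eta]\!]+[\![\boldsymbol\eta,\boldsymbol\varphi]\!]=0_p\}$. Energy and Hamiltonian. With $\rho(\boldsymbol\varphi)=\sum_{j=1}^p|\varphi_j|^2$, an ionic potential $\vartheta_{\rm ion}$ and an exchange-correlation energy $\mathcal E_{\rm xc}$, $$\mathcal E(\boldsymbol\varphi)=\tfrac12\int_\Omega\sum_j\|\nabla\varphi_j\|^2dx+\int_\Omega\vartheta_{\rm ion}\,\rho(\boldsymbol\varphi)\,dx+\tfrac12\int_\Omega\int_\Omega\frac{\rho(\boldsymbol\varphi)(x)\rho(\boldsymbol\varphi)(y)}{\|x-y\|}dy\,dx+\mathcal E_{\rm xc}(\rho(\boldsymbol\varphi)).$$ The Kohn-Sham Hamiltonian $\mathcal H_{\boldsymbol\varphi}:\boldsymbol H\to\boldsymbol H'$ is the linear Hermitian operator acting component-wise by $$\mathcal H_{\boldsymbol\varphi}\boldsymbol v=-\Delta\boldsymbol v+2\vartheta_{\rm ion}\boldsymbol v+2\vartheta_H(\rho(\boldsymbol\varphi))\boldsymbol v+2\vartheta_{\rm xc}(\rho(\boldsymbol\varphi))\boldsymbol v,$$ with $\vartheta_H(\rho)=\rho\star\|\cdot\|^{-1}$ and $\vartheta_{\rm xc}(\rho)=\frac{d\mathcal E_{\rm xc}(\rho)}{d\rho}$. The real Fréchet derivative of $\mathcal E$ is $\mathrm D\mathcal E(\boldsymbol\varphi)[\boldsymbol w]=\langle\mathcal H_{\boldsymbol\varphi}\boldsymbol\varphi,\boldsymbol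 w\rangle$. Standing assumptions on the model ($\vartheta_{\rm ion}$ and $\mathcal E_{\rm xc}$ satisfy boundedness conditions guaranteeing the following): $\mathcal H_{\boldsymbol\varphi}$ is bounded (uniformly in $\boldsymbol\varphi$), depends smoothly on $\boldsymbol\varphi$, and for each $\boldsymbol\varphi\in\mathrm{St}(p,\boldsymbol H)$ there is $\sigma_{\boldsymbol\varphi}>0$ with $\langle\mathcal H_{\boldsymbol\varphi}\boldsymbol v,\boldsymbol v\rangle+\sigma_{\boldsymbol\varphi}\|\boldsymbol v\|_{\boldsymbol L}^2\ge\|\boldsymbol v\|_{\boldsymbol H}^2$ for all $\boldsymbol v\in\boldsymbol H$. Ground state and Aufbau principle. A ground state $\boldsymbol\varphi_\star$ is a global minimizer of $\mathcal E$ over $\mathrm{St}(p,\boldsymbol H)$; it satisfies $\mathcal H_{\boldsymbol\varphi_\star}\boldsymbol\varphi_\star=\boldsymbol\varphi_\star\Lambda_\star$ with the Lagrange multiplier $\Lambda_\star=\langle\!\langle\mathcal H_{\boldsymbol\varphi_\star}\boldsymbol\varphi_\star,\boldsymbol\varphi_\star\rangle\!\rangle\in\mathrm{Herm}(p)$. It satisfies the Aufbau principle if the eigenvalues of $\Lambda_\star$ are the $p$ smallest eigenvalues (counted with multiplicity) of the component-wise action $H_{\mathbb C}\to H_{\mathbb C}'$ of $\mathcal H_{\boldsymbol\varphi_\star}$. *)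

theory Defs
  imports "HOL-Analysis.Analysis" "HOL-Library.Function_Algebras" "HOL-Library.Extended_Nat"
begin

text \<open>
  Elements of \<open>L\<^sup>2\<close> and \<open>H\<^sup>1\<close> are represented by functions on \<open>real^3\<close>, of which only the values
  almost everywhere on \<open>\<Omega>\<close> matter. Norms are therefore seminorms on functions, and equality of
  elements is equality almost everywhere on \<open>\<Omega>\<close>. A \<open>p\<close>-frame is indexed by a finite type
  with \<open>p = CARD('p)\<close> elements.
\<close>

type_synonym wavefun = "real^3 \<Rightarrow> complex"
type_synonym 'p frame = "'p \<Rightarrow> wavefun"
type_synonym 'p dual_frame = "'p \<Rightarrow> wavefun \<Rightarrow> complex"


section \<open>Domain and function spaces\<close>

definition lipschitz_boundary :: "(real^3) set \<Rightarrow> bool" where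
  "lipschitz_boundary \<Omega> \<longleftrightarrow>
     (\<forall>z\<in>frontier \<Omega>. \<exists>U R \<gamma> C. open U \<and> z \<in> U \<and> orthogonal_transformation (R :: real^3 \<Rightarrow> real^3) \<and>
        C-lipschitz_on UNIV (\<gamma> :: real \<times> real \<Rightarrow> real) \<and>
        \<Omega> \<inter> U = {x\<in>U. \<gamma> (R x $ 1, R x $ 2) < R x $ 3})"

definition bounded_convex_lipschitz_domain :: "(real^3) set \<Rightarrow> bool" where
  "bounded_convex_lipschitz_domain \<Omega> \<longleftrightarrow>
     open \<Omega> \<and> \<Omega> \<noteq> {} \<and> connected \<Omega> \<and> bounded \<Omega> \<and> convex \<Omega> \<and> lipschitz_boundary \<Omega>"

definition L2 :: "(real^3) set \<Rightarrow> wavefun set" where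
  "L2 \<Omega> = {v. v \<in> borel_measurable (lebesgue_on \<Omega>) \<and>
               integrable (lebesgue_on \<Omega>) (\<lambda>x. (norm (v x))\<^sup>2)}"

definition L2_inner :: "(real^3) set \<Rightarrow> wavefun \<Rightarrow> wavefun \<Rightarrow> complex" where
  "L2_inner \<Omega> v w = (LINT x|lebesgue_on \<Omega>. cnj (v x) * w x)"

definition L2_norm :: "(real^3) set \<Rightarrow> wavefun \<Rightarrow> real" where
  "L2_norm \<Omega> v = sqrt (Re (L2_inner \<Omega> v v))"

definition partial_deriv :: "3 \<Rightarrow> (real^3 \<Rightarrow> real) \<Rightarrow> real^3 \<Rightarrow> real" where
  "partial_deriv i f x = frechet_derivative f (at x) (axis i 1)"

text \<open>Infinitely differentiable: every iterated partial derivative is differentiable everywhere.\<close>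

definition smooth_fun :: "(real^3 \<Rightarrow> real) \<Rightarrow> bool" where
  "smooth_fun f \<longleftrightarrow> (\<forall>is x. foldr partial_deriv is f differentiable (at x))"

definition test_functions :: "(real^3) set \<Rightarrow> (real^3 \<Rightarrow> real) set" where
  "test_functions \<Omega> = {\<psi>. smooth_fun \<psi> \<and> (\<exists>K. compact K \<and> K \<subseteq> \<Omega> \<and> (\<forall>x. x \<notin> K \<longrightarrow> \<psi> x = 0))}"

definition is_weak_gradient :: "(real^3) set \<Rightarrow> wavefun \<Rightarrow> (real^3 \<Rightarrow> complex^3) \<Rightarrow> bool" where
  "is_weak_gradient \<Omega> v g \<longleftrightarrow>
     (\<forall>\<psi>\<in>test_functions \<Omega>. \<forall>i.
        (LINT x|lebesgue_on \<Omega>. v x * of_real (partial_deriv i \<psi> x)) =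
        - (LINT x|lebesgue_on \<Omega>. g x $ i * of_real (\<psi> x)))"

definition H1 :: "(real^3) set \<Rightarrow> wavefun set" where
  "H1 \<Omega> = {v \<in> L2 \<Omega>. \<exists>g. (\<forall>i. (\<lambda>x. g x $ i) \<in> L2 \<Omega>) \<and> is_weak_gradient \<Omega> v g}"

text \<open>The weak gradient is unique almost everywhere on \<open>\<Omega>\<close>; we pick a representative.\<close>

definition weak_gradient :: "(real^3) set \<Rightarrow> wavefun \<Rightarrow> real^3 \<Rightarrow> complex^3" where
  "weak_gradient \<Omega> v = (SOME g. (\<forall>i. (\<lambda>x. g x $ i) \<in> L2 \<Omega>) \<and> is_weak_gradient \<Omega> v g)"

definition grad_inner :: "(real^3) set \<Rightarrow> wavefun \<Rightarrow> wavefun \<Rightarrow> complex" where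
  "grad_inner \<Omega> v w =
     (LINT x|lebesgue_on \<Omega>. (\<Sum>i\<in>UNIV. cnj (weak_gradient \<Omega> v x $ i) * weak_gradient \<Omega> w x $ i))"

definition H1_inner :: "(real^3) set \<Rightarrow> wavefun \<Rightarrow> wavefun \<Rightarrow> complex" where
  "H1_inner \<Omega> v w =
     (LINT x|lebesgue_on \<Omega>.
        (\<Sum>i\<in>UNIV. cnj (weak_gradient \<Omega> v x $ i) * weak_gradient \<Omega> w x $ i) + cnj (v x) * w x)"

definition H1_norm :: "(real^3) set \<Rightarrow> wavefun \<Rightarrow> real" where
  "H1_norm \<Omega> v = sqrt (Re (H1_inner \<Omega> v v))"

text \<open>
  Closedness is sequential closedness in the \<open>H\<^sup>1\<close> seminorm; in particular \<open>H\<close> is closed under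
  changing a function on a null set.
\<close>

definition closed_dense_subspace :: "(real^3) set \<Rightarrow> wavefun set \<Rightarrow> bool" where
  "closed_dense_subspace \<Omega> H \<longleftrightarrow>
     H \<subseteq> H1 \<Omega> \<and> (\<lambda>x. 0) \<in> H \<and>
     (\<forall>v\<in>H. \<forall>w\<in>H. \<forall>a b. (\<lambda>x. a * v x + b * w x) \<in> H) \<and>
     (\<forall>u v. (\<forall>n::nat. u n \<in> H) \<longrightarrow> v \<in> H1 \<Omega> \<longrightarrow> (\<lambda>n. H1_norm \<Omega> (u n - v)) \<longlonglongrightarrow> 0 \<longrightarrow> v \<in> H) \<and>
     (\<forall>v\<in>L2 \<Omega>. \<forall>e>0. \<exists>w\<in>H. L2_norm \<Omega> (v - w) < e)"


section \<open>Frames and dual frames\<close>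

definition frames :: "wavefun set \<Rightarrow> 'p frame set" where
  "frames H = {v. \<forall>j. v j \<in> H}"

definition gram :: "(real^3) set \<Rightarrow> 'p::finite frame \<Rightarrow> 'p frame \<Rightarrow> complex^'p^'p" where
  "gram \<Omega> v w = (\<chi> i j. L2_inner \<Omega> (v i) (w j))"

definition frame_L_norm :: "(real^3) set \<Rightarrow> 'p::finite frame \<Rightarrow> real" where
  "frame_L_norm \<Omega> v = sqrt (Re (trace (gram \<Omega> v v)))"

definition frame_H_norm :: "(real^3) set \<Rightarrow> 'p::finite frame \<Rightarrow> real" where
  "frame_H_norm \<Omega> v = sqrt (\<Sum>j\<in>UNIV. Re (H1_inner \<Omega> (v j) (v j)))"

definition frame_mult :: "'p::finite frame \<Rightarrow> complex^'p^'p \<Rightarrow> 'p frame" where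
  "frame_mult v M = (\<lambda>j x. \<Sum>i\<in>UNIV. v i x * M $ i $ j)"

text \<open>
  An element \<open>f\<close> of the dual space is given by the functional \<open>w \<mapsto> \<langle>f, w\<rangle>\<close>, i.e. the duality pairing,
  which is complex linear in its second argument. A bounded real linear functional on \<open>H\<close>
  is the real part of exactly one such complex linear functional, which is how the real dual and
  the complex dual are identified. Only the values on \<open>H\<close> matter.
\<close>

definition dual :: "(real^3) set \<Rightarrow> wavefun set \<Rightarrow> (wavefun \<Rightarrow> complex) set" where
  "dual \<Omega> H = {f. (\<forall>v\<in>H. \<forall>w\<in>H. \<forall>a b. f (\<lambda>x. a * v x + b * w x) = a * f v + b * f w) \<and>
                  (\<exists>C. \<forall>v\<in>H. norm (f v) \<le> C * H1_norm \<Omega> v)}"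

definition dual_frames :: "(real^3) set \<Rightarrow> wavefun set \<Rightarrow> 'p dual_frame set" where
  "dual_frames \<Omega> H = {f. \<forall>j. f j \<in> dual \<Omega> H}"

definition dual_eq :: "wavefun set \<Rightarrow> 'p dual_frame \<Rightarrow> 'p dual_frame \<Rightarrow> bool" where
  "dual_eq H f g \<longleftrightarrow> (\<forall>j. \<forall>w\<in>H. f j w = g j w)"

text \<open>The inclusion of the Gelfand triple.\<close>

definition embed :: "(real^3) set \<Rightarrow> 'p frame \<Rightarrow> 'p dual_frame" where
  "embed \<Omega> v = (\<lambda>j w. L2_inner \<Omega> (v j) w)"

definition dual_gram :: "'p::finite dual_frame \<Rightarrow> 'p frame \<Rightarrow> complex^'p^'p" where
  "dual_gram f w = (\<chi> i j. f i (w j))"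

definition dual_pair :: "'p::finite dual_frame \<Rightarrow> 'p frame \<Rightarrow> real" where
  "dual_pair f w = Re (trace (dual_gram f w))"

definition dual_norm :: "(real^3) set \<Rightarrow> wavefun set \<Rightarrow> 'p::finite dual_frame \<Rightarrow> real" where
  "dual_norm \<Omega> H f = (SUP w\<in>{w \<in> frames H. frame_H_norm \<Omega> w \<le> 1}. \<bar>dual_pair f w\<bar>)"


section \<open>Stiefel manifold\<close>

definition stiefel :: "(real^3) set \<Rightarrow> wavefun set \<Rightarrow> 'p::finite frame set" where
  "stiefel \<Omega> H = {\<phi> \<in> frames H. gram \<Omega> \<phi> \<phi> = mat 1}"

definition tangent :: "(real^3) set \<Rightarrow> wavefun set \<Rightarrow> 'p::finite frame \<Rightarrow> 'p frame set" where
  "tangent \<Omega> H \<phi> = {\<eta> \<in> frames H. gram \<Omega> \<phi> \<eta> + gram \<Omega> \<eta> \<phi> = 0}"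

definition open_in_stiefel :: "(real^3) set \<Rightarrow> wavefun set \<Rightarrow> 'p::finite frame set \<Rightarrow> bool" where
  "open_in_stiefel \<Omega> H U \<longleftrightarrow>
     U \<subseteq> stiefel \<Omega> H \<and>
     (\<forall>\<phi>\<in>U. \<exists>e>0. \<forall>\<psi>\<in>stiefel \<Omega> H. frame_H_norm \<Omega> (\<psi> - \<phi>) < e \<longrightarrow> \<psi> \<in> U)"


section \<open>Energy and Hamiltonian\<close>

definition density :: "'p::finite frame \<Rightarrow> real^3 \<Rightarrow> real" where
  "density \<phi> x = (\<Sum>j\<in>UNIV. (norm (\<phi> j x))\<^sup>2)"

definition hartree :: "(real^3) set \<Rightarrow> (real^3 \<Rightarrow> real) \<Rightarrow> real^3 \<Rightarrow> real" where
  "hartree \<Omega> \<rho> x = (LINT y|lebesgue_on \<Omega>. \<rho> y / norm (x - y))"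

definition energy ::
  "(real^3) set \<Rightarrow> (real^3 \<Rightarrow> real) \<Rightarrow> ((real^3 \<Rightarrow> real) \<Rightarrow> real) \<Rightarrow> 'p::finite frame \<Rightarrow> real" where
  "energy \<Omega> v\<^sub>i\<^sub>o\<^sub>n E\<^sub>x\<^sub>c \<phi> =
     1/2 * (LINT x|lebesgue_on \<Omega>. (\<Sum>j\<in>UNIV. (norm (weak_gradient \<Omega> (\<phi> j) x))\<^sup>2)) +
     (LINT x|lebesgue_on \<Omega>. v\<^sub>i\<^sub>o\<^sub>n x * density \<phi> x) +
     1/2 * (LINT x|lebesgue_on \<Omega>. (LINT y|lebesgue_on \<Omega>. density \<phi> x * density \<phi> y / norm (x - y))) +
     E\<^sub>x\<^sub>c (density \<phi>)"

text \<open>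
  The component-wise action of the Hamiltonian. The operator \<open>-\<Delta>\<close> from \<open>H\<close> to its dual is
  the weak one, \<open>v \<mapsto> (w \<mapsto> \<integral> (\<nabla>v)\<^sup>* \<nabla>w)\<close>.
\<close>

definition hamiltonian1 ::
  "(real^3) set \<Rightarrow> (real^3 \<Rightarrow> real) \<Rightarrow> ((real^3 \<Rightarrow> real) \<Rightarrow> real^3 \<Rightarrow> real) \<Rightarrow> 'p::finite frame \<Rightarrow>
   wavefun \<Rightarrow> wavefun \<Rightarrow> complex" where
  "hamiltonian1 \<Omega> v\<^sub>i\<^sub>o\<^sub>n v\<^sub>x\<^sub>c \<phi> v w =
     grad_inner \<Omega> v w +
     (LINT x|lebesgue_on \<Omega>. of_real (2 * v\<^sub>i\<^sub>o\<^sub>n x) * (cnj (v x) * w x)) +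
     (LINT x|lebesgue_on \<Omega>. of_real (2 * hartree \<Omega> (density \<phi>) x) * (cnj (v x) * w x)) +
     (LINT x|lebesgue_on \<Omega>. of_real (2 * v\<^sub>x\<^sub>c (density \<phi>) x) * (cnj (v x) * w x))"

definition hamiltonian ::
  "(real^3) set \<Rightarrow> (real^3 \<Rightarrow> real) \<Rightarrow> ((real^3 \<Rightarrow> real) \<Rightarrow> real^3 \<Rightarrow> real) \<Rightarrow> 'p::finite frame \<Rightarrow>
   'p frame \<Rightarrow> 'p dual_frame" where
  "hamiltonian \<Omega> v\<^sub>i\<^sub>o\<^sub>n v\<^sub>x\<^sub>c \<phi> v = (\<lambda>j. hamiltonian1 \<Omega> v\<^sub>i\<^sub>o\<^sub>n v\<^sub>x\<^sub>c \<phi> (v j))"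

definition multiplier ::
  "(real^3) set \<Rightarrow> (real^3 \<Rightarrow> real) \<Rightarrow> ((real^3 \<Rightarrow> real) \<Rightarrow> real^3 \<Rightarrow> real) \<Rightarrow> 'p::finite frame \<Rightarrow>
   complex^'p^'p" where
  "multiplier \<Omega> v\<^sub>i\<^sub>o\<^sub>n v\<^sub>x\<^sub>c \<phi> = dual_gram (hamiltonian \<Omega> v\<^sub>i\<^sub>o\<^sub>n v\<^sub>x\<^sub>c \<phi> \<phi>) \<phi>"

definition shift ::
  "(real^3) set \<Rightarrow> (real^3 \<Rightarrow> real) \<Rightarrow> ((real^3 \<Rightarrow> real) \<Rightarrow> real^3 \<Rightarrow> real) \<Rightarrow> 'p::finite frame \<Rightarrow> real \<Rightarrow>
   complex^'p^'p" where
  "shift \<Omega> v\<^sub>i\<^sub>o\<^sub>n v\<^sub>x\<^sub>c \<phi> \<mu> = multiplier \<Omega> v\<^sub>i\<^sub>o\<^sub>n v\<^sub>x\<^sub>c \<phi> - mat (of_real \<mu>)"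

definition shifted_hamiltonian ::
  "(real^3) set \<Rightarrow> (real^3 \<Rightarrow> real) \<Rightarrow> ((real^3 \<Rightarrow> real) \<Rightarrow> real^3 \<Rightarrow> real) \<Rightarrow> 'p::finite frame \<Rightarrow>
   complex^'p^'p \<Rightarrow> 'p frame \<Rightarrow> 'p dual_frame" where
  "shifted_hamiltonian \<Omega> v\<^sub>i\<^sub>o\<^sub>n v\<^sub>x\<^sub>c \<phi> S v =
     hamiltonian \<Omega> v\<^sub>i\<^sub>o\<^sub>n v\<^sub>x\<^sub>c \<phi> v - embed \<Omega> (frame_mult v S)"

text \<open>
  \<open>is_xc_potential\<close>: \<open>v\<^sub>x\<^sub>c(\<rho>)\<close> is the functional derivative of \<open>E\<^sub>x\<^sub>c\<close> at \<open>\<rho>\<close>. Since densities are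
  nonnegative, the variation is one-sided, in the direction of another density.
  The first two conditions say that \<open>E\<^sub>x\<^sub>c\<close> and \<open>v\<^sub>x\<^sub>c\<close> act on almost-everywhere classes of functions on \<open>\<Omega>\<close>.
\<close>

definition is_xc_potential ::
  "(real^3) set \<Rightarrow> wavefun set \<Rightarrow> ((real^3 \<Rightarrow> real) \<Rightarrow> real) \<Rightarrow>
   ((real^3 \<Rightarrow> real) \<Rightarrow> real^3 \<Rightarrow> real) \<Rightarrow> 'p::finite itself \<Rightarrow> bool" where
  "is_xc_potential \<Omega> H E\<^sub>x\<^sub>c v\<^sub>x\<^sub>c p \<longleftrightarrow>
     (\<forall>\<rho> \<rho>'. (AE x in lebesgue_on \<Omega>. \<rho> x = \<rho>' x) \<longrightarrow>
        E\<^sub>x\<^sub>c \<rho> = E\<^sub>x\<^sub>c \<rho>' \<and> (AE x in lebesgue_on \<Omega>. v\<^sub>x\<^sub>c \<rho> x = v\<^sub>x\<^sub>c \<rho>' x)) \<and>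
     (\<forall>\<phi>\<in>(frames H :: 'p frame set). \<forall>\<psi>\<in>(frames H :: 'p frame set).
        ((\<lambda>t. E\<^sub>x\<^sub>c (\<lambda>x. density \<phi> x + t * density \<psi> x)) has_real_derivative
           (LINT x|lebesgue_on \<Omega>. v\<^sub>x\<^sub>c (density \<phi>) x * density \<psi> x)) (at 0 within {0..}))"

text \<open>The three potential terms of the Hamiltonian are given by absolutely convergent integrals.\<close>

definition potentials_well_defined ::
  "(real^3) set \<Rightarrow> wavefun set \<Rightarrow> (real^3 \<Rightarrow> real) \<Rightarrow>
   ((real^3 \<Rightarrow> real) \<Rightarrow> real^3 \<Rightarrow> real) \<Rightarrow> 'p::finite itself \<Rightarrow> bool" where
  "potentials_well_defined \<Omega> H v\<^sub>i\<^sub>o\<^sub>n v\<^sub>x\<^sub>c p \<longleftrightarrow>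
     (\<forall>\<phi>\<in>(frames H :: 'p frame set).
        \<forall>V\<in>{v\<^sub>i\<^sub>o\<^sub>n, hartree \<Omega> (density \<phi>), v\<^sub>x\<^sub>c (density \<phi>)}.
          V \<in> borel_measurable (lebesgue_on \<Omega>) \<and>
          (\<forall>v\<in>H. \<forall>w\<in>H. integrable (lebesgue_on \<Omega>) (\<lambda>x. of_real (V x) * (cnj (v x) * w x))))"

text \<open>Real Frechet differentiability on the Hilbert space of frames.\<close>

definition has_frame_derivative ::
  "(real^3) set \<Rightarrow> wavefun set \<Rightarrow> ('p::finite frame \<Rightarrow> real) \<Rightarrow> ('p frame \<Rightarrow> real) \<Rightarrow> 'p frame \<Rightarrow> bool" where
  "has_frame_derivative \<Omega> H E L \<phi> \<longleftrightarrow>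
     (\<forall>e>0. \<exists>d>0. \<forall>w\<in>frames H. frame_H_norm \<Omega> w < d \<longrightarrow>
        \<bar>E (\<phi> + w) - E \<phi> - L w\<bar> \<le> e * frame_H_norm \<Omega> w)"

text \<open>
  Smoothness of the map \<open>\<phi> \<mapsto> F \<phi>\<close> from frames into the bounded operators from frames to dual
  frames, with the operator norm. \<open>D \<phi> [h\<^sub>1, \<dots>, h\<^sub>n] v w\<close> is \<open>\<langle>D\<^sup>nF(\<phi>)[h\<^sub>1, \<dots>, h\<^sub>n] v, w\<rangle>\<close>, the newest
  direction at the head of the list; each derivative is Frechet, i.e. its remainder is small
  uniformly over the remaining arguments in the unit ball. Linearity in the other slots is inherited
  from lower order.
\<close>

definition smooth_operator_map ::
  "(real^3) set \<Rightarrow> wavefun set \<Rightarrow> ('p::finite frame \<Rightarrow> 'p frame \<Rightarrow> 'p dual_frame) \<Rightarrow> bool" where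
  "smooth_operator_map \<Omega> H F \<longleftrightarrow>
     (\<exists>D :: 'p frame \<Rightarrow> 'p frame list \<Rightarrow> 'p frame \<Rightarrow> 'p frame \<Rightarrow> real.
        (\<forall>\<phi>\<in>frames H. \<forall>v\<in>frames H. \<forall>w\<in>frames H. D \<phi> [] v w = dual_pair (F \<phi> v) w) \<and>
        (\<forall>\<phi>\<in>frames H. \<forall>h\<in>frames H. \<forall>k\<in>frames H. \<forall>a b :: real.
           \<forall>hs\<in>lists (frames H). \<forall>v\<in>frames H. \<forall>w\<in>frames H.
             D \<phi> ((\<lambda>j x. of_real a * h j x + of_real b * k j x) # hs) v w =
             a * D \<phi> (h # hs) v w + b * D \<phi> (k # hs) v w) \<and>
        (\<forall>\<phi>\<in>frames H. \<forall>n. \<exists>C. \<forall>hs\<in>lists (frames H). length hs = n \<longrightarrow>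
           (\<forall>v\<in>frames H. \<forall>w\<in>frames H.
              \<bar>D \<phi> hs v w\<bar> \<le>
                C * prod_list (map (frame_H_norm \<Omega>) hs) * frame_H_norm \<Omega> v * frame_H_norm \<Omega> w)) \<and>
        (\<forall>\<phi>\<in>frames H. \<forall>n. \<forall>e>0. \<exists>d>0. \<forall>h\<in>frames H. frame_H_norm \<Omega> h < d \<longrightarrow>
           (\<forall>hs\<in>lists (frames H). length hs = n \<longrightarrow>
              (\<forall>v\<in>frames H. \<forall>w\<in>frames H.
                 \<bar>D (\<phi> + h) hs v w - D \<phi> hs v w - D \<phi> (h # hs) v w\<bar> \<le>
                   e * frame_H_norm \<Omega> h * prod_list (map (frame_H_norm \<Omega>) hs)
                     * frame_H_norm \<Omega> v * frame_H_norm \<Omega> w))))"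


section \<open>Ground states, eigenvalues, and the Aufbau principle\<close>

definition ground_state ::
  "(real^3) set \<Rightarrow> wavefun set \<Rightarrow> ('p::finite frame \<Rightarrow> real) \<Rightarrow> 'p frame \<Rightarrow> bool" where
  "ground_state \<Omega> H E \<phi> \<longleftrightarrow> \<phi> \<in> stiefel \<Omega> H \<and> (\<forall>\<psi>\<in>stiefel \<Omega> H. E \<phi> \<le> E \<psi>)"

text \<open>
  \<open>l 1 \<le> \<dots> \<le> l p\<close> are the (real) eigenvalues of \<open>M\<close>, counted with multiplicity as roots of the
  characteristic polynomial.
\<close>

definition ordered_eigenvalues :: "complex^'p^'p \<Rightarrow> (nat \<Rightarrow> real) \<Rightarrow> bool" where
  "ordered_eigenvalues M l \<longleftrightarrow>
     mono_on {1..CARD('p)} l \<and>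
     (\<forall>z. det (mat z - M) = (\<Prod>i\<in>{1..CARD('p)}. z - of_real (l i)))"

definition eigenspace ::
  "(real^3) set \<Rightarrow> wavefun set \<Rightarrow> (wavefun \<Rightarrow> wavefun \<Rightarrow> complex) \<Rightarrow> real \<Rightarrow> wavefun set" where
  "eigenspace \<Omega> H T \<kappa> = {v\<in>H. \<forall>w\<in>H. T v w = L2_inner \<Omega> (\<lambda>x. of_real \<kappa> * v x) w}"

text \<open>
  The complex dimension of the eigenspace, modulo equality almost everywhere; it is zero if \<open>\<kappa>\<close>
  is not an eigenvalue.
\<close>

definition eig_multiplicity ::
  "(real^3) set \<Rightarrow> wavefun set \<Rightarrow> (wavefun \<Rightarrow> wavefun \<Rightarrow> complex) \<Rightarrow> real \<Rightarrow> enat" where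
  "eig_multiplicity \<Omega> H T \<kappa> =
     Sup {enat n | n. \<exists>v :: nat \<Rightarrow> wavefun. (\<forall>i<n. v i \<in> eigenspace \<Omega> H T \<kappa>) \<and>
            (\<forall>c. (AE x in lebesgue_on \<Omega>. (\<Sum>i<n. c i * v i x) = 0) \<longrightarrow> (\<forall>i<n. c i = 0))}"

text \<open>
  For \<open>l 1 \<le> \<dots> \<le> l n\<close>: these are the first \<open>n\<close> terms of the nondecreasing enumeration, with
  multiplicity, of the eigenvalues of \<open>T\<close>. Every eigenvalue below \<open>l n\<close> is listed as often as
  its multiplicity, and \<open>l n\<close> itself at most that often.
\<close>

definition smallest_eigenvalues ::
  "(real^3) set \<Rightarrow> wavefun set \<Rightarrow> (wavefun \<Rightarrow> wavefun \<Rightarrow> complex) \<Rightarrow> nat \<Rightarrow> (nat \<Rightarrow> real) \<Rightarrow> bool" where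
  "smallest_eigenvalues \<Omega> H T n l \<longleftrightarrow>
     (\<forall>\<kappa>. enat (card {i\<in>{1..n}. l i = \<kappa>}) \<le> eig_multiplicity \<Omega> H T \<kappa>) \<and>
     (\<forall>\<kappa><l n. enat (card {i\<in>{1..n}. l i = \<kappa>}) = eig_multiplicity \<Omega> H T \<kappa>)"

definition aufbau ::
  "(real^3) set \<Rightarrow> wavefun set \<Rightarrow> (real^3 \<Rightarrow> real) \<Rightarrow> ((real^3 \<Rightarrow> real) \<Rightarrow> real^3 \<Rightarrow> real) \<Rightarrow>
   'p::finite frame \<Rightarrow> bool" where
  "aufbau \<Omega> H v\<^sub>i\<^sub>o\<^sub>n v\<^sub>x\<^sub>c \<phi> \<longleftrightarrow>
     (\<exists>l. ordered_eigenvalues (multiplier \<Omega> v\<^sub>i\<^sub>o\<^sub>n v\<^sub>x\<^sub>c \<phi>) l \<and>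
          smallest_eigenvalues \<Omega> H (hamiltonian1 \<Omega> v\<^sub>i\<^sub>o\<^sub>n v\<^sub>x\<^sub>c \<phi>) CARD('p) l)"


section \<open>Coercivity and invertibility\<close>

definition coercive_on ::
  "(real^3) set \<Rightarrow> 'p::finite frame set \<Rightarrow> ('p frame \<Rightarrow> 'p dual_frame) \<Rightarrow> bool" where
  "coercive_on \<Omega> X T \<longleftrightarrow> (\<exists>c>0. \<forall>\<eta>\<in>X. dual_pair (T \<eta>) \<eta> \<ge> c * (frame_H_norm \<Omega> \<eta>)\<^sup>2)"

text \<open>Bijective from frames (modulo equality a.e.) onto dual frames, with bounded inverse.\<close>

definition invertible_operator ::
  "(real^3) set \<Rightarrow> wavefun set \<Rightarrow> ('p::finite frame \<Rightarrow> 'p dual_frame) \<Rightarrow> bool" where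
  "invertible_operator \<Omega> H T \<longleftrightarrow>
     (\<forall>v\<in>frames H. T v \<in> dual_frames \<Omega> H) \<and>
     (\<forall>v\<in>frames H. \<forall>w\<in>frames H. dual_eq H (T v) (T w) \<longrightarrow>
        (\<forall>j. AE x in lebesgue_on \<Omega>. v j x = w j x)) \<and>
     (\<forall>f\<in>dual_frames \<Omega> H. \<exists>v\<in>frames H. dual_eq H (T v) f) \<and>
     (\<exists>C. \<forall>v\<in>frames H. frame_H_norm \<Omega> v \<le> C * dual_norm \<Omega> H (T v))"

end

theory Submission
  imports Defs "HOL-Library.Diagonal_Subsequence"
begin

text \<open>
  Work with the Hermitian form \<open>a\<close> of the Hamiltonian at the ground state and rotate frames by a unitary
  matrix that diagonalises the multiplier. By the Euler-Lagrange equation the rotated ground state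
  consists of orthonormal eigenvectors with eigenvalues \<open>d j\<close>. The embedding of \<open>H\<close> into \<open>L\<^sup>2\<close> is compact
  (on a convex domain the Poincare inequality holds on every cell of a grid), so on the orthogonal
  complement of these eigenvectors the infimum of the Rayleigh quotient is attained whenever it is below
  the largest \<open>d j\<close>, which the Aufbau principle forbids; hence \<open>a\<close> is bounded below there by
  the largest \<open>d j\<close>.
  In rotated coordinates the shifted Hamiltonian acts on component \<open>j\<close> as the Hamiltonian minus \<open>d j - \<mu>\<close>,
  a number below the gap that is no eigenvalue, which gives an inf-sup estimate. On a tangent vector the
  matrix of coefficients along the ground state is skew-Hermitian, so the contributions of \<open>d i - d j\<close> cancel
  and \<open>\<mu>\<close> is left. Both estimates are stable under small perturbations in the energy norm.
\<close>

section \<open>Symmetric forms\<close>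

text \<open>Only classes of functions modulo null sets matter, so every norm is a seminorm. The
  Hilbert space theory is therefore developed for positive semidefinite forms on carrier sets:
  limits are not unique, and equality becomes distance zero. The obstacle to invertibility is
  indefiniteness. The numbers \<open>d j - \<mu>\<close> may lie between eigenvalues, so no
  coercivity on all of \<open>H\<close> can be expected and an inf-sup condition takes its place.
  The largest eigenvalue of the multiplier may coincide with the next one of the Hamiltonian. This
  does no harm: since \<open>\<mu> > 0\<close>, the number \<open>d j - \<mu>\<close> stays strictly
  below it, and it is an eigenvalue only if it equals some \<open>d i\<close>, which is the origin
  of the excluded differences. Coercivity is asked on a tangent space that moves with the frame. A
  vector tangent at a nearby frame is only nearly skew along the ground state, so the estimate
  carries a defect \<open>r\<close> that is absorbed at the end. Weak derivatives see only test
  functions with compact support in the domain. Convexity keeps segments inside it, so the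
  compactness argument needs no extension of weak derivatives across the boundary.\<close>

instantiation "fun" :: (type, real_vector) real_vector
begin

text \<open>Scaling is pointwise, so wave functions and, by using the instance twice, frames become
  real vector spaces. The lemmas on real forms then apply to both.\<close>

definition scaleR_fun :: "real \<Rightarrow> ('a \<Rightarrow> 'b) \<Rightarrow> 'a \<Rightarrow> 'b" where
  "scaleR_fun r f = (\<lambda>x. r *\<^sub>R f x)"

instance
  by standard (auto simp: scaleR_fun_def fun_eq_iff algebra_simps)

end

lemma scaleR_fun_apply [simp]: "(r *\<^sub>R f) x = r *\<^sub>R f x"
  by (simp add: scaleR_fun_def)

text \<open>First-order optimality: near \<open>t = 0\<close> a nonzero linear term dominates the
  quadratic one. The test value \<open>- b / k\<close> with \<open>k > a\<close> makes this
  quantitative, whatever the sign of \<open>a\<close>.\<close>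

lemma linear_term_zero:
  fixes a b :: real
  assumes "\<And>t. 0 \<le> t * b + t\<^sup>2 * a"
  shows "b = 0"
proof (rule ccontr)
  assume b: "b \<noteq> 0"
  define k where "k = \<bar>a\<bar> + 1"
  have k: "k > 0" "a < k" by (auto simp: k_def)
  have "0 \<le> (- b / k) * b + (- b / k)\<^sup>2 * a" using assms .
  also have "\<dots> = (a - k) * (b / k)\<^sup>2"
    using k by (simp add: power2_eq_square divide_simps) (simp add: algebra_simps)
  also have "\<dots> < 0"
    using b k by (intro mult_neg_pos) auto
  finally show False by simp
qed

lemma tendsto_zero_squeeze:
  fixes f g :: "nat \<Rightarrow> real"
  assumes "g \<longlonglongrightarrow> 0" "\<And>n. 0 \<le> f n" "\<And>n. f n \<le> g n"
  shows "f \<longlonglongrightarrow> 0"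
  using tendsto_sandwich[of "\<lambda>_. 0" f sequentially g 0] assms by simp

text \<open>The carrier is a set and not a type because forms are needed on several subspaces: on
  \<open>H\<close>, on the orthogonal complement of finitely many eigenvectors, and on frames.
  Linearity is assumed in the second argument only; symmetry supplies the first.\<close>

locale sym_form =
  fixes V :: "'a::real_vector set" and s :: "'a \<Rightarrow> 'a \<Rightarrow> real"
  assumes sub: "subspace V"
    and add_right: "u \<in> V \<Longrightarrow> v \<in> V \<Longrightarrow> w \<in> V \<Longrightarrow> s u (v + w) = s u v + s u w"
    and scale_right: "u \<in> V \<Longrightarrow> v \<in> V \<Longrightarrow> s u (r *\<^sub>R v) = r * s u v"
    and sym: "u \<in> V \<Longrightarrow> v \<in> V \<Longrightarrow> s u v = s v u"
begin

lemma mem [simp, intro]: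
  shows "0 \<in> V"
    and "u \<in> V \<Longrightarrow> v \<in> V \<Longrightarrow> u + v \<in> V"
    and "u \<in> V \<Longrightarrow> v \<in> V \<Longrightarrow> u - v \<in> V"
    and "u \<in> V \<Longrightarrow> r *\<^sub>R u \<in> V"
  using sub by (auto intro: subspace_0 subspace_add subspace_diff subspace_scale)

lemma add_left: "u \<in> V \<Longrightarrow> v \<in> V \<Longrightarrow> w \<in> V \<Longrightarrow> s (u + v) w = s u w + s v w"
  using add_right[of w u v] sym by simp

lemma scale_left: "u \<in> V \<Longrightarrow> v \<in> V \<Longrightarrow> s (r *\<^sub>R u) v = r * s u v"
  using scale_right[of v u r] sym by simp

lemma diff_right: "u \<in> V \<Longrightarrow> v \<in> V \<Longrightarrow> w \<in> V \<Longrightarrow> s u (v - w) = s u v - s u w"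
  using add_right[of u "v - w" w] by simp

lemma diff_left: "u \<in> V \<Longrightarrow> v \<in> V \<Longrightarrow> w \<in> V \<Longrightarrow> s (u - v) w = s u w - s v w"
  using diff_right[of w u v] sym by simp

lemma zero_right: "u \<in> V \<Longrightarrow> s u 0 = 0"
  using scale_right[of u u 0] by simp

lemmas bilin = add_left add_right scale_left scale_right diff_left diff_right

lemma square_add: "u \<in> V \<Longrightarrow> v \<in> V \<Longrightarrow> s (u + v) (u + v) = s u u + 2 * s u v + s v v"
  by (simp add: bilin sym[of v u])

lemma square_diff: "u \<in> V \<Longrightarrow> v \<in> V \<Longrightarrow> s (u - v) (u - v) = s u u - 2 * s u v + s v v"
  by (simp add: bilin sym[of v u])

lemma square_scale: "u \<in> V \<Longrightarrow> s (r *\<^sub>R u) (r *\<^sub>R u) = r\<^sup>2 * s u u"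
  by (simp add: bilin power2_eq_square)

end

text \<open>Semidefinite rather than definite: functions that differ on a null set have distance
  zero without being equal.\<close>

locale psd_form = sym_form +
  assumes nonneg: "v \<in> V \<Longrightarrow> 0 \<le> s v v"
begin

text \<open>The usual minimiser \<open>t = s u v / s v v\<close> is available only if
  \<open>s v v\<close> is positive. If \<open>s v v = 0\<close>, the form is affine in
  \<open>r\<close> along \<open>(1/2) u + r v\<close>, and an affine function bounded below has
  slope zero.\<close>

lemma Cauchy_Schwarz: 
  assumes u: "u \<in> V" and v: "v \<in> V"
  shows "(s u v)\<^sup>2 \<le> s u u * s v v"
proof (cases "s v v = 0")
  case True
  have "0 \<le> t * (2 * s u v) + t\<^sup>2 * 0" for t
  proof -
    have "0 \<le> s ((1/2) *\<^sub>R u + r *\<^sub>R v) ((1/2) *\<^sub>R u + r *\<^sub>R v)" for r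
      using u v by (intro nonneg) auto
    moreover have "s ((1/2) *\<^sub>R u + r *\<^sub>R v) ((1/2) *\<^sub>R u + r *\<^sub>R v) = s u u / 4 + r * s u v" for r
      using u v True by (simp add: square_add square_scale scale_left scale_right power2_eq_square)
    ultimately have *: "0 \<le> s u u / 4 + r * s u v" for r by metis
    show ?thesis
    proof (rule ccontr)
      assume "\<not> ?thesis"
      hence n: "s u v \<noteq> 0" by auto
      show False using *[of "- (s u u / 4 + 1) / s u v"] n by (simp add: field_simps)
    qed
  qed
  hence "2 * s u v = 0" by (rule linear_term_zero)
  then show ?thesis by (simp add: True)
next
  case False
  hence p: "s v v > 0" using nonneg[OF v] by simp
  define t where "t = s u v / s v v"
  have "0 \<le> s (u - t *\<^sub>R v) (u - t *\<^sub>R v)" using u v by (intro nonneg) auto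
  also have "\<dots> = s u u - 2 * (t * s u v) + t\<^sup>2 * s v v"
    using u v by (simp add: square_diff scale_left scale_right power2_eq_square)
  also have "\<dots> = s u u - (s u v)\<^sup>2 / s v v"
    using p by (simp add: t_def field_simps power2_eq_square)
  finally show ?thesis using p by (simp add: field_simps)
qed

lemma Cauchy_Schwarz_sqrt:
  assumes "u \<in> V" "v \<in> V"
  shows "\<bar>s u v\<bar> \<le> sqrt (s u u) * sqrt (s v v)"
  using Cauchy_Schwarz[OF assms] real_sqrt_le_mono[of "(s u v)\<^sup>2" "s u u * s v v"]
  by (simp add: real_sqrt_mult)

lemma triangle:
  assumes u: "u \<in> V" and v: "v \<in> V"
  shows "sqrt (s (u + v) (u + v)) \<le> sqrt (s u u) + sqrt (s v v)"
proof (rule real_le_lsqrt)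
  show "s (u + v) (u + v) \<le> (sqrt (s u u) + sqrt (s v v))\<^sup>2"
    using Cauchy_Schwarz_sqrt[OF u v] nonneg[OF u] nonneg[OF v] u v
    by (simp add: square_add power2_sum)
qed (use nonneg u v in auto)

lemma square_le_double:
  assumes u: "u \<in> V" and v: "v \<in> V"
  shows "s (u + v) (u + v) \<le> 2 * s u u + 2 * s v v"
    and "s (u - v) (u - v) \<le> 2 * s u u + 2 * s v v"
proof -
  have "0 \<le> s (u - v) (u - v)" "0 \<le> s (u + v) (u + v)" using u v by (auto intro: nonneg)
  thus "s (u + v) (u + v) \<le> 2 * s u u + 2 * s v v"
    "s (u - v) (u - v) \<le> 2 * s u u + 2 * s v v"
    using u v by (simp_all add: square_add square_diff)
qed

lemma tendsto_form:
  assumes u: "\<And>n. u n \<in> V" and v: "v \<in> V" and w: "w \<in> V"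
    and lim: "(\<lambda>n. s (u n - v) (u n - v)) \<longlonglongrightarrow> 0"
  shows "(\<lambda>n. s (u n) w) \<longlonglongrightarrow> s v w"
proof -
  have "(\<lambda>n. sqrt (s (u n - v) (u n - v)) * sqrt (s w w)) \<longlonglongrightarrow> sqrt 0 * sqrt (s w w)"
    by (intro tendsto_intros lim)
  hence "(\<lambda>n. \<bar>s (u n - v) w\<bar>) \<longlonglongrightarrow> 0"
    using u v w by (intro tendsto_zero_squeeze[OF _ _ Cauchy_Schwarz_sqrt]) simp_all
  hence "(\<lambda>n. s (u n - v) w) \<longlonglongrightarrow> 0" by (rule tendsto_rabs_zero_cancel)
  thus ?thesis using u v w by (simp add: diff_left LIM_zero_iff)
qed

lemma tendsto_square:
  assumes u: "\<And>n. u n \<in> V" and v: "v \<in> V"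
    and lim: "(\<lambda>n. s (u n - v) (u n - v)) \<longlonglongrightarrow> 0"
  shows "(\<lambda>n. s (u n) (u n)) \<longlonglongrightarrow> s v v"
proof -
  have "(\<lambda>n. s (u n - v) (u n - v) + 2 * s (u n) v - s v v) \<longlonglongrightarrow> 0 + 2 * s v v - s v v"
    by (intro tendsto_intros lim tendsto_form u v)
  thus ?thesis using u v by (simp add: square_diff)
qed

end

section \<open>Completeness, Riesz representation, and equations under an inf-sup condition\<close>

definition form_Cauchy :: "('a::real_vector \<Rightarrow> 'a \<Rightarrow> real) \<Rightarrow> (nat \<Rightarrow> 'a) \<Rightarrow> bool" where
  "form_Cauchy s u \<longleftrightarrow> (\<forall>e>0. \<exists>N. \<forall>m\<ge>N. \<forall>n\<ge>N. s (u m - u n) (u m - u n) < e)"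

definition form_complete :: "'a::real_vector set \<Rightarrow> ('a \<Rightarrow> 'a \<Rightarrow> real) \<Rightarrow> bool" where
  "form_complete V s \<longleftrightarrow>
     (\<forall>u. (\<forall>n. u n \<in> V) \<longrightarrow> form_Cauchy s u \<longrightarrow> (\<exists>v\<in>V. (\<lambda>n. s (u n - v) (u n - v)) \<longlonglongrightarrow> 0))"

text \<open>One criterion for all later uses: with \<open>t = 0\<close> it turns the parallelogram
  law into convergence of minimising sequences, with \<open>A = 0\<close> it transfers the Cauchy
  property to a weaker form, and with both terms present it upgrades \<open>L\<close>-Cauchy to
  \<open>N\<close>-Cauchy by a Garding inequality.\<close>

lemma form_Cauchy_le:
  assumes "\<And>m n. s (u m - u n) (u m - u n) \<le> A m + A n + B * t (u m - u n) (u m - u n)"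
    and A: "A \<longlonglongrightarrow> 0" and t: "form_Cauchy t u" and B: "B \<ge> 0"
  shows "form_Cauchy s u"
  unfolding form_Cauchy_def
proof safe
  fix e :: real assume e: "e > 0"
  have "eventually (\<lambda>n. A n < e / 3) sequentially"
    using A e by (intro order_tendstoD(2)[OF A]) auto
  then obtain N1 where N1: "\<And>n. n \<ge> N1 \<Longrightarrow> A n < e / 3"
    by (auto simp: eventually_sequentially)
  have "e / (3 * (B + 1)) > 0" using e B by simp
  then obtain N2 where N2: "\<And>m n. m \<ge> N2 \<Longrightarrow> n \<ge> N2 \<Longrightarrow> t (u m - u n) (u m - u n) < e / (3 * (B + 1))"
    using t unfolding form_Cauchy_def by meson
  show "\<exists>N. \<forall>m\<ge>N. \<forall>n\<ge>N. s (u m - u n) (u m - u n) < e"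
  proof (intro exI[of _ "max N1 N2"] allI impI)
    fix m n assume mn: "max N1 N2 \<le> m" "max N1 N2 \<le> n"
    have "B * t (u m - u n) (u m - u n) \<le> B * (e / (3 * (B + 1)))"
      using N2[of m n] mn B by (intro mult_left_mono) auto
    also have "\<dots> \<le> e / 3" using B e by (simp add: field_simps)
    finally show "s (u m - u n) (u m - u n) < e"
      using assms(1)[of m n] N1[of m] N1[of n] mn by simp
  qed
qed

text \<open>The representer minimises \<open>J v = s v v - 2 * f v\<close>, which is bounded below
  by \<open>- C\<^sup>2\<close> after completing the square. A minimising sequence converges, and
  the first-order condition at its limit is the representation.\<close>

lemma Riesz_representation:
  fixes f :: "'a::real_vector \<Rightarrow> real"
  assumes "psd_form V s" and complete: "form_complete V s"
    and f_add: "\<And>v w. v \<in> V \<Longrightarrow> w \<in> V \<Longrightarrow> f (v + w) = f v + f w"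
    and f_scale: "\<And>r v. v \<in> V \<Longrightarrow> f (r *\<^sub>R v) = r * f v"
    and f_bound: "\<And>v. v \<in> V \<Longrightarrow> \<bar>f v\<bar> \<le> C * sqrt (s v v)"
  shows "\<exists>v\<in>V. \<forall>w\<in>V. s v w = f w"
proof -
  interpret psd_form V s by fact
  define J where "J v = s v v - 2 * f v" for v
  have J_ge: "J v \<ge> - C\<^sup>2" if "v \<in> V" for v
  proof -
    have "f v \<le> C * sqrt (s v v)" using f_bound[OF that] by simp
    moreover have "0 \<le> (sqrt (s v v) - C)\<^sup>2" by simp
    moreover have "(sqrt (s v v) - C)\<^sup>2 = s v v - 2 * (C * sqrt (s v v)) + C\<^sup>2"
      using nonneg[OF that] by (simp add: power2_diff)
    ultimately show ?thesis by (simp add: J_def)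
  qed
  define m where "m = Inf (J ` V)"
  have bdd: "bdd_below (J ` V)" using J_ge by (auto intro!: bdd_belowI)
  have m_le: "m \<le> J v" if "v \<in> V" for v
    unfolding m_def using that bdd by (intro cINF_lower) auto
  have "\<exists>v\<in>V. J v < m + inverse (real (Suc n))" for n
    using cInf_lessD[of "J ` V" "m + inverse (real (Suc n))"] mem(1) by (force simp: m_def)
  then obtain u where u: "\<And>n. u n \<in> V" and Ju: "\<And>n. J (u n) < m + inverse (real (Suc n))"
    by metis
  have "form_Cauchy s u"
  proof (rule form_Cauchy_le[where A = "\<lambda>n. 2 * inverse (real (Suc n))" and B = 0 and t = "\<lambda>_ _. 0"])
    fix k n
    \<comment> \<open>Parallelogram law: the midpoint of two almost minimisers would lie below the
      infimum unless they were close to each other.\<close>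
    have "m \<le> J ((1/2) *\<^sub>R (u k + u n))" using u by (intro m_le) auto
    also have "\<dots> = (J (u k) + J (u n)) / 2 - s (u k - u n) (u k - u n) / 4"
      using u by (simp add: J_def square_scale square_add square_diff f_scale f_add power2_eq_square
          scale_left scale_right field_simps)
    finally show "s (u k - u n) (u k - u n) \<le> 2 * inverse (real (Suc k)) + 2 * inverse (real (Suc n)) + 0 * 0"
      using Ju[of k] Ju[of n] by argo
  next
    show "(\<lambda>n. 2 * inverse (real (Suc n))) \<longlonglongrightarrow> 0"
      using tendsto_mult[OF tendsto_const LIMSEQ_inverse_real_of_nat, of 2] by simp
  qed (auto simp: form_Cauchy_def)
  then obtain v where v: "v \<in> V" and lim: "(\<lambda>n. s (u n - v) (u n - v)) \<longlonglongrightarrow> 0"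
    using complete u unfolding form_complete_def by blast
  have "s v w = f w" if w: "w \<in> V" for w
  proof -
    \<comment> \<open>The competitor \<open>u n + t w\<close> is compared with \<open>u n\<close>
      before the limit is taken. Only terms linear in \<open>u n\<close> have to converge, so
      \<open>J\<close> is never evaluated at the limit.\<close>
    have "0 \<le> t * (2 * (s v w - f w)) + t\<^sup>2 * s w w" for t
    proof (rule LIMSEQ_le_const)
      have "(\<lambda>n. t * (2 * (s (u n) w - f w)) + t\<^sup>2 * s w w + inverse (real (Suc n)))
          \<longlonglongrightarrow> t * (2 * (s v w - f w)) + t\<^sup>2 * s w w + 0"
        by (intro tendsto_add tendsto_mult tendsto_diff tendsto_const tendsto_form[OF u v w lim]
            LIMSEQ_inverse_real_of_nat)
      thus "(\<lambda>n. t * (2 * (s (u n) w - f w)) + t\<^sup>2 * s w w + inverse (real (Suc n)))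
          \<longlonglongrightarrow> t * (2 * (s v w - f w)) + t\<^sup>2 * s w w" by simp
      have "0 \<le> t * (2 * (s (u n) w - f w)) + t\<^sup>2 * s w w + inverse (real (Suc n))" for n
      proof -
        have "m \<le> J (u n + t *\<^sub>R w)" using u w by (intro m_le) auto
        also have "\<dots> = J (u n) + t * (2 * (s (u n) w - f w)) + t\<^sup>2 * s w w"
          using u w by (simp add: J_def square_add f_add f_scale scale_left scale_right power2_eq_square algebra_simps)
        finally show ?thesis using Ju[of n] by simp
      qed
      thus "\<exists>N. \<forall>n\<ge>N. 0 \<le> t * (2 * (s (u n) w - f w)) + t\<^sup>2 * s w w + inverse (real (Suc n))"
        by blast
    qed
    hence "2 * (s v w - f w) = 0" by (rule linear_term_zero)
    thus ?thesis by simp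
  qed
  thus ?thesis using v by blast
qed

text \<open>Let \<open>R\<close> represent \<open>B\<close> through \<open>N\<close>. By boundedness
  and inf-sup, \<open>N (R v) (R w)\<close> is a form equivalent to \<open>N\<close>, hence
  complete, so the normal equation \<open>R (R v) = R g\<close> is solvable by the Riesz theorem,
  where \<open>g\<close> represents \<open>f\<close>. The inf-sup condition makes \<open>R\<close>
  injective up to null vectors, hence \<open>R v\<close> agrees with \<open>g\<close>. Symmetry of
  \<open>B\<close> makes \<open>R\<close> self-adjoint.\<close>

lemma inf_sup_solvable:
  fixes f :: "'a::real_vector \<Rightarrow> real"
  assumes "psd_form V N" and complete: "form_complete V N" and "sym_form V B"
    and B_bound: "\<And>v w. v \<in> V \<Longrightarrow> w \<in> V \<Longrightarrow> \<bar>B v w\<bar> \<le> M * sqrt (N v v) * sqrt (N w w)"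
    and c: "c > 0" and K: "K > 0"
    and inf_sup: "\<And>v. v \<in> V \<Longrightarrow> \<exists>w\<in>V. sqrt (N w w) \<le> K * sqrt (N v v) \<and> c * N v v \<le> B v w"
    and f_add: "\<And>v w. v \<in> V \<Longrightarrow> w \<in> V \<Longrightarrow> f (v + w) = f v + f w"
    and f_scale: "\<And>r v. v \<in> V \<Longrightarrow> f (r *\<^sub>R v) = r * f v"
    and f_bound: "\<And>v. v \<in> V \<Longrightarrow> \<bar>f v\<bar> \<le> C * sqrt (N v v)"
  shows "\<exists>v\<in>V. \<forall>w\<in>V. B v w = f w"
proof -
  interpret N: psd_form V N by fact
  interpret B: sym_form V B by fact
  have "\<exists>r\<in>V. \<forall>w\<in>V. N r w = B v w" if "v \<in> V" for v
    by (rule Riesz_representation[where C = "M * sqrt (N v v)"])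
      (use that complete B_bound in \<open>auto simp: B.bilin N.psd_form_axioms\<close>)
  then obtain R where R: "\<And>v. v \<in> V \<Longrightarrow> R v \<in> V"
    and NR: "\<And>v w. v \<in> V \<Longrightarrow> w \<in> V \<Longrightarrow> N (R v) w = B v w"
    by metis
  \<comment> \<open>The form of the normal equation; it equals \<open>N (R v) (R w)\<close>, from
    which symmetry and positivity are visible.\<close>
  define s where "s v w = B v (R w)" for v w
  have s_N: "s v w = N (R v) (R w)" if "v \<in> V" "w \<in> V" for v w
    using that R NR by (simp add: s_def)
  have s_N': "s v w = B w (R v)" if "v \<in> V" "w \<in> V" for v w
    using that R NR N.sym[of "R v" "R w"] by (simp add: s_N)
  interpret s: psd_form V s
  proof
    show "s u (v + w) = s u v + s u w" if "u \<in> V" "v \<in> V" "w \<in> V" for u v w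
      using that R by (simp add: s_N' B.bilin)
    show "s u (r *\<^sub>R v) = r * s u v" if "u \<in> V" "v \<in> V" for u v r
      using that R by (simp add: s_N' B.bilin)
    show "s u v = s v u" if "u \<in> V" "v \<in> V" for u v
      using that R by (simp add: s_N N.sym)
    show "0 \<le> s v v" if "v \<in> V" for v
      using that R by (simp add: s_N N.nonneg)
  qed (rule N.sub)
  have lower: "c * sqrt (N v v) \<le> K * sqrt (s v v)" if v: "v \<in> V" for v
  proof -
    obtain w where w: "w \<in> V" "sqrt (N w w) \<le> K * sqrt (N v v)" "c * N v v \<le> B v w"
      using inf_sup[OF v] by blast
    have "c * N v v \<le> N (R v) w" using w v by (simp add: NR)
    also have "\<dots> \<le> sqrt (s v v) * sqrt (N w w)"
      using N.Cauchy_Schwarz_sqrt[of "R v" w] R v w by (simp add: s_N)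
    also have "\<dots> \<le> sqrt (s v v) * (K * sqrt (N v v))"
      using w s.nonneg[OF v] by (intro mult_left_mono) auto
    finally have *: "(c * sqrt (N v v)) * sqrt (N v v) \<le> (K * sqrt (s v v)) * sqrt (N v v)"
      using N.nonneg[OF v] by (simp add: mult_ac)
    show ?thesis
    proof (cases "N v v = 0")
      case False
      hence "sqrt (N v v) > 0" using N.nonneg[OF v] by simp
      thus ?thesis using * by (simp add: mult_le_cancel_right)
    qed (use K s.nonneg[OF v] in auto)
  qed
  have lower2: "N v v \<le> (K / c)\<^sup>2 * s v v" if v: "v \<in> V" for v
  proof -
    have "sqrt (N v v) \<le> (K / c) * sqrt (s v v)" using lower[OF v] c by (simp add: field_simps)
    hence "(sqrt (N v v))\<^sup>2 \<le> ((K / c) * sqrt (s v v))\<^sup>2"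
      using N.nonneg[OF v] by (intro power_mono) auto
    thus ?thesis using N.nonneg[OF v] s.nonneg[OF v] by (simp add: power_mult_distrib power_divide)
  qed
  have upper2: "s v v \<le> M\<^sup>2 * N v v" if v: "v \<in> V" for v
  proof -
    have "s v v \<le> (M * sqrt (N v v)) * sqrt (s v v)"
      using B_bound[of v "R v"] v R[OF v] s_N[OF v v] by (simp add: s_def)
    hence "sqrt (s v v) * sqrt (s v v) \<le> (M * sqrt (N v v)) * sqrt (s v v)"
      using s.nonneg[OF v] by simp
    hence "sqrt (s v v) = 0 \<or> sqrt (s v v) \<le> M * sqrt (N v v)"
      using s.nonneg[OF v] unfolding mult_le_cancel_right by (auto simp: less_le)
    hence "s v v = 0 \<or> sqrt (s v v) \<le> M * sqrt (N v v)" by simp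
    thus ?thesis
    proof
      assume "sqrt (s v v) \<le> M * sqrt (N v v)"
      hence "(sqrt (s v v))\<^sup>2 \<le> (M * sqrt (N v v))\<^sup>2" 
        using s.nonneg[OF v] by (intro power_mono) auto
      thus ?thesis using N.nonneg[OF v] s.nonneg[OF v] by (simp add: power_mult_distrib power_divide)
    qed (use N.nonneg[OF v] in auto)
  qed
  have s_complete: "form_complete V s"
    unfolding form_complete_def
  proof (intro allI impI)
    fix u :: "nat \<Rightarrow> 'a" assume u: "\<forall>n. u n \<in> V" and Cauchy: "form_Cauchy s u"
    have "form_Cauchy N u"
    proof (rule form_Cauchy_le[OF _ tendsto_const Cauchy])
      show "N (u m - u n) (u m - u n) \<le> 0 + 0 + (K / c)\<^sup>2 * s (u m - u n) (u m - u n)" for m n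
        using lower2[of "u m - u n"] u by simp
    qed simp
    then obtain v where v: "v \<in> V" "(\<lambda>n. N (u n - v) (u n - v)) \<longlonglongrightarrow> 0"
      using complete u unfolding form_complete_def by blast
    have "(\<lambda>n. M\<^sup>2 * N (u n - v) (u n - v)) \<longlonglongrightarrow> M\<^sup>2 * 0"
      by (intro tendsto_intros v)
    hence "(\<lambda>n. s (u n - v) (u n - v)) \<longlonglongrightarrow> 0"
      using u v by (intro tendsto_zero_squeeze[OF _ s.nonneg upper2]) simp_all
    thus "\<exists>v\<in>V. (\<lambda>n. s (u n - v) (u n - v)) \<longlonglongrightarrow> 0" using v by blast
  qed
  obtain g where g: "g \<in> V" "\<And>w. w \<in> V \<Longrightarrow> N g w = f w"
    using Riesz_representation[OF \<open>psd_form V N\<close> complete f_add f_scale f_bound] by blast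
  \<comment> \<open>The normal equation \<open>R (R v) = R g\<close>, tested with \<open>w\<close>.
    Its right-hand side is bounded in the form \<open>s\<close> because it equals
    \<open>N (R w) g\<close>.\<close>
  have "\<exists>v\<in>V. \<forall>w\<in>V. s v w = B w g"
  proof (rule Riesz_representation[where C = "sqrt (N g g)"])
    show "\<bar>B v g\<bar> \<le> sqrt (N g g) * sqrt (s v v)" if "v \<in> V" for v
      using N.Cauchy_Schwarz_sqrt[of "R v" g] that g R by (simp add: NR s_N mult.commute)
  qed (use g s_complete s.psd_form_axioms in \<open>auto simp: B.bilin\<close>)
  then obtain v where v: "v \<in> V" "\<And>w. w \<in> V \<Longrightarrow> s v w = B w g" by blast
  have "N (R v - g) (R v - g) = 0"
  proof -
    have d: "R v - g \<in> V" using R v g by auto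
    \<comment> \<open>The residual is \<open>B\<close>-orthogonal to everything, so its own inf-sup
      test vector forces its seminorm to vanish.\<close>
    have "B (R v - g) w = 0" if "w \<in> V" for w
      using that v g R s_N'[of v w] by (simp add: B.diff_right B.sym[of _ w])
    hence "c * N (R v - g) (R v - g) \<le> 0" using inf_sup[OF d] by fastforce
    thus ?thesis using c N.nonneg[OF d] by (simp add: mult_le_0_iff)
  qed
  hence "N (R v - g) w = 0" if "w \<in> V" for w
    using N.Cauchy_Schwarz[of "R v - g" w] R v g that by simp
  hence "B v w = f w" if "w \<in> V" for w
    using that R v g NR[of v w] by (simp add: N.diff_left)
  thus ?thesis using v by blast
qed

text \<open>The vector \<open>v0\<close> puts the infimum \<open>\<kappa>\<close> of the Rayleigh
  quotient below \<open>l\<close>. Compactness gives an \<open>L\<close>-Cauchy minimising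
  subsequence, and the Garding inequality makes it \<open>N\<close>-Cauchy. The limit is a null
  vector of the nonnegative form \<open>q = a - \<kappa> L\<close>, so Cauchy-Schwarz for
  \<open>q\<close> yields the eigenvalue equation without differentiating under the
  constraint.\<close>

lemma Rayleigh_minimizer:
  fixes a L N :: "'a::real_vector \<Rightarrow> 'a \<Rightarrow> real"
  assumes "psd_form V N" and complete: "form_complete V N" and "psd_form V L" and "sym_form V a"
    and L_le: "\<And>v. v \<in> V \<Longrightarrow> L v v \<le> N v v"
    and a_bound: "\<And>v. v \<in> V \<Longrightarrow> a v v \<le> C * N v v"
    and garding: "\<And>v. v \<in> V \<Longrightarrow> N v v \<le> a v v + \<sigma> * L v v"
    and compact: "\<And>u K. (\<forall>n. u n \<in> V) \<Longrightarrow> (\<forall>n. N (u n) (u n) \<le> K) \<Longrightarrow>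
       \<exists>r. strict_mono (r :: nat \<Rightarrow> nat) \<and> form_Cauchy L (u \<circ> r)"
    and v0: "v0 \<in> V" "a v0 v0 < l * L v0 v0"
  shows "\<exists>v\<in>V. \<exists>\<kappa><l. L v v = 1 \<and> (\<forall>w\<in>V. a v w = \<kappa> * L v w)"
proof -
  interpret N: psd_form V N by fact
  interpret L: psd_form V L by fact
  interpret a: sym_form V a by fact
  define S where "S = {v \<in> V. L v v = 1}"
  have normalize: "(1 / sqrt (L v v)) *\<^sub>R v \<in> S \<and>
      a ((1 / sqrt (L v v)) *\<^sub>R v) ((1 / sqrt (L v v)) *\<^sub>R v) = a v v / L v v"
    if "v \<in> V" "L v v > 0" for v
    using that by (simp add: S_def L.square_scale a.square_scale power_divide N.mem)
  have L_pos: "L v v > 0 \<or> a v v \<ge> 0 \<and> L v v = 0" if "v \<in> V" for v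
    using L.nonneg[OF that] N.nonneg[OF that] garding[OF that] by (cases "L v v = 0") auto
  define \<kappa> where "\<kappa> = Inf ((\<lambda>v. a v v) ` S)"
  have bdd: "bdd_below ((\<lambda>v. a v v) ` S)"
  proof (rule bdd_belowI2)
    fix v assume "v \<in> S"
    hence "v \<in> V" "L v v = 1" by (auto simp: S_def)
    with garding[of v] N.nonneg[of v] show "- \<sigma> \<le> a v v" by simp
  qed
  have \<kappa>_le: "\<kappa> \<le> a v v" if "v \<in> S" for v
    unfolding \<kappa>_def using that bdd by (intro cINF_lower) auto
  have Lv0: "L v0 v0 > 0" using L_pos[OF v0(1)] v0(2) by auto
  have \<kappa>: "\<kappa> < l"
  proof -
    have "\<kappa> \<le> a v0 v0 / L v0 v0"
      using \<kappa>_le normalize[OF v0(1) Lv0] by metis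
    also have "\<dots> < l" using v0(2) Lv0 by (simp add: field_simps)
    finally show ?thesis .
  qed
  \<comment> \<open>Nonnegative because \<open>\<kappa>\<close> is the infimum; vectors with
    \<open>L v v = 0\<close> are handled by the Garding inequality. Its null vectors are exactly the
    eigenvectors for \<open>\<kappa>\<close>.\<close>
  define q where "q v w = a v w - \<kappa> * L v w" for v w
  have q_nonneg: "0 \<le> q v v" if "v \<in> V" for v
  proof (cases "L v v > 0")
    case True
    have "\<kappa> \<le> a v v / L v v" using \<kappa>_le normalize[OF that True] by metis
    thus ?thesis using True by (simp add: q_def field_simps)
  qed (use L_pos[OF that] in \<open>auto simp: q_def\<close>)
  interpret q: psd_form V q
  proof
    show "0 \<le> q v v" if "v \<in> V" for v by (rule q_nonneg[OF that])
  qed (auto simp: q_def a.bilin L.bilin a.sym L.sym algebra_simps N.sub)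
  have "\<exists>v\<in>S. a v v < \<kappa> + inverse (real (Suc n))" for n
    using cInf_lessD[of "(\<lambda>v. a v v) ` S" "\<kappa> + inverse (real (Suc n))"] normalize[OF v0(1) Lv0]
    by (auto simp: \<kappa>_def)
  then obtain u where u: "\<And>n. u n \<in> S" and au: "\<And>n. a (u n) (u n) < \<kappa> + inverse (real (Suc n))"
    by metis
  have uV: "u n \<in> V" and Lu: "L (u n) (u n) = 1" for n using u by (auto simp: S_def)
  have qu: "q (u n) (u n) < inverse (real (Suc n))" for n
    using au[of n] Lu by (simp add: q_def)
  have "N (u n) (u n) \<le> \<kappa> + 1 + \<sigma>" for n
  proof -
    have "inverse (real (Suc n)) \<le> 1" by (simp add: field_simps)
    thus ?thesis using garding[OF uV[of n]] au[of n] Lu by simp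
  qed
  then obtain r :: "nat \<Rightarrow> nat" where r: "strict_mono r" "form_Cauchy L (u \<circ> r)"
    using compact[of u] uV by blast
  define x where "x = u \<circ> r"
  have xV: "x n \<in> V" and Lx: "L (x n) (x n) = 1" for n by (auto simp: x_def uV Lu)
  have qx0: "q (x n) (x n) \<le> inverse (real (Suc n))" for n
  proof -
    have "n \<le> r n" using r(1) by (rule seq_suble)
    hence "inverse (real (Suc (r n))) \<le> inverse (real (Suc n))" by (simp add: field_simps)
    thus ?thesis using qu[of "r n"] unfolding x_def o_def by linarith
  qed
  have qlim: "(\<lambda>n. q (x n) (x n)) \<longlonglongrightarrow> 0"
    using xV by (intro tendsto_zero_squeeze[OF LIMSEQ_inverse_real_of_nat q.nonneg qx0])
  \<comment> \<open>By the Garding inequality \<open>N\<close> is at most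
    \<open>q + (\<kappa> + \<sigma>) L\<close>. The \<open>q\<close> part of a difference is small
    because \<open>q (x n) (x n)\<close> tends to zero, the \<open>L\<close> part because of
    compactness.\<close>
  have "form_Cauchy N x"
  proof (rule form_Cauchy_le[where t = L])
    fix m n
    have d: "x m - x n \<in> V" using xV by auto
    have "N (x m - x n) (x m - x n) \<le> q (x m - x n) (x m - x n) + (\<kappa> + \<sigma>) * L (x m - x n) (x m - x n)"
      using garding[OF d] by (simp add: q_def algebra_simps)
    also have "q (x m - x n) (x m - x n) \<le> 2 * q (x m) (x m) + 2 * q (x n) (x n)"
      using xV by (intro q.square_le_double)
    also have "(\<kappa> + \<sigma>) * L (x m - x n) (x m - x n) \<le> \<bar>\<kappa> + \<sigma>\<bar> * L (x m - x n) (x m - x n)"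
      using L.nonneg[OF d] by (intro mult_right_mono) auto
    finally show "N (x m - x n) (x m - x n) \<le>
        2 * q (x m) (x m) + 2 * q (x n) (x n) + \<bar>\<kappa> + \<sigma>\<bar> * L (x m - x n) (x m - x n)" by simp
  next
    show "(\<lambda>n. 2 * q (x n) (x n)) \<longlonglongrightarrow> 0" using tendsto_mult[OF tendsto_const qlim, of 2] by simp
  qed (use r in \<open>auto simp: x_def\<close>)
  then obtain v where v: "v \<in> V" and lim: "(\<lambda>n. N (x n - v) (x n - v)) \<longlonglongrightarrow> 0"
    using complete xV unfolding form_complete_def by blast
  have Llim: "(\<lambda>n. L (x n - v) (x n - v)) \<longlonglongrightarrow> 0"
    using xV v by (intro tendsto_zero_squeeze[OF lim L.nonneg L_le]) auto
  have Lv: "L v v = 1"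
    using L.tendsto_square[OF xV v Llim] Lx by (simp add: LIMSEQ_const_iff)
  \<comment> \<open>Continuity of \<open>q\<close> along the sequence: the upper bound on
    \<open>a\<close> is what makes \<open>q\<close> of the error tend to zero.\<close>
  have "(\<lambda>n. C * N (x n - v) (x n - v) - \<kappa> * L (x n - v) (x n - v)) \<longlonglongrightarrow> C * 0 - \<kappa> * 0"
    by (intro tendsto_intros lim Llim)
  moreover have "q (x n - v) (x n - v) \<le> C * N (x n - v) (x n - v) - \<kappa> * L (x n - v) (x n - v)" for n
    using a_bound[of "x n - v"] xV[of n] v by (simp add: q_def)
  ultimately have "(\<lambda>n. q (x n - v) (x n - v)) \<longlonglongrightarrow> 0"
    using xV v by (intro tendsto_zero_squeeze[OF _ q.nonneg]) simp_all
  from q.tendsto_square[OF xV v this] have "q v v = 0"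
    using qlim by (rule LIMSEQ_unique)
  hence "q v w = 0" if "w \<in> V" for w using q.Cauchy_Schwarz[OF v that] by simp
  thus ?thesis using v Lv \<kappa> by (intro bexI[of _ v] exI[of _ \<kappa>]) (auto simp: q_def)
qed

section \<open>Test functions\<close>

text \<open>Smoothness as a greatest fixed point: a function is smooth if it has a derivative that
  is smooth. Closure properties then follow by exhibiting a class of functions that is closed under
  differentiation.\<close>

coinductive smooth1 :: "(real \<Rightarrow> real) \<Rightarrow> bool" where
  smooth1I: "(\<And>x. (f has_real_derivative f' x) (at x)) \<Longrightarrow> smooth1 f' \<Longrightarrow> smooth1 f"

lemma smooth1E:
  assumes "smooth1 f"
  obtains f' where "\<And>x. (f has_real_derivative f' x) (at x)" "smooth1 f'"
  using assms by (cases rule: smooth1.cases) blast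

text \<open>The class has to admit a constant factor, because each differentiation multiplies by
  \<open>a\<close>.\<close>

lemma smooth1_affine:
  assumes "smooth1 f"
  shows "smooth1 (\<lambda>t. f (a * t + b))"
proof -
  let ?X = "\<lambda>h. \<exists>c g. h = (\<lambda>t. c * g (a * t + b)) \<and> smooth1 g"
  have "?X (\<lambda>t. f (a * t + b))"
    using assms by (intro exI[of _ 1] exI[of _ f]) auto
  thus ?thesis
  proof (rule smooth1.coinduct[of ?X])
    fix h assume "?X h"
    then obtain c g where h: "h = (\<lambda>t. c * g (a * t + b))" and g: "smooth1 g" by blast
    obtain g' where g': "\<And>x. (g has_real_derivative g' x) (at x)" "smooth1 g'"
      using smooth1E[OF g] by blast
    have "(h has_real_derivative (c * a) * g' (a * x + b)) (at x)" for x
      unfolding h by (rule derivative_eq_intros DERIV_chain2[OF g'(1)] refl | simp)+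
    thus "\<exists>f f'. h = f \<and> (\<forall>x. (f has_real_derivative f' x) (at x)) \<and> (?X f' \<or> smooth1 f')"
      using g' by (intro exI[of _ h] exI[of _ "\<lambda>x. (c * a) * g' (a * x + b)"]) blast
  qed
qed

text \<open>Products alone are not closed under differentiation; finite sums of products are, by the
  product rule. A list of factor pairs represents such a sum.\<close>

lemma smooth1_mult:
  assumes "smooth1 f" "smooth1 g"
  shows "smooth1 (\<lambda>t. f t * g t)"
proof -
  let ?X = "\<lambda>h. \<exists>xs. h = (\<lambda>t. \<Sum>(f, g)\<leftarrow>xs. f t * g t) \<and> (\<forall>(f, g)\<in>set xs. smooth1 f \<and> smooth1 g)"
  have "?X (\<lambda>t. f t * g t)"
    using assms by (intro exI[of _ "[(f, g)]"]) auto
  thus ?thesis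
  proof (rule smooth1.coinduct[of ?X])
    fix h assume "?X h"
    then obtain xs where h: "h = (\<lambda>t. \<Sum>(f, g)\<leftarrow>xs. f t * g t)"
      and xs: "\<forall>(f, g)\<in>set xs. smooth1 f \<and> smooth1 g" by blast
    have "\<exists>ys. (\<forall>x. ((\<lambda>t. \<Sum>(f, g)\<leftarrow>xs. f t * g t) has_real_derivative
        (\<Sum>(f, g)\<leftarrow>ys. f x * g x)) (at x)) \<and> (\<forall>(f, g)\<in>set ys. smooth1 f \<and> smooth1 g)"
      using xs
    proof (induction xs)
      case Nil
      show ?case by (intro exI[of _ "[]"]) auto
    next
      case (Cons p xs)
      obtain f g where p: "p = (f, g)" by force
      obtain ys where ys: "\<And>x. ((\<lambda>t. \<Sum>(f, g)\<leftarrow>xs. f t * g t) has_real_derivative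
        (\<Sum>(f, g)\<leftarrow>ys. f x * g x)) (at x)" "\<forall>(f, g)\<in>set ys. smooth1 f \<and> smooth1 g"
        using Cons by auto
      obtain f' where f': "\<And>x. (f has_real_derivative f' x) (at x)" "smooth1 f'"
        using Cons.prems p smooth1E[of f] by auto
      obtain g' where g': "\<And>x. (g has_real_derivative g' x) (at x)" "smooth1 g'"
        using Cons.prems p smooth1E[of g] by auto
      have "((\<lambda>t. f t * g t + (\<Sum>(f, g)\<leftarrow>xs. f t * g t)) has_real_derivative
          f' x * g x + (f x * g' x + (\<Sum>(f, g)\<leftarrow>ys. f x * g x))) (at x)" for x
        by (rule derivative_eq_intros f' g' ys refl)+ (simp add: algebra_simps)
      thus ?case
        using ys f' g' Cons.prems p by (intro exI[of _ "(f', g) # (f, g') # ys"]) auto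
    qed
    then obtain ys where "\<forall>x. (h has_real_derivative (\<Sum>(f, g)\<leftarrow>ys. f x * g x)) (at x)"
      "\<forall>(f, g)\<in>set ys. smooth1 f \<and> smooth1 g" unfolding h by blast
    thus "\<exists>f f'. h = f \<and> (\<forall>x. (f has_real_derivative f' x) (at x)) \<and> (?X f' \<or> smooth1 f')"
      by (intro exI[of _ h] exI[of _ "\<lambda>x. \<Sum>(f, g)\<leftarrow>ys. f x * g x"]) blast
  qed
qed

definition flat_exp :: "real \<Rightarrow> real" where
  "flat_exp t = (if t > 0 then exp (- inverse t) else 0)"

lemma flat_exp_bounds: "0 \<le> flat_exp t" "flat_exp t \<le> 1"
  by (auto simp: flat_exp_def)

lemma flat_exp_eq_0_iff: "flat_exp t = 0 \<longleftrightarrow> t \<le> 0"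
  by (auto simp: flat_exp_def)

lemma poly_times_exp_tendsto_0:
  "((\<lambda>y. poly p y * exp (- y)) \<longlongrightarrow> (0::real)) at_top"
proof -
  have "((\<lambda>y. \<Sum>i\<le>degree p. coeff p i * (y ^ i / exp y)) \<longlongrightarrow> (\<Sum>i\<le>degree p. coeff p i * 0)) at_top"
    by (intro tendsto_intros tendsto_power_div_exp_0)
  thus ?thesis
    by (simp add: poly_altdef exp_minus sum_distrib_right divide_inverse mult.assoc)
qed

text \<open>The class of functions \<open>poly p (1/t) * exp (- 1/t)\<close>, extended by zero for
  \<open>t\<close> up to 0, is closed under differentiation, and \<open>p = 1\<close> is the
  function in question.\<close>

lemma smooth1_flat_exp: "smooth1 flat_exp"
proof -
  define E where "E p t = (if t > 0 then poly p (inverse t) * exp (- inverse t) else 0)" for p and t :: real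
  have "flat_exp = E 1" by (auto simp: E_def flat_exp_def fun_eq_iff)
  moreover have "smooth1 (E p)" for p
  proof (coinduction arbitrary: p rule: smooth1.coinduct)
    case (smooth1 p)
    \<comment> \<open>With \<open>y = 1/t\<close>, whose derivative is \<open>- y\<^sup>2\<close>,
      the chain rule turns \<open>p(y) exp(-y)\<close> into
      \<open>y\<^sup>2 (p(y) - p'(y)) exp(-y)\<close>.\<close>
    define q where "q = [:0, 0, 1:] * (p - pderiv p)"
    have "(E p has_real_derivative E q t) (at t)" for t
    proof -
      consider "t > 0" | "t < 0" | "t = 0" by linarith
      thus ?thesis
      proof cases
        case 1
        have inv: "(inverse has_real_derivative - (inverse t)\<^sup>2) (at t)"
          using DERIV_inverse[of t] 1 by (simp add: numeral_2_eq_2)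
        have "((\<lambda>t. poly p (inverse t) * exp (- inverse t)) has_real_derivative
            poly (pderiv p) (inverse t) * (- (inverse t)\<^sup>2) * exp (- inverse t) +
            exp (- inverse t) * - (- (inverse t)\<^sup>2) * poly p (inverse t)) (at t)"
          by (intro DERIV_mult DERIV_chain2[OF poly_DERIV inv] DERIV_chain2[OF DERIV_exp] DERIV_minus inv)
        also have "poly (pderiv p) (inverse t) * (- (inverse t)\<^sup>2) * exp (- inverse t) +
            exp (- inverse t) * - (- (inverse t)\<^sup>2) * poly p (inverse t) = E q t"
          using 1 by (simp add: E_def q_def power2_eq_square algebra_simps)
        finally have "((\<lambda>t. poly p (inverse t) * exp (- inverse t)) has_real_derivative E q t) (at t)" .
        moreover have "eventually (\<lambda>s. s > 0) (nhds t)"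
          using 1 eventually_nhds_in_open[of "{0<..}" t] by auto
        hence "eventually (\<lambda>s. E p s = poly p (inverse s) * exp (- inverse s)) (nhds t)"
          by eventually_elim (simp add: E_def)
        ultimately show ?thesis by (rule DERIV_cong_ev[OF refl _ refl, THEN iffD2, rotated])
      next
        case 2
        have "eventually (\<lambda>s. s < 0) (nhds t)"
          using 2 eventually_nhds_in_open[of "{..<0}" t] by auto
        hence ev: "eventually (\<lambda>s. E p s = 0) (nhds t)"
          by eventually_elim (simp add: E_def)
        have "((\<lambda>s. 0) has_real_derivative E q t) (at t)" using 2 by (simp add: E_def)
        from this ev show ?thesis by (rule DERIV_cong_ev[OF refl _ refl, THEN iffD2, rotated])
      next
        case 3
        \<comment> \<open>The right difference quotient at 0 is again a polynomial in
          \<open>1/h\<close> times \<open>exp (- 1/h)\<close>; the division by \<open>h\<close> is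
          the factor added by \<open>pCons 0\<close>.\<close>
        have "((\<lambda>y. poly (pCons 0 p) y * exp (- y)) \<longlongrightarrow> 0) at_top" by (rule poly_times_exp_tendsto_0)
        hence "((\<lambda>h. poly (pCons 0 p) (inverse h) * exp (- inverse h)) \<longlongrightarrow> 0) (at_right 0)"
          by (rule filterlim_compose[OF _ filterlim_inverse_at_top_right])
        moreover have "eventually (\<lambda>h. poly (pCons 0 p) (inverse h) * exp (- inverse h) = (E p (0 + h) - E p 0) / h) (at_right 0)"
          by (rule eventually_at_right_less[THEN eventually_mono]) (simp add: E_def field_simps)
        ultimately have "((\<lambda>h. (E p (0 + h) - E p 0) / h) \<longlongrightarrow> 0) (at_right 0)"
          by (rule Lim_transform_eventually)
        moreover have "((\<lambda>h. (E p (0 + h) - E p 0) / h) \<longlongrightarrow> 0) (at_left 0)"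
          by (rule Lim_transform_eventually[OF tendsto_const])
            (auto simp: E_def eventually_at_left_field intro: exI[of _ "-1"])
        ultimately show ?thesis
          using 3 by (simp add: DERIV_def filterlim_split_at E_def)
      qed
    qed
    thus ?case by blast
  qed
  ultimately show ?thesis by metis
qed

section \<open>Smooth bumps on boxes and the fundamental lemma of the calculus of variations\<close>

definition tensor :: "('n::finite \<Rightarrow> real \<Rightarrow> real) \<Rightarrow> real^'n \<Rightarrow> real" where
  "tensor f x = (\<Prod>i\<in>UNIV. f i (x $ i))"

lemma tensor_has_derivative:
  assumes "\<And>i t. (f i has_real_derivative f' i t) (at t)"
  shows "(tensor f has_derivative (\<lambda>h. \<Sum>i\<in>UNIV. f' i (x $ i) * h $ i * (\<Prod>j\<in>UNIV - {i}. f j (x $ j)))) (at x)"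
  unfolding tensor_def[abs_def]
proof (rule has_derivative_prod)
  fix i :: 'a
  have "((\<lambda>x. x $ i) has_derivative (\<lambda>h. h $ i)) (at x)" 
    by (rule bounded_linear_imp_has_derivative[OF bounded_linear_vec_nth])
  thus "((\<lambda>x. f i (x $ i)) has_derivative (\<lambda>h. f' i (x $ i) * h $ i)) (at x)"
    using has_derivative_compose[where g = "f i" and g' = "(*) (f' i (x $ i))" and f = "\<lambda>x. x $ i"]
      assms[of i "x $ i"] unfolding has_field_derivative_def by blast
qed

text \<open>A partial derivative changes a single factor, so iterated partial derivatives stay
  within tensor products. This reduces smoothness in several variables to smoothness of the
  factors.\<close>

lemma partial_deriv_tensor:
  assumes "\<And>i t. (f i has_real_derivative f' i t) (at t)"
  shows "partial_deriv k (tensor f) = tensor (f(k := f' k))"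
proof
  fix x
  have "partial_deriv k (tensor f) x = (\<Sum>i\<in>UNIV. f' i (x $ i) * axis k 1 $ i * (\<Prod>j\<in>UNIV - {i}. f j (x $ j)))"
    unfolding partial_deriv_def frechet_derivative_at[OF tensor_has_derivative[OF assms], symmetric] ..
  also have "\<dots> = f' k (x $ k) * (\<Prod>j\<in>UNIV - {k}. f j (x $ j))"
    by (subst sum.remove[of _ k]) (auto simp: axis_def intro!: sum.neutral)
  also have "\<dots> = tensor (f(k := f' k)) x"
    by (simp add: tensor_def prod.remove[of UNIV k])
  finally show "partial_deriv k (tensor f) x = tensor (f(k := f' k)) x" .
qed

lemma smooth_fun_tensor:
  assumes "\<And>i. smooth1 (f i)"
  shows "smooth_fun (tensor f)"
proof -
  have "\<exists>g. foldr partial_deriv is (tensor f) = tensor g \<and> (\<forall>i. smooth1 (g i))" for "is"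
  proof (induction "is")
    case (Cons k "is")
    then obtain g where g: "foldr partial_deriv is (tensor f) = tensor g" "\<And>i. smooth1 (g i)" by blast
    have "\<exists>g'. (\<forall>t. (g i has_real_derivative g' t) (at t)) \<and> smooth1 g'" for i
      using smooth1E[OF g(2)[of i]] by blast
    then obtain g' where g': "\<And>i t. (g i has_real_derivative g' i t) (at t)" "\<And>i. smooth1 (g' i)"
      by metis
    have "foldr partial_deriv (k # is) (tensor f) = tensor (g(k := g' k))"
      using partial_deriv_tensor[OF g'(1)] g by (simp del: fun_upd_apply)
    moreover have "\<forall>i. smooth1 ((g(k := g' k)) i)" using g g' by simp
    ultimately show ?case by blast
  qed (use assms in auto)
  moreover have "tensor g differentiable (at x)" if g: "\<forall>i. smooth1 (g i)" for g and x :: "real^3"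
  proof -
    have "\<exists>g'. (\<forall>t. (g i has_real_derivative g' t) (at t)) \<and> smooth1 g'" for i
      using smooth1E[OF g[rule_format, of i]] by blast
    then obtain g' where g': "\<And>i t. (g i has_real_derivative g' i t) (at t)" by metis
    show ?thesis by (rule differentiableI[OF tensor_has_derivative[OF g']])
  qed
  ultimately show ?thesis
    unfolding smooth_fun_def by (intro allI) metis
qed

text \<open>The parameter \<open>k\<close> is a sharpness: the argument of each flat exponential
  grows with \<open>k\<close>, so inside the box the value tends to 1, while outside it is always 0.
  Values between 0 and 1 serve dominated convergence.\<close>

definition box_bump :: "real \<Rightarrow> real^'n::finite \<Rightarrow> real^'n \<Rightarrow> real^'n \<Rightarrow> real" where
  "box_bump k a b = tensor (\<lambda>i t. flat_exp (k * (t - a $ i)) * flat_exp (k * (b $ i - t)))"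

lemma smooth_fun_box_bump: "smooth_fun (box_bump k a b)"
  unfolding box_bump_def
proof (rule smooth_fun_tensor)
  fix i
  have "smooth1 (\<lambda>t. flat_exp (k * t + - k * a $ i) * flat_exp (- k * t + k * b $ i))"
    by (intro smooth1_mult smooth1_affine smooth1_flat_exp)
  thus "smooth1 (\<lambda>t. flat_exp (k * (t - a $ i)) * flat_exp (k * (b $ i - t)))"
    by (simp add: algebra_simps)
qed

lemma box_bump_bounds: "0 \<le> box_bump k a b x" "box_bump k a b x \<le> 1"
  unfolding box_bump_def tensor_def
  by (auto intro!: prod_nonneg prod_le_1 mult_nonneg_nonneg mult_le_one flat_exp_bounds)

lemma box_bump_eq_0: "k > 0 \<Longrightarrow> x \<notin> box a b \<Longrightarrow> box_bump k a b x = 0"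
  unfolding box_bump_def tensor_def
  by (auto simp: mem_box_cart flat_exp_eq_0_iff mult_le_0_iff not_less)

lemma box_bump_in_test_functions: "k > 0 \<Longrightarrow> cbox a b \<subseteq> \<Omega> \<Longrightarrow> box_bump k a b \<in> test_functions \<Omega>"
  unfolding test_functions_def
  using box_bump_eq_0[of k _ a b] smooth_fun_box_bump[of k a b] box_subset_cbox[of a b]
  by (auto intro!: exI[of _ "cbox a b"])

lemma box_bump_tendsto_indicator: "(\<lambda>n. box_bump (real (Suc n)) a b x) \<longlonglongrightarrow> indicator (box a b) x"
proof (cases "x \<in> box a b")
  case True
  have lim: "(\<lambda>n. flat_exp (real (Suc n) * t)) \<longlonglongrightarrow> 1" if "t > 0" for t
  proof -
    have "(\<lambda>n. exp (- (inverse (real (Suc n)) * inverse t))) \<longlonglongrightarrow> exp (- (0 * inverse t))"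
      by (intro tendsto_intros LIMSEQ_inverse_real_of_nat)
    thus ?thesis using that by (simp add: flat_exp_def del: of_nat_Suc)
  qed
  have "(\<lambda>n. box_bump (real (Suc n)) a b x) \<longlonglongrightarrow> (\<Prod>i\<in>(UNIV :: 'a set). 1 * 1)"
    unfolding box_bump_def tensor_def using True
    by (intro tendsto_prod tendsto_mult lim) (auto simp: mem_box_cart)
  thus ?thesis using True by simp
qed (simp add: box_bump_eq_0)

text \<open>A Dynkin class argument: boxes are stable under intersection and generate the Borel
  sets, and the sets over which \<open>f\<close> has integral zero are closed under complements and
  countable disjoint unions.\<close>

lemma AE_eq_0_if_box_integrals_0:
  fixes f :: "'a::euclidean_space \<Rightarrow> 'b::euclidean_space"
  assumes f: "integrable lborel f"
    and box: "\<And>a b. (LINT x|lborel. indicator (box a b) x *\<^sub>R f x) = 0"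
  shows "AE x in lborel. f x = 0"
proof (rule sigma_finite_measure.density_zero[OF lborel.sigma_finite_measure_axioms f])
  fix A :: "'a set" assume "A \<in> sets lborel"
  have int: "integrable lborel (\<lambda>x. indicator B x *\<^sub>R f x)" if "B \<in> sets borel" for B
    using f that by (intro integrable_mult_indicator) auto
  let ?G = "range (\<lambda>(a, b). box a b :: 'a set)"
  \<comment> \<open>Closure under complements needs the integral over the whole space, which is the
    limit of integrals over growing boxes.\<close>
  have total: "(LINT x|lborel. f x) = 0"
  proof -
    have "(\<lambda>n. LINT x|lborel. indicator (box (- (real n *\<^sub>R One)) (real n *\<^sub>R One)) x *\<^sub>R f x)
        \<longlonglongrightarrow> (LINT x|lborel. f x)"
    proof (rule integral_dominated_convergence[where w = "\<lambda>x. norm (f x)"])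
      show "AE x in lborel. (\<lambda>n. indicator (box (- (real n *\<^sub>R One)) (real n *\<^sub>R One)) x *\<^sub>R f x) \<longlonglongrightarrow> f x"
      proof (rule AE_I2)
        fix x :: 'a
        obtain N :: nat where N: "norm x < real N" using reals_Archimedean2 by blast
        have "x \<in> box (- (real n *\<^sub>R One)) (real n *\<^sub>R One)" if "n \<ge> N" for n
          using N that Basis_le_norm[of _ x] unfolding mem_box by (fastforce simp: abs_le_iff)
        hence "eventually (\<lambda>n. indicator (box (- (real n *\<^sub>R One)) (real n *\<^sub>R One)) x *\<^sub>R f x = f x) sequentially"
          unfolding eventually_sequentially by (intro exI[of _ N]) auto
        thus "(\<lambda>n. indicator (box (- (real n *\<^sub>R One)) (real n *\<^sub>R One)) x *\<^sub>R f x) \<longlonglongrightarrow> f x"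
          by (rule tendsto_eventually)
      qed
    qed (use f in \<open>auto simp: indicator_def intro!: AE_I2\<close>)
    thus ?thesis by (simp add: box LIMSEQ_const_iff)
  qed
  have A: "A \<in> sigma_sets UNIV ?G" using \<open>A \<in> sets lborel\<close> by (simp add: borel_eq_box)
  have "Int_stable ?G" by (auto simp: Int_stable_def box_Int_box)
  moreover have "?G \<subseteq> Pow UNIV" by simp
  moreover note A
  ultimately have "(LINT x:A|lborel. f x) = 0"
  proof (induction rule: sigma_sets_induct_disjoint)
    case (basic A)
    thus ?case using box by (auto simp: set_lebesgue_integral_def)
  next
    case (compl A)
    hence "A \<in> sets borel" by (simp add: borel_eq_box)
    have "indicator (UNIV - A) x *\<^sub>R f x = f x - indicator A x *\<^sub>R f x" for x
      by (simp add: indicator_def)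
    hence "(LINT x:UNIV - A|lborel. f x) = (LINT x|lborel. f x) - (LINT x:A|lborel. f x)"
      unfolding set_lebesgue_integral_def
      by (simp only: Bochner_Integration.integral_diff[OF f int[OF \<open>A \<in> sets borel\<close>]])
    thus ?case using compl total by simp
  next
    case (union A)
    hence A: "range A \<subseteq> sets borel" by (simp add: borel_eq_box)
    have "(LINT x:(\<Union>i. A i)|lborel. f x) = (\<Sum>i. (LINT x:(A i)|lborel. f x))"
      using A union by (intro lebesgue_integral_countable_add)
        (auto simp: disjoint_family_on_def set_integrable_def intro!: int)
    thus ?case using union by simp
  qed (simp add: set_lebesgue_integral_def)
  thus "(LINT x:A|lborel. f x) = 0" .
qed

text \<open>Bumps converge to the indicator of a box whose closure lies in the domain, so integrals
  over such boxes vanish and \<open>f\<close> is zero almost everywhere in each of them. Countably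
  many rational boxes cover the domain, and their boundaries are null sets.\<close>

lemma fundamental_lemma_lborel:
  fixes f :: "real^3 \<Rightarrow> complex"
  assumes \<Omega>: "open \<Omega>" and f: "integrable lborel f" and zero: "\<And>x. x \<notin> \<Omega> \<Longrightarrow> f x = 0"
    and test: "\<And>\<psi>. \<psi> \<in> test_functions \<Omega> \<Longrightarrow> (LINT x|lborel. f x * of_real (\<psi> x)) = 0"
  shows "AE x in lborel. f x = 0"
proof -
  have [measurable]: "f \<in> borel_measurable borel" using f by auto
  have box0: "(LINT x|lborel. indicator (box a b) x *\<^sub>R f x) = 0" if "cbox a b \<subseteq> \<Omega>" for a b
  proof -
    have "(\<lambda>n. LINT x|lborel. f x * of_real (box_bump (real (Suc n)) a b x))
        \<longlonglongrightarrow> (LINT x|lborel. f x * of_real (indicator (box a b) x))"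
    proof (rule integral_dominated_convergence[where w = "\<lambda>x. norm (f x)"])
      show "AE x in lborel. (\<lambda>n. f x * of_real (box_bump (real (Suc n)) a b x))
          \<longlonglongrightarrow> f x * of_real (indicator (box a b) x)"
        by (intro AE_I2 tendsto_intros box_bump_tendsto_indicator)
      show "AE x in lborel. norm (f x * of_real (box_bump (real (Suc n)) a b x)) \<le> norm (f x)" for n
        by (intro AE_I2) (auto simp: norm_mult box_bump_bounds intro!: mult_left_le)
      show "(\<lambda>x. f x * of_real (box_bump (real (Suc n)) a b x)) \<in> borel_measurable lborel" for n
        unfolding box_bump_def tensor_def flat_exp_def by measurable
    qed (use f in auto)
    moreover have "(LINT x|lborel. f x * of_real (box_bump (real (Suc n)) a b x)) = 0" for n
      using that by (intro test box_bump_in_test_functions) auto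
    ultimately have "(LINT x|lborel. f x * of_real (indicator (box a b) x)) = 0"
      by (simp add: LIMSEQ_const_iff)
    thus ?thesis by (simp add: scaleR_conv_of_real mult.commute)
  qed
  have AE_box: "AE x in lborel. x \<in> box a b \<longrightarrow> f x = 0" if ab: "cbox a b \<subseteq> \<Omega>" for a b
  proof -
    have "AE x in lborel. indicator (box a b) x *\<^sub>R f x = 0"
    proof (rule AE_eq_0_if_box_integrals_0)
      show "integrable lborel (\<lambda>x. indicator (box a b) x *\<^sub>R f x)"
        using f by (intro integrable_mult_indicator) auto
    next
      fix c d
      obtain c' d' where cd: "box c d \<inter> box a b = box c' d'" using box_Int_box by blast
      have "(LINT x|lborel. indicator (box c' d') x *\<^sub>R f x) = 0"
      proof (cases "box c' d' = {}")
        case False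
        \<comment> \<open>Passing from open to closed boxes requires a nonempty interior: an empty
          open box may have arbitrary end points.\<close>
        have "cbox c' d' \<subseteq> cbox a b"
          using closure_mono[of "box c' d'" "box a b"] cd False closure_box[of c' d'] closure_subset
          by (metis Int_lower2 box_subset_cbox closed_cbox closure_minimal order_trans)
        thus ?thesis using ab by (intro box0) auto
      qed simp
      moreover have "indicator (box c d) x *\<^sub>R indicator (box a b) x *\<^sub>R f x = indicator (box c' d') x *\<^sub>R f x" for x
        unfolding cd[symmetric] by (simp add: indicator_inter_arith)
      ultimately show "(LINT x|lborel. indicator (box c d) x *\<^sub>R indicator (box a b) x *\<^sub>R f x) = 0"
        by (simp only:)
    qed
    thus ?thesis by eventually_elim (auto simp: indicator_def)
  qed
  define a' b' :: "(real^3 \<Rightarrow> real \<times> real) \<Rightarrow> real^3"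
    where "a' g = (\<Sum>i\<in>Basis. fst (g i) *\<^sub>R i)" and "b' g = (\<Sum>i\<in>Basis. snd (g i) *\<^sub>R i)" for g
  define I where "I = {g \<in> Basis \<rightarrow>\<^sub>E \<rat> \<times> \<rat>. cbox (a' g) (b' g) \<subseteq> \<Omega>}"
  have I: "\<Omega> = (\<Union>g\<in>I. cbox (a' g) (b' g))"
    using open_UNION_cbox[OF \<Omega>] by (simp add: a'_def[abs_def] b'_def[abs_def] I_def)
  have "countable ((Basis :: (real^3) set) \<rightarrow>\<^sub>E \<rat> \<times> (\<rat> :: real set))"
    by (intro countable_PiE countable_SIGMA countable_rat) simp
  hence "countable I" by (rule countable_subset[rotated]) (auto simp: I_def)
  moreover have "AE x in lborel. x \<in> cbox (a' g) (b' g) \<longrightarrow> f x = 0" if "g \<in> I" for g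
  proof -
    have "cbox (a' g) (b' g) - box (a' g) (b' g) \<in> null_sets lebesgue"
      using negligible_frontier_interval[of "a' g" "b' g"] by (simp add: negligible_iff_null_sets)
    from AE_not_in[OF this] have "AE x in lborel. x \<notin> cbox (a' g) (b' g) - box (a' g) (b' g)"
      by (simp only: AE_completion_iff)
    moreover have "AE x in lborel. x \<in> box (a' g) (b' g) \<longrightarrow> f x = 0"
      using that by (intro AE_box) (auto simp: I_def)
    ultimately show ?thesis by eventually_elim auto
  qed
  ultimately have "AE x in lborel. \<forall>g\<in>I. x \<in> cbox (a' g) (b' g) \<longrightarrow> f x = 0"
    by (subst AE_ball_countable) auto
  thus ?thesis
  proof eventually_elim
    case (elim x)
    thus ?case using zero[of x] I by (cases "x \<in> \<Omega>") blast+
  qed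
qed

section \<open>Hermitian forms and square integrable functions\<close>

text \<open>Conjugate linear in the first and linear in the second argument, as for the duality
  pairing. The points of \<open>'x\<close> may be positions or matrix indices, so the locale serves
  wave functions and vectors alike.\<close>

locale herm_form =
  fixes V :: "('x \<Rightarrow> complex) set" and s :: "('x \<Rightarrow> complex) \<Rightarrow> ('x \<Rightarrow> complex) \<Rightarrow> complex"
  assumes zero: "(\<lambda>x. 0) \<in> V"
    and comb: "v \<in> V \<Longrightarrow> w \<in> V \<Longrightarrow> (\<lambda>x. a * v x + b * w x) \<in> V"
    and lin: "u \<in> V \<Longrightarrow> v \<in> V \<Longrightarrow> w \<in> V \<Longrightarrow> s u (\<lambda>x. a * v x + b * w x) = a * s u v + b * s u w"
    and herm: "u \<in> V \<Longrightarrow> v \<in> V \<Longrightarrow> s v u = cnj (s u v)"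
begin

lemma cscale_mem: "v \<in> V \<Longrightarrow> (\<lambda>x. a * v x) \<in> V"
  using comb[of v v a 0] by simp

lemma subspace_V: "subspace V"
  unfolding subspace_def using zero comb[of _ _ 1 1] cscale_mem
  by (auto simp: zero_fun_def plus_fun_def scaleR_fun_def scaleR_conv_of_real)

lemma cscale_right: "u \<in> V \<Longrightarrow> v \<in> V \<Longrightarrow> s u (\<lambda>x. a * v x) = a * s u v"
  using lin[of u v v a 0] by simp

lemma cscale_left: "u \<in> V \<Longrightarrow> v \<in> V \<Longrightarrow> s (\<lambda>x. a * u x) v = cnj a * s u v"
  using herm[of v "\<lambda>x. a * u x"] herm[of v u] cscale_mem by (simp add: cscale_right)

lemma plus_right: "u \<in> V \<Longrightarrow> v \<in> V \<Longrightarrow> w \<in> V \<Longrightarrow> s u (v + w) = s u v + s u w"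
  using lin[of u v w 1 1] by (simp add: plus_fun_def)

lemma minus_right: "u \<in> V \<Longrightarrow> v \<in> V \<Longrightarrow> w \<in> V \<Longrightarrow> s u (v - w) = s u v - s u w"
  using lin[of u v w 1 "-1"] by (simp add: fun_diff_def)

lemma minus_mem: "v \<in> V \<Longrightarrow> w \<in> V \<Longrightarrow> v - w \<in> V"
  using subspace_V by (rule subspace_diff)

lemma plus_mem: "v \<in> V \<Longrightarrow> w \<in> V \<Longrightarrow> v + w \<in> V"
  using subspace_V by (rule subspace_add)

lemma minus_left: "u \<in> V \<Longrightarrow> v \<in> V \<Longrightarrow> w \<in> V \<Longrightarrow> s (u - v) w = s u w - s v w"
  using herm[of w "u - v"] herm[of w u] herm[of w v] by (simp add: minus_right minus_mem)

lemma sum_mem: "(\<And>i. i \<in> I \<Longrightarrow> v i \<in> V) \<Longrightarrow> (\<lambda>x. \<Sum>i\<in>I. c i * v i x) \<in> V"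
proof (induction I rule: infinite_finite_induct)
  case (insert i I)
  thus ?case using comb[of "v i" "\<lambda>x. \<Sum>i\<in>I. c i * v i x" "c i" 1] by simp
qed (simp_all add: zero)

lemma sum_right:
  "u \<in> V \<Longrightarrow> (\<And>i. i \<in> I \<Longrightarrow> v i \<in> V) \<Longrightarrow> s u (\<lambda>x. \<Sum>i\<in>I. c i * v i x) = (\<Sum>i\<in>I. c i * s u (v i))"
proof (induction I rule: infinite_finite_induct)
  case (insert i I)
  thus ?case using lin[of u "v i" "\<lambda>x. \<Sum>i\<in>I. c i * v i x" "c i" 1] sum_mem[of I v c] by simp
qed (use lin[of u u u 0 0] in simp_all)

lemma sum_left:
  assumes "u \<in> V" "\<And>i. i \<in> I \<Longrightarrow> v i \<in> V"
  shows "s (\<lambda>x. \<Sum>i\<in>I. c i * v i x) u = (\<Sum>i\<in>I. cnj (c i) * s (v i) u)"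
proof -
  have "s (\<lambda>x. \<Sum>i\<in>I. c i * v i x) u = cnj (\<Sum>i\<in>I. c i * s u (v i))"
    using assms sum_mem[of I v c] by (subst herm[of u]) (auto simp: sum_right)
  also have "\<dots> = (\<Sum>i\<in>I. cnj (c i) * s (v i) u)"
    using assms herm[of u] by (auto intro!: sum.cong)
  finally show ?thesis .
qed

lemma Im_self: "v \<in> V \<Longrightarrow> Im (s v v) = 0"
  using arg_cong[OF herm[of v v], of Im] by simp

lemma self_eq_Re: "v \<in> V \<Longrightarrow> s v v = of_real (Re (s v v))"
  using Im_self[of v] by (simp add: complex_eq_iff)

lemma Re_sym_form: "sym_form V (\<lambda>v w. Re (s v w))"
proof
  show "Re (s u (v + w)) = Re (s u v) + Re (s u w)" if "u \<in> V" "v \<in> V" "w \<in> V" for u v w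
    using that by (simp add: plus_right)
  show "Re (s u (r *\<^sub>R v)) = r * Re (s u v)" if "u \<in> V" "v \<in> V" for u v r
    using that cscale_right[of u v "of_real r"] by (simp add: scaleR_fun_def scaleR_conv_of_real)
  show "Re (s u v) = Re (s v u)" if "u \<in> V" "v \<in> V" for u v
    using herm[OF that] by simp
qed (rule subspace_V)

text \<open>A unit factor \<open>c\<close> turns the value real and nonnegative. The assumptions on
  the Hamiltonian bound only real pairings, and this recovers bounds on the complex ones.\<close>

lemma norm_le_of_Re_le:
  assumes "u \<in> V" "v \<in> V" and le: "\<And>c. norm c = 1 \<Longrightarrow> Re (s u (\<lambda>x. c * v x)) \<le> B"
  shows "norm (s u v) \<le> B"
proof -
  obtain c where c: "norm c = 1" "c * s u v = of_real (norm (s u v))"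
  proof (cases "s u v = 0")
    case False
    have "(cnj (s u v) / of_real (norm (s u v))) * s u v = of_real (norm (s u v))"
      using False by (simp add: field_simps complex_norm_square power2_eq_square mult.commute
          flip: of_real_mult) (simp add: complex_norm_square[symmetric] power2_eq_square mult.commute)
    thus ?thesis using False by (intro that[of "cnj (s u v) / of_real (norm (s u v))"]) (auto simp: norm_divide)
  qed (use that[of 1] in auto)
  have "norm (s u v) = Re (s u (\<lambda>x. c * v x))"
    using assms c by (simp add: cscale_right)
  thus ?thesis using le[OF c(1)] by simp
qed

end

locale pos_herm_form = herm_form +
  assumes pos: "v \<in> V \<Longrightarrow> 0 \<le> Re (s v v)"
begin

sublocale Re: psd_form V "\<lambda>v w. Re (s v w)"
  by (intro psd_form.intro Re_sym_form psd_form_axioms.intro pos)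

lemma norm_le:
  assumes "u \<in> V" "v \<in> V"
  shows "norm (s u v) \<le> sqrt (Re (s u u)) * sqrt (Re (s v v))"
proof (rule norm_le_of_Re_le[OF assms])
  fix c :: complex assume c: "norm c = 1"
  have "Re (s u (\<lambda>x. c * v x)) \<le> sqrt (Re (s u u)) * sqrt (Re (s (\<lambda>x. c * v x) (\<lambda>x. c * v x)))"
    using Re.Cauchy_Schwarz_sqrt[of u "\<lambda>x. c * v x"] assms cscale_mem by (auto simp: abs_le_iff)
  also have "s (\<lambda>x. c * v x) (\<lambda>x. c * v x) = (cnj c * c) * s v v"
    using assms cscale_mem by (simp add: cscale_left cscale_right)
  also have "cnj c * c = 1" using c by (simp add: complex_norm_square[symmetric] mult.commute)
  finally show "Re (s u (\<lambda>x. c * v x)) \<le> sqrt (Re (s u u)) * sqrt (Re (s v v))" by simp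
qed

lemma tendsto_right:
  assumes u: "\<And>n. u n \<in> V" and v: "v \<in> V" and w: "w \<in> V"
    and lim: "(\<lambda>n. Re (s (u n - v) (u n - v))) \<longlonglongrightarrow> 0"
  shows "(\<lambda>n. s w (u n)) \<longlonglongrightarrow> s w v"
proof -
  have "(\<lambda>n. sqrt (Re (s w w)) * sqrt (Re (s (u n - v) (u n - v)))) \<longlonglongrightarrow> sqrt (Re (s w w)) * sqrt 0"
    by (intro tendsto_intros lim)
  hence "(\<lambda>n. norm (s w (u n - v))) \<longlonglongrightarrow> 0"
    using u v w by (intro tendsto_zero_squeeze[OF _ _ norm_le]) (simp_all add: minus_mem)
  hence "(\<lambda>n. s w (u n - v)) \<longlonglongrightarrow> 0" by (rule tendsto_norm_zero_cancel)
  thus ?thesis using u v w by (simp add: minus_right LIM_zero_iff)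
qed

end

section \<open>The inner product of square integrable functions and completeness\<close>

lemma measurable_cnj [measurable (raw)]:
  "f \<in> borel_measurable M \<Longrightarrow> (\<lambda>x. cnj (f x)) \<in> borel_measurable M"
  by (rule borel_measurable_continuous_on[of cnj]) (auto intro: continuous_intros)

lemma L2_measurable: "v \<in> L2 \<Omega> \<Longrightarrow> v \<in> borel_measurable (lebesgue_on \<Omega>)"
  by (simp add: L2_def)

lemma L2_integrable_square: "v \<in> L2 \<Omega> \<Longrightarrow> integrable (lebesgue_on \<Omega>) (\<lambda>x. (norm (v x))\<^sup>2)"
  by (simp add: L2_def)

lemma L2_integrable_mult:
  assumes v: "v \<in> L2 \<Omega>" and w: "w \<in> L2 \<Omega>"
  shows "integrable (lebesgue_on \<Omega>) (\<lambda>x. cnj (v x) * w x)"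
proof (rule Bochner_Integration.integrable_bound)
  show "integrable (lebesgue_on \<Omega>) (\<lambda>x. (norm (v x))\<^sup>2 + (norm (w x))\<^sup>2)"
    using v w by (intro Bochner_Integration.integrable_add L2_integrable_square)
  show "(\<lambda>x. cnj (v x) * w x) \<in> borel_measurable (lebesgue_on \<Omega>)"
    using L2_measurable[OF v] L2_measurable[OF w] by measurable
  have "norm (v x) * norm (w x) \<le> (norm (v x))\<^sup>2 + (norm (w x))\<^sup>2" for x
    using sum_squares_bound[of "norm (v x)" "norm (w x)"] mult_nonneg_nonneg[of "norm (v x)" "norm (w x)"]
    unfolding mult.assoc by (smt (verit) norm_ge_zero)
  thus "AE x in lebesgue_on \<Omega>. norm (cnj (v x) * w x) \<le> norm ((norm (v x))\<^sup>2 + (norm (w x))\<^sup>2)"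
    by (intro AE_I2) (simp add: norm_mult)
qed

lemma L2_comb:
  assumes v: "v \<in> L2 \<Omega>" and w: "w \<in> L2 \<Omega>"
  shows "(\<lambda>x. a * v x + b * w x) \<in> L2 \<Omega>"
proof -
  have [measurable]: "v \<in> borel_measurable (lebesgue_on \<Omega>)" "w \<in> borel_measurable (lebesgue_on \<Omega>)"
    using v w by (auto simp: L2_measurable)
  have "integrable (lebesgue_on \<Omega>) (\<lambda>x. (norm (a * v x + b * w x))\<^sup>2)"
  proof (rule Bochner_Integration.integrable_bound)
    show "integrable (lebesgue_on \<Omega>) (\<lambda>x. 2 * (norm a)\<^sup>2 * (norm (v x))\<^sup>2 + 2 * (norm b)\<^sup>2 * (norm (w x))\<^sup>2)"
      using v w by (intro Bochner_Integration.integrable_add Bochner_Integration.integrable_mult_right L2_integrable_square)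
    have "(norm (a * v x + b * w x))\<^sup>2 \<le> 2 * (norm a)\<^sup>2 * (norm (v x))\<^sup>2 + 2 * (norm b)\<^sup>2 * (norm (w x))\<^sup>2" for x
    proof -
      have "(norm (a * v x + b * w x))\<^sup>2 \<le> (norm (a * v x) + norm (b * w x))\<^sup>2"
        by (intro power_mono norm_triangle_ineq) auto
      also have "\<dots> \<le> 2 * (norm (a * v x))\<^sup>2 + 2 * (norm (b * w x))\<^sup>2"
        using sum_squares_bound[of "norm (a * v x)" "norm (b * w x)"] by (simp add: power2_sum)
      finally show ?thesis by (simp add: norm_mult power_mult_distrib)
    qed
    thus "AE x in lebesgue_on \<Omega>. norm ((norm (a * v x + b * w x))\<^sup>2) \<le>
        norm (2 * (norm a)\<^sup>2 * (norm (v x))\<^sup>2 + 2 * (norm b)\<^sup>2 * (norm (w x))\<^sup>2)"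
      by (intro AE_I2) simp
  qed measurable
  thus ?thesis by (simp add: L2_def)
qed

lemma L2_inner_self: "L2_inner \<Omega> v v = of_real (LINT x|lebesgue_on \<Omega>. (norm (v x))\<^sup>2)"
proof -
  have "L2_inner \<Omega> v v = (LINT x|lebesgue_on \<Omega>. of_real ((norm (v x))\<^sup>2))"
    unfolding L2_inner_def
    by (intro Bochner_Integration.integral_cong) (simp_all add: complex_norm_square mult.commute del: of_real_power)
  thus ?thesis by (simp only: integral_complex_of_real)
qed

interpretation L2: pos_herm_form "L2 \<Omega>" "L2_inner \<Omega>" for \<Omega>
proof
  show "(\<lambda>x. 0) \<in> L2 \<Omega>" by (simp add: L2_def)
  show "(\<lambda>x. a * v x + b * w x) \<in> L2 \<Omega>" if "v \<in> L2 \<Omega>" "w \<in> L2 \<Omega>" for v w a b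
    using that by (rule L2_comb)
  show "L2_inner \<Omega> u (\<lambda>x. a * v x + b * w x) = a * L2_inner \<Omega> u v + b * L2_inner \<Omega> u w"
    if "u \<in> L2 \<Omega>" "v \<in> L2 \<Omega>" "w \<in> L2 \<Omega>" for u v w a b
  proof -
    have "L2_inner \<Omega> u (\<lambda>x. a * v x + b * w x) =
        (LINT x|lebesgue_on \<Omega>. a * (cnj (u x) * v x) + b * (cnj (u x) * w x))"
      unfolding L2_inner_def by (simp add: algebra_simps)
    also have "\<dots> = a * L2_inner \<Omega> u v + b * L2_inner \<Omega> u w"
      unfolding L2_inner_def using that by (simp add: L2_integrable_mult)
    finally show ?thesis .
  qed
  show "L2_inner \<Omega> v u = cnj (L2_inner \<Omega> u v)" if "u \<in> L2 \<Omega>" "v \<in> L2 \<Omega>" for u v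
    unfolding L2_inner_def Bochner_Integration.integral_cnj[symmetric]
    by (intro Bochner_Integration.integral_cong) (simp_all add: mult.commute)
  show "0 \<le> Re (L2_inner \<Omega> v v)" if "v \<in> L2 \<Omega>" for v
    by (simp add: L2_inner_self)
qed

lemma L2_inner_self_eq_0_iff:
  assumes "v \<in> L2 \<Omega>"
  shows "Re (L2_inner \<Omega> v v) = 0 \<longleftrightarrow> (AE x in lebesgue_on \<Omega>. v x = 0)"
  using integral_nonneg_eq_0_iff_AE[OF L2_integrable_square[OF assms]] by (simp add: L2_inner_self)

lemma L2_inner_cong_AE:
  assumes "v \<in> L2 \<Omega>" "v' \<in> L2 \<Omega>" "w \<in> L2 \<Omega>" "w' \<in> L2 \<Omega>"
    and "AE x in lebesgue_on \<Omega>. v x = v' x" "AE x in lebesgue_on \<Omega>. w x = w' x"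
  shows "L2_inner \<Omega> v w = L2_inner \<Omega> v' w'"
  unfolding L2_inner_def
proof (rule integral_cong_AE)
  show "AE x in lebesgue_on \<Omega>. cnj (v x) * w x = cnj (v' x) * w' x"
    using assms(5,6) by eventually_elim simp
qed (use assms(1-4)[THEN L2_measurable] in measurable)

text \<open>The increments are summable in the mean, so their sum is finite almost everywhere and
  the series telescopes. Finite measure enters when square integrals are traded for integrals of the
  increments themselves.\<close>

lemma fast_Cauchy_AE_convergent:
  fixes u :: "nat \<Rightarrow> 'a \<Rightarrow> complex"
  assumes "finite_measure M" and [measurable]: "\<And>n. u n \<in> borel_measurable M"
    and int: "\<And>n. integrable M (\<lambda>x. (norm (u (Suc n) x - u n x))\<^sup>2)"
    and le: "\<And>n. (LINT x|M. (norm (u (Suc n) x - u n x))\<^sup>2) \<le> (1/4) ^ n"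
  shows "AE x in M. convergent (\<lambda>n. u n x)"
proof -
  interpret finite_measure M by fact
  define d where "d n x = norm (u (Suc n) x - u n x)" for n x
  have [measurable]: "d n \<in> borel_measurable M" for n unfolding d_def by measurable
  define B where "B = 1 + measure M (space M)"
  have nn: "(\<integral>\<^sup>+x. ennreal (d n x) \<partial>M) \<le> ennreal (B * (1/2) ^ n)" for n
  proof -
    \<comment> \<open>The weights \<open>2 ^ n\<close> and its inverse balance: the square integral
      is at most \<open>(1/4) ^ n\<close>, so both terms integrate to multiples of
      \<open>(1/2) ^ n\<close>.\<close>
    have AMGM: "d n x \<le> (1/2) ^ n + 2 ^ n * (d n x)\<^sup>2" for x
    proof -
      have "2 * d n x = 2 * (sqrt ((1/2)^n) * (sqrt (2^n) * d n x))"
        by (simp add: real_sqrt_mult[symmetric] power_divide flip: mult.assoc)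
      also have "\<dots> \<le> (sqrt ((1/2)^n))\<^sup>2 + (sqrt (2^n) * d n x)\<^sup>2"
        using sum_squares_bound[of "sqrt ((1/2)^n)" "sqrt (2^n) * d n x"] by (simp add: mult.assoc)
      also have "\<dots> = (1/2) ^ n + 2 ^ n * (d n x)\<^sup>2" by (simp add: power_mult_distrib)
      finally show ?thesis using norm_ge_zero[of "u (Suc n) x - u n x"] unfolding d_def by linarith
    qed
    have int': "integrable M (\<lambda>x. (1/2) ^ n + 2 ^ n * (d n x)\<^sup>2)"
      using int by (simp add: d_def)
    have "(\<integral>\<^sup>+x. ennreal (d n x) \<partial>M) \<le> (\<integral>\<^sup>+x. ennreal ((1/2) ^ n + 2 ^ n * (d n x)\<^sup>2) \<partial>M)"
      using AMGM by (intro nn_integral_mono ennreal_leI)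
    also have "\<dots> = ennreal (LINT x|M. (1/2) ^ n + 2 ^ n * (d n x)\<^sup>2)"
      using int' by (intro nn_integral_eq_integral) auto
    also have "(LINT x|M. (1/2) ^ n + 2 ^ n * (d n x)\<^sup>2) =
        (1/2) ^ n * measure M (space M) + 2 ^ n * (LINT x|M. (d n x)\<^sup>2)"
      using int by (simp add: d_def)
    also have "\<dots> \<le> (1/2) ^ n * measure M (space M) + 2 ^ n * (1/4) ^ n"
      using le[of n] by (simp add: d_def)
    also have "2 ^ n * (1/4) ^ n = ((1/2) ^ n :: real)"
      by (simp flip: power_mult_distrib)
    finally show ?thesis by (simp add: B_def algebra_simps ennreal_leI)
  qed
  have "(\<integral>\<^sup>+x. (\<Sum>n. ennreal (d n x)) \<partial>M) = (\<Sum>n. \<integral>\<^sup>+x. ennreal (d n x) \<partial>M)"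
    by (rule nn_integral_suminf) measurable
  also have "\<dots> \<le> (\<Sum>n. ennreal (B * (1/2) ^ n))"
    by (intro suminf_le nn summableI)
  also have "\<dots> = ennreal (\<Sum>n. B * (1/2) ^ n)"
    by (rule suminf_ennreal2) (auto simp: B_def intro!: summable_mult summable_geometric mult_nonneg_nonneg)
  finally have "(\<integral>\<^sup>+x. (\<Sum>n. ennreal (d n x)) \<partial>M) \<noteq> \<infinity>"
    by (auto simp: top_unique)
  hence "AE x in M. (\<Sum>n. ennreal (d n x)) \<noteq> \<infinity>"
    by (intro nn_integral_PInf_AE) measurable
  thus ?thesis
  proof eventually_elim
    case (elim x)
    hence "summable (\<lambda>n. d n x)"
      by (intro summable_suminf_not_top) (auto simp: d_def)
    hence "summable (\<lambda>n. u (Suc n) x - u n x)"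
      unfolding d_def by (rule summable_norm_cancel)
    hence "convergent (\<lambda>n. \<Sum>i<n. u (Suc i) x - u i x)" by (simp add: summable_iff_convergent)
    hence "convergent (\<lambda>n. u n x - u 0 x)" by (simp only: sum_lessThan_telescope[of "\<lambda>i. u i x"])
    hence "convergent (\<lambda>n. (u n x - u 0 x) + u 0 x)" by (intro convergent_add convergent_const)
    thus ?case by simp
  qed
qed

text \<open>The Riesz-Fischer argument: a fast subsequence converges almost everywhere, and Fatou's
  lemma bounds the distance of the original sequence to that limit.\<close>

lemma L2_complete:
  assumes fin: "finite_measure (lebesgue_on \<Omega>)"
  shows "form_complete (L2 \<Omega>) (\<lambda>v w. Re (L2_inner \<Omega> v w))"
  unfolding form_complete_def
proof (intro allI impI)
  fix u :: "nat \<Rightarrow> wavefun"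
  assume "\<forall>n. u n \<in> L2 \<Omega>" and Cauchy: "form_Cauchy (\<lambda>v w. Re (L2_inner \<Omega> v w)) u"
  hence u: "u n \<in> L2 \<Omega>" for n by blast
  have [measurable]: "u n \<in> borel_measurable (lebesgue_on \<Omega>)" for n using u L2_measurable by blast
  define N where "N m n = Re (L2_inner \<Omega> (u m - u n) (u m - u n))" for m n
  have uu: "u m - u n \<in> L2 \<Omega>" for m n using u by (intro L2.minus_mem)
  have N_int: "N m n = (LINT x|lebesgue_on \<Omega>. (norm (u m x - u n x))\<^sup>2)" for m n
    by (simp add: N_def L2_inner_self)
  have "\<exists>K. \<forall>m\<ge>K. \<forall>n\<ge>K. N m n < (1/4) ^ k" for k
    using Cauchy unfolding form_Cauchy_def N_def by (simp del: power_one_over)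
  then obtain K where K: "\<And>k m n. m \<ge> K k \<Longrightarrow> n \<ge> K k \<Longrightarrow> N m n < (1/4) ^ k" by metis
  \<comment> \<open>Cumulative sums make the index monotone and at least \<open>K k\<close>; the
    added \<open>k\<close> makes it unbounded even if all \<open>K i\<close> vanish.\<close>
  define r where "r k = (\<Sum>i\<le>k. K i) + k" for k
  have rK: "r k \<ge> K k" for k
    unfolding r_def by (rule trans_le_add1) (rule member_le_sum, auto)
  have r_mono: "r k \<le> r (Suc k)" for k by (simp add: r_def)
  have r_ge: "r k \<ge> k" for k by (simp add: r_def)
  have conv: "AE x in lebesgue_on \<Omega>. convergent (\<lambda>k. u (r k) x)"
  proof (rule fast_Cauchy_AE_convergent[OF fin])
    show "integrable (lebesgue_on \<Omega>) (\<lambda>x. (norm (u (r (Suc n)) x - u (r n) x))\<^sup>2)" for n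
      using L2_integrable_square[OF uu[of "r (Suc n)" "r n"]] by simp
    show "(LINT x|lebesgue_on \<Omega>. (norm (u (r (Suc n)) x - u (r n) x))\<^sup>2) \<le> (1/4) ^ n" for n
      using K[of n "r (Suc n)" "r n"] rK[of n] r_mono[of n] by (simp add: N_int)
  qed measurable
  define v where "v x = lim (\<lambda>k. u (r k) x)" for x
  have [measurable]: "v \<in> borel_measurable (lebesgue_on \<Omega>)" unfolding v_def by measurable
  have lim: "AE x in lebesgue_on \<Omega>. (\<lambda>k. u (r k) x) \<longlonglongrightarrow> v x"
    using conv by eventually_elim (simp add: v_def convergent_LIMSEQ_iff)
  have bound: "(\<integral>\<^sup>+x. ennreal ((norm (u n x - v x))\<^sup>2) \<partial>lebesgue_on \<Omega>) \<le> ennreal ((1/4) ^ k)"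
    if n: "n \<ge> K k" for n k
  proof -
    \<comment> \<open>Fatou is applied with \<open>n\<close> fixed and the subsequence running. The
      estimate thus holds for the whole tail of \<open>u\<close>, and no separate passage from
      subsequence to sequence is needed.\<close>
    have "(\<integral>\<^sup>+x. ennreal ((norm (u n x - v x))\<^sup>2) \<partial>lebesgue_on \<Omega>) =
        (\<integral>\<^sup>+x. liminf (\<lambda>j. ennreal ((norm (u n x - u (r j) x))\<^sup>2)) \<partial>lebesgue_on \<Omega>)"
    proof (rule nn_integral_cong_AE)
      show "AE x in lebesgue_on \<Omega>. ennreal ((norm (u n x - v x))\<^sup>2) =
          liminf (\<lambda>j. ennreal ((norm (u n x - u (r j) x))\<^sup>2))"
        using lim
      proof eventually_elim
        case (elim x)
        have "(\<lambda>j. ennreal ((norm (u n x - u (r j) x))\<^sup>2)) \<longlonglongrightarrow> ennreal ((norm (u n x - v x))\<^sup>2)"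
          by (intro tendsto_ennrealI tendsto_intros elim)
        thus ?case using lim_imp_Liminf[OF sequentially_bot] by metis
      qed
    qed
    also have "\<dots> \<le> liminf (\<lambda>j. \<integral>\<^sup>+x. ennreal ((norm (u n x - u (r j) x))\<^sup>2) \<partial>lebesgue_on \<Omega>)"
      by (rule nn_integral_liminf) measurable
    also have "\<dots> \<le> limsup (\<lambda>j. \<integral>\<^sup>+x. ennreal ((norm (u n x - u (r j) x))\<^sup>2) \<partial>lebesgue_on \<Omega>)"
      by (rule Liminf_le_Limsup) simp
    also have "\<dots> \<le> ennreal ((1/4) ^ k)"
    proof (rule Limsup_bounded)
      have "(\<integral>\<^sup>+x. ennreal ((norm (u n x - u (r j) x))\<^sup>2) \<partial>lebesgue_on \<Omega>) \<le> ennreal ((1/4) ^ k)" if "j \<ge> K k" for j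
      proof -
        have "(\<integral>\<^sup>+x. ennreal ((norm (u n x - u (r j) x))\<^sup>2) \<partial>lebesgue_on \<Omega>) = ennreal (N n (r j))"
          unfolding N_int using L2_integrable_square[OF uu[of n "r j"]] by (intro nn_integral_eq_integral) auto
        also have "\<dots> \<le> ennreal ((1/4) ^ k)"
          using K[of k n "r j"] n r_ge[of j] that by (intro ennreal_leI) auto
        finally show ?thesis .
      qed
      thus "\<forall>\<^sub>F j in sequentially. (\<integral>\<^sup>+x. ennreal ((norm (u n x - u (r j) x))\<^sup>2) \<partial>lebesgue_on \<Omega>) \<le> ennreal ((1/4) ^ k)"
        unfolding eventually_sequentially by blast
    qed
    finally show ?thesis .
  qed
  have diff: "u n - v \<in> L2 \<Omega>" if "n \<ge> K k" for n k
  proof -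
    have "integrable (lebesgue_on \<Omega>) (\<lambda>x. (norm (u n x - v x))\<^sup>2)"
    proof (rule integrableI_bounded)
      show "(\<integral>\<^sup>+x. ennreal (norm ((norm (u n x - v x))\<^sup>2)) \<partial>lebesgue_on \<Omega>) < \<infinity>"
        using le_less_trans[OF bound[OF that] ennreal_less_top] by (simp del: ennreal_power)
    qed measurable
    moreover have "(\<lambda>x. u n x - v x) \<in> borel_measurable (lebesgue_on \<Omega>)" by measurable
    ultimately show ?thesis by (simp add: L2_def fun_diff_def)
  qed
  have v: "v \<in> L2 \<Omega>"
    using L2.minus_mem[OF u[of "K 0"] diff[of 0 "K 0"]] by simp
  have le: "Re (L2_inner \<Omega> (u n - v) (u n - v)) \<le> (1/4) ^ k" if "n \<ge> K k" for n k
  proof -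
    have "ennreal (Re (L2_inner \<Omega> (u n - v) (u n - v))) = (\<integral>\<^sup>+x. ennreal ((norm (u n x - v x))\<^sup>2) \<partial>lebesgue_on \<Omega>)"
      using L2_integrable_square[OF L2.minus_mem[OF u[of n] v]]
      by (subst nn_integral_eq_integral) (auto simp: L2_inner_self)
    also note bound[OF that]
    finally show ?thesis by simp
  qed
  have "(\<lambda>n. Re (L2_inner \<Omega> (u n - v) (u n - v))) \<longlonglongrightarrow> 0"
  proof (rule LIMSEQ_I)
    fix e :: real assume "e > 0"
    then obtain k where k: "(1/4) ^ k < e" using real_arch_pow_inv[of e "1/4"] by auto
    have "norm (Re (L2_inner \<Omega> (u n - v) (u n - v)) - 0) < e" if "n \<ge> K k" for n
      using le[OF that] k L2.pos[OF L2.minus_mem[OF u[of n] v]] by simp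
    thus "\<exists>no. \<forall>n\<ge>no. norm (Re (L2_inner \<Omega> (u n - v) (u n - v)) - 0) < e" by blast
  qed
  thus "\<exists>v\<in>L2 \<Omega>. (\<lambda>n. Re (L2_inner \<Omega> (u n - v) (u n - v))) \<longlonglongrightarrow> 0" using v by blast
qed

lemma (in herm_form) lin_left:
  assumes "u \<in> V" "v \<in> V" "w \<in> V"
  shows "s (\<lambda>x. a * v x + b * w x) u = cnj a * s v u + cnj b * s w u"
  using herm[of u "\<lambda>x. a * v x + b * w x"] herm[of u v] herm[of u w] assms comb[of v w a b]
  by (simp add: lin)

lemma (in psd_form) triangle_diff:
  assumes u: "u \<in> V" and v: "v \<in> V"
  shows "sqrt (s (u - v) (u - v)) \<le> sqrt (s u u) + sqrt (s v v)"
proof (rule real_le_lsqrt)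
  show "s (u - v) (u - v) \<le> (sqrt (s u u) + sqrt (s v v))\<^sup>2"
    using Cauchy_Schwarz_sqrt[OF u v] nonneg[OF u] nonneg[OF v] u v
    by (simp add: square_diff power2_sum)
qed (use nonneg u v in auto)

lemma (in pos_herm_form) sqrt_cscale:
  assumes "v \<in> V"
  shows "sqrt (Re (s (\<lambda>x. a * v x) (\<lambda>x. a * v x))) = norm a * sqrt (Re (s v v))"
proof -
  have "s (\<lambda>x. a * v x) (\<lambda>x. a * v x) = (a * cnj a) * s v v"
    using assms cscale_mem by (simp add: cscale_left cscale_right)
  also have "a * cnj a = of_real ((norm a)\<^sup>2)" by (simp only: complex_norm_square)
  finally have "Re (s (\<lambda>x. a * v x) (\<lambda>x. a * v x)) = (norm a)\<^sup>2 * Re (s v v)"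
    by (simp del: of_real_power)
  thus ?thesis by (simp add: real_sqrt_mult)
qed

lemma (in pos_herm_form) sqrt_sum_le:
  assumes v: "\<And>i. i \<in> I \<Longrightarrow> v i \<in> V"
  shows "sqrt (Re (s (\<lambda>x. \<Sum>i\<in>I. c i * v i x) (\<lambda>x. \<Sum>i\<in>I. c i * v i x))) \<le> (\<Sum>i\<in>I. norm (c i) * sqrt (Re (s (v i) (v i))))"
  using v
proof (induction I rule: infinite_finite_induct)
  case (insert i I)
  let ?z = "\<lambda>x. \<Sum>i\<in>I. c i * v i x"
  have z: "?z \<in> V" using insert.prems by (intro sum_mem) auto
  have i: "(\<lambda>x. c i * v i x) \<in> V" using insert.prems by (intro cscale_mem) auto
  have eq: "(\<lambda>x. \<Sum>i\<in>insert i I. c i * v i x) = (\<lambda>x. c i * v i x) + ?z"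
    using insert.hyps by (simp add: fun_eq_iff)
  show ?case
    unfolding eq using Re.triangle[OF i z] insert sqrt_cscale[of "v i" "c i"] by simp
qed (use cscale_right[OF zero zero, of 0] in simp_all)

section \<open>Weak gradients\<close>

lemma form_completeD:
  assumes "form_complete V s" "\<And>n. u n \<in> V" "form_Cauchy s u"
  shows "\<exists>v. v \<in> V \<and> (\<lambda>n. s (u n - v) (u n - v)) \<longlonglongrightarrow> 0"
  using assms unfolding form_complete_def by blast

text \<open>Translations and Fubini are carried out for Borel functions on the whole space, whereas
  the function spaces live on a completed restricted measure. Changing a null set and extending by
  zero connects the two.\<close>

lemma borel_representative:
  fixes f :: "'a::euclidean_space \<Rightarrow> complex"
  assumes \<Omega>: "\<Omega> \<in> sets borel" and f: "f \<in> borel_measurable (lebesgue_on \<Omega>)"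
  obtains g where "g \<in> borel_measurable borel" "\<And>x. x \<notin> \<Omega> \<Longrightarrow> g x = 0"
    "AE x in lborel. x \<in> \<Omega> \<longrightarrow> f x = g x"
proof -
  define h where "h x = (if x \<in> \<Omega> then f x else 0)" for x
  have "h \<in> borel_measurable lebesgue"
    unfolding h_def[abs_def] using \<Omega> f by (intro borel_measurable_if_I) auto
  hence "(\<lambda>x. Re (h x)) \<in> borel_measurable lebesgue" "(\<lambda>x. Im (h x)) \<in> borel_measurable lebesgue"
    by measurable
  then obtain g1 g2 where g: "g1 \<in> borel_measurable lborel" "AE x in lborel. Re (h x) = g1 x"
      "g2 \<in> borel_measurable lborel" "AE x in lborel. Im (h x) = g2 x"
    using completion_ex_borel_measurable_real by metis
  have [measurable]: "g1 \<in> borel_measurable borel" "g2 \<in> borel_measurable borel" using g by auto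
  have [measurable]: "\<Omega> \<in> sets borel" by fact
  show thesis
  proof (rule that)
    show "(\<lambda>x. indicator \<Omega> x *\<^sub>R Complex (g1 x) (g2 x)) \<in> borel_measurable borel"
      unfolding Complex_eq by measurable
    show "AE x in lborel. x \<in> \<Omega> \<longrightarrow> f x = indicator \<Omega> x *\<^sub>R Complex (g1 x) (g2 x)"
      using g(2,4) by eventually_elim (auto simp: h_def complex_eq_iff)
  qed simp
qed

lemma lebesgue_on_borel_representative:
  fixes f g :: "'a::euclidean_space \<Rightarrow> complex"
  assumes \<Omega>: "\<Omega> \<in> sets borel" and f: "f \<in> borel_measurable (lebesgue_on \<Omega>)"
    and g: "g \<in> borel_measurable borel" and zero: "\<And>x. x \<notin> \<Omega> \<Longrightarrow> g x = 0"
    and AE: "AE x in lborel. x \<in> \<Omega> \<longrightarrow> f x = g x"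
  shows "integrable (lebesgue_on \<Omega>) f \<longleftrightarrow> integrable lborel g"
    and "(LINT x|lebesgue_on \<Omega>. f x) = (LINT x|lborel. g x)"
proof -
  have sets: "\<Omega> \<inter> space lebesgue \<in> sets lebesgue" using \<Omega> by auto
  have m1: "(\<lambda>x. indicator \<Omega> x *\<^sub>R f x) \<in> borel_measurable lebesgue"
    using f \<Omega> borel_measurable_restrict_space_iff[OF sets, of f] by auto
  have m2: "g \<in> borel_measurable lebesgue" using g by (auto intro: measurable_completion)
  have "AE x in lborel. indicator \<Omega> x *\<^sub>R f x = g x"
    using AE by eventually_elim (use zero in \<open>auto simp: indicator_def\<close>)
  hence ae: "AE x in lebesgue. indicator \<Omega> x *\<^sub>R f x = g x" by (simp only: AE_completion_iff)
  have "integrable (lebesgue_on \<Omega>) f \<longleftrightarrow> integrable lebesgue (\<lambda>x. indicator \<Omega> x *\<^sub>R f x)"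
    by (rule integrable_restrict_space[OF sets])
  also have "\<dots> \<longleftrightarrow> integrable lebesgue g" by (rule integrable_cong_AE[OF m1 m2 ae])
  also have "\<dots> \<longleftrightarrow> integrable lborel g" using g by (intro integrable_completion) simp
  finally show "integrable (lebesgue_on \<Omega>) f \<longleftrightarrow> integrable lborel g" .
  have "(LINT x|lebesgue_on \<Omega>. f x) = (LINT x|lebesgue. indicator \<Omega> x *\<^sub>R f x)"
    by (rule integral_restrict_space[OF sets])
  also have "\<dots> = (LINT x|lebesgue. g x)" by (rule integral_cong_AE[OF m1 m2 ae])
  also have "\<dots> = (LINT x|lborel. g x)" using g by (intro integral_completion) simp
  finally show "(LINT x|lebesgue_on \<Omega>. f x) = (LINT x|lborel. g x)" .
qed

lemma AE_lebesgue_on_iff: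
  fixes \<Omega> :: "'a::euclidean_space set"
  assumes "\<Omega> \<in> sets borel"
  shows "(AE x in lebesgue_on \<Omega>. P x) \<longleftrightarrow> (AE x in lborel. x \<in> \<Omega> \<longrightarrow> P x)"
proof -
  have "(AE x in lebesgue_on \<Omega>. P x) \<longleftrightarrow> (AE x in lebesgue. x \<in> \<Omega> \<longrightarrow> P x)"
    using assms by (intro AE_restrict_space_iff) auto
  thus ?thesis by (simp only: AE_completion_iff)
qed

lemma fundamental_lemma:
  fixes f :: "real^3 \<Rightarrow> complex"
  assumes \<Omega>: "open \<Omega>" and f: "integrable (lebesgue_on \<Omega>) f"
    and cont: "\<And>\<psi>. \<psi> \<in> test_functions \<Omega> \<Longrightarrow> continuous_on UNIV \<psi>"
    and test: "\<And>\<psi>. \<psi> \<in> test_functions \<Omega> \<Longrightarrow> (LINT x|lebesgue_on \<Omega>. f x * of_real (\<psi> x)) = 0"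
  shows "AE x in lebesgue_on \<Omega>. f x = 0"
proof -
  have \<Omega>': "\<Omega> \<in> sets borel" using \<Omega> by auto
  obtain g where g: "g \<in> borel_measurable borel" "\<And>x. x \<notin> \<Omega> \<Longrightarrow> g x = 0"
    "AE x in lborel. x \<in> \<Omega> \<longrightarrow> f x = g x"
    using borel_representative[OF \<Omega>' borel_measurable_integrable[OF f]] by blast
  have "integrable lborel g"
    using lebesgue_on_borel_representative(1)[OF \<Omega>' borel_measurable_integrable[OF f] g] f by simp
  hence "AE x in lborel. g x = 0"
  proof (rule fundamental_lemma_lborel[OF \<Omega> _ g(2)])
    fix \<psi> assume \<psi>: "\<psi> \<in> test_functions \<Omega>"
    have [measurable]: "\<psi> \<in> borel_measurable borel"
      using cont[OF \<psi>] by (rule borel_measurable_continuous_onI)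
    have "(LINT x|lebesgue_on \<Omega>. f x * of_real (\<psi> x)) = (LINT x|lborel. g x * of_real (\<psi> x))"
    proof (rule lebesgue_on_borel_representative(2)[OF \<Omega>'])
      have "\<psi> \<in> borel_measurable (lebesgue_on \<Omega>)"
        by (intro measurable_restrict_space1 measurable_completion) simp
      thus "(\<lambda>x. f x * of_real (\<psi> x)) \<in> borel_measurable (lebesgue_on \<Omega>)"
        using borel_measurable_integrable[OF f] by measurable
      show "(\<lambda>x. g x * of_real (\<psi> x)) \<in> borel_measurable borel" using g(1) by measurable
      show "AE x in lborel. x \<in> \<Omega> \<longrightarrow> f x * of_real (\<psi> x) = g x * of_real (\<psi> x)"
        using g(3) by eventually_elim auto
    qed (use g in auto)
    thus "(LINT x|lborel. g x * of_real (\<psi> x)) = 0" using test[OF \<psi>] by simp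
  qed
  thus ?thesis unfolding AE_lebesgue_on_iff[OF \<Omega>'] using g(3) by eventually_elim auto
qed

lemma smooth_fun_has_derivative:
  assumes "smooth_fun \<psi>"
  shows "(\<psi> has_derivative (\<lambda>h. \<Sum>i\<in>UNIV. h $ i * partial_deriv i \<psi> x)) (at x)"
proof -
  have "\<psi> differentiable (at x)" using assms[unfolded smooth_fun_def, rule_format, of "[]" x] by simp
  hence d: "(\<psi> has_derivative frechet_derivative \<psi> (at x)) (at x)" by (simp add: frechet_derivative_works)
  interpret bounded_linear "frechet_derivative \<psi> (at x)" using d by (rule has_derivative_bounded_linear)
  have "frechet_derivative \<psi> (at x) h = (\<Sum>i\<in>UNIV. h $ i * partial_deriv i \<psi> x)" for h
  proof -
    have "h = (\<Sum>i\<in>UNIV. h $ i *\<^sub>R axis i 1)" using basis_expansion[of h] by (simp add: scalar_mult_eq_scaleR)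
    hence "frechet_derivative \<psi> (at x) h = frechet_derivative \<psi> (at x) (\<Sum>i\<in>UNIV. h $ i *\<^sub>R axis i 1)" by simp
    thus ?thesis by (simp add: sum scaleR partial_deriv_def)
  qed
  hence "frechet_derivative \<psi> (at x) = (\<lambda>h. \<Sum>i\<in>UNIV. h $ i * partial_deriv i \<psi> x)" by (rule ext)
  thus ?thesis using d by (simp only:)
qed

lemma smooth_fun_continuous: "smooth_fun \<psi> \<Longrightarrow> continuous_on S \<psi>"
  using smooth_fun_has_derivative by (meson continuous_at_imp_continuous_on has_derivative_continuous)

lemma smooth_fun_partial_deriv:
  assumes "smooth_fun \<psi>"
  shows "smooth_fun (partial_deriv i \<psi>)"
  unfolding smooth_fun_def
proof (intro allI)
  fix "is" x
  show "foldr partial_deriv is (partial_deriv i \<psi>) differentiable at x"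
    using assms[unfolded smooth_fun_def, rule_format, of "is @ [i]" x] by simp
qed

lemma test_functions_partial_deriv:
  assumes "\<psi> \<in> test_functions \<Omega>"
  shows "partial_deriv i \<psi> \<in> test_functions \<Omega>"
proof -
  obtain K where K: "compact K" "K \<subseteq> \<Omega>" "\<And>x. x \<notin> K \<Longrightarrow> \<psi> x = 0" and s: "smooth_fun \<psi>"
    using assms unfolding test_functions_def by blast
  have "partial_deriv i \<psi> x = 0" if "x \<notin> K" for x
  proof -
    have "(\<psi> has_derivative (\<lambda>h. 0)) (at x)"
    proof (rule has_derivative_transform_within_open[OF has_derivative_const])
      show "open (- K)" using K by (simp add: compact_imp_closed open_Compl)
    qed (use that K in auto)
    hence "frechet_derivative \<psi> (at x) = (\<lambda>h. 0)" using frechet_derivative_at by metis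
    thus ?thesis by (simp add: partial_deriv_def)
  qed
  thus ?thesis using K s smooth_fun_partial_deriv unfolding test_functions_def by blast
qed

lemma test_functions_continuous: "\<psi> \<in> test_functions \<Omega> \<Longrightarrow> continuous_on S \<psi>"
  by (auto simp: test_functions_def smooth_fun_continuous)

lemma test_functions_measurable: "\<psi> \<in> test_functions \<Omega> \<Longrightarrow> \<psi> \<in> borel_measurable borel"
  by (intro borel_measurable_continuous_onI test_functions_continuous)

lemma test_functions_bounded:
  assumes "\<psi> \<in> test_functions \<Omega>"
  obtains B where "B \<ge> 0" "\<And>x. \<bar>\<psi> x\<bar> \<le> B"
proof -
  obtain K where K: "compact K" "\<And>x. x \<notin> K \<Longrightarrow> \<psi> x = 0"
    using assms unfolding test_functions_def by blast
  have "bounded (\<psi> ` K)"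
    using compact_continuous_image[OF test_functions_continuous[OF assms] K(1)] compact_imp_bounded by blast
  then obtain B where B: "B > 0" "\<And>y. y \<in> \<psi> ` K \<Longrightarrow> norm y \<le> B" using bounded_pos by metis
  have "\<bar>\<psi> x\<bar> \<le> B" for x using B K by (cases "x \<in> K") force+
  thus ?thesis using B that[of B] by simp
qed

locale bounded_open =
  fixes \<Omega> :: "(real^3) set"
  assumes open_dom: "open \<Omega>" and bounded_dom: "bounded \<Omega>"
begin

lemma dom_borel [measurable, simp]: "\<Omega> \<in> sets borel" using open_dom by simp

lemma dom_lmeasurable: "\<Omega> \<in> lmeasurable" using open_dom bounded_dom by (simp add: lmeasurable_open)

lemma finite_dom: "finite_measure (lebesgue_on \<Omega>)"
  by (rule finite_measure_lebesgue_on[OF dom_lmeasurable])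

lemma bounded_in_L2:
  assumes "f \<in> borel_measurable borel" and B: "\<And>x. norm (f x) \<le> B"
  shows "f \<in> L2 \<Omega>"
proof -
  interpret finite_measure "lebesgue_on \<Omega>" by (rule finite_dom)
  have m: "f \<in> borel_measurable (lebesgue_on \<Omega>)"
    using assms by (intro measurable_restrict_space1 measurable_completion) simp
  have "integrable (lebesgue_on \<Omega>) (\<lambda>x. (norm (f x))\<^sup>2)"
    using B m by (intro integrable_const_bound[where B = "B\<^sup>2"]) (auto intro!: AE_I2 power_mono)
  thus ?thesis using m by (simp add: L2_def)
qed

lemma test_function_L2: "\<psi> \<in> test_functions \<Omega> \<Longrightarrow> (\<lambda>x. of_real (\<psi> x)) \<in> L2 \<Omega>"
proof -
  assume \<psi>: "\<psi> \<in> test_functions \<Omega>"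
  obtain B where B: "\<And>x. \<bar>\<psi> x\<bar> \<le> B" using test_functions_bounded[OF \<psi>] by metis
  show ?thesis
    using test_functions_measurable[OF \<psi>] B by (intro bounded_in_L2[where B = B]) auto
qed

lemma L2_integrable: "v \<in> L2 \<Omega> \<Longrightarrow> integrable (lebesgue_on \<Omega>) v"
  using L2_integrable_mult[of "\<lambda>_. 1" \<Omega> v] bounded_in_L2[of "\<lambda>_. 1" 1] by simp

lemma is_weak_gradient_iff:
  "is_weak_gradient \<Omega> v g \<longleftrightarrow> (\<forall>\<psi>\<in>test_functions \<Omega>. \<forall>i.
     L2_inner \<Omega> (\<lambda>x. of_real (partial_deriv i \<psi> x)) v = - L2_inner \<Omega> (\<lambda>x. of_real (\<psi> x)) (\<lambda>x. g x $ i))"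
  unfolding is_weak_gradient_def L2_inner_def by (simp add: mult.commute)

text \<open>The weak gradient is a chosen representative, so its components depend linearly on
  \<open>v\<close> only almost everywhere. Inner products do not see the difference.\<close>

definition grad_comp :: "3 \<Rightarrow> wavefun \<Rightarrow> wavefun" where
  "grad_comp i v x = weak_gradient \<Omega> v x $ i"

lemma H1_weak_gradient:
  assumes "v \<in> H1 \<Omega>"
  shows "grad_comp i v \<in> L2 \<Omega>" "is_weak_gradient \<Omega> v (weak_gradient \<Omega> v)"
proof -
  have "\<exists>g. (\<forall>i. (\<lambda>x. g x $ i) \<in> L2 \<Omega>) \<and> is_weak_gradient \<Omega> v g"
    using assms unfolding H1_def by blast
  from someI_ex[OF this] show "grad_comp i v \<in> L2 \<Omega>" "is_weak_gradient \<Omega> v (weak_gradient \<Omega> v)"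
    unfolding weak_gradient_def grad_comp_def[abs_def] by blast+
qed

lemma H1_L2: "v \<in> H1 \<Omega> \<Longrightarrow> v \<in> L2 \<Omega>" by (simp add: H1_def)

lemma H1I:
  assumes "v \<in> L2 \<Omega>" "\<And>i. (\<lambda>x. g x $ i) \<in> L2 \<Omega>" "is_weak_gradient \<Omega> v g"
  shows "v \<in> H1 \<Omega>"
  using assms unfolding H1_def by blast

text \<open>Two weak gradients have the same integrals against all test functions; the fundamental
  lemma applies to their difference.\<close>

lemma weak_gradient_unique:
  assumes "v \<in> L2 \<Omega>" "\<And>i. (\<lambda>x. g x $ i) \<in> L2 \<Omega>" "is_weak_gradient \<Omega> v g"
  shows "AE x in lebesgue_on \<Omega>. grad_comp i v x = g x $ i"
proof -
  have v: "v \<in> H1 \<Omega>" using assms by (rule H1I)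
  have d: "grad_comp i v - (\<lambda>x. g x $ i) \<in> L2 \<Omega>"
    using H1_weak_gradient(1)[OF v] assms(2) by (rule L2.minus_mem)
  have "AE x in lebesgue_on \<Omega>. (grad_comp i v - (\<lambda>x. g x $ i)) x = 0"
  proof (rule fundamental_lemma[OF open_dom L2_integrable[OF d] test_functions_continuous])
    fix \<psi> assume \<psi>: "\<psi> \<in> test_functions \<Omega>"
    have "L2_inner \<Omega> (\<lambda>x. of_real (\<psi> x)) (grad_comp i v) = L2_inner \<Omega> (\<lambda>x. of_real (\<psi> x)) (\<lambda>x. g x $ i)"
      using assms(3) H1_weak_gradient(2)[OF v] \<psi>
      unfolding is_weak_gradient_iff grad_comp_def[abs_def] by (metis neg_equal_iff_equal)
    hence "L2_inner \<Omega> (\<lambda>x. of_real (\<psi> x)) (grad_comp i v - (\<lambda>x. g x $ i)) = 0"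
      using test_function_L2[OF \<psi>] H1_weak_gradient(1)[OF v] assms(2) by (simp add: L2.minus_right)
    thus "(LINT x|lebesgue_on \<Omega>. (grad_comp i v - (\<lambda>x. g x $ i)) x * of_real (\<psi> x)) = 0"
      by (simp add: L2_inner_def mult.commute)
  qed
  thus ?thesis by eventually_elim simp
qed

lemma H1_comb:
  assumes v: "v \<in> H1 \<Omega>" and w: "w \<in> H1 \<Omega>"
  shows "(\<lambda>x. a * v x + b * w x) \<in> H1 \<Omega>"
    and "AE x in lebesgue_on \<Omega>. grad_comp i (\<lambda>x. a * v x + b * w x) x = a * grad_comp i v x + b * grad_comp i w x"
proof -
  define g :: "real^3 \<Rightarrow> complex^3" where "g x = (\<chi> i. a * grad_comp i v x + b * grad_comp i w x)" for x
  have L2: "(\<lambda>x. a * v x + b * w x) \<in> L2 \<Omega>" using v w by (intro L2_comb H1_L2)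
  have gL2: "(\<lambda>x. g x $ i) \<in> L2 \<Omega>" for i
    unfolding g_def using v w by (simp add: L2_comb H1_weak_gradient)
  have "is_weak_gradient \<Omega> (\<lambda>x. a * v x + b * w x) g"
    unfolding is_weak_gradient_iff
  proof (intro ballI allI)
    fix \<psi> i assume \<psi>: "\<psi> \<in> test_functions \<Omega>"
    have "L2_inner \<Omega> (\<lambda>x. of_real (partial_deriv i \<psi> x)) v = - L2_inner \<Omega> (\<lambda>x. of_real (\<psi> x)) (grad_comp i v)"
      "L2_inner \<Omega> (\<lambda>x. of_real (partial_deriv i \<psi> x)) w = - L2_inner \<Omega> (\<lambda>x. of_real (\<psi> x)) (grad_comp i w)"
      using H1_weak_gradient(2)[OF v] H1_weak_gradient(2)[OF w] \<psi>
      unfolding is_weak_gradient_iff grad_comp_def[abs_def] by blast+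
    thus "L2_inner \<Omega> (\<lambda>x. of_real (partial_deriv i \<psi> x)) (\<lambda>x. a * v x + b * w x) =
        - L2_inner \<Omega> (\<lambda>x. of_real (\<psi> x)) (\<lambda>x. g x $ i)"
      using test_function_L2[OF \<psi>] test_function_L2[OF test_functions_partial_deriv[OF \<psi>]] v w
      by (simp add: g_def L2.lin H1_L2 H1_weak_gradient)
  qed
  thus "(\<lambda>x. a * v x + b * w x) \<in> H1 \<Omega>"
    "AE x in lebesgue_on \<Omega>. grad_comp i (\<lambda>x. a * v x + b * w x) x = a * grad_comp i v x + b * grad_comp i w x"
    using H1I[OF L2 gL2] weak_gradient_unique[OF L2 gL2, of i] by (simp_all add: g_def[symmetric])
      (simp add: g_def)
qed

lemma grad_inner_eq:
  assumes "v \<in> H1 \<Omega>" "w \<in> H1 \<Omega>"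
  shows "grad_inner \<Omega> v w = (\<Sum>i\<in>UNIV. L2_inner \<Omega> (grad_comp i v) (grad_comp i w))"
  unfolding grad_inner_def L2_inner_def grad_comp_def[symmetric]
  using assms[THEN H1_weak_gradient(1)]
  by (subst Bochner_Integration.integral_sum[symmetric]) (auto intro!: L2_integrable_mult)

lemma H1_inner_eq:
  assumes "v \<in> H1 \<Omega>" "w \<in> H1 \<Omega>"
  shows "H1_inner \<Omega> v w = grad_inner \<Omega> v w + L2_inner \<Omega> v w"
  unfolding H1_inner_def grad_inner_def L2_inner_def
  using assms H1_weak_gradient(1)[OF assms(1)] H1_weak_gradient(1)[OF assms(2)]
  by (subst Bochner_Integration.integral_add[symmetric])
    (auto intro!: L2_integrable_mult Bochner_Integration.integrable_sum simp: H1_L2 grad_comp_def[symmetric])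

lemma grad_pos_herm_form: "pos_herm_form (H1 \<Omega>) (grad_inner \<Omega>)"
proof
  have 0: "is_weak_gradient \<Omega> (\<lambda>x. 0) (\<lambda>x. 0)" by (simp add: is_weak_gradient_def)
  show "(\<lambda>x. 0) \<in> H1 \<Omega>" by (rule H1I[OF _ _ 0]) (simp_all add: L2_def)
  show "(\<lambda>x. a * v x + b * w x) \<in> H1 \<Omega>" if "v \<in> H1 \<Omega>" "w \<in> H1 \<Omega>" for v w a b
    using that by (rule H1_comb)
  show "grad_inner \<Omega> u (\<lambda>x. a * v x + b * w x) = a * grad_inner \<Omega> u v + b * grad_inner \<Omega> u w"
    if u: "u \<in> H1 \<Omega>" and v: "v \<in> H1 \<Omega>" and w: "w \<in> H1 \<Omega>" for u v w a b
  proof -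
    have "L2_inner \<Omega> (grad_comp i u) (grad_comp i (\<lambda>x. a * v x + b * w x)) =
        a * L2_inner \<Omega> (grad_comp i u) (grad_comp i v) + b * L2_inner \<Omega> (grad_comp i u) (grad_comp i w)" for i
    proof -
      note D = H1_weak_gradient(1)
      have "L2_inner \<Omega> (grad_comp i u) (grad_comp i (\<lambda>x. a * v x + b * w x)) =
        L2_inner \<Omega> (grad_comp i u) (\<lambda>x. a * grad_comp i v x + b * grad_comp i w x)"
        by (rule L2_inner_cong_AE[OF D[OF u] D[OF u] D[OF H1_comb(1)[OF v w]] L2_comb[OF D[OF v] D[OF w]] _ H1_comb(2)[OF v w]]) simp
      thus ?thesis by (simp add: L2.lin[OF D[OF u] D[OF v] D[OF w]])
    qed
    thus ?thesis
      using u v w by (simp add: grad_inner_eq H1_comb(1) sum.distrib sum_distrib_left)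
  qed
  show "grad_inner \<Omega> v u = cnj (grad_inner \<Omega> u v)" if "u \<in> H1 \<Omega>" "v \<in> H1 \<Omega>" for u v
    using that by (auto simp: grad_inner_eq H1_weak_gradient intro!: sum.cong L2.herm)
  show "0 \<le> Re (grad_inner \<Omega> v v)" if "v \<in> H1 \<Omega>" for v
    using that by (auto simp: grad_inner_eq H1_weak_gradient intro!: sum_nonneg L2.pos)
qed

sublocale grad: pos_herm_form "H1 \<Omega>" "grad_inner \<Omega>" by (rule grad_pos_herm_form)

sublocale H1: pos_herm_form "H1 \<Omega>" "H1_inner \<Omega>"
proof
  show "H1_inner \<Omega> u (\<lambda>x. a * v x + b * w x) = a * H1_inner \<Omega> u v + b * H1_inner \<Omega> u w"
    if u: "u \<in> H1 \<Omega>" and v: "v \<in> H1 \<Omega>" and w: "w \<in> H1 \<Omega>" for u v w a b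
    using that by (simp add: H1_inner_eq H1_comb(1) grad.lin L2.lin H1_L2 algebra_simps)
  show "H1_inner \<Omega> v u = cnj (H1_inner \<Omega> u v)" if "u \<in> H1 \<Omega>" "v \<in> H1 \<Omega>" for u v
    using that by (simp add: H1_inner_eq H1_L2 L2.herm[of u] grad.herm[of u])
  show "0 \<le> Re (H1_inner \<Omega> v v)" if "v \<in> H1 \<Omega>" for v
    using that by (simp add: H1_inner_eq H1_L2 L2.pos grad.pos)
qed (simp_all add: grad.zero H1_comb)

lemma L2_le_H1: "v \<in> H1 \<Omega> \<Longrightarrow> Re (L2_inner \<Omega> v v) \<le> Re (H1_inner \<Omega> v v)"
  using grad.pos[of v] by (simp add: H1_inner_eq)

lemma grad_comp_le_H1:
  assumes v: "v \<in> H1 \<Omega>"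
  shows "Re (L2_inner \<Omega> (grad_comp i v) (grad_comp i v)) \<le> Re (H1_inner \<Omega> v v)"
proof -
  have "Re (L2_inner \<Omega> (grad_comp i v) (grad_comp i v)) \<le>
      (\<Sum>i\<in>UNIV. Re (L2_inner \<Omega> (grad_comp i v) (grad_comp i v)))"
    using v by (intro member_le_sum) (auto intro!: L2.pos H1_weak_gradient)
  also have "\<dots> = Re (grad_inner \<Omega> v v)" using v by (simp add: grad_inner_eq)
  finally show ?thesis using v L2.pos[of v \<Omega>] by (simp add: H1_inner_eq H1_L2)
qed

lemma grad_comp_minus:
  assumes "v \<in> H1 \<Omega>" "w \<in> H1 \<Omega>"
  shows "AE x in lebesgue_on \<Omega>. grad_comp i (v - w) x = (grad_comp i v - grad_comp i w) x"
  using H1_comb(2)[OF assms, of i 1 "-1"] by (simp add: fun_diff_def)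

text \<open>The functions and each gradient component converge in \<open>L2\<close>. Both sides of
  the identity that defines a weak gradient are continuous in that sense, so the limit of the
  gradients is the gradient of the limit.\<close>

lemma H1_complete: "form_complete (H1 \<Omega>) (\<lambda>v w. Re (H1_inner \<Omega> v w))"
  unfolding form_complete_def
proof (intro allI impI)
  fix u :: "nat \<Rightarrow> wavefun"
  assume "\<forall>n. u n \<in> H1 \<Omega>" and Cauchy: "form_Cauchy (\<lambda>v w. Re (H1_inner \<Omega> v w)) u"
  hence u: "u n \<in> H1 \<Omega>" for n by blast
  note D = H1_weak_gradient(1)
  have D_minus: "Re (L2_inner \<Omega> (grad_comp i v - grad_comp i w) (grad_comp i v - grad_comp i w)) =
      Re (L2_inner \<Omega> (grad_comp i (v - w)) (grad_comp i (v - w)))" if "v \<in> H1 \<Omega>" "w \<in> H1 \<Omega>" for v w i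
    using that grad_comp_minus[OF that, of i]
    by (intro arg_cong[of _ _ Re] L2_inner_cong_AE L2.minus_mem D H1.minus_mem) (auto elim: eventually_mono)
  have "form_Cauchy (\<lambda>v w. Re (L2_inner \<Omega> v w)) u"
    by (rule form_Cauchy_le[OF _ tendsto_const Cauchy, where B = 1])
      (use u L2_le_H1 H1.minus_mem in auto)
  from form_completeD[OF L2_complete[OF finite_dom] H1_L2[OF u] this]
  obtain v where v: "v \<in> L2 \<Omega>" and v_lim: "(\<lambda>n. Re (L2_inner \<Omega> (u n - v) (u n - v))) \<longlonglongrightarrow> 0"
    by blast
  have ex: "\<exists>G. G \<in> L2 \<Omega> \<and> (\<lambda>n. Re (L2_inner \<Omega> (grad_comp i (u n) - G) (grad_comp i (u n) - G))) \<longlonglongrightarrow> 0" for i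
  proof -
    have "form_Cauchy (\<lambda>v w. Re (L2_inner \<Omega> v w)) (\<lambda>n. grad_comp i (u n))"
      unfolding form_Cauchy_def
    proof (rule allI, rule impI)
      fix e :: real assume "e > 0"
      then obtain N where N: "\<And>m n. m \<ge> N \<Longrightarrow> n \<ge> N \<Longrightarrow> Re (H1_inner \<Omega> (u m - u n) (u m - u n)) < e"
        using Cauchy unfolding form_Cauchy_def by metis
      have "Re (L2_inner \<Omega> (grad_comp i (u m) - grad_comp i (u n)) (grad_comp i (u m) - grad_comp i (u n))) < e"
        if "m \<ge> N" "n \<ge> N" for m n
        unfolding D_minus[OF u u]
        by (rule le_less_trans[OF grad_comp_le_H1[OF H1.minus_mem[OF u u]] N[OF that]])
      thus "\<exists>N. \<forall>m\<ge>N. \<forall>n\<ge>N. Re (L2_inner \<Omega> (grad_comp i (u m) - grad_comp i (u n)) (grad_comp i (u m) - grad_comp i (u n))) < e"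
        by (intro exI[of _ N] allI impI)
    qed
    from form_completeD[OF L2_complete[OF finite_dom] _ this] D[OF u] show ?thesis by blast
  qed
  have "\<exists>G. \<forall>i. G i \<in> L2 \<Omega> \<and> (\<lambda>n. Re (L2_inner \<Omega> (grad_comp i (u n) - G i) (grad_comp i (u n) - G i))) \<longlonglongrightarrow> 0"
    by (rule choice, rule allI, rule ex)
  then obtain G where G: "\<And>i. G i \<in> L2 \<Omega>"
    and G_lim: "\<And>i. (\<lambda>n. Re (L2_inner \<Omega> (grad_comp i (u n) - G i) (grad_comp i (u n) - G i))) \<longlonglongrightarrow> 0"
    by blast
  define g :: "real^3 \<Rightarrow> complex^3" where "g x = (\<chi> i. G i x)" for x
  have g: "(\<lambda>x. g x $ i) = G i" for i by (simp add: g_def)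
  have wg: "is_weak_gradient \<Omega> v g"
    unfolding is_weak_gradient_iff g
  proof (intro ballI allI)
    fix \<psi> i assume \<psi>: "\<psi> \<in> test_functions \<Omega>"
    have eq: "L2_inner \<Omega> (\<lambda>x. of_real (partial_deriv i \<psi> x)) (u n) = - L2_inner \<Omega> (\<lambda>x. of_real (\<psi> x)) (grad_comp i (u n))" for n
      using H1_weak_gradient(2)[OF u[of n]] \<psi> unfolding is_weak_gradient_iff grad_comp_def[abs_def] by blast
    have "(\<lambda>n. L2_inner \<Omega> (\<lambda>x. of_real (partial_deriv i \<psi> x)) (u n)) \<longlonglongrightarrow> L2_inner \<Omega> (\<lambda>x. of_real (partial_deriv i \<psi> x)) v"
      by (rule L2.tendsto_right[OF H1_L2[OF u] v test_function_L2[OF test_functions_partial_deriv[OF \<psi>]] v_lim])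
    moreover have "(\<lambda>n. - L2_inner \<Omega> (\<lambda>x. of_real (\<psi> x)) (grad_comp i (u n))) \<longlonglongrightarrow> - L2_inner \<Omega> (\<lambda>x. of_real (\<psi> x)) (G i)"
      by (rule tendsto_minus[OF L2.tendsto_right[OF D[OF u] G test_function_L2[OF \<psi>] G_lim]])
    ultimately show "L2_inner \<Omega> (\<lambda>x. of_real (partial_deriv i \<psi> x)) v = - L2_inner \<Omega> (\<lambda>x. of_real (\<psi> x)) (G i)"
      unfolding eq by (rule LIMSEQ_unique)
  qed
  have vH1: "v \<in> H1 \<Omega>" using v G wg by (intro H1I[of _ g]) (simp_all add: g)
  have vg: "AE x in lebesgue_on \<Omega>. grad_comp i v x = G i x" for i
    using weak_gradient_unique[OF v _ wg, of i] G by (simp add: g g_def)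
  have "Re (H1_inner \<Omega> (u n - v) (u n - v)) =
      (\<Sum>i\<in>UNIV. Re (L2_inner \<Omega> (grad_comp i (u n) - G i) (grad_comp i (u n) - G i))) +
      Re (L2_inner \<Omega> (u n - v) (u n - v))" for n
  proof -
    have "L2_inner \<Omega> (grad_comp i (u n - v)) (grad_comp i (u n - v)) =
        L2_inner \<Omega> (grad_comp i (u n) - G i) (grad_comp i (u n) - G i)" for i
    proof -
      have "AE x in lebesgue_on \<Omega>. grad_comp i (u n - v) x = (grad_comp i (u n) - G i) x"
        using grad_comp_minus[OF u vH1, of i n] vg[of i] by eventually_elim simp
      thus ?thesis using u vH1 G by (intro L2_inner_cong_AE L2.minus_mem D H1.minus_mem)
    qed
    thus ?thesis using H1.minus_mem[OF u vH1] by (simp add: H1_inner_eq grad_inner_eq)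
  qed
  moreover have "(\<lambda>n. (\<Sum>i\<in>UNIV. Re (L2_inner \<Omega> (grad_comp i (u n) - G i) (grad_comp i (u n) - G i))) +
      Re (L2_inner \<Omega> (u n - v) (u n - v))) \<longlonglongrightarrow> (\<Sum>i\<in>(UNIV :: 3 set). 0) + 0"
    by (intro tendsto_add tendsto_sum G_lim v_lim)
  ultimately have "(\<lambda>n. Re (H1_inner \<Omega> (u n - v) (u n - v))) \<longlonglongrightarrow> 0"
    by (simp only: sum.neutral_const add_0_right)
  thus "\<exists>v\<in>H1 \<Omega>. (\<lambda>n. Re (H1_inner \<Omega> (u n - v) (u n - v))) \<longlonglongrightarrow> 0"
    using vH1 by (rule bexI)
qed

end

section \<open>Translations and averages over cubes\<close>

lemma lborel_translate:
  fixes f :: "'a::euclidean_space \<Rightarrow> 'b::{banach, second_countable_topology}"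
  assumes f: "f \<in> borel_measurable borel"
  shows "integrable lborel (\<lambda>x. f (x + a)) \<longleftrightarrow> integrable lborel f"
    and "(LINT x|lborel. f (x + a)) = (LINT x|lborel. f x)"
proof -
  have "integrable (distr lborel borel ((+) a)) f \<longleftrightarrow> integrable lborel (\<lambda>x. f (a + x))"
    using f by (intro integrable_distr_eq) auto
  thus "integrable lborel (\<lambda>x. f (x + a)) \<longleftrightarrow> integrable lborel f"
    by (simp add: lborel_distr_plus add.commute)
  have "integral\<^sup>L (distr lborel borel ((+) a)) f = (LINT x|lborel. f (a + x))"
    using f by (intro integral_distr) auto
  thus "(LINT x|lborel. f (x + a)) = (LINT x|lborel. f x)"
    by (simp add: lborel_distr_plus add.commute)
qed

lemma nn_integral_lborel_affine:
  fixes f :: "'a::euclidean_space \<Rightarrow> ennreal"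
  assumes f: "f \<in> borel_measurable borel" and c: "c \<noteq> 0"
  shows "(\<integral>\<^sup>+x. f x \<partial>lborel) = ennreal (\<bar>c\<bar> ^ DIM('a)) * (\<integral>\<^sup>+x. f (a + c *\<^sub>R x) \<partial>lborel)"
  using f by (subst lborel_affine[OF c, of a])
    (simp add: nn_integral_density nn_integral_distr nn_integral_cmult)

lemma nn_integral_lborel_translate:
  fixes f :: "'a::euclidean_space \<Rightarrow> ennreal"
  assumes "f \<in> borel_measurable borel"
  shows "(\<integral>\<^sup>+x. f (x + a) \<partial>lborel) = (\<integral>\<^sup>+x. f x \<partial>lborel)"
  using nn_integral_lborel_affine[OF assms, of 1 a] by (simp add: add.commute)

lemma integrable_mult_bounded:
  fixes f :: "'a \<Rightarrow> complex" and c :: "'a \<Rightarrow> real"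
  assumes f: "integrable M f" and [measurable]: "c \<in> borel_measurable M" and B: "\<And>x. \<bar>c x\<bar> \<le> B"
  shows "integrable M (\<lambda>x. f x * of_real (c x))"
proof (rule Bochner_Integration.integrable_bound)
  show "integrable M (\<lambda>x. B * norm (f x))" using f by simp
  show "(\<lambda>x. f x * of_real (c x)) \<in> borel_measurable M" using f by measurable
  have "norm (f x * of_real (c x)) \<le> norm (B * norm (f x))" for x
  proof -
    have "norm (f x * of_real (c x)) = \<bar>c x\<bar> * norm (f x)" by (simp add: norm_mult)
    also have "\<dots> \<le> B * norm (f x)" by (intro mult_right_mono B) simp
    finally show ?thesis by simp
  qed
  thus "AE x in M. norm (f x * of_real (c x)) \<le> norm (B * norm (f x))" by (intro AE_I2)
qed

text \<open>By Tonelli with \<open>t\<close> outermost and translation invariance, the inner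
  integral does not depend on \<open>t\<close>. This justifies the exchanges of integrals along
  segments.\<close>

lemma integrable_shift:
  fixes G :: "real^3 \<Rightarrow> complex"
  assumes G: "integrable lborel G"
  shows "integrable (lborel \<Otimes>\<^sub>M lborel) (\<lambda>(x, t). indicator {0..1::real} t *\<^sub>R G (x + t *\<^sub>R h))"
proof (rule integrableI_bounded)
  have [measurable]: "G \<in> borel_measurable borel" using G by simp
  show "(\<lambda>(x, t). indicator {0..1::real} t *\<^sub>R G (x + t *\<^sub>R h)) \<in> borel_measurable (lborel \<Otimes>\<^sub>M lborel)"
    by measurable
  have "(\<integral>\<^sup>+z. ennreal (norm (case z of (x, t) \<Rightarrow> indicator {0..1::real} t *\<^sub>R G (x + t *\<^sub>R h))) \<partial>(lborel \<Otimes>\<^sub>M lborel))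
      = (\<integral>\<^sup>+(x, t). indicator {0..1::real} t * ennreal (norm (G (x + t *\<^sub>R h))) \<partial>(lborel \<Otimes>\<^sub>M lborel))"
    by (intro nn_integral_cong) (auto simp: indicator_def)
  also have "\<dots> = (\<integral>\<^sup>+t. \<integral>\<^sup>+x. indicator {0..1::real} t * ennreal (norm (G (x + t *\<^sub>R h))) \<partial>lborel \<partial>lborel)"
    by (rule lborel_pair.nn_integral_snd[of "\<lambda>(x, t). indicator {0..1::real} t * ennreal (norm (G (x + t *\<^sub>R h)))",
        unfolded prod.case, symmetric]) measurable
  also have "\<dots> = (\<integral>\<^sup>+t. indicator {0..1::real} t * (\<integral>\<^sup>+x. ennreal (norm (G x)) \<partial>lborel) \<partial>lborel)"
    by (intro nn_integral_cong)
      (simp add: nn_integral_cmult nn_integral_lborel_translate[of "\<lambda>x. ennreal (norm (G x))"])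
  also have "\<dots> = (\<integral>\<^sup>+x. ennreal (norm (G x)) \<partial>lborel)"
    by (simp add: nn_integral_multc)
  also have "\<dots> < \<infinity>" using G by (simp add: integrable_iff_bounded)
  finally show "(\<integral>\<^sup>+z. ennreal (norm (case z of (x, t) \<Rightarrow> indicator {0..1::real} t *\<^sub>R G (x + t *\<^sub>R h))) \<partial>(lborel \<Otimes>\<^sub>M lborel)) < \<infinity>" .
qed

lemma test_functions_translate:
  assumes \<psi>: "\<psi> \<in> test_functions W" and sub: "(\<lambda>x. x + a) ` W \<subseteq> \<Omega>"
  shows "(\<lambda>x. \<psi> (x - a)) \<in> test_functions \<Omega>"
    and "partial_deriv i (\<lambda>x. \<psi> (x - a)) x = partial_deriv i \<psi> (x - a)"
proof -
  obtain K where K: "compact K" "K \<subseteq> W" "\<And>x. x \<notin> K \<Longrightarrow> \<psi> x = 0" and s: "smooth_fun \<psi>"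
    using \<psi> unfolding test_functions_def by blast
  have deriv: "((\<lambda>x. f (x - a)) has_derivative f') (at x)"
    if "(f has_derivative f') (at (x - a))" for f :: "real^3 \<Rightarrow> real" and f' x
  proof -
    have "((\<lambda>x. x - a) has_derivative (\<lambda>h. h)) (at x)" by (auto intro!: derivative_eq_intros)
    from has_derivative_compose[OF this that] show ?thesis .
  qed
  have pd: "partial_deriv i (\<lambda>x. f (x - a)) = (\<lambda>x. partial_deriv i f (x - a))"
    if "\<And>x. f differentiable (at x)" for f :: "real^3 \<Rightarrow> real" and i
  proof
    fix x
    have "(f has_derivative frechet_derivative f (at (x - a))) (at (x - a))"
      using that by (simp add: frechet_derivative_works)
    from frechet_derivative_at[OF deriv[OF this]]
    show "partial_deriv i (\<lambda>x. f (x - a)) x = partial_deriv i f (x - a)"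
      by (simp add: partial_deriv_def)
  qed
  have sm: "foldr partial_deriv is \<psi> differentiable (at x)" for "is" x
    using s by (simp add: smooth_fun_def)
  show "partial_deriv i (\<lambda>x. \<psi> (x - a)) x = partial_deriv i \<psi> (x - a)"
    using pd[of \<psi> i] sm[of "[]"] by simp
  have "foldr partial_deriv is (\<lambda>x. \<psi> (x - a)) = (\<lambda>x. foldr partial_deriv is \<psi> (x - a))" for "is"
    by (induction "is") (simp_all add: pd sm)
  hence "smooth_fun (\<lambda>x. \<psi> (x - a))"
    unfolding smooth_fun_def using deriv sm by (metis differentiable_def)
  moreover have "compact ((\<lambda>x. x + a) ` K)"
    by (intro compact_continuous_image continuous_intros K)
  moreover have "(\<lambda>x. x + a) ` K \<subseteq> \<Omega>" using sub K by blast
  moreover have "\<psi> (x - a) = 0" if "x \<notin> (\<lambda>x. x + a) ` K" for x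
    using that K(3)[of "x - a"] by (metis diff_add_cancel image_eqI)
  ultimately show "(\<lambda>x. \<psi> (x - a)) \<in> test_functions \<Omega>"
    unfolding test_functions_def by blast
qed

text \<open>The fundamental theorem of calculus along the segment from \<open>x\<close> to
  \<open>x + h\<close>, for a weak gradient. It is proved by duality: the translations are moved
  onto the test function, the weak gradient is applied to the translated test function, and the
  classical theorem is used for the smooth test function only.\<close>

lemma translation_identity:
  fixes u :: "real^3 \<Rightarrow> complex" and g :: "3 \<Rightarrow> real^3 \<Rightarrow> complex"
  assumes \<Omega>: "open \<Omega>" "convex \<Omega>" and u: "integrable lborel u" and g: "\<And>i. integrable lborel (g i)"
    and weak: "\<And>\<psi> i. \<psi> \<in> test_functions \<Omega> \<Longrightarrow>
      (LINT x|lborel. u x * of_real (partial_deriv i \<psi> x)) = - (LINT x|lborel. g i x * of_real (\<psi> x))"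
  shows "AE x in lborel. x \<in> \<Omega> \<and> x + h \<in> \<Omega> \<longrightarrow>
    u (x + h) - u x = (LINT t|lborel. indicator {0..1} t *\<^sub>R (\<Sum>i\<in>UNIV. of_real (h $ i) * g i (x + t *\<^sub>R h)))"
proof -
  have [measurable]: "u \<in> borel_measurable borel" "\<And>i. g i \<in> borel_measurable borel" using u g by auto
  define G where "G x = (\<Sum>i\<in>UNIV. of_real (h $ i) * g i x)" for x
  have G: "integrable lborel G" unfolding G_def[abs_def] using g by simp
  have [measurable]: "G \<in> borel_measurable borel" using G by simp
  define S where "S x = (LINT t|lborel. indicator {0..1} t *\<^sub>R G (x + t *\<^sub>R h))" for x
  have S: "integrable lborel S"
    unfolding S_def[abs_def] using lborel_pair.integrable_fst[OF integrable_shift[OF G, of h]] .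
  have uh: "integrable lborel (\<lambda>x. u (x + h))" using u by (simp add: lborel_translate)
  define W where "W = \<Omega> \<inter> (\<lambda>x. x + h) -` \<Omega>"
  have W: "open W" unfolding W_def using \<Omega> by (intro open_Int open_vimage continuous_intros)
  have [measurable]: "W \<in> sets borel" using W by simp
  define D where "D x = u (x + h) - u x - S x" for x
  have D: "integrable lborel D" unfolding D_def[abs_def] using u uh S by simp
  have "AE x in lborel. indicator W x *\<^sub>R D x = 0"
  proof (rule fundamental_lemma_lborel[OF W])
    show "integrable lborel (\<lambda>x. indicator W x *\<^sub>R D x)"
      using D by (intro integrable_mult_indicator) auto
  next
    fix \<psi> assume \<psi>: "\<psi> \<in> test_functions W"
    obtain B where B: "\<And>x. \<bar>\<psi> x\<bar> \<le> B" using test_functions_bounded[OF \<psi>] by metis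
    have [measurable]: "\<psi> \<in> borel_measurable borel" "\<And>i. partial_deriv i \<psi> \<in> borel_measurable borel"
      using \<psi> by (auto intro: test_functions_measurable test_functions_partial_deriv)
    note bdd = integrable_mult_bounded[OF _ _ B]
    \<comment> \<open>Convexity enters here. If both end points lie in the domain, so does the
      segment, hence the translates of \<open>\<psi>\<close> are test functions of the
      domain.\<close>
    have Wt: "(\<lambda>x. x + t *\<^sub>R h) ` W \<subseteq> \<Omega>" if "t \<in> {0..1}" for t
    proof safe
      fix x assume "x \<in> W"
      hence "x \<in> \<Omega>" "x + h \<in> \<Omega>" by (auto simp: W_def)
      hence "(1 - t) *\<^sub>R x + t *\<^sub>R (x + h) \<in> \<Omega>" using \<Omega>(2) that by (intro convexD) auto
      thus "x + t *\<^sub>R h \<in> \<Omega>" by (simp add: algebra_simps)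
    qed
    \<comment> \<open>The directional derivative of \<open>\<psi>\<close> along \<open>h\<close> at
      \<open>y - t h\<close>, which is minus the derivative of \<open>\<psi> (y - t h)\<close> in
      \<open>t\<close>.\<close>
    define c where "c y t = (\<Sum>i\<in>UNIV. h $ i * partial_deriv i \<psi> (y - t *\<^sub>R h))" for y t
    have [measurable]: "case_prod c \<in> borel_measurable (lborel \<Otimes>\<^sub>M lborel)"
      unfolding c_def case_prod_beta' by measurable
    have "\<forall>i. \<exists>B. \<forall>x. \<bar>partial_deriv i \<psi> x\<bar> \<le> B"
      using test_functions_bounded[OF test_functions_partial_deriv[OF \<psi>]] by metis
    then obtain B' where B': "\<And>i x. \<bar>partial_deriv i \<psi> x\<bar> \<le> B' i" by metis
    define C where "C = (\<Sum>i\<in>UNIV. \<bar>h $ i\<bar> * B' i)"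
    have C: "\<bar>c y t\<bar> \<le> C" for y t
    proof -
      have "\<bar>c y t\<bar> \<le> (\<Sum>i\<in>UNIV. \<bar>h $ i * partial_deriv i \<psi> (y - t *\<^sub>R h)\<bar>)"
        unfolding c_def by (rule sum_abs)
      also have "\<dots> \<le> C" unfolding C_def abs_mult by (intro sum_mono mult_left_mono B') simp
      finally show ?thesis .
    qed
    have inner: "(LINT x|lborel. G (x + t *\<^sub>R h) * of_real (\<psi> x)) = - (LINT y|lborel. u y * of_real (c y t))"
      if t: "t \<in> {0..1}" for t
    proof -
      note tr = test_functions_translate[OF \<psi> Wt[OF t]]
      obtain B2 where B2: "\<And>i x. \<bar>partial_deriv i \<psi> (x - t *\<^sub>R h)\<bar> \<le> B2 i" using B' by metis
      have "(LINT x|lborel. G (x + t *\<^sub>R h) * of_real (\<psi> x)) =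
          (LINT x|lborel. G (x + t *\<^sub>R h) * of_real (\<psi> (x + t *\<^sub>R h - t *\<^sub>R h)))" by simp
      also have "\<dots> = (LINT y|lborel. G y * of_real (\<psi> (y - t *\<^sub>R h)))"
        by (rule lborel_translate(2)[where f = "\<lambda>y. G y * of_real (\<psi> (y - t *\<^sub>R h))"]) measurable
      also have "\<dots> = (LINT y|lborel. (\<Sum>i\<in>UNIV. of_real (h $ i) * (g i y * of_real (\<psi> (y - t *\<^sub>R h)))))"
        unfolding G_def by (simp add: sum_distrib_right mult.assoc)
      also have "\<dots> = (\<Sum>i\<in>UNIV. of_real (h $ i) * (LINT y|lborel. g i y * of_real (\<psi> (y - t *\<^sub>R h))))"
        by (subst Bochner_Integration.integral_sum)
          (auto intro!: integrable_mult_bounded[OF g _ B] Bochner_Integration.integrable_mult_right)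
      also have "\<dots> = (\<Sum>i\<in>UNIV. of_real (h $ i) * - (LINT y|lborel. u y * of_real (partial_deriv i \<psi> (y - t *\<^sub>R h))))"
        using weak[OF tr(1)] by (simp add: tr(2))
      also have "\<dots> = - (LINT y|lborel. (\<Sum>i\<in>UNIV. of_real (h $ i) * (u y * of_real (partial_deriv i \<psi> (y - t *\<^sub>R h)))))"
        by (subst Bochner_Integration.integral_sum)
          (auto intro!: integrable_mult_bounded[OF u _ B2] Bochner_Integration.integrable_mult_right simp: sum_negf)
      also have "(\<lambda>y. \<Sum>i\<in>UNIV. of_real (h $ i) * (u y * of_real (partial_deriv i \<psi> (y - t *\<^sub>R h)))) = (\<lambda>y. u y * of_real (c y t))"
        by (simp add: c_def sum_distrib_left mult_ac)
      finally show ?thesis .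
    qed
    have c_int: "(LINT t|lborel. indicator {0..1} t *\<^sub>R c y t) = - (\<psi> (y - h) - \<psi> y)" for y
    proof -
      have "(LINT t|lborel. indicator {0..1} t *\<^sub>R c y t) = - \<psi> (y - 1 *\<^sub>R h) - - \<psi> (y - 0 *\<^sub>R h)"
      proof (rule integral_FTC_atLeastAtMost[where F = "\<lambda>t. - \<psi> (y - t *\<^sub>R h)"])
        fix t :: real
        have "((\<lambda>t. y - t *\<^sub>R h) has_derivative (\<lambda>s. - (s *\<^sub>R h))) (at t)"
          by (auto intro!: derivative_eq_intros)
        from has_derivative_compose[OF this smooth_fun_has_derivative]
        have "((\<lambda>t. \<psi> (y - t *\<^sub>R h)) has_derivative (\<lambda>s. \<Sum>i\<in>UNIV. (- (s *\<^sub>R h)) $ i * partial_deriv i \<psi> (y - t *\<^sub>R h))) (at t)"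
          using \<psi> unfolding test_functions_def by blast
        hence "((\<lambda>t. - \<psi> (y - t *\<^sub>R h)) has_derivative (\<lambda>s. - (\<Sum>i\<in>UNIV. (- (s *\<^sub>R h)) $ i * partial_deriv i \<psi> (y - t *\<^sub>R h)))) (at t)"
          by (rule has_derivative_minus)
        also have "(\<lambda>s. - (\<Sum>i\<in>UNIV. (- (s *\<^sub>R h)) $ i * partial_deriv i \<psi> (y - t *\<^sub>R h))) = (\<lambda>s. s *\<^sub>R c y t)"
          by (simp add: c_def fun_eq_iff sum_negf[symmetric] sum_distrib_left mult_ac)
        finally show "((\<lambda>t. - \<psi> (y - t *\<^sub>R h)) has_vector_derivative c y t) (at t within {0..1})"
          unfolding has_vector_derivative_def by (rule has_derivative_at_withinI)
      next
        show "continuous_on {0..1} (c y)"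
          unfolding c_def[abs_def]
          by (intro continuous_on_sum continuous_on_mult continuous_on_const
              continuous_on_compose2[OF test_functions_continuous[OF test_functions_partial_deriv[OF \<psi>], of UNIV]]
              continuous_intros) auto
      qed simp
      thus ?thesis by simp
    qed
    have int1: "integrable (lborel \<Otimes>\<^sub>M lborel) (\<lambda>(x, t). (indicator {0..1::real} t *\<^sub>R G (x + t *\<^sub>R h)) * of_real (\<psi> x))"
      using integrable_mult_bounded[OF integrable_shift[OF G, of h], of "\<lambda>z. \<psi> (fst z)" B] B
      by (simp add: case_prod_beta')
    \<comment> \<open>The shift lemma with displacement 0 gives integrability of \<open>u\<close> on
      the strip; the bounded factor \<open>c\<close> does not destroy it.\<close>
    have int2: "integrable (lborel \<Otimes>\<^sub>M lborel) (\<lambda>(x, t). (indicator {0..1::real} t *\<^sub>R u x) * of_real (c x t))"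
      using integrable_mult_bounded[OF integrable_shift[OF u, of 0], of "case_prod c" C] C
      by (simp add: case_prod_beta')
    have "(LINT x|lborel. S x * of_real (\<psi> x)) =
        (LINT x|lborel. LINT t|lborel. (indicator {0..1} t *\<^sub>R G (x + t *\<^sub>R h)) * of_real (\<psi> x))"
      unfolding S_def by (simp only: integral_mult_left_zero)
    also have "\<dots> = (LINT t|lborel. LINT x|lborel. (indicator {0..1} t *\<^sub>R G (x + t *\<^sub>R h)) * of_real (\<psi> x))"
      by (rule lborel_pair.Fubini_integral[OF int1, symmetric])
    also have "\<dots> = (LINT t|lborel. - (LINT x|lborel. (indicator {0..1} t *\<^sub>R u x) * of_real (c x t)))"
    proof (rule Bochner_Integration.integral_cong[OF refl])
      fix t :: real
      show "(LINT x|lborel. (indicator {0..1} t *\<^sub>R G (x + t *\<^sub>R h)) * of_real (\<psi> x)) =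
          - (LINT x|lborel. (indicator {0..1} t *\<^sub>R u x) * of_real (c x t))"
        using inner[of t] by (cases "t \<in> {0..1}") simp_all
    qed
    also have "\<dots> = - (LINT x|lborel. LINT t|lborel. (indicator {0..1} t *\<^sub>R u x) * of_real (c x t))"
      using lborel_pair.Fubini_integral[OF int2] by simp
    also have "(\<lambda>x. LINT t|lborel. (indicator {0..1} t *\<^sub>R u x) * of_real (c x t)) = (\<lambda>x. u x * of_real (- (\<psi> (x - h) - \<psi> x)))"
    proof
      fix x
      have "(LINT t|lborel. (indicator {0..1} t *\<^sub>R u x) * of_real (c x t)) = (LINT t|lborel. u x * of_real (indicator {0..1} t *\<^sub>R c x t))"
        by (intro Bochner_Integration.integral_cong) (auto simp: scaleR_conv_of_real)
      also have "\<dots> = u x * of_real (LINT t|lborel. indicator {0..1} t *\<^sub>R c x t)"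
        by (simp only: integral_mult_right_zero integral_complex_of_real)
      finally show "(LINT t|lborel. (indicator {0..1} t *\<^sub>R u x) * of_real (c x t)) = u x * of_real (- (\<psi> (x - h) - \<psi> x))"
        by (simp only: c_int)
    qed
    also have "- (LINT x|lborel. u x * of_real (- (\<psi> (x - h) - \<psi> x))) =
        (LINT x|lborel. u x * of_real (\<psi> (x - h)) - u x * of_real (\<psi> x))"
      by (simp add: algebra_simps flip: Bochner_Integration.integral_minus)
    also have "\<dots> = (LINT x|lborel. u x * of_real (\<psi> (x - h))) - (LINT x|lborel. u x * of_real (\<psi> x))"
      by (intro Bochner_Integration.integral_diff bdd u) measurable
    also have "(LINT x|lborel. u x * of_real (\<psi> (x - h))) = (LINT x|lborel. u (x + h) * of_real (\<psi> x))"
      using lborel_translate(2)[of "\<lambda>x. u x * of_real (\<psi> (x - h))" h] by simp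
    finally have S\<psi>: "(LINT x|lborel. S x * of_real (\<psi> x)) =
        (LINT x|lborel. u (x + h) * of_real (\<psi> x)) - (LINT x|lborel. u x * of_real (\<psi> x))" .
    have "\<psi> x = 0" if "x \<notin> W" for x using \<psi> that unfolding test_functions_def by blast
    hence "(LINT x|lborel. (indicator W x *\<^sub>R D x) * of_real (\<psi> x)) = (LINT x|lborel. D x * of_real (\<psi> x))"
      by (intro Bochner_Integration.integral_cong) (auto simp: indicator_def)
    also have "\<dots> = (LINT x|lborel. (u (x + h) * of_real (\<psi> x) - u x * of_real (\<psi> x)) - S x * of_real (\<psi> x))"
      by (simp add: D_def algebra_simps)
    also have "\<dots> = (LINT x|lborel. u (x + h) * of_real (\<psi> x)) - (LINT x|lborel. u x * of_real (\<psi> x)) -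
        (LINT x|lborel. S x * of_real (\<psi> x))"
      using bdd[OF uh] bdd[OF u] bdd[OF S] by simp
    also have "\<dots> = 0" by (simp add: S\<psi>)
    finally show "(LINT x|lborel. (indicator W x *\<^sub>R D x) * of_real (\<psi> x)) = 0" .
  qed simp
  thus ?thesis
  proof eventually_elim
    case (elim x)
    thus ?case by (auto simp: W_def D_def S_def G_def indicator_def)
  qed
qed

text \<open>Jensen's inequality on an interval of length one. It is stated in extended reals because
  along a single segment the right-hand side may be infinite.\<close>

lemma square_integral_unit_interval_le:
  fixes f :: "real \<Rightarrow> complex"
  assumes [measurable]: "f \<in> borel_measurable borel"
  shows "ennreal ((norm (LINT t|lborel. indicator {0..1} t *\<^sub>R f t))\<^sup>2)
    \<le> (\<integral>\<^sup>+t. indicator {0..1} t * ennreal ((norm (f t))\<^sup>2) \<partial>lborel)" (is "_ \<le> ?R")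
proof (cases "?R = \<infinity>")
  case False
  define I where "I t = (indicator {0..1} t :: real)" for t :: real
  have [measurable]: "I \<in> borel_measurable borel" unfolding I_def by measurable
  have I: "integrable lborel I" by (simp add: I_def[abs_def])
  have "?R = (\<integral>\<^sup>+t. ennreal (I t * (norm (f t))\<^sup>2) \<partial>lborel)"
    by (intro nn_integral_cong) (auto simp: I_def indicator_def)
  hence R: "(\<integral>\<^sup>+t. ennreal (I t * (norm (f t))\<^sup>2) \<partial>lborel) = ?R" ..
  have int2: "integrable lborel (\<lambda>t. I t * (norm (f t))\<^sup>2)"
  proof (rule integrableI_bounded)
    have "norm (I t * (norm (f t))\<^sup>2) = I t * (norm (f t))\<^sup>2" for t by (simp add: I_def)
    thus "(\<integral>\<^sup>+t. ennreal (norm (I t * (norm (f t))\<^sup>2)) \<partial>lborel) < \<infinity>"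
      using R False by (simp add: less_top)
  qed measurable
  have int1: "integrable lborel (\<lambda>t. I t * norm (f t))"
  proof (rule Bochner_Integration.integrable_bound)
    show "integrable lborel (\<lambda>t. I t + I t * (norm (f t))\<^sup>2)" using int2 I by simp
    have "norm (f t) \<le> 1 + (norm (f t))\<^sup>2" for t
      using sum_squares_bound[of 1 "norm (f t)"] by (simp add: ) (smt (verit) norm_ge_zero)
    thus "AE t in lborel. norm (I t * norm (f t)) \<le> norm (I t + I t * (norm (f t))\<^sup>2)"
      by (intro AE_I2) (auto simp: I_def indicator_def)
  qed measurable
  define m where "m = (LINT t|lborel. I t * norm (f t))"
  have "norm (LINT t|lborel. indicator {0..1} t *\<^sub>R f t) \<le> m"
  proof -
    have "norm (LINT t|lborel. indicator {0..1} t *\<^sub>R f t) \<le> (LINT t|lborel. norm (indicator {0..1} t *\<^sub>R f t))"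
      by (rule integral_norm_bound)
    also have "\<dots> = m" by (simp add: m_def I_def)
    finally show ?thesis .
  qed
  hence "(norm (LINT t|lborel. indicator {0..1} t *\<^sub>R f t))\<^sup>2 \<le> m\<^sup>2" by (intro power_mono) auto
  also have "m\<^sup>2 \<le> (LINT t|lborel. I t * (norm (f t))\<^sup>2)"
  proof -
    \<comment> \<open>The variance of the modulus about its mean \<open>m\<close> is
      nonnegative.\<close>
    have "0 \<le> (LINT t|lborel. I t * (norm (f t) - m)\<^sup>2)"
      by (intro integral_nonneg_AE AE_I2) (auto simp: I_def)
    also have "(\<lambda>t. I t * (norm (f t) - m)\<^sup>2) = (\<lambda>t. I t * (norm (f t))\<^sup>2 - 2 * m * (I t * norm (f t)) + m\<^sup>2 * I t)"
      by (auto simp: fun_eq_iff power2_diff algebra_simps)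
    also have "(LINT t|lborel. I t * (norm (f t))\<^sup>2 - 2 * m * (I t * norm (f t)) + m\<^sup>2 * I t) =
        (LINT t|lborel. I t * (norm (f t))\<^sup>2) - 2 * m * m + m\<^sup>2 * (LINT t|lborel. I t)"
      using int1 int2 I by (simp add: m_def[symmetric])
    also have "(LINT t|lborel. I t) = 1" by (simp add: I_def)
    finally show ?thesis by (simp add: power2_eq_square)
  qed
  finally have "ennreal ((norm (LINT t|lborel. indicator {0..1} t *\<^sub>R f t))\<^sup>2) \<le> ennreal (LINT t|lborel. I t * (norm (f t))\<^sup>2)"
    by (rule ennreal_leI)
  also have "\<dots> = (\<integral>\<^sup>+t. ennreal (I t * (norm (f t))\<^sup>2) \<partial>lborel)"
    using int2 by (intro nn_integral_eq_integral[symmetric]) (auto simp: I_def)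
  finally show ?thesis by (simp only: R)
qed simp

section \<open>Compactness of the embedding\<close>

text \<open>The substitution \<open>x = z + c h\<close> has Jacobian
  \<open>\<bar>c\<bar> ^ 3\<close>, which is at least \<open>1/8\<close>.\<close>

lemma nn_integral_indicator_affine_le:
  fixes z :: "real^3"
  assumes [measurable]: "K \<in> sets borel" and c: "\<bar>c\<bar> \<ge> 1/2"
  shows "(\<integral>\<^sup>+h. indicator K (z + c *\<^sub>R h) \<partial>lborel) \<le> 8 * emeasure lborel K"
proof -
  let ?X = "\<integral>\<^sup>+h. indicator K (z + c *\<^sub>R h) \<partial>lborel"
  have "emeasure lborel K = (\<integral>\<^sup>+x. indicator K x \<partial>lborel)" by simp
  also have "\<dots> = ennreal (\<bar>c\<bar> ^ 3) * ?X"
    using c by (subst nn_integral_lborel_affine[of _ c z]) auto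
  finally have eq: "emeasure lborel K = ennreal (\<bar>c\<bar> ^ 3) * ?X" .
  have "(1/2) ^ 3 \<le> \<bar>c\<bar> ^ 3" using c by (intro power_mono) auto
  hence c3: "1 \<le> 8 * \<bar>c\<bar> ^ 3" by (simp add: power_divide)
  have "?X = 1 * ?X" by simp
  also have "\<dots> \<le> ennreal (8 * \<bar>c\<bar> ^ 3) * ?X"
    using c3 by (intro mult_right_mono) (auto simp: ennreal_1[symmetric] simp del: ennreal_1 intro!: ennreal_leI)
  also have "\<dots> = 8 * emeasure lborel K" by (simp add: eq ennreal_mult mult.assoc)
  finally show ?thesis .
qed

lemma Cauchy_Schwarz_vec:
  fixes h :: "real^'n" and z :: "'n \<Rightarrow> complex"
  shows "(norm (\<Sum>i\<in>UNIV. of_real (h $ i) * z i))\<^sup>2 \<le> (norm h)\<^sup>2 * (\<Sum>i\<in>UNIV. (norm (z i))\<^sup>2)"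
proof -
  have "norm (\<Sum>i\<in>UNIV. of_real (h $ i) * z i) \<le> (\<Sum>i\<in>UNIV. \<bar>h $ i\<bar> * \<bar>norm (z i)\<bar>)"
    by (rule order_trans[OF norm_sum]) (simp add: norm_mult)
  also have "\<dots> \<le> L2_set (\<lambda>i. h $ i) UNIV * L2_set (\<lambda>i. norm (z i)) UNIV"
    by (rule L2_set_mult_ineq)
  finally have "(norm (\<Sum>i\<in>UNIV. of_real (h $ i) * z i))\<^sup>2 \<le> (L2_set (\<lambda>i. h $ i) UNIV * L2_set (\<lambda>i. norm (z i)) UNIV)\<^sup>2"
    by (rule power_mono) simp
  thus ?thesis by (simp add: power_mult_distrib L2_set_def norm_vec_def sum_nonneg)
qed

text \<open>The factor \<open>8 = 2\<^sup>3\<close>: of the two end points \<open>z - t h\<close> and \<open>z + (1 - t) h\<close> of the segment, one depends on \<open>h\<close>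
  with a factor of at least \<open>1/2\<close>, so the substitution costs at most \<open>2\<^sup>3\<close>.\<close>

lemma Poincare_double_integral:
  fixes u :: "real^3 \<Rightarrow> complex" and g :: "3 \<Rightarrow> real^3 \<Rightarrow> complex"
  assumes \<Omega>: "open \<Omega>" "convex \<Omega>" and u: "integrable lborel u" and g: "\<And>i. integrable lborel (g i)"
    and weak: "\<And>\<psi> i. \<psi> \<in> test_functions \<Omega> \<Longrightarrow>
      (LINT x|lborel. u x * of_real (partial_deriv i \<psi> x)) = - (LINT x|lborel. g i x * of_real (\<psi> x))"
    and K: "K \<in> sets borel" "convex K" "K \<subseteq> \<Omega>" and d: "\<And>x y. x \<in> K \<Longrightarrow> y \<in> K \<Longrightarrow> norm (x - y) \<le> d"
  shows "(\<integral>\<^sup>+x. \<integral>\<^sup>+y. indicator K x * indicator K y * ennreal ((norm (u x - u y))\<^sup>2) \<partial>lborel \<partial>lborel)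
    \<le> ennreal (d\<^sup>2) * (8 * emeasure lborel K * (\<integral>\<^sup>+x. indicator K x * ennreal (\<Sum>i\<in>UNIV. (norm (g i x))\<^sup>2) \<partial>lborel))"
proof -
  have [measurable]: "u \<in> borel_measurable borel" "\<And>i. g i \<in> borel_measurable borel" using u g by auto
  have [measurable]: "K \<in> sets borel" by fact
  define G where "G x = indicator K x * ennreal (\<Sum>i\<in>UNIV. (norm (g i x))\<^sup>2)" for x
  have [measurable]: "G \<in> borel_measurable borel" unfolding G_def by measurable
  define I where "I t = (indicator {0..1} t :: ennreal)" for t :: real
  have [measurable]: "I \<in> borel_measurable borel" unfolding I_def by measurable
  let ?F = "\<lambda>x y. indicator K x * indicator K y * ennreal ((norm (u x - u y))\<^sup>2)"
  \<comment> \<open>Pairs of points become a base point \<open>x\<close> and a displacement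
    \<open>h\<close>, so that the identity along segments can be used for fixed
    \<open>h\<close>.\<close>
  have "(\<integral>\<^sup>+x. \<integral>\<^sup>+y. ?F x y \<partial>lborel \<partial>lborel) = (\<integral>\<^sup>+x. \<integral>\<^sup>+h. ?F x (h + x) \<partial>lborel \<partial>lborel)"
    by (rule nn_integral_cong, rule nn_integral_lborel_translate[symmetric]) measurable
  also have "\<dots> = (\<integral>\<^sup>+h. \<integral>\<^sup>+x. ?F x (h + x) \<partial>lborel \<partial>lborel)"
    by (intro lborel_pair.Fubini'[symmetric]) measurable
  also have "\<dots> \<le> (\<integral>\<^sup>+h. \<integral>\<^sup>+x. indicator K x * indicator K (h + x) * (ennreal (d\<^sup>2) * (\<integral>\<^sup>+t. I t * G (x + t *\<^sub>R h) \<partial>lborel)) \<partial>lborel \<partial>lborel)"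
  proof (rule nn_integral_mono, rule nn_integral_mono_AE)
    fix h :: "real^3"
    have "AE x in lborel. x \<in> \<Omega> \<and> x + h \<in> \<Omega> \<longrightarrow> u (x + h) - u x =
        (LINT t|lborel. indicator {0..1} t *\<^sub>R (\<Sum>i\<in>UNIV. of_real (h $ i) * g i (x + t *\<^sub>R h)))"
      using \<Omega> u g weak by (rule translation_identity)
    thus "AE x in lborel. ?F x (h + x) \<le> indicator K x * indicator K (h + x) * (ennreal (d\<^sup>2) * (\<integral>\<^sup>+t. I t * G (x + t *\<^sub>R h) \<partial>lborel))"
    proof eventually_elim
      case (elim x)
      show ?case
      proof (cases "x \<in> K \<and> x + h \<in> K")
        case True
        let ?f = "\<lambda>t. \<Sum>i\<in>UNIV. of_real (h $ i) * g i (x + t *\<^sub>R h)"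
        have hd: "(norm h)\<^sup>2 \<le> d\<^sup>2" using d[of "x + h" x] True by (intro power_mono) auto
        have eq: "u (x + h) - u x = (LINT t|lborel. indicator {0..1} t *\<^sub>R ?f t)"
          using elim True K(3) by blast
        have "ennreal ((norm (u (x + h) - u x))\<^sup>2) \<le> (\<integral>\<^sup>+t. indicator {0..1} t * ennreal ((norm (?f t))\<^sup>2) \<partial>lborel)"
          unfolding eq by (rule square_integral_unit_interval_le) measurable
        also have "\<dots> \<le> (\<integral>\<^sup>+t. ennreal (d\<^sup>2) * (I t * G (x + t *\<^sub>R h)) \<partial>lborel)"
        proof (rule nn_integral_mono)
          fix t :: real
          show "indicator {0..1} t * ennreal ((norm (?f t))\<^sup>2) \<le> ennreal (d\<^sup>2) * (I t * G (x + t *\<^sub>R h))"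
          proof (cases "t \<in> {0..1}")
            case t: True
            have "(1 - t) *\<^sub>R x + t *\<^sub>R (x + h) \<in> K" using K(2) t True by (intro convexD) auto
            hence xt: "x + t *\<^sub>R h \<in> K" by (simp add: algebra_simps)
            have "(norm (?f t))\<^sup>2 \<le> (norm h)\<^sup>2 * (\<Sum>i\<in>UNIV. (norm (g i (x + t *\<^sub>R h)))\<^sup>2)"
              by (rule Cauchy_Schwarz_vec)
            also have "\<dots> \<le> d\<^sup>2 * (\<Sum>i\<in>UNIV. (norm (g i (x + t *\<^sub>R h)))\<^sup>2)"
              by (intro mult_right_mono hd sum_nonneg) auto
            finally show ?thesis
              using t xt by (simp add: I_def G_def ennreal_mult[symmetric] sum_nonneg ennreal_leI del: ennreal_power)
          qed simp
        qed
        also have "\<dots> = ennreal (d\<^sup>2) * (\<integral>\<^sup>+t. I t * G (x + t *\<^sub>R h) \<partial>lborel)"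
          by (intro nn_integral_cmult) measurable
        finally show ?thesis using True by (simp add: add.commute norm_minus_commute)
      qed (auto simp: indicator_def add.commute)
    qed
  qed
  also have "\<dots> = (\<integral>\<^sup>+h. \<integral>\<^sup>+x. ennreal (d\<^sup>2) * (\<integral>\<^sup>+t. I t * (indicator K x * indicator K (h + x) * G (x + t *\<^sub>R h)) \<partial>lborel) \<partial>lborel \<partial>lborel)"
    by (intro nn_integral_cong) (simp add: nn_integral_cmult[symmetric] mult_ac)
  also have "\<dots> = (\<integral>\<^sup>+h. ennreal (d\<^sup>2) * (\<integral>\<^sup>+x. \<integral>\<^sup>+t. I t * (indicator K x * indicator K (h + x) * G (x + t *\<^sub>R h)) \<partial>lborel \<partial>lborel) \<partial>lborel)"
    by (intro nn_integral_cong nn_integral_cmult) measurable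
  also have "\<dots> = ennreal (d\<^sup>2) * (\<integral>\<^sup>+h. \<integral>\<^sup>+x. \<integral>\<^sup>+t. I t * (indicator K x * indicator K (h + x) * G (x + t *\<^sub>R h)) \<partial>lborel \<partial>lborel \<partial>lborel)"
    by (intro nn_integral_cmult) measurable
  also have "(\<integral>\<^sup>+h. \<integral>\<^sup>+x. \<integral>\<^sup>+t. I t * (indicator K x * indicator K (h + x) * G (x + t *\<^sub>R h)) \<partial>lborel \<partial>lborel \<partial>lborel) =
      (\<integral>\<^sup>+h. \<integral>\<^sup>+t. \<integral>\<^sup>+x. I t * (indicator K x * indicator K (h + x) * G (x + t *\<^sub>R h)) \<partial>lborel \<partial>lborel \<partial>lborel)"
    by (intro nn_integral_cong lborel_pair.Fubini'[symmetric]) measurable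
  \<comment> \<open>With the new variable \<open>z = x + t h\<close>, the gradient term no longer
    depends on \<open>h\<close>. What remains to integrate in \<open>h\<close> is a purely geometric
    factor.\<close>
  also have "\<dots> = (\<integral>\<^sup>+h. \<integral>\<^sup>+t. \<integral>\<^sup>+z. I t * (indicator K (z - t *\<^sub>R h) * indicator K (h + (z - t *\<^sub>R h)) * G z) \<partial>lborel \<partial>lborel \<partial>lborel)"
  proof (rule nn_integral_cong, rule nn_integral_cong)
    fix h :: "real^3" and t :: real
    show "(\<integral>\<^sup>+x. I t * (indicator K x * indicator K (h + x) * G (x + t *\<^sub>R h)) \<partial>lborel) =
        (\<integral>\<^sup>+z. I t * (indicator K (z - t *\<^sub>R h) * indicator K (h + (z - t *\<^sub>R h)) * G z) \<partial>lborel)"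
      by (subst nn_integral_lborel_translate[of _ "t *\<^sub>R h", symmetric]) simp_all
  qed
  also have "\<dots> = (\<integral>\<^sup>+t. \<integral>\<^sup>+h. \<integral>\<^sup>+z. I t * (indicator K (z - t *\<^sub>R h) * indicator K (h + (z - t *\<^sub>R h)) * G z) \<partial>lborel \<partial>lborel \<partial>lborel)"
    by (intro lborel_pair.Fubini'[symmetric]) measurable
  also have "\<dots> = (\<integral>\<^sup>+t. \<integral>\<^sup>+z. \<integral>\<^sup>+h. I t * (indicator K (z - t *\<^sub>R h) * indicator K (h + (z - t *\<^sub>R h)) * G z) \<partial>lborel \<partial>lborel \<partial>lborel)"
    by (rule nn_integral_cong, rule lborel_pair.Fubini'[symmetric]) measurable
  also have "\<dots> \<le> (\<integral>\<^sup>+t. \<integral>\<^sup>+z. I t * (8 * emeasure lborel K * G z) \<partial>lborel \<partial>lborel)"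
  proof (intro nn_integral_mono)
    fix t :: real and z :: "real^3"
    have le: "(\<integral>\<^sup>+h. indicator K (z - t *\<^sub>R h) * indicator K (h + (z - t *\<^sub>R h)) \<partial>lborel) \<le> 8 * emeasure lborel K"
    proof (cases "t \<ge> 1/2")
      case True
      have "(\<integral>\<^sup>+h. indicator K (z - t *\<^sub>R h) * indicator K (h + (z - t *\<^sub>R h)) \<partial>lborel) \<le> (\<integral>\<^sup>+h. indicator K (z + (- t) *\<^sub>R h) \<partial>lborel)"
        by (intro nn_integral_mono) (auto simp: indicator_def)
      also have "\<dots> \<le> 8 * emeasure lborel K" using True by (intro nn_integral_indicator_affine_le) auto
      finally show ?thesis .
    next
      case False
      have eq: "h + (z - t *\<^sub>R h) = z + (1 - t) *\<^sub>R h" for h by (simp add: algebra_simps)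
      have "(\<integral>\<^sup>+h. indicator K (z - t *\<^sub>R h) * indicator K (h + (z - t *\<^sub>R h)) \<partial>lborel) \<le> (\<integral>\<^sup>+h. indicator K (z + (1 - t) *\<^sub>R h) \<partial>lborel)"
        unfolding eq by (intro nn_integral_mono) (auto simp: indicator_def)
      also have "\<dots> \<le> 8 * emeasure lborel K" using False by (intro nn_integral_indicator_affine_le) auto
      finally show ?thesis .
    qed
    have "(\<integral>\<^sup>+h. I t * (indicator K (z - t *\<^sub>R h) * indicator K (h + (z - t *\<^sub>R h)) * G z) \<partial>lborel) =
        (I t * G z) * (\<integral>\<^sup>+h. indicator K (z - t *\<^sub>R h) * indicator K (h + (z - t *\<^sub>R h)) \<partial>lborel)"
      by (subst nn_integral_cmult[symmetric]) (auto simp: mult_ac)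
    also have "\<dots> \<le> (I t * G z) * (8 * emeasure lborel K)" by (intro mult_left_mono le) simp
    finally show "(\<integral>\<^sup>+h. I t * (indicator K (z - t *\<^sub>R h) * indicator K (h + (z - t *\<^sub>R h)) * G z) \<partial>lborel)
        \<le> I t * (8 * emeasure lborel K * G z)" by (simp add: mult_ac)
  qed
  also have "\<dots> = (\<integral>\<^sup>+t. I t * (8 * emeasure lborel K * (\<integral>\<^sup>+z. G z \<partial>lborel)) \<partial>lborel)"
    by (simp add: nn_integral_cmult)
  also have "\<dots> = 8 * emeasure lborel K * (\<integral>\<^sup>+z. G z \<partial>lborel)"
    by (simp add: nn_integral_multc I_def)
  finally show ?thesis by (simp add: G_def mult_left_mono)
qed

section \<open>Convex cells and the Poincare inequality on them\<close>

lemma convex_grid_cell: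
  fixes k :: "'n::finite \<Rightarrow> int"
  shows "convex {x :: real^'n. \<forall>i. \<lfloor>x $ i / \<delta>\<rfloor> = k i}"
proof -
  have "convex {t::real. \<lfloor>t / \<delta>\<rfloor> = j}" for j
  proof -
    have "{t::real. \<lfloor>t / \<delta>\<rfloor> = j} = (\<lambda>t. t / \<delta>) -` {of_int j..<of_int j + 1}"
      by (auto simp: floor_eq_iff)
    moreover have "linear (\<lambda>t. t / \<delta>)" by (auto simp: linear_iff add_divide_distrib)
    ultimately show ?thesis by (metis convex_linear_vimage convex_real_interval(7))
  qed
  hence "convex ((\<lambda>x :: real^'n. x $ i) -` {t. \<lfloor>t / \<delta>\<rfloor> = k i})" for i
    by (intro convex_linear_vimage bounded_linear.linear bounded_linear_vec_nth) 
  hence "convex (\<Inter>i. (\<lambda>x :: real^'n. x $ i) -` {t. \<lfloor>t / \<delta>\<rfloor> = k i})" by (intro convex_INT)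
  thus ?thesis by (simp add: vimage_def Collect_all_eq[symmetric] INTER_eq)
qed

text \<open>Rounding coordinates down gives half-open cubes, which are disjoint without overlap on
  faces; intersecting with the convex domain keeps them convex. The diameter bound
  \<open>3 * \<delta>\<close> is the crude one through the sum of the coordinate
  differences.\<close>

lemma finite_convex_partition:
  fixes \<Omega> :: "(real^3) set"
  assumes "bounded \<Omega>" "convex \<Omega>" and [measurable]: "\<Omega> \<in> sets borel" and \<delta>: "\<delta> > 0"
  obtains P :: "(real^3) set set" where "finite P" "\<Union>P = \<Omega>" "disjoint P"
    "\<And>K. K \<in> P \<Longrightarrow> K \<in> sets borel \<and> convex K \<and> K \<subseteq> \<Omega>"
    "\<And>K x y. K \<in> P \<Longrightarrow> x \<in> K \<Longrightarrow> y \<in> K \<Longrightarrow> norm (x - y) \<le> 3 * \<delta>"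
proof -
  define c where "c x i = \<lfloor>x $ i / \<delta>\<rfloor>" for x :: "real^3" and i
  define cell where "cell k = {x \<in> \<Omega>. c x = k}" for k
  obtain B where B: "\<And>x. x \<in> \<Omega> \<Longrightarrow> norm x \<le> B" using assms(1) bounded_iff by metis
  define N where "N = \<lceil>B / \<delta>\<rceil> + 1"
  have cN: "c x i \<in> {- N..N}" if "x \<in> \<Omega>" for x i
  proof -
    have "\<bar>x $ i\<bar> \<le> B" using component_le_norm_cart[of x i] B[OF that] by linarith
    hence "\<bar>x $ i / \<delta>\<bar> \<le> B / \<delta>" using \<delta> by (simp add: divide_right_mono)
    hence "- (B / \<delta>) \<le> x $ i / \<delta>" "x $ i / \<delta> \<le> B / \<delta>" by (simp_all only: abs_le_iff) linarith+
    hence "- \<lceil>B / \<delta>\<rceil> - 1 \<le> \<lfloor>x $ i / \<delta>\<rfloor>" "\<lfloor>x $ i / \<delta>\<rfloor> \<le> \<lceil>B / \<delta>\<rceil> + 1" by linarith+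
    thus ?thesis unfolding c_def N_def by simp
  qed
  have "finite ((UNIV :: 3 set) \<rightarrow>\<^sub>E {- N..N})" by (intro finite_PiE) auto
  moreover have "c ` \<Omega> \<subseteq> UNIV \<rightarrow>\<^sub>E {- N..N}" using cN by (auto simp: PiE_iff)
  ultimately have fin: "finite (c ` \<Omega>)" by (rule finite_subset[rotated])
  show ?thesis
  proof (rule that[of "cell ` c ` \<Omega>"])
    show "finite (cell ` c ` \<Omega>)" using fin by simp
    show "\<Union> (cell ` c ` \<Omega>) = \<Omega>" by (auto simp: cell_def)
    show "disjoint (cell ` c ` \<Omega>)" by (auto simp: disjoint_def cell_def)
  next
    fix K assume "K \<in> cell ` c ` \<Omega>"
    then obtain k where K: "K = cell k" by blast
    have eq: "cell k = \<Omega> \<inter> {x. \<forall>i. \<lfloor>x $ i / \<delta>\<rfloor> = k i}" by (auto simp: cell_def c_def fun_eq_iff)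
    have "{x :: real^3. \<forall>i. \<lfloor>x $ i / \<delta>\<rfloor> = k i} \<in> sets borel"
      by measurable
    thus "K \<in> sets borel \<and> convex K \<and> K \<subseteq> \<Omega>"
      unfolding K eq using assms(2) convex_grid_cell[of \<delta> k] by (auto intro!: convex_Int)
    fix x y assume "x \<in> K" "y \<in> K"
    hence xy: "\<lfloor>x $ i / \<delta>\<rfloor> = \<lfloor>y $ i / \<delta>\<rfloor>" for i by (auto simp: K eq)
    have "\<bar>(x - y) $ i\<bar> \<le> \<delta>" for i
    proof -
      have "\<bar>x $ i / \<delta> - y $ i / \<delta>\<bar> \<le> 1" using xy[of i] by linarith
      hence "\<bar>(x $ i - y $ i) / \<delta>\<bar> \<le> 1" by (simp add: diff_divide_distrib)
      thus ?thesis using \<delta> by (simp add: field_simps)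
    qed
    hence "(\<Sum>i\<in>UNIV. \<bar>(x - y) $ i\<bar>) \<le> (\<Sum>i\<in>(UNIV :: 3 set). \<delta>)" by (intro sum_mono)
    thus "norm (x - y) \<le> 3 * \<delta>" using norm_le_l1_cart[of "x - y"] by simp
  qed
qed

lemma integral_diff_add:
  fixes f g h :: "'a \<Rightarrow> real"
  assumes "integrable M f" "integrable M g" "integrable M h"
  shows "(LINT x|M. f x - g x + h x) = (LINT x|M. f x) - (LINT x|M. g x) + (LINT x|M. h x)"
  using assms by simp

text \<open>With \<open>k\<close> the measure of \<open>K\<close>, \<open>p\<close> the integral of
  the squared modulus of \<open>u\<close> over \<open>K\<close> and \<open>m\<close> the integral of
  \<open>u\<close>, the double integral of squared differences is
  \<open>2 k p - 2 |m|\<^sup>2\<close>. Dividing the double integral estimate by \<open>2 k\<close>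
  turns its constant 8 into 4, and the weight \<open>1 / sqrt k\<close> makes the mean term equal to
  \<open>|m|\<^sup>2 / k\<close>.\<close>

lemma Poincare_cell:
  fixes u :: "real^3 \<Rightarrow> complex" and g :: "3 \<Rightarrow> real^3 \<Rightarrow> complex"
  assumes \<Omega>: "open \<Omega>" "convex \<Omega>" and u: "integrable lborel u" and g: "\<And>i. integrable lborel (g i)"
    and weak: "\<And>\<psi> i. \<psi> \<in> test_functions \<Omega> \<Longrightarrow>
      (LINT x|lborel. u x * of_real (partial_deriv i \<psi> x)) = - (LINT x|lborel. g i x * of_real (\<psi> x))"
    and u2: "integrable lborel (\<lambda>x. (norm (u x))\<^sup>2)" and g2: "\<And>i. integrable lborel (\<lambda>x. (norm (g i x))\<^sup>2)"
    and K: "K \<in> sets borel" "convex K" "K \<subseteq> \<Omega>" and d: "\<And>x y. x \<in> K \<Longrightarrow> y \<in> K \<Longrightarrow> norm (x - y) \<le> d"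
    and fin: "emeasure lborel K < \<infinity>"
  shows "(LINT x|lborel. indicator K x * (norm (u x))\<^sup>2) \<le>
    (norm (LINT x|lborel. of_real (indicator K x / sqrt (measure lborel K)) * u x))\<^sup>2 +
    4 * d\<^sup>2 * (LINT x|lborel. indicator K x * (\<Sum>i\<in>UNIV. (norm (g i x))\<^sup>2))"
proof -
  have [measurable]: "u \<in> borel_measurable borel" "\<And>i. g i \<in> borel_measurable borel" using u g by auto
  have [measurable]: "K \<in> sets borel" by fact
  define k where "k = measure lborel K"
  define J where "J x = (indicator K x :: real)" for x
  have [measurable]: "J \<in> borel_measurable borel" unfolding J_def by measurable
  define p where "p = (LINT x|lborel. J x * (norm (u x))\<^sup>2)"
  define q where "q = (LINT x|lborel. J x * (\<Sum>i\<in>UNIV. (norm (g i x))\<^sup>2))"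
  define m where "m = (LINT x|lborel. u x * of_real (J x))"
  have J01: "0 \<le> J x" "J x \<le> 1" for x by (auto simp: J_def indicator_def)
  have J_int: "integrable lborel J" unfolding J_def[abs_def] using fin K by simp
  have Jk: "(LINT x|lborel. J x) = k" unfolding J_def k_def using fin by simp
  have em: "emeasure lborel K = ennreal k" unfolding k_def using fin by (simp add: emeasure_eq_ennreal_measure)
  have k0: "k \<ge> 0" by (simp add: k_def)
  have Ju2: "integrable lborel (\<lambda>x. J x * (norm (u x))\<^sup>2)"
    using integrable_mult_indicator[OF _ u2, of K] by (simp add: J_def)
  have Jg2: "integrable lborel (\<lambda>x. J x * (\<Sum>i\<in>UNIV. (norm (g i x))\<^sup>2))"
    using integrable_mult_indicator[of K lborel "\<lambda>x. \<Sum>i\<in>UNIV. (norm (g i x))\<^sup>2"] g2 by (simp add: J_def)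
  have Ju: "integrable lborel (\<lambda>x. u x * of_real (J x))"
    by (rule integrable_mult_bounded[OF u, of _ 1]) (auto simp: J01)
  have q0: "q \<ge> 0" unfolding q_def by (intro integral_nonneg_AE AE_I2 mult_nonneg_nonneg J01 sum_nonneg) auto
  have sq: "(norm (a - b))\<^sup>2 = (norm a)\<^sup>2 - 2 * Re (cnj a * b) + (norm b)\<^sup>2" for a b :: complex
    by (simp add: cmod_power2 power2_diff algebra_simps)
  define A where "A x = k * (norm (u x))\<^sup>2 - 2 * Re (cnj (u x) * m) + p" for x
  have inner_int: "integrable lborel (\<lambda>y. J y * (norm (u x - u y))\<^sup>2)"
    and inner: "(LINT y|lborel. J y * (norm (u x - u y))\<^sup>2) = A x" for x
  proof -
    have eq: "(\<lambda>y. J y * (norm (u x - u y))\<^sup>2) =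
        (\<lambda>y. (norm (u x))\<^sup>2 * J y - 2 * Re (cnj (u x) * (u y * of_real (J y))) + J y * (norm (u y))\<^sup>2)"
      unfolding sq by (auto simp: fun_eq_iff algebra_simps)
    have i1: "integrable lborel (\<lambda>y. cnj (u x) * (u y * of_real (J y)))" using Ju by simp
    show "integrable lborel (\<lambda>y. J y * (norm (u x - u y))\<^sup>2)"
      unfolding eq by (intro Bochner_Integration.integrable_add Bochner_Integration.integrable_diff
          Bochner_Integration.integrable_mult_right integrable_Re[OF i1] J_int Ju2)
    have "(LINT y|lborel. Re (cnj (u x) * (u y * of_real (J y)))) = Re (cnj (u x) * m)"
      unfolding m_def integral_mult_right_zero[symmetric] using i1 by (rule integral_Re)
    thus "(LINT y|lborel. J y * (norm (u x - u y))\<^sup>2) = A x"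
      unfolding eq integral_diff_add[OF Bochner_Integration.integrable_mult_right[OF J_int]
          Bochner_Integration.integrable_mult_right[OF integrable_Re[OF i1]] Ju2]
      by (simp only: A_def Jk p_def mult.commute[of _ k] integral_mult_right_zero)
  qed
  have A0: "A x \<ge> 0" for x unfolding inner[symmetric] by (intro integral_nonneg_AE AE_I2 mult_nonneg_nonneg J01) auto
  have JA_eq: "(\<lambda>x. J x * A x) = (\<lambda>x. k * (J x * (norm (u x))\<^sup>2) - 2 * Re (cnj m * (u x * of_real (J x))) + p * J x)"
    by (auto simp: fun_eq_iff A_def algebra_simps)
  have i2: "integrable lborel (\<lambda>y. cnj m * (u y * of_real (J y)))" using Ju by simp
  have JA_int: "integrable lborel (\<lambda>x. J x * A x)"
    unfolding JA_eq by (intro Bochner_Integration.integrable_add Bochner_Integration.integrable_diff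
        Bochner_Integration.integrable_mult_right integrable_Re[OF i2] J_int Ju2)
  have "(LINT y|lborel. Re (cnj m * (u y * of_real (J y)))) = Re (cnj m * m)"
    unfolding m_def integral_mult_right_zero[symmetric] using i2[unfolded m_def] by (rule integral_Re)
  also have "\<dots> = (norm m)\<^sup>2" unfolding cmod_power2 by (simp add: power2_eq_square)
  finally have JA: "(LINT x|lborel. J x * A x) = 2 * k * p - 2 * (norm m)\<^sup>2"
    unfolding JA_eq integral_diff_add[OF Bochner_Integration.integrable_mult_right[OF Ju2]
        Bochner_Integration.integrable_mult_right[OF integrable_Re[OF i2]]
        Bochner_Integration.integrable_mult_right[OF J_int]]
    by (simp only: Jk p_def[symmetric] integral_mult_right_zero, simp)
  have ind: "indicator K x = ennreal (J x)" for x by (simp add: J_def indicator_def)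
  have "(\<integral>\<^sup>+x. \<integral>\<^sup>+y. indicator K x * indicator K y * ennreal ((norm (u x - u y))\<^sup>2) \<partial>lborel \<partial>lborel) =
      (\<integral>\<^sup>+x. ennreal (J x * A x) \<partial>lborel)"
  proof (intro nn_integral_cong)
    fix x
    have "(\<integral>\<^sup>+y. indicator K x * indicator K y * ennreal ((norm (u x - u y))\<^sup>2) \<partial>lborel) =
        (\<integral>\<^sup>+y. ennreal (J x) * ennreal (J y * (norm (u x - u y))\<^sup>2) \<partial>lborel)"
      by (intro nn_integral_cong) (simp add: ind ennreal_mult J01 mult.assoc)
    also have "\<dots> = ennreal (J x) * ennreal (A x)"
      unfolding inner[symmetric]
      by (subst nn_integral_cmult, simp) (subst nn_integral_eq_integral[OF inner_int], auto simp: J01)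
    finally show "(\<integral>\<^sup>+y. indicator K x * indicator K y * ennreal ((norm (u x - u y))\<^sup>2) \<partial>lborel) = ennreal (J x * A x)"
      by (simp add: ennreal_mult J01 A0)
  qed
  also have "\<dots> = ennreal (2 * k * p - 2 * (norm m)\<^sup>2)"
    unfolding JA[symmetric] using JA_int by (intro nn_integral_eq_integral) (auto simp: J01 A0)
  finally have lhs: "(\<integral>\<^sup>+x. \<integral>\<^sup>+y. indicator K x * indicator K y * ennreal ((norm (u x - u y))\<^sup>2) \<partial>lborel \<partial>lborel) =
      ennreal (2 * k * p - 2 * (norm m)\<^sup>2)" .
  have "(\<integral>\<^sup>+x. indicator K x * ennreal (\<Sum>i\<in>UNIV. (norm (g i x))\<^sup>2) \<partial>lborel) =
      (\<integral>\<^sup>+x. ennreal (J x * (\<Sum>i\<in>UNIV. (norm (g i x))\<^sup>2)) \<partial>lborel)"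
    by (intro nn_integral_cong) (simp add: ind ennreal_mult J01 sum_nonneg)
  also have "\<dots> = ennreal q"
    unfolding q_def using Jg2 by (intro nn_integral_eq_integral) (auto simp: J01 sum_nonneg)
  finally have rhs: "(\<integral>\<^sup>+x. indicator K x * ennreal (\<Sum>i\<in>UNIV. (norm (g i x))\<^sup>2) \<partial>lborel) = ennreal q" .
  have "ennreal (2 * k * p - 2 * (norm m)\<^sup>2) \<le> ennreal (d\<^sup>2) * (8 * ennreal k * ennreal q)"
    unfolding lhs[symmetric] rhs[symmetric] em[symmetric]
    using \<Omega> u g weak K d by (rule Poincare_double_integral)
  also have "\<dots> = ennreal (8 * d\<^sup>2 * k * q)"
    using k0 q0 by (simp add: ennreal_mult[symmetric] ennreal_numeral[symmetric] mult_ac del: ennreal_numeral ennreal_power)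
  finally have main: "2 * k * p - 2 * (norm m)\<^sup>2 \<le> 8 * d\<^sup>2 * k * q"
    using k0 q0 by (subst (asm) ennreal_le_iff) auto
  have m': "(LINT x|lborel. of_real (indicator K x / sqrt (measure lborel K)) * u x) = of_real (1 / sqrt k) * m"
    unfolding m_def integral_mult_right_zero[symmetric]
    by (intro Bochner_Integration.integral_cong) (auto simp: k_def J_def)
  have "p \<le> (norm (of_real (1 / sqrt k) * m))\<^sup>2 + 4 * d\<^sup>2 * q"
  \<comment> \<open>A cell may be a null set. Then \<open>p = 0\<close>, and the convention for
    division by zero makes the mean term vanish as well.\<close>
  proof (cases "k = 0")
    case True
    hence "emeasure lborel K = 0" by (simp add: em)
    hence "AE x in lborel. x \<notin> K" by (intro AE_not_in) (simp add: null_setsI)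
    hence "AE x in lborel. J x * (norm (u x))\<^sup>2 = 0" by eventually_elim (simp add: J_def)
    hence "p = 0" unfolding p_def by (rule integral_eq_zero_AE)
    thus ?thesis using q0 by simp
  next
    case False
    hence k: "k > 0" using k0 by simp
    have "(norm (of_real (1 / sqrt k) * m))\<^sup>2 = (norm m)\<^sup>2 / k"
      using k by (simp add: norm_mult norm_divide power_divide power_mult_distrib)
    moreover have "k * p \<le> k * ((norm m)\<^sup>2 / k + 4 * d\<^sup>2 * q)"
      using main k by (simp add: algebra_simps)
    ultimately show ?thesis using k by simp
  qed
  thus ?thesis unfolding m' p_def q_def J_def .
qed

context bounded_open
begin

text \<open>A single Borel function has to carry the norm and all pairings with real Borel functions
  at once. The defining identity of the weak gradient then transfers to the whole space, as do the
  cell averages.\<close>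

lemma lborel_representative:
  assumes v: "v \<in> L2 \<Omega>"
  obtains u where "integrable lborel u" "integrable lborel (\<lambda>x. (norm (u x))\<^sup>2)" "\<And>x. x \<notin> \<Omega> \<Longrightarrow> u x = 0"
    "Re (L2_inner \<Omega> v v) = (LINT x|lborel. (norm (u x))\<^sup>2)"
    "\<And>c. c \<in> borel_measurable borel \<Longrightarrow> L2_inner \<Omega> (\<lambda>x. of_real (c x)) v = (LINT x|lborel. of_real (c x) * u x)"
proof -
  obtain u where u: "u \<in> borel_measurable borel" "\<And>x. x \<notin> \<Omega> \<Longrightarrow> u x = 0" "AE x in lborel. x \<in> \<Omega> \<longrightarrow> v x = u x"
    using borel_representative[OF dom_borel L2_measurable[OF v]] by blast
  note rep = lebesgue_on_borel_representative[OF dom_borel]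
  have mv: "v \<in> borel_measurable (lebesgue_on \<Omega>)" using v by (rule L2_measurable)
  show thesis
  proof (rule that)
    show "integrable lborel u" using rep(1)[OF mv u] L2_integrable[OF v] by simp
    have sq: "(\<lambda>x. of_real ((norm (v x))\<^sup>2) :: complex) \<in> borel_measurable (lebesgue_on \<Omega>)"
        "(\<lambda>x. of_real ((norm (u x))\<^sup>2) :: complex) \<in> borel_measurable borel"
        "\<And>x. x \<notin> \<Omega> \<Longrightarrow> (of_real ((norm (u x))\<^sup>2) :: complex) = 0"
        "AE x in lborel. x \<in> \<Omega> \<longrightarrow> (of_real ((norm (v x))\<^sup>2) :: complex) = of_real ((norm (u x))\<^sup>2)"
      using mv u by (measurable, measurable, simp, auto elim: eventually_mono)
    have "integrable (lebesgue_on \<Omega>) (\<lambda>x. of_real ((norm (v x))\<^sup>2) :: complex)"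
      using L2_integrable_square[OF v] by (simp only: complex_of_real_integrable_eq)
    moreover have "integrable (lebesgue_on \<Omega>) (\<lambda>x. of_real ((norm (v x))\<^sup>2) :: complex) \<longleftrightarrow>
        integrable lborel (\<lambda>x. of_real ((norm (u x))\<^sup>2) :: complex)"
      using sq by (rule rep(1))
    ultimately have "integrable lborel (\<lambda>x. of_real ((norm (u x))\<^sup>2) :: complex)" by (rule iffD1[rotated])
    thus "integrable lborel (\<lambda>x. (norm (u x))\<^sup>2)" by (simp only: complex_of_real_integrable_eq)
    have "(LINT x|lebesgue_on \<Omega>. of_real ((norm (v x))\<^sup>2) :: complex) = (LINT x|lborel. of_real ((norm (u x))\<^sup>2))"
      using sq by (rule rep(2))
    hence "(LINT x|lebesgue_on \<Omega>. (norm (v x))\<^sup>2) = (LINT x|lborel. (norm (u x))\<^sup>2)"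
      by (simp only: integral_complex_of_real of_real_eq_iff)
    thus "Re (L2_inner \<Omega> v v) = (LINT x|lborel. (norm (u x))\<^sup>2)" by (simp only: L2_inner_self Re_complex_of_real)
  next
    fix c :: "real^3 \<Rightarrow> real" assume [measurable]: "c \<in> borel_measurable borel"
    have "c \<in> borel_measurable (lebesgue_on \<Omega>)"
      by (intro measurable_restrict_space1 measurable_completion) simp
    hence "(\<lambda>x. cnj (of_real (c x)) * v x) \<in> borel_measurable (lebesgue_on \<Omega>)" using mv by measurable
    thus "L2_inner \<Omega> (\<lambda>x. of_real (c x)) v = (LINT x|lborel. of_real (c x) * u x)"
      unfolding L2_inner_def
    proof (rule rep(2))
      show "(\<lambda>x. of_real (c x) * u x) \<in> borel_measurable borel" using u by measurable
      show "AE x in lborel. x \<in> \<Omega> \<longrightarrow> cnj (of_real (c x)) * v x = of_real (c x) * u x"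
        using u(3) by eventually_elim simp
    qed (use u in auto)
  qed (use u in auto)
qed

text \<open>Up to \<open>\<epsilon>\<close> times the gradient energy, finitely many cell averages
  control the norm. They depend on \<open>\<epsilon>\<close> but not on \<open>w\<close>; this
  uniformity is what yields compactness.\<close>

lemma Poincare_partition:
  assumes "convex \<Omega>" and \<epsilon>: "\<epsilon> > 0"
  shows "\<exists>N e. (\<forall>k. e k \<in> L2 \<Omega>) \<and> (\<forall>w\<in>H1 \<Omega>. Re (L2_inner \<Omega> w w) \<le>
    (\<Sum>k<(N::nat). (norm (L2_inner \<Omega> (e k) w))\<^sup>2) + \<epsilon> * Re (grad_inner \<Omega> w w))"
proof -
  \<comment> \<open>Cells of diameter at most \<open>3 * \<delta>\<close> give the factor
    \<open>4 * (3 * \<delta>)\<^sup>2\<close>, which is to be \<open>\<epsilon>\<close>.\<close>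
  define \<delta> where "\<delta> = sqrt \<epsilon> / 6"
  have \<delta>: "\<delta> > 0" "4 * (3 * \<delta>)\<^sup>2 = \<epsilon>" using \<epsilon> by (auto simp: \<delta>_def power2_eq_square)
  obtain P where P: "finite P" "\<Union>P = \<Omega>" "disjoint P"
    "\<And>K. K \<in> P \<Longrightarrow> K \<in> sets borel \<and> convex K \<and> K \<subseteq> \<Omega>"
    "\<And>K x y. K \<in> P \<Longrightarrow> x \<in> K \<Longrightarrow> y \<in> K \<Longrightarrow> norm (x - y) \<le> 3 * \<delta>"
    using finite_convex_partition[OF bounded_dom assms(1) dom_borel \<delta>(1)] by blast
  obtain b where b: "bij_betw b {..<card P} P"
    using ex_bij_betw_nat_finite[OF P(1)] by (auto simp: atLeast0LessThan)
  define f where "f K x = indicator K x / sqrt (measure lborel K)" for K and x :: "real^3"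
  have fm: "f K \<in> borel_measurable borel" if "K \<in> P" for K
  proof -
    have [measurable]: "K \<in> sets borel" using P(4)[OF that] by simp
    show ?thesis unfolding f_def by measurable
  qed
  have fL2: "(\<lambda>x. of_real (f K x)) \<in> L2 \<Omega>" if "K \<in> P" for K
  proof (rule bounded_in_L2)
    show "(\<lambda>x. complex_of_real (f K x)) \<in> borel_measurable borel" using fm[OF that] by measurable
    show "norm (complex_of_real (f K x)) \<le> 1 / sqrt (measure lborel K)" for x
      unfolding norm_of_real by (auto simp: f_def indicator_def)
  qed
  \<comment> \<open>Indices beyond the number of cells receive the zero function, so that
    \<open>e\<close> is a total sequence in \<open>L2\<close>.\<close>
  define e :: "nat \<Rightarrow> wavefun" where "e k = (if k < card P then (\<lambda>x. of_real (f (b k) x)) else (\<lambda>x. 0))" for k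
  have "e k \<in> L2 \<Omega>" for k
    using fL2[of "b k"] bij_betwE[OF b] L2.zero by (auto simp: e_def)
  moreover have "Re (L2_inner \<Omega> w w) \<le> (\<Sum>k<card P. (norm (L2_inner \<Omega> (e k) w))\<^sup>2) + \<epsilon> * Re (grad_inner \<Omega> w w)"
    if w: "w \<in> H1 \<Omega>" for w
  proof -
    obtain u where u: "integrable lborel u" "integrable lborel (\<lambda>x. (norm (u x))\<^sup>2)" "\<And>x. x \<notin> \<Omega> \<Longrightarrow> u x = 0"
      "Re (L2_inner \<Omega> w w) = (LINT x|lborel. (norm (u x))\<^sup>2)"
      "\<And>c. c \<in> borel_measurable borel \<Longrightarrow> L2_inner \<Omega> (\<lambda>x. of_real (c x)) w = (LINT x|lborel. of_real (c x) * u x)"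
      using lborel_representative[OF H1_L2[OF w]] by blast
    have "\<exists>g. integrable lborel g \<and> integrable lborel (\<lambda>x. (norm (g x))\<^sup>2) \<and> (\<forall>x. x \<notin> \<Omega> \<longrightarrow> g x = 0) \<and>
      Re (L2_inner \<Omega> (grad_comp i w) (grad_comp i w)) = (LINT x|lborel. (norm (g x))\<^sup>2) \<and>
      (\<forall>c. c \<in> borel_measurable borel \<longrightarrow> L2_inner \<Omega> (\<lambda>x. of_real (c x)) (grad_comp i w) = (LINT x|lborel. of_real (c x) * g x))" for i
      by (rule lborel_representative[OF H1_weak_gradient(1)[OF w, of i]]) blast
    hence "\<exists>g. \<forall>i. integrable lborel (g i) \<and> integrable lborel (\<lambda>x. (norm (g i x))\<^sup>2) \<and> (\<forall>x. x \<notin> \<Omega> \<longrightarrow> g i x = 0) \<and>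
      Re (L2_inner \<Omega> (grad_comp i w) (grad_comp i w)) = (LINT x|lborel. (norm (g i x))\<^sup>2) \<and>
      (\<forall>c. c \<in> borel_measurable borel \<longrightarrow> L2_inner \<Omega> (\<lambda>x. of_real (c x)) (grad_comp i w) = (LINT x|lborel. of_real (c x) * g i x))"
      by (intro choice allI)
    then obtain g where g: "\<And>i. integrable lborel (g i)" "\<And>i. integrable lborel (\<lambda>x. (norm (g i x))\<^sup>2)"
      "\<And>i x. x \<notin> \<Omega> \<Longrightarrow> g i x = 0"
      "\<And>i. Re (L2_inner \<Omega> (grad_comp i w) (grad_comp i w)) = (LINT x|lborel. (norm (g i x))\<^sup>2)"
      "\<And>i c. c \<in> borel_measurable borel \<Longrightarrow> L2_inner \<Omega> (\<lambda>x. of_real (c x)) (grad_comp i w) = (LINT x|lborel. of_real (c x) * g i x)"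
      by blast
    have weak: "(LINT x|lborel. u x * of_real (partial_deriv i \<psi> x)) = - (LINT x|lborel. g i x * of_real (\<psi> x))"
      if \<psi>: "\<psi> \<in> test_functions \<Omega>" for \<psi> i
    proof -
      have "L2_inner \<Omega> (\<lambda>x. of_real (partial_deriv i \<psi> x)) w = - L2_inner \<Omega> (\<lambda>x. of_real (\<psi> x)) (grad_comp i w)"
        using H1_weak_gradient(2)[OF w] \<psi> unfolding is_weak_gradient_iff grad_comp_def[abs_def] by blast
      thus ?thesis
        using u(5)[OF test_functions_measurable[OF test_functions_partial_deriv[OF \<psi>]]] g(5)[OF test_functions_measurable[OF \<psi>]]
        by (simp add: mult.commute)
    qed
    define q where "q x = (\<Sum>i\<in>UNIV. (norm (g i x))\<^sup>2)" for x
    have q: "integrable lborel q" unfolding q_def[abs_def] using g(2) by simp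
    have cell: "(LINT x|lborel. indicator K x * (norm (u x))\<^sup>2) \<le>
        (norm (L2_inner \<Omega> (\<lambda>x. of_real (f K x)) w))\<^sup>2 + \<epsilon> * (LINT x|lborel. indicator K x * q x)" if K: "K \<in> P" for K
    proof -
      have "bounded K" using P(4)[OF K] bounded_dom bounded_subset by blast
      hence "emeasure lborel K < \<infinity>" by (rule emeasure_bounded_finite)
      hence "(LINT x|lborel. indicator K x * (norm (u x))\<^sup>2) \<le>
        (norm (LINT x|lborel. of_real (indicator K x / sqrt (measure lborel K)) * u x))\<^sup>2 +
        4 * (3 * \<delta>)\<^sup>2 * (LINT x|lborel. indicator K x * (\<Sum>i\<in>UNIV. (norm (g i x))\<^sup>2))"
        using P(4)[OF K] P(5)[OF K] open_dom assms(1) u(1,2) g(1,2) weak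
        by (intro Poincare_cell[where \<Omega> = \<Omega>]) auto
      thus ?thesis using u(5)[OF fm[OF K]] unfolding \<delta>(2) q_def f_def by simp
    qed
    have ind: "(\<Sum>K\<in>P. indicator K x) = (indicator \<Omega> x :: real)" for x
    proof -
      have "(indicator (\<Union>K\<in>P. K) x :: real) = (\<Sum>K\<in>P. indicator K x)"
        using P(1,3) by (intro indicator_UN_disjoint) (auto simp: disjoint_def disjoint_family_on_def)
      thus ?thesis using P(2) by simp
    qed
    have split: "(LINT x|lborel. h x) = (\<Sum>K\<in>P. LINT x|lborel. indicator K x * h x)"
      if "integrable lborel h" "\<And>x. x \<notin> \<Omega> \<Longrightarrow> h x = 0" for h :: "real^3 \<Rightarrow> real"
    proof -
      have "(LINT x|lborel. h x) = (LINT x|lborel. (\<Sum>K\<in>P. indicator K x * h x))"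
        unfolding sum_distrib_right[symmetric] ind
        using that(2) by (intro Bochner_Integration.integral_cong) (auto simp: indicator_def)
      also have "\<dots> = (\<Sum>K\<in>P. LINT x|lborel. indicator K x * h x)"
        using that(1) P(4) integrable_mult_indicator[of _ lborel h]
        by (intro Bochner_Integration.integral_sum) auto
      finally show ?thesis .
    qed
    have "Re (L2_inner \<Omega> w w) = (\<Sum>K\<in>P. LINT x|lborel. indicator K x * (norm (u x))\<^sup>2)"
      unfolding u(4) using u(2,3) by (intro split) auto
    also have "\<dots> \<le> (\<Sum>K\<in>P. (norm (L2_inner \<Omega> (\<lambda>x. of_real (f K x)) w))\<^sup>2 + \<epsilon> * (LINT x|lborel. indicator K x * q x))"
      by (intro sum_mono cell)
    also have "\<dots> = (\<Sum>K\<in>P. (norm (L2_inner \<Omega> (\<lambda>x. of_real (f K x)) w))\<^sup>2) + \<epsilon> * (LINT x|lborel. q x)"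
      using split[OF q] g(3) by (simp add: sum.distrib sum_distrib_left q_def)
    also have "(LINT x|lborel. q x) = Re (grad_inner \<Omega> w w)"
      unfolding q_def using w g(2,4) by (simp add: grad_inner_eq)
    also have "(\<Sum>K\<in>P. (norm (L2_inner \<Omega> (\<lambda>x. of_real (f K x)) w))\<^sup>2) = (\<Sum>k<card P. (norm (L2_inner \<Omega> (e k) w))\<^sup>2)"
      by (subst sum.reindex_bij_betw[OF b, symmetric]) (simp add: e_def)
    finally show ?thesis .
  qed
  ultimately show ?thesis by (intro exI[of _ "card P"] exI[of _ e]) blast
qed

text \<open>All averages for all accuracies \<open>1 / (j + 1)\<close> form a countable family of
  bounded sequences; a diagonal subsequence makes every one of them converge. The Poincare estimate
  then controls differences.\<close>

lemma Rellich_compactness: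
  assumes "convex \<Omega>" and v: "\<And>n. v n \<in> H1 \<Omega>" and bound: "\<And>n. Re (H1_inner \<Omega> (v n) (v n)) \<le> C"
  shows "\<exists>r. strict_mono (r :: nat \<Rightarrow> nat) \<and> form_Cauchy (\<lambda>v w. Re (L2_inner \<Omega> v w)) (v \<circ> r)"
proof -
  have "\<forall>j. \<exists>N e. (\<forall>k. e k \<in> L2 \<Omega>) \<and> (\<forall>w\<in>H1 \<Omega>. Re (L2_inner \<Omega> w w) \<le>
    (\<Sum>k<(N::nat). (norm (L2_inner \<Omega> (e k) w))\<^sup>2) + inverse (real (Suc j)) * Re (grad_inner \<Omega> w w))"
    by (intro allI Poincare_partition assms) simp
  from choice[OF this] obtain N :: "nat \<Rightarrow> nat" where
    "\<forall>j. \<exists>e. (\<forall>k. e k \<in> L2 \<Omega>) \<and> (\<forall>w\<in>H1 \<Omega>. Re (L2_inner \<Omega> w w) \<le>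
    (\<Sum>k<N j. (norm (L2_inner \<Omega> (e k) w))\<^sup>2) + inverse (real (Suc j)) * Re (grad_inner \<Omega> w w))" ..
  from choice[OF this] obtain e :: "nat \<Rightarrow> nat \<Rightarrow> wavefun" where
    "\<forall>j. (\<forall>k. e j k \<in> L2 \<Omega>) \<and> (\<forall>w\<in>H1 \<Omega>. Re (L2_inner \<Omega> w w) \<le>
    (\<Sum>k<N j. (norm (L2_inner \<Omega> (e j k) w))\<^sup>2) + inverse (real (Suc j)) * Re (grad_inner \<Omega> w w))" ..
  hence e: "e j k \<in> L2 \<Omega>" and ineq: "w \<in> H1 \<Omega> \<Longrightarrow> Re (L2_inner \<Omega> w w) \<le>
    (\<Sum>k<N j. (norm (L2_inner \<Omega> (e j k) w))\<^sup>2) + inverse (real (Suc j)) * Re (grad_inner \<Omega> w w)" for j k w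
    by blast+
  define x where "x i n = L2_inner \<Omega> (case prod_decode i of (j, k) \<Rightarrow> e j k) (v n)" for i n
  define Q where "Q i s = convergent (\<lambda>n. x i (s n))" for i and s :: "nat \<Rightarrow> nat"
  interpret subseqs Q
  proof
    fix i :: nat and s :: "nat \<Rightarrow> nat"
    obtain j k where jk: "prod_decode i = (j, k)" by force
    have "norm (x i n) \<le> sqrt (Re (L2_inner \<Omega> (e j k) (e j k))) * sqrt C" for n
    proof -
      have "norm (x i n) \<le> sqrt (Re (L2_inner \<Omega> (e j k) (e j k))) * sqrt (Re (L2_inner \<Omega> (v n) (v n)))"
        unfolding x_def jk using L2.norm_le[OF e H1_L2[OF v]] by simp
      also have "\<dots> \<le> sqrt (Re (L2_inner \<Omega> (e j k) (e j k))) * sqrt C"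
        using L2_le_H1[OF v, of n] bound[of n] L2.pos[OF e, of j k] by (intro mult_left_mono) auto
      finally show ?thesis .
    qed
    hence "bounded (range (\<lambda>n. x i (s n)))" unfolding bounded_iff by auto
    then obtain l r where "strict_mono r" "((\<lambda>n. x i (s n)) \<circ> r) \<longlonglongrightarrow> l"
      using bounded_imp_convergent_subsequence by metis
    thus "\<exists>r'. strict_mono r' \<and> Q i (s \<circ> r')"
      unfolding Q_def by (intro exI[of _ r]) (auto simp: o_def convergent_def)
  qed
  have conv: "convergent (\<lambda>n. x i (diagseq n))" for i
  proof -
    \<comment> \<open>Only from index \<open>Suc i\<close> on is the diagonal sequence a subsequence
      of the one chosen at stage \<open>i\<close>; the initial segment is irrelevant for
      convergence.\<close>
    have "Q i (diagseq \<circ> ((+) (Suc i)))"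
    proof (rule diagseq_holds)
      fix r s :: "nat \<Rightarrow> nat" and n assume "strict_mono r" "Q n s"
      thus "Q n (s \<circ> r)"
        using convergent_subseq_convergent[of "\<lambda>k. x n (s k)" r] by (simp add: Q_def o_def)
    qed
    hence "convergent (\<lambda>n. x i (diagseq (n + Suc i)))" by (simp add: Q_def o_def add.commute)
    thus ?thesis using convergent_ignore_initial_segment[of "\<lambda>n. x i (diagseq n)" "Suc i"] by simp
  qed
  have "form_Cauchy (\<lambda>v w. Re (L2_inner \<Omega> v w)) (v \<circ> diagseq)"
    unfolding form_Cauchy_def
  proof (intro allI impI)
    fix \<epsilon> :: real assume \<epsilon>: "\<epsilon> > 0"
    have C0: "C \<ge> 0" using bound[of 0] H1.pos[OF v[of 0]] by linarith
    \<comment> \<open>Differences have squared energy norm at most \<open>4 * C\<close>, so this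
      \<open>j\<close> keeps the gradient term below \<open>\<epsilon> / 2\<close>; the added 1
      protects against \<open>C = 0\<close>. The averages supply the other half.\<close>
    obtain j where j: "inverse (real (Suc j)) < \<epsilon> / (2 * (4 * C + 1))"
      using reals_Archimedean[of "\<epsilon> / (2 * (4 * C + 1))"] \<epsilon> C0 by auto
    have "\<exists>l. (\<lambda>n. L2_inner \<Omega> (e j k) (v (diagseq n))) \<longlonglongrightarrow> l" for k
      using conv[of "prod_encode (j, k)"] by (simp add: x_def convergent_def)
    then obtain l where l: "\<And>k. (\<lambda>n. L2_inner \<Omega> (e j k) (v (diagseq n))) \<longlonglongrightarrow> l k" by metis
    define A where "A n = (\<Sum>k<N j. 2 * (norm (L2_inner \<Omega> (e j k) (v (diagseq n)) - l k))\<^sup>2)" for n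
    have "A \<longlonglongrightarrow> (\<Sum>k<N j. 2 * (norm (l k - l k))\<^sup>2)"
      unfolding A_def by (intro tendsto_intros l)
    hence "A \<longlonglongrightarrow> 0" by simp
    hence "eventually (\<lambda>n. A n < \<epsilon> / 4) sequentially" using \<epsilon> by (intro order_tendstoD(2)) auto
    then obtain M where M: "\<And>n. n \<ge> M \<Longrightarrow> A n < \<epsilon> / 4" unfolding eventually_sequentially by blast
    have "Re (L2_inner \<Omega> (v (diagseq m) - v (diagseq n)) (v (diagseq m) - v (diagseq n))) < \<epsilon>"
      if mn: "m \<ge> M" "n \<ge> M" for m n
    proof -
      define w where "w = v (diagseq m) - v (diagseq n)"
      have w: "w \<in> H1 \<Omega>" unfolding w_def using v by (intro H1.minus_mem)
      have "Re (grad_inner \<Omega> w w) \<le> Re (H1_inner \<Omega> w w)"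
        using w L2.pos[OF H1_L2[OF w]] by (simp add: H1_inner_eq)
      also have "\<dots> \<le> 2 * Re (H1_inner \<Omega> (v (diagseq m)) (v (diagseq m))) + 2 * Re (H1_inner \<Omega> (v (diagseq n)) (v (diagseq n)))"
        unfolding w_def by (intro H1.Re.square_le_double v)
      also have "\<dots> \<le> 4 * C" using bound[of "diagseq m"] bound[of "diagseq n"] by simp
      finally have "inverse (real (Suc j)) * Re (grad_inner \<Omega> w w) \<le> inverse (real (Suc j)) * (4 * C + 1)"
        by (intro mult_left_mono) auto
      also have "\<dots> < \<epsilon> / (2 * (4 * C + 1)) * (4 * C + 1)"
        using j C0 by (intro mult_strict_right_mono) auto
      also have "\<dots> = \<epsilon> / 2" using C0 by (simp add: field_simps)
      finally have 1: "inverse (real (Suc j)) * Re (grad_inner \<Omega> w w) < \<epsilon> / 2" .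
      have "(norm (L2_inner \<Omega> (e j k) w))\<^sup>2 \<le> 2 * (norm (L2_inner \<Omega> (e j k) (v (diagseq m)) - l k))\<^sup>2 +
          2 * (norm (L2_inner \<Omega> (e j k) (v (diagseq n)) - l k))\<^sup>2" for k
      proof -
        define a where "a = norm (L2_inner \<Omega> (e j k) (v (diagseq m)) - l k)"
        define b where "b = norm (L2_inner \<Omega> (e j k) (v (diagseq n)) - l k)"
        have "L2_inner \<Omega> (e j k) w = (L2_inner \<Omega> (e j k) (v (diagseq m)) - l k) - (L2_inner \<Omega> (e j k) (v (diagseq n)) - l k)"
          unfolding w_def using e H1_L2[OF v] by (simp add: L2.minus_right)
        hence "norm (L2_inner \<Omega> (e j k) w) \<le> a + b"
          unfolding a_def b_def using norm_triangle_ineq4 by metis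
        hence "(norm (L2_inner \<Omega> (e j k) w))\<^sup>2 \<le> (a + b)\<^sup>2" by (intro power_mono) auto
        also have "\<dots> \<le> 2 * a\<^sup>2 + 2 * b\<^sup>2" using sum_squares_bound[of a b] by (simp add: power2_sum)
        finally show ?thesis by (simp add: a_def b_def)
      qed
      hence "(\<Sum>k<N j. (norm (L2_inner \<Omega> (e j k) w))\<^sup>2) \<le> A m + A n"
        unfolding A_def sum.distrib[symmetric] by (intro sum_mono)
      with ineq[OF w, of j] 1 M[OF mn(1)] M[OF mn(2)] show ?thesis unfolding w_def by linarith
    qed
    thus "\<exists>M. \<forall>m\<ge>M. \<forall>n\<ge>M. Re (L2_inner \<Omega> ((v \<circ> diagseq) m - (v \<circ> diagseq) n) ((v \<circ> diagseq) m - (v \<circ> diagseq) n)) < \<epsilon>"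
      unfolding o_def by (intro exI[of _ M] allI impI)
  qed
  thus ?thesis using subseq_diagseq by (intro exI[of _ diagseq] conjI)
qed

end

section \<open>Diagonalisation of Hermitian matrices\<close>

text \<open>Vectors are written as functions of the index, so the sesquilinear calculus for wave
  functions can be reused for matrices.\<close>

lemma herm_form_matrix:
  fixes M :: "complex^'n^'n"
  assumes M: "\<And>i j. M $ i $ j = cnj (M $ j $ i)"
  shows "herm_form UNIV (\<lambda>x y :: 'n \<Rightarrow> complex. \<Sum>k\<in>UNIV. \<Sum>l\<in>UNIV. cnj (x k) * M $ k $ l * y l)"
proof
  fix u v w :: "'n \<Rightarrow> complex" and a b
  show "(\<Sum>k\<in>UNIV. \<Sum>l\<in>UNIV. cnj (u k) * M $ k $ l * (a * v l + b * w l)) =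
      a * (\<Sum>k\<in>UNIV. \<Sum>l\<in>UNIV. cnj (u k) * M $ k $ l * v l) + b * (\<Sum>k\<in>UNIV. \<Sum>l\<in>UNIV. cnj (u k) * M $ k $ l * w l)"
    by (simp add: sum_distrib_left sum.distrib[symmetric] algebra_simps)
  have "(\<Sum>k\<in>UNIV. \<Sum>l\<in>UNIV. cnj (v k) * M $ k $ l * u l) = (\<Sum>l\<in>UNIV. \<Sum>k\<in>UNIV. cnj (v k) * M $ k $ l * u l)"
    by (rule sum.swap)
  also have "\<dots> = cnj (\<Sum>k\<in>UNIV. \<Sum>l\<in>UNIV. cnj (u k) * M $ k $ l * v l)"
    unfolding cnj_sum
  proof (intro sum.cong refl)
    fix k l
    show "cnj (v l) * M $ l $ k * u k = cnj (cnj (u k) * M $ k $ l * v l)"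
      using M[of l k] by (simp add: mult_ac)
  qed
  finally show "(\<Sum>k\<in>UNIV. \<Sum>l\<in>UNIV. cnj (v k) * M $ k $ l * u l) = cnj (\<Sum>k\<in>UNIV. \<Sum>l\<in>UNIV. cnj (u k) * M $ k $ l * v l)" .
qed auto

text \<open>Orthonormality is a closed condition and bounds every entry by 1. Compactness provides
  the maximiser used for diagonalisation.\<close>

lemma compact_orthonormal_columns:
  "compact {U :: complex^'n^'n. \<forall>i j. (\<Sum>k\<in>UNIV. cnj (U $ k $ i) * U $ k $ j) = (if i = j then 1 else 0)}" (is "compact ?S")
proof -
  have "closed {U :: complex^'n^'n. (\<Sum>k\<in>UNIV. cnj (U $ k $ i) * U $ k $ j) = (if i = j then 1 else 0)}" for i j
    by (intro closed_Collect_eq continuous_intros)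
  hence "closed (\<Inter>i. \<Inter>j. {U :: complex^'n^'n. (\<Sum>k\<in>UNIV. cnj (U $ k $ i) * U $ k $ j) = (if i = j then 1 else 0)})"
    by (intro closed_INT ballI)
  moreover have "?S = (\<Inter>i. \<Inter>j. {U :: complex^'n^'n. (\<Sum>k\<in>UNIV. cnj (U $ k $ i) * U $ k $ j) = (if i = j then 1 else 0)})"
    by auto
  ultimately have "closed ?S" by simp
  moreover have "norm U \<le> (\<Sum>k\<in>(UNIV :: 'n set). \<Sum>i\<in>(UNIV :: 'n set). 1)" if U: "U \<in> ?S" for U
  proof -
    have "norm (U $ k $ i) \<le> 1" for k i
    proof -
      have "(\<Sum>k\<in>UNIV. cnj (U $ k $ i) * U $ k $ i) = of_real (\<Sum>k\<in>UNIV. (norm (U $ k $ i))\<^sup>2)"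
        unfolding of_real_sum by (intro sum.cong refl) (simp add: complex_norm_square mult.commute del: of_real_power)
      hence "of_real (\<Sum>k\<in>UNIV. (norm (U $ k $ i))\<^sup>2) = (1 :: complex)" using U by simp
      hence "(\<Sum>k\<in>UNIV. (norm (U $ k $ i))\<^sup>2) = 1" by (simp only: of_real_eq_1_iff)
      moreover have "(norm (U $ k $ i))\<^sup>2 \<le> (\<Sum>k\<in>UNIV. (norm (U $ k $ i))\<^sup>2)" by (rule member_le_sum) auto
      ultimately show ?thesis by (simp add: power2_le_iff_abs_le[of 1, simplified])
    qed
    hence "(\<Sum>k\<in>UNIV. \<Sum>i\<in>UNIV. norm (U $ k $ i)) \<le> (\<Sum>k\<in>(UNIV :: 'n set). \<Sum>i\<in>(UNIV :: 'n set). 1)"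
      by (intro sum_mono)
    moreover have "norm U \<le> (\<Sum>k\<in>UNIV. norm (U $ k))" unfolding norm_vec_def by (rule L2_set_le_sum) simp
    moreover have "norm (U $ k) \<le> (\<Sum>i\<in>UNIV. norm (U $ k $ i))" for k
      unfolding norm_vec_def by (rule L2_set_le_sum) simp
    hence "(\<Sum>k\<in>UNIV. norm (U $ k)) \<le> (\<Sum>k\<in>UNIV. \<Sum>i\<in>UNIV. norm (U $ k $ i))" by (intro sum_mono)
    ultimately show ?thesis by linarith
  qed
  hence "bounded ?S" unfolding bounded_iff by blast
  ultimately show ?thesis by (simp add: compact_eq_bounded_closed)
qed

text \<open>A unitary matrix maximising a weighted trace with distinct weights diagonalises: the derivative
  along the rotations in the plane of two columns is a multiple of their off-diagonal entry.\<close>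

lemma hermitian_diagonalization:
  fixes M :: "complex^'n^'n"
  assumes M: "\<And>i j. M $ i $ j = cnj (M $ j $ i)"
  obtains U :: "complex^'n^'n" and d :: "'n \<Rightarrow> real"
  where "\<And>i j. (\<Sum>k\<in>UNIV. cnj (U $ k $ i) * U $ k $ j) = (if i = j then 1 else 0)"
    and "\<And>i j. (\<Sum>k\<in>UNIV. U $ i $ k * cnj (U $ j $ k)) = (if i = j then 1 else 0)"
    and "\<And>k j. (\<Sum>l\<in>UNIV. M $ k $ l * U $ l $ j) = of_real (d j) * U $ k $ j"
    and "\<And>z. det (mat z - M) = (\<Prod>i\<in>UNIV. z - of_real (d i))"
proof -
  define h where "h x y = (\<Sum>k\<in>UNIV. cnj (x k) * y k)" for x y :: "'n \<Rightarrow> complex"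
  define q where "q x y = (\<Sum>k\<in>UNIV. \<Sum>l\<in>UNIV. cnj (x k) * M $ k $ l * y l)" for x y :: "'n \<Rightarrow> complex"
  interpret q: herm_form UNIV q
    unfolding q_def[abs_def] by (rule herm_form_matrix[OF M])
  interpret h: herm_form UNIV h
  proof
    fix u v w :: "'n \<Rightarrow> complex" and a b
    show "h u (\<lambda>x. a * v x + b * w x) = a * h u v + b * h u w"
      by (simp add: h_def sum_distrib_left sum.distrib[symmetric] algebra_simps)
    show "h v u = cnj (h u v)" by (simp add: h_def mult.commute)
  qed auto
  define col where "col U i = (\<lambda>k. U $ k $ i)" for U :: "complex^'n^'n" and i
  define S where "S = {U. \<forall>i j. h (col U i) (col U j) = (if i = j then 1 else 0)}"
  have S: "compact S" using compact_orthonormal_columns by (simp add: S_def h_def col_def)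
  have "h (col (mat 1) i) (col (mat 1) j) = (\<Sum>k\<in>UNIV. if k = i then (if i = j then 1 else 0) else 0)" for i j
    unfolding h_def col_def by (intro sum.cong) (auto simp: mat_def)
  hence "mat 1 \<in> S" by (simp add: S_def)
  hence ne: "S \<noteq> {}" by blast
  \<comment> \<open>Distinct weights are essential: with equal weights the trace is invariant under
    rotations in the plane of two columns, and maximality says nothing about their off-diagonal
    entry.\<close>
  obtain wgt :: "'n \<Rightarrow> nat" where wgt: "inj wgt"
    using finite_imp_inj_to_nat_seg[of "UNIV :: 'n set"] by auto
  define f where "f U = (\<Sum>i\<in>UNIV. real (wgt i) * Re (q (col U i) (col U i)))" for U
  have "continuous_on S f"
    unfolding f_def q_def col_def by (intro continuous_intros)
  then obtain U where U: "U \<in> S" and max: "\<And>V. V \<in> S \<Longrightarrow> f V \<le> f U"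
    using continuous_attains_sup[OF S ne] by blast
  have Uh: "h (col U i) (col U j) = (if i = j then 1 else 0)" for i j using U by (simp add: S_def)
  have off: "q (col U i) (col U j) = 0" if ij: "i \<noteq> j" for i j
  proof -
    \<comment> \<open>The phase \<open>c\<close> is kept free in the rotation: \<open>c = 1\<close>
      and \<open>c = \<i>\<close> yield the real and the imaginary part of the entry.\<close>
    have Re0: "Re (c * q (col U i) (col U j)) = 0" if c: "norm c = 1" for c
    proof -
      have cc: "cnj c * c = 1" "c * cnj c = 1" using c by (simp_all add: complex_norm_square[symmetric] mult.commute)
      define x y where "x = col U i" and "y = col U j"
      define x' where "x' t = (\<lambda>k. of_real (cos t) * x k + (of_real (sin t) * c) * y k)" for t
      define y' where "y' t = (\<lambda>k. (- of_real (sin t) * cnj c) * x k + of_real (cos t) * y k)" for t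
      define R :: "real \<Rightarrow> complex^'n^'n"
        where "R t = (\<chi> k l. if l = i then x' t k else if l = j then y' t k else U $ k $ l)" for t
      have colR: "col (R t) l = (if l = i then x' t else if l = j then y' t else col U l)" for t l
        using ij by (auto simp: R_def col_def fun_eq_iff)
      have cs: "complex_of_real (cos t) * of_real (cos t) + of_real (sin t) * of_real (sin t) = 1" for t
        unfolding of_real_mult[symmetric] of_real_add[symmetric] using sin_cos_squared_add3[of t] by simp
      have hxy: "h x x = 1" "h y y = 1" "h x y = 0" "h y x = 0" using ij by (auto simp: x_def y_def Uh)
      have "R t \<in> S" for t
      proof -
        have "h (x' t) (x' t) = of_real (cos t) * of_real (cos t) + of_real (sin t) * of_real (sin t) * (c * cnj c)"
          by (simp only: x'_def h.lin h.lin_left UNIV_I hxy) (simp add: algebra_simps)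
        hence 1: "h (x' t) (x' t) = 1" by (simp only: cc cs mult_1_right)
        have "h (y' t) (y' t) = of_real (cos t) * of_real (cos t) + of_real (sin t) * of_real (sin t) * (c * cnj c)"
          by (simp only: y'_def h.lin h.lin_left UNIV_I hxy) (simp add: algebra_simps)
        hence 2: "h (y' t) (y' t) = 1" by (simp only: cc cs mult_1_right)
        have 3: "h (x' t) (y' t) = 0" "h (y' t) (x' t) = 0"
          by (simp_all only: x'_def y'_def h.lin h.lin_left UNIV_I hxy) simp_all
        have 4: "h (x' t) (col U l) = 0" "h (y' t) (col U l) = 0" "h (col U l) (x' t) = 0" "h (col U l) (y' t) = 0"
          if "l \<noteq> i" "l \<noteq> j" for l
          using that by (simp_all only: x'_def y'_def x_def y_def h.lin h.lin_left UNIV_I Uh if_False) simp_all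
        show ?thesis unfolding S_def using ij by (auto simp: colR Uh 1 2 3 4)
      qed
      hence le: "f (R t) \<le> f U" for t by (rule max)
      define a b r where "a = Re (q x x)" and "b = Re (q y y)" and "r = Re (c * q x y)"
      have qyx: "q y x = cnj (q x y)" by (rule q.herm) auto
      have qx': "Re (q (x' t) (x' t)) = (cos t)\<^sup>2 * a + (sin t)\<^sup>2 * b + 2 * sin t * cos t * r" for t
      proof -
        have "q (x' t) (x' t) = of_real ((cos t)\<^sup>2) * q x x + of_real ((sin t)\<^sup>2) * ((c * cnj c) * q y y) +
            of_real (sin t * cos t) * (c * q x y + cnj (c * q x y))"
          unfolding x'_def by (simp only: q.lin q.lin_left UNIV_I qyx) (simp add: power2_eq_square algebra_simps)
        from arg_cong[OF this[unfolded cc], of Re] show ?thesis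
          by (simp add: a_def b_def r_def algebra_simps)
      qed
      have qy': "Re (q (y' t) (y' t)) = (sin t)\<^sup>2 * a + (cos t)\<^sup>2 * b - 2 * sin t * cos t * r" for t
      proof -
        have "q (y' t) (y' t) = of_real ((sin t)\<^sup>2) * ((c * cnj c) * q x x) + of_real ((cos t)\<^sup>2) * q y y -
            of_real (sin t * cos t) * (c * q x y + cnj (c * q x y))"
          unfolding y'_def by (simp only: q.lin q.lin_left UNIV_I qyx) (simp add: power2_eq_square algebra_simps)
        from arg_cong[OF this[unfolded cc], of Re] show ?thesis
          by (simp add: a_def b_def r_def algebra_simps)
      qed
      \<comment> \<open>The contribution of the two rotated columns. The others do not move, so
        \<open>g\<close> is maximal at 0, where its derivative is \<open>2 * r\<close> times the
        difference of the weights.\<close>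
      define g where "g t = real (wgt i) * ((cos t)\<^sup>2 * a + (sin t)\<^sup>2 * b + 2 * sin t * cos t * r) +
          real (wgt j) * ((sin t)\<^sup>2 * a + (cos t)\<^sup>2 * b - 2 * sin t * cos t * r)" for t
      have split: "(\<Sum>l\<in>UNIV. F l) = F i + F j + (\<Sum>l\<in>UNIV - {i, j}. F l)" for F :: "'n \<Rightarrow> real"
        using ij sum.subset_diff[of "{i, j}" UNIV F] by simp
      have "f (R t) = g t + (\<Sum>l\<in>UNIV - {i, j}. real (wgt l) * Re (q (col U l) (col U l)))" for t
        unfolding f_def split using ij by (simp add: colR qx' qy' g_def)
      moreover have "f U = g 0 + (\<Sum>l\<in>UNIV - {i, j}. real (wgt l) * Re (q (col U l) (col U l)))"
        unfolding f_def split by (simp add: g_def a_def b_def x_def y_def)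
      ultimately have mx: "g t \<le> g 0" for t using le[of t] by simp
      have dg: "(g has_real_derivative (real (wgt i) - real (wgt j)) * (2 * r)) (at 0)"
        unfolding g_def by (auto intro!: derivative_eq_intros simp: algebra_simps)
      have "(real (wgt i) - real (wgt j)) * (2 * r) = 0"
        by (rule DERIV_local_max[OF dg, of 1]) (use mx in auto)
      moreover have "wgt i \<noteq> wgt j" using wgt ij by (simp add: inj_eq)
      ultimately show ?thesis by (simp add: r_def x_def y_def)
    qed
    have "Re (q (col U i) (col U j)) = 0" "Im (q (col U i) (col U j)) = 0"
      using Re0[of 1] Re0[of \<i>] by simp_all
    thus ?thesis by (simp add: complex_eq_iff)
  qed
  define d where "d i = Re (q (col U i) (col U i))" for i
  have diag: "q (col U i) (col U j) = (if i = j then of_real (d i) else 0)" for i j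
    using off[of i j] q.self_eq_Re[of "col U i"] by (cases "i = j") (simp_all add: d_def)
  define Ud :: "complex^'n^'n" where "Ud = (\<chi> i k. cnj (U $ k $ i))"
  define D :: "complex^'n^'n" where "D = (\<chi> i j. if i = j then of_real (d i) else 0)"
  have UdU: "Ud ** U = mat 1"
    using Uh by (simp add: vec_eq_iff matrix_matrix_mult_def Ud_def mat_def h_def col_def)
  hence UUd: "U ** Ud = mat 1" by (simp add: matrix_left_right_inverse)
  have UMU: "Ud ** (M ** U) = D"
    using diag by (simp add: vec_eq_iff matrix_matrix_mult_def Ud_def D_def q_def col_def sum_distrib_left mult.assoc)
  have MU: "M ** U = U ** D"
    using arg_cong[OF UMU, of "\<lambda>X. U ** X"] by (simp add: matrix_mul_assoc UUd)
  show thesis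
  proof (rule that)
    show "(\<Sum>k\<in>UNIV. cnj (U $ k $ i) * U $ k $ j) = (if i = j then 1 else 0)" for i j
      using Uh[of i j] by (simp add: h_def col_def)
    show "(\<Sum>k\<in>UNIV. U $ i $ k * cnj (U $ j $ k)) = (if i = j then 1 else 0)" for i j
      using UUd by (simp add: vec_eq_iff matrix_matrix_mult_def Ud_def mat_def)
    show "(\<Sum>l\<in>UNIV. M $ k $ l * U $ l $ j) = of_real (d j) * U $ k $ j" for k j
    proof -
      have "(\<Sum>l\<in>UNIV. M $ k $ l * U $ l $ j) = (M ** U) $ k $ j" by (simp add: matrix_matrix_mult_def)
      also have "\<dots> = (\<Sum>l\<in>UNIV. if l = j then U $ k $ l * of_real (d l) else 0)"
        unfolding MU by (simp add: matrix_matrix_mult_def D_def if_distrib cong: if_cong)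
      finally show ?thesis by (simp add: mult.commute)
    qed
    show "det (mat z - M) = (\<Prod>i\<in>UNIV. z - of_real (d i))" for z
    proof -
      have "det (mat z - M) = det Ud * det (mat z - M) * det U"
        using arg_cong[OF UdU, of det] by (simp add: det_mul mult_ac flip: mult.assoc)
      also have "\<dots> = det (Ud ** ((mat z - M) ** U))" by (simp add: det_mul mult_ac)
      also have "Ud ** ((mat z - M) ** U) = mat z - D"
      proof -
        have "mat z ** U = U ** mat z"
        proof -
          have "(\<Sum>k\<in>UNIV. (if i = k then z else 0) * U $ k $ j) = (\<Sum>k\<in>UNIV. if k = i then z * U $ k $ j else 0)"
            "(\<Sum>k\<in>UNIV. U $ i $ k * (if k = j then z else 0)) = (\<Sum>k\<in>UNIV. if k = j then z * U $ i $ k else 0)" for i j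
            by (rule sum.cong, simp, simp)+
          thus ?thesis by (simp add: vec_eq_iff matrix_matrix_mult_def mat_def)
        qed
        hence "(mat z - M) ** U = U ** mat z - M ** U" by (simp add: vec_eq_iff matrix_matrix_mult_def algebra_simps sum_subtractf)
        moreover have "Ud ** (U ** mat z - M ** U) = Ud ** (U ** mat z) - Ud ** (M ** U)"
          unfolding vec_eq_iff by (simp add: matrix_matrix_mult_def[of Ud] right_diff_distrib sum_subtractf)
        ultimately have "Ud ** ((mat z - M) ** U) = Ud ** (U ** mat z) - Ud ** (M ** U)" by simp
        thus ?thesis by (simp add: matrix_mul_assoc UdU UMU[unfolded matrix_mul_assoc])
      qed
      also have "det (mat z - D) = (\<Prod>i\<in>UNIV. (mat z - D) $ i $ i)"
        by (rule det_diagonal) (simp add: mat_def D_def)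
      finally show ?thesis by (simp add: mat_def D_def)
    qed
  qed
qed

section \<open>The spectral gap\<close>

locale rigged = L: pos_herm_form H L + N: pos_herm_form H N
  for H :: "('x \<Rightarrow> complex) set" and L N +
  assumes L_le_N: "v \<in> H \<Longrightarrow> Re (L v v) \<le> Re (N v v)"

text \<open>What is used of the ground state, free of frames and domains. The Aufbau principle
  enters only as \<open>no_lower\<close>: orthogonally to the vectors \<open>\<psi> i\<close> there
  is no eigenvector below \<open>\<Lambda>\<close>. Equality with \<open>\<Lambda>\<close> remains
  possible.\<close>

locale spectral_gap = rigged H L N + a: herm_form H a
  for H :: "('x \<Rightarrow> complex) set" and L N a +
  fixes C \<sigma> \<Lambda> :: real and \<psi> :: "'p::finite \<Rightarrow> 'x \<Rightarrow> complex" and d :: "'p \<Rightarrow> real"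
  assumes complete: "form_complete H (\<lambda>v w. Re (N v w))"
    and compact: "\<And>u K. (\<And>n. u n \<in> H) \<Longrightarrow> (\<And>n. Re (N (u n) (u n)) \<le> K) \<Longrightarrow>
       \<exists>r. strict_mono (r :: nat \<Rightarrow> nat) \<and> form_Cauchy (\<lambda>v w. Re (L v w)) (u \<circ> r)"
    and a_bound: "\<And>v. v \<in> H \<Longrightarrow> Re (a v v) \<le> C * Re (N v v)"
    and garding: "\<And>v. v \<in> H \<Longrightarrow> Re (N v v) \<le> Re (a v v) + \<sigma> * Re (L v v)"
    and \<sigma>: "\<sigma> > 0"
    and \<psi>: "\<psi> i \<in> H" and orthonormal: "L (\<psi> i) (\<psi> j) = (if i = j then 1 else 0)"
    and eigen: "w \<in> H \<Longrightarrow> a (\<psi> i) w = of_real (d i) * L (\<psi> i) w"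
    and no_lower: "\<And>\<kappa> v. \<kappa> < \<Lambda> \<Longrightarrow> v \<in> H \<Longrightarrow> Re (L v v) = 1 \<Longrightarrow> (\<And>i. L (\<psi> i) v = 0) \<Longrightarrow>
       (\<And>w. w \<in> H \<Longrightarrow> a v w = of_real \<kappa> * L v w) \<Longrightarrow> False"
begin

definition orth :: "('x \<Rightarrow> complex) set" where
  "orth = {v \<in> H. \<forall>i. L (\<psi> i) v = 0}"

lemma orth_H: "v \<in> orth \<Longrightarrow> v \<in> H" by (simp add: orth_def)

lemma subspace_orth: "subspace orth"
  unfolding subspace_def
proof (intro conjI allI ballI)
  have "L (\<psi> i) 0 = 0" for i
    using L.cscale_right[OF \<psi>[of i] \<psi>[of i], of 0] by (simp add: zero_fun_def)
  thus "0 \<in> orth" using L.zero by (simp add: orth_def zero_fun_def)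
  show "v + w \<in> orth" if "v \<in> orth" "w \<in> orth" for v w
    using that \<psi> by (simp add: orth_def L.plus_mem L.plus_right)
  show "r *\<^sub>R v \<in> orth" if "v \<in> orth" for r v
    using that \<psi> L.cscale_mem[of v "of_real r"]
    by (simp add: orth_def scaleR_fun_def scaleR_conv_of_real L.cscale_right)
qed

lemma sym_form_orth:
  assumes "herm_form H s"
  shows "sym_form orth (\<lambda>v w. Re (s v w))"
proof -
  interpret s: herm_form H s by fact
  interpret Re: sym_form H "\<lambda>v w. Re (s v w)" by (rule s.Re_sym_form)
  show ?thesis
    by (intro sym_form.intro subspace_orth Re.add_right Re.scale_right Re.sym orth_H)
qed

text \<open>The \<open>L\<close>-orthogonal projection onto the span of the \<open>\<psi> i\<close>.
  As these are eigenvectors, the splitting is orthogonal for \<open>a\<close> as well.\<close>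

definition proj :: "('x \<Rightarrow> complex) \<Rightarrow> 'x \<Rightarrow> complex" where
  "proj v = (\<lambda>x. \<Sum>i\<in>UNIV. L (\<psi> i) v * \<psi> i x)"

lemma proj_H: "proj v \<in> H"
  unfolding proj_def by (rule L.sum_mem[OF \<psi>])

lemma L_proj: "L (\<psi> j) (proj v) = L (\<psi> j) v"
  unfolding proj_def by (subst L.sum_right[OF \<psi> \<psi>]) (simp add: orthonormal if_distrib cong: if_cong)

lemma minus_proj_orth:
  assumes "v \<in> H"
  shows "v - proj v \<in> orth"
  using assms proj_H \<psi> by (simp add: orth_def L.minus_mem L.minus_right L_proj)

lemma a_right_\<psi>: "v \<in> H \<Longrightarrow> a v (\<psi> i) = of_real (d i) * cnj (L (\<psi> i) v)"
  using a.herm[OF \<psi>, of v i] eigen[of v i] by simp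

lemma norm_sq_cnj: "cnj z * z = of_real ((norm z)\<^sup>2)" "z * cnj z = of_real ((norm z)\<^sup>2)"
  by (simp_all add: complex_norm_square mult.commute del: of_real_power)

lemma L_v_proj: "v \<in> H \<Longrightarrow> L v (proj v) = of_real (\<Sum>i\<in>UNIV. (norm (L (\<psi> i) v))\<^sup>2)"
  unfolding proj_def by (subst L.sum_right[OF _ \<psi>]) (auto simp: L.herm[OF \<psi>, of v] norm_sq_cnj simp del: of_real_power)

lemma a_v_proj: "v \<in> H \<Longrightarrow> a v (proj v) = of_real (\<Sum>i\<in>UNIV. d i * (norm (L (\<psi> i) v))\<^sup>2)"
  unfolding proj_def
  by (subst a.sum_right[OF _ \<psi>]) (auto simp: a_right_\<psi> mult.left_commute norm_sq_cnj simp del: of_real_power)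

lemma a_orth_proj:
  assumes "w \<in> orth"
  shows "a w (proj v) = 0" "L w (proj v) = 0"
proof -
  have w: "w \<in> H" "\<And>i. L (\<psi> i) w = 0" using assms by (auto simp: orth_def)
  show "a w (proj v) = 0" unfolding proj_def
    by (subst a.sum_right[OF w(1) \<psi>]) (simp add: a_right_\<psi> w)
  show "L w (proj v) = 0" unfolding proj_def
    by (subst L.sum_right[OF w(1) \<psi>]) (simp add: L.herm[OF \<psi> w(1)] w)
qed

text \<open>A violation would produce, by minimisation within \<open>orth\<close>, an eigenvector of
  the restricted form below \<open>\<Lambda>\<close>. Since \<open>a\<close> and \<open>L\<close>
  both vanish between \<open>orth\<close> and the span of the \<open>\<psi> i\<close>, it is an
  eigenvector on all of \<open>H\<close>, which \<open>no_lower\<close> rules out.\<close>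

lemma gap:
  assumes v: "v \<in> orth"
  shows "\<Lambda> * Re (L v v) \<le> Re (a v v)"
proof (rule ccontr)
  assume "\<not> ?thesis"
  hence less: "Re (a v v) < \<Lambda> * Re (L v v)" by simp
  have psdN: "psd_form orth (\<lambda>v w. Re (N v w))"
    by (intro psd_form.intro psd_form_axioms.intro sym_form_orth N.herm_form_axioms N.pos orth_H)
  have psdL: "psd_form orth (\<lambda>v w. Re (L v w))"
    by (intro psd_form.intro psd_form_axioms.intro sym_form_orth L.herm_form_axioms L.pos orth_H)
  have completeW: "form_complete orth (\<lambda>v w. Re (N v w))"
    unfolding form_complete_def
  proof (intro allI impI)
    fix u :: "nat \<Rightarrow> 'x \<Rightarrow> complex"
    assume u: "\<forall>n. u n \<in> orth" and Cauchy: "form_Cauchy (\<lambda>v w. Re (N v w)) u"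
    have uH: "u n \<in> H" for n using u by (simp add: orth_def)
    have "\<exists>w\<in>H. (\<lambda>n. Re (N (u n - w) (u n - w))) \<longlonglongrightarrow> 0"
      using complete uH Cauchy unfolding form_complete_def by simp
    then obtain w where w: "w \<in> H" and lim: "(\<lambda>n. Re (N (u n - w) (u n - w))) \<longlonglongrightarrow> 0" by blast
    have d: "u n - w \<in> H" for n using uH w by (rule L.minus_mem)
    have lim': "(\<lambda>n. Re (L (u n - w) (u n - w))) \<longlonglongrightarrow> 0"
      by (rule tendsto_zero_squeeze[OF lim L.pos[OF d] L_le_N[OF d]])
    have "L (\<psi> i) w = 0" for i
    proof -
      have "(\<lambda>n. L (\<psi> i) (u n)) \<longlonglongrightarrow> L (\<psi> i) w" by (rule L.tendsto_right[OF uH w \<psi> lim'])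
      moreover have "L (\<psi> i) (u n) = 0" for n using u by (simp add: orth_def)
      ultimately show ?thesis by (simp add: LIMSEQ_const_iff)
    qed
    hence "w \<in> orth" using w by (simp add: orth_def)
    with lim show "\<exists>w\<in>orth. (\<lambda>n. Re (N (u n - w) (u n - w))) \<longlonglongrightarrow> 0" by (rule bexI)
  qed
  have "\<exists>v\<in>orth. \<exists>\<kappa><\<Lambda>. Re (L v v) = 1 \<and> (\<forall>w\<in>orth. Re (a v w) = \<kappa> * Re (L v w))"
  proof (rule Rayleigh_minimizer[OF psdN completeW psdL sym_form_orth[OF a.herm_form_axioms]])
    show "Re (L v v) \<le> Re (N v v)" "Re (a v v) \<le> C * Re (N v v)" "Re (N v v) \<le> Re (a v v) + \<sigma> * Re (L v v)"
      if "v \<in> orth" for v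
      using L_le_N[OF orth_H[OF that]] a_bound[OF orth_H[OF that]] garding[OF orth_H[OF that]] by simp_all
    show "\<exists>r. strict_mono (r :: nat \<Rightarrow> nat) \<and> form_Cauchy (\<lambda>v w. Re (L v w)) (u \<circ> r)"
      if "\<forall>n. u n \<in> orth" "\<forall>n. Re (N (u n) (u n)) \<le> K" for u K
      by (rule compact[of u K]) (use that orth_H in auto)
  qed (fact v, fact less)
  then obtain v \<kappa> where v: "v \<in> orth" and \<kappa>: "\<kappa> < \<Lambda>" and Lv: "Re (L v v) = 1"
    and eig: "\<And>w. w \<in> orth \<Longrightarrow> Re (a v w) = \<kappa> * Re (L v w)" by blast
  have vH: "v \<in> H" using v by (rule orth_H)
  have "a v w = of_real \<kappa> * L v w" if w: "w \<in> H" for w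
  proof -
    define w' where "w' = w - proj w"
    have w': "w' \<in> orth" unfolding w'_def by (rule minus_proj_orth[OF w])
    \<comment> \<open>The minimisation yields only real parts; testing with \<open>\<i> * w'\<close>
      supplies the imaginary part.\<close>
    have iw: "(\<lambda>x. \<i> * w' x) \<in> orth"
      using w' \<psi> by (simp add: orth_def L.cscale_mem L.cscale_right)
    have "Re (a v w') = \<kappa> * Re (L v w')" by (rule eig[OF w'])
    moreover have "Im (a v w') = \<kappa> * Im (L v w')"
      using eig[OF iw] a.cscale_right[OF vH orth_H[OF w'], of \<i>] L.cscale_right[OF vH orth_H[OF w'], of \<i>] by simp
    ultimately have "a v w' = of_real \<kappa> * L v w'" by (simp add: complex_eq_iff)
    moreover have "a v w' = a v w" "L v w' = L v w"
      unfolding w'_def using vH w proj_H a_orth_proj[OF v] by (simp_all add: a.minus_right L.minus_right)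
    ultimately show ?thesis by simp
  qed
  moreover have "L (\<psi> i) v = 0" for i using v by (simp add: orth_def)
  ultimately show False using no_lower[OF \<kappa> vH Lv] by blast
qed

lemma L_minus_proj:
  assumes v: "v \<in> H"
  shows "L (v - proj v) (v - proj v) = L v v - L v (proj v)"
proof -
  have "L (v - proj v) (v - proj v) = L (v - proj v) v"
    using L.minus_right[OF orth_H[OF minus_proj_orth[OF v]] v proj_H, of v] a_orth_proj(2)[OF minus_proj_orth[OF v]] by simp
  also have "\<dots> = L v v - L (proj v) v" by (rule L.minus_left[OF v proj_H v])
  also have "L (proj v) v = L v (proj v)" using L.herm[OF v proj_H, of v] L_v_proj[OF v] by simp
  finally show ?thesis .
qed

lemma a_minus_proj:
  assumes v: "v \<in> H"
  shows "a (v - proj v) (v - proj v) = a v v - a v (proj v)"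
proof -
  have "a (v - proj v) (v - proj v) = a (v - proj v) v"
    using a.minus_right[OF orth_H[OF minus_proj_orth[OF v]] v proj_H, of v] a_orth_proj(1)[OF minus_proj_orth[OF v]] by simp
  also have "\<dots> = a v v - a (proj v) v" by (rule a.minus_left[OF v proj_H v])
  also have "a (proj v) v = a v (proj v)" using a.herm[OF v proj_H, of v] a_v_proj[OF v] by simp
  finally show ?thesis .
qed

lemma Bessel:
  assumes v: "v \<in> H"
  shows "(\<Sum>i\<in>UNIV. (norm (L (\<psi> i) v))\<^sup>2) \<le> Re (L v v)"
  using L.pos[OF orth_H[OF minus_proj_orth[OF v]]] by (simp add: L_minus_proj[OF v] L_v_proj[OF v])

text \<open>The form is block diagonal for the splitting: the gap bounds the orthogonal part by
  \<open>\<Lambda>\<close>, and the rest is explicit in the coefficients.\<close>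

lemma a_lower_bound:
  assumes v: "v \<in> H"
  shows "\<Lambda> * (Re (L v v) - (\<Sum>i\<in>UNIV. (norm (L (\<psi> i) v))\<^sup>2)) + (\<Sum>i\<in>UNIV. d i * (norm (L (\<psi> i) v))\<^sup>2) \<le> Re (a v v)"
  using gap[OF minus_proj_orth[OF v]]
  by (simp add: L_minus_proj[OF v] a_minus_proj[OF v] L_v_proj[OF v] a_v_proj[OF v])

text \<open>Where the shifted form is negative, the sign of the test vector is changed, so every
  component contributes positively and at least \<open>m\<close> times its mass. This bounds
  \<open>L\<close>; the Garding inequality then bounds \<open>N\<close>.\<close>

lemma shifted_inf_sup:
  assumes \<kappa>: "\<kappa> < \<Lambda>" and d: "\<And>i. d i \<noteq> \<kappa>"
  shows "\<exists>c>0. \<exists>K>0. \<forall>v\<in>H. \<exists>w\<in>H. sqrt (Re (N w w)) \<le> K * sqrt (Re (N v v)) \<and>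
    c * Re (N v v) \<le> Re (a v w) - \<kappa> * Re (L v w)"
proof -
  \<comment> \<open>The distance from \<open>\<kappa>\<close> to everything known of the spectrum:
    the values \<open>d i\<close>, and all numbers from \<open>\<Lambda>\<close> on.\<close>
  define m where "m = Min (insert (\<Lambda> - \<kappa>) (range (\<lambda>i. \<bar>d i - \<kappa>\<bar>)))"
  have m: "m > 0" unfolding m_def using \<kappa> d by (subst Min_gr_iff) auto
  have m_le: "m \<le> \<Lambda> - \<kappa>" "m \<le> \<bar>d i - \<kappa>\<bar>" for i unfolding m_def by (rule Min_le; simp)+
  \<comment> \<open>With \<open>B\<close> the tested form, \<open>N\<close> is at most
    \<open>B\<close> plus \<open>\<sigma> + \<bar>\<kappa>\<bar>\<close> times \<open>L\<close>, and
    \<open>m\<close> times \<open>L\<close> is at most \<open>B\<close>.\<close>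
  define c where "c = m / (m + \<sigma> + \<bar>\<kappa>\<bar>)"
  \<comment> \<open>The reflected coefficients are at most twice the norm of \<open>v\<close>; the 1
    accounts for \<open>v\<close> itself.\<close>
  define K where "K = 1 + (\<Sum>i\<in>UNIV. 2 * sqrt (Re (N (\<psi> i) (\<psi> i))))"
  have c: "c > 0" using m \<sigma> by (simp add: c_def)
  have K: "K > 0" unfolding K_def using N.pos[OF \<psi>] by (intro add_pos_nonneg sum_nonneg) auto
  have "\<exists>w\<in>H. sqrt (Re (N w w)) \<le> K * sqrt (Re (N v v)) \<and> c * Re (N v v) \<le> Re (a v w) - \<kappa> * Re (L v w)"
    if v: "v \<in> H" for v
  proof -
    \<comment> \<open>The test vector \<open>w\<close> is \<open>v\<close> with the signs of its components along the eigenvectors below \<open>\<kappa>\<close> reversed.\<close>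
    define b where "b i = (if d i < \<kappa> then 2 * L (\<psi> i) v else 0)" for i
    define z where "z = (\<lambda>x. \<Sum>i\<in>UNIV. b i * \<psi> i x)"
    have z: "z \<in> H" unfolding z_def by (rule L.sum_mem[OF \<psi>])
    define w where "w = v - z"
    have w: "w \<in> H" unfolding w_def using v z by (rule L.minus_mem)
    define s where "s i = (norm (L (\<psi> i) v))\<^sup>2" for i
    have s0: "s i \<ge> 0" for i by (simp add: s_def)
    have Lz: "L v z = (\<Sum>i\<in>UNIV. of_real (if d i < \<kappa> then 2 * s i else 0))"
      unfolding z_def by (subst L.sum_right[OF v \<psi>], rule sum.cong)
        (auto simp: b_def s_def L.herm[OF \<psi> v] norm_sq_cnj mult.assoc simp del: of_real_power)
    have az: "a v z = (\<Sum>i\<in>UNIV. of_real (if d i < \<kappa> then 2 * d i * s i else 0))"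
      unfolding z_def
    proof (subst a.sum_right[OF v \<psi>], rule sum.cong[OF refl])
      fix i
      have "L (\<psi> i) v * (of_real (d i) * cnj (L (\<psi> i) v)) = of_real (d i) * (L (\<psi> i) v * cnj (L (\<psi> i) v))" by simp
      thus "b i * a v (\<psi> i) = of_real (if d i < \<kappa> then 2 * d i * s i else 0)"
        by (simp add: b_def s_def a_right_\<psi>[OF v] norm_sq_cnj mult.assoc del: of_real_power)
    qed
    define q where "q = Re (a v v) - \<kappa> * Re (L v v)"
    have form: "Re (a v w) - \<kappa> * Re (L v w) = q + (\<Sum>i\<in>UNIV. if d i < \<kappa> then 2 * (\<kappa> - d i) * s i else 0)"
    proof -
      have "Re (a v w) - \<kappa> * Re (L v w) = q - (Re (a v z) - \<kappa> * Re (L v z))"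
        unfolding w_def q_def using v z by (simp add: a.minus_right L.minus_right algebra_simps)
      also have "Re (a v z) - \<kappa> * Re (L v z) = (\<Sum>i\<in>UNIV. (if d i < \<kappa> then 2 * d i * s i else 0) - \<kappa> * (if d i < \<kappa> then 2 * s i else 0))"
        unfolding Lz az by (simp add: sum_subtractf sum_distrib_left)
      also have "\<dots> = - (\<Sum>i\<in>UNIV. if d i < \<kappa> then 2 * (\<kappa> - d i) * s i else 0)"
        unfolding sum_negf[symmetric] by (intro sum.cong) (auto simp: algebra_simps)
      finally show ?thesis by simp
    qed
    have ge_q: "q \<le> Re (a v w) - \<kappa> * Re (L v w)"
      unfolding form using s0 by (simp add: sum_nonneg)
    have "m * Re (L v v) = m * (Re (L v v) - sum s UNIV) + (\<Sum>i\<in>UNIV. m * s i)"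
      by (simp add: sum_distrib_left algebra_simps)
    also have "\<dots> \<le> (\<Lambda> - \<kappa>) * (Re (L v v) - sum s UNIV) + (\<Sum>i\<in>UNIV. \<bar>d i - \<kappa>\<bar> * s i)"
      using m_le Bessel[OF v] s0 by (intro add_mono mult_right_mono sum_mono) (auto simp: s_def)
    \<comment> \<open>The modulus is the number itself plus twice its negative part; the second sum
      is precisely what the reflection adds.\<close>
    also have "(\<Sum>i\<in>UNIV. \<bar>d i - \<kappa>\<bar> * s i) = (\<Sum>i\<in>UNIV. (d i - \<kappa>) * s i) + (\<Sum>i\<in>UNIV. if d i < \<kappa> then 2 * (\<kappa> - d i) * s i else 0)"
      unfolding sum.distrib[symmetric] by (intro sum.cong) (auto simp: algebra_simps)
    also have "(\<Lambda> - \<kappa>) * (Re (L v v) - sum s UNIV) + ((\<Sum>i\<in>UNIV. (d i - \<kappa>) * s i) + (\<Sum>i\<in>UNIV. if d i < \<kappa> then 2 * (\<kappa> - d i) * s i else 0)) \<le>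
        Re (a v w) - \<kappa> * Re (L v w)"
      unfolding form q_def using a_lower_bound[OF v]
      by (simp add: s_def[symmetric] sum_subtractf sum_distrib_left algebra_simps)
    finally have mL: "m * Re (L v v) \<le> Re (a v w) - \<kappa> * Re (L v w)" by simp
    define B where "B = Re (a v w) - \<kappa> * Re (L v w)"
    have "Re (N v v) \<le> q + (\<sigma> + \<kappa>) * Re (L v v)" using garding[OF v] by (simp add: q_def algebra_simps)
    also have "\<dots> \<le> B + (\<sigma> + \<bar>\<kappa>\<bar>) * Re (L v v)"
      using ge_q L.pos[OF v] unfolding B_def by (intro add_mono mult_right_mono) auto
    finally have "m * Re (N v v) \<le> m * B + (\<sigma> + \<bar>\<kappa>\<bar>) * (m * Re (L v v))"
      using m by (simp add: mult_left_mono[of _ _ m, OF _ less_imp_le] algebra_simps)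
        (metis (no_types, opaque_lifting) distrib_left mult.assoc mult.commute mult_left_mono less_imp_le)
    also have "\<dots> \<le> m * B + (\<sigma> + \<bar>\<kappa>\<bar>) * B"
      using mL \<sigma> unfolding B_def by (intro add_left_mono mult_left_mono) auto
    finally have "m * Re (N v v) \<le> (m + \<sigma> + \<bar>\<kappa>\<bar>) * B" by (simp add: algebra_simps)
    hence cB: "c * Re (N v v) \<le> B" using m \<sigma> by (simp add: c_def field_simps)
    have "norm (b i) \<le> 2 * sqrt (Re (N v v))" for i
    proof -
      have "norm (L (\<psi> i) v) \<le> sqrt (Re (L v v))"
        using L.norm_le[OF \<psi> v, of i] by (simp add: orthonormal)
      also have "\<dots> \<le> sqrt (Re (N v v))" using L_le_N[OF v] by simp
      finally show ?thesis using N.pos[OF v] by (simp add: b_def norm_mult)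
    qed
    hence "(\<Sum>i\<in>UNIV. norm (b i) * sqrt (Re (N (\<psi> i) (\<psi> i)))) \<le> (\<Sum>i\<in>UNIV. (2 * sqrt (Re (N v v))) * sqrt (Re (N (\<psi> i) (\<psi> i))))"
      using N.pos[OF \<psi>] by (intro sum_mono mult_right_mono) auto
    also have "\<dots> = (K - 1) * sqrt (Re (N v v))"
      by (simp add: K_def sum_distrib_left sum_distrib_right mult_ac)
    finally have "sqrt (Re (N z z)) \<le> (K - 1) * sqrt (Re (N v v))"
      using N.sqrt_sum_le[of UNIV \<psi> b] \<psi> unfolding z_def by simp
    hence "sqrt (Re (N w w)) \<le> K * sqrt (Re (N v v))"
      using N.Re.triangle_diff[OF v z] unfolding w_def by (simp add: algebra_simps)
    thus ?thesis using w cB unfolding B_def by blast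
  qed
  thus ?thesis using c K by blast
qed

end

section \<open>Forms on frames\<close>

definition frame_form :: "(wavefun \<Rightarrow> wavefun \<Rightarrow> complex) \<Rightarrow> 'p::finite frame \<Rightarrow> 'p frame \<Rightarrow> real" where
  "frame_form s v w = (\<Sum>j\<in>UNIV. Re (s (v j) (w j)))"

lemma framesD: "v \<in> frames H \<Longrightarrow> v j \<in> H"
  by (simp add: frames_def)

lemma subspace_frames: "subspace H \<Longrightarrow> subspace (frames H)"
  by (auto simp: subspace_def frames_def zero_fun_def)

lemma frame_form_sym_form:
  assumes "herm_form H s"
  shows "sym_form (frames H :: 'b::finite frame set) (frame_form s)"
proof -
  interpret s: herm_form H s by fact
  interpret Re: sym_form H "\<lambda>v w. Re (s v w)" by (rule s.Re_sym_form)
  show ?thesis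
  proof
    show "subspace (frames H)" by (rule subspace_frames[OF Re.sub])
    show "frame_form s u (v + w) = frame_form s u v + frame_form s u w"
      if "u \<in> frames H" "v \<in> frames H" "w \<in> frames H" for u v w :: "'b frame"
      using that by (simp add: frame_form_def framesD Re.add_right sum.distrib)
    show "frame_form s u (r *\<^sub>R v) = r * frame_form s u v" if "u \<in> frames H" "v \<in> frames H" for u v :: "'b frame" and r
      using that by (simp add: frame_form_def framesD Re.scale_right sum_distrib_left)
    show "frame_form s u v = frame_form s v u" if "u \<in> frames H" "v \<in> frames H" for u v :: "'b frame"
      unfolding frame_form_def using that by (intro sum.cong Re.sym framesD refl)
  qed
qed

lemma frame_form_psd_form:
  assumes "pos_herm_form H s"
  shows "psd_form (frames H) (frame_form s)"
proof -
  interpret s: pos_herm_form H s by fact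
  show ?thesis
    by (intro psd_form.intro frame_form_sym_form s.herm_form_axioms psd_form_axioms.intro)
      (auto simp: frame_form_def framesD intro!: sum_nonneg s.pos)
qed

lemma component_le_frame_form:
  assumes "pos_herm_form H s" "v \<in> frames H"
  shows "Re (s (v j) (v j)) \<le> frame_form s v v"
proof -
  interpret s: pos_herm_form H s by fact
  show ?thesis unfolding frame_form_def using assms(2)
    by (intro member_le_sum) (auto simp: framesD intro!: s.pos)
qed

lemma frame_form_complete:
  fixes s :: "wavefun \<Rightarrow> wavefun \<Rightarrow> complex"
  assumes s: "pos_herm_form H s" and complete: "form_complete H (\<lambda>v w. Re (s v w))"
  shows "form_complete (frames H :: 'p::finite frame set) (frame_form s)"
  unfolding form_complete_def
proof (intro allI impI)
  fix u :: "nat \<Rightarrow> 'p frame" assume u: "\<forall>n. u n \<in> frames H" and Cauchy: "form_Cauchy (frame_form s) u"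
  interpret s: pos_herm_form H s by fact
  interpret F: psd_form "frames H :: 'p frame set" "frame_form s" by (rule frame_form_psd_form[OF s])
  have uj: "u n j \<in> H" for n j using u by (simp add: framesD)
  have ex: "\<exists>v. v \<in> H \<and> (\<lambda>n. Re (s (u n j - v) (u n j - v))) \<longlonglongrightarrow> 0" for j
  proof -
    have "form_Cauchy (\<lambda>v w. Re (s v w)) (\<lambda>n. u n j)"
      unfolding form_Cauchy_def
    proof (rule allI, rule impI)
      fix e :: real assume "e > 0"
      then obtain K where K: "\<And>m n. m \<ge> K \<Longrightarrow> n \<ge> K \<Longrightarrow> frame_form s (u m - u n) (u m - u n) < e"
        using Cauchy unfolding form_Cauchy_def by metis
      have "Re (s (u m j - u n j) (u m j - u n j)) < e" if "m \<ge> K" "n \<ge> K" for m n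
        using component_le_frame_form[OF s, of "u m - u n" j] K[OF that] u by simp
      thus "\<exists>N. \<forall>m\<ge>N. \<forall>n\<ge>N. Re (s (u m j - u n j) (u m j - u n j)) < e" by blast
    qed
    from form_completeD[OF complete _ this] uj show ?thesis by blast
  qed
  have "\<exists>v. \<forall>j. v j \<in> H \<and> (\<lambda>n. Re (s (u n j - v j) (u n j - v j))) \<longlonglongrightarrow> 0"
    by (rule choice, rule allI, rule ex)
  then obtain v where v: "\<And>j. v j \<in> H" and lim: "\<And>j. (\<lambda>n. Re (s (u n j - v j) (u n j - v j))) \<longlonglongrightarrow> 0"
    by blast
  have "(\<lambda>n. \<Sum>j\<in>UNIV. Re (s (u n j - v j) (u n j - v j))) \<longlonglongrightarrow> (\<Sum>j\<in>(UNIV :: 'p set). 0)"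
    by (intro tendsto_sum lim)
  hence "(\<lambda>n. frame_form s (u n - v) (u n - v)) \<longlonglongrightarrow> 0" by (simp add: frame_form_def)
  moreover have "v \<in> frames H" using v by (simp add: frames_def)
  ultimately show "\<exists>v\<in>frames H. (\<lambda>n. frame_form s (u n - v) (u n - v)) \<longlonglongrightarrow> 0" by (rule bexI)
qed

lemma frame_mult_eq: "frame_mult v A j = (\<lambda>x. \<Sum>i\<in>UNIV. A $ i $ j * v i x)"
  by (simp add: frame_mult_def mult.commute)

lemma frame_mult_frames:
  assumes "herm_form H s" "v \<in> frames H"
  shows "frame_mult v A \<in> frames H"
proof -
  interpret s: herm_form H s by fact
  show ?thesis unfolding frames_def frame_mult_eq using s.sum_mem[of UNIV v] assms(2) by (simp add: framesD)
qed

lemma form_frame_mult: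
  assumes "herm_form H s" "v \<in> frames H" "z \<in> H"
  shows "s (frame_mult v A j) z = (\<Sum>i\<in>UNIV. cnj (A $ i $ j) * s (v i) z)"
    and "s z (frame_mult v A j) = (\<Sum>i\<in>UNIV. A $ i $ j * s z (v i))"
proof -
  interpret s: herm_form H s by fact
  show "s (frame_mult v A j) z = (\<Sum>i\<in>UNIV. cnj (A $ i $ j) * s (v i) z)"
    unfolding frame_mult_eq by (rule s.sum_left[OF assms(3) framesD[OF assms(2)]])
  show "s z (frame_mult v A j) = (\<Sum>i\<in>UNIV. A $ i $ j * s z (v i))"
    unfolding frame_mult_eq by (rule s.sum_right[OF assms(3) framesD[OF assms(2)]])
qed

text \<open>With weights \<open>e\<close> this is conjugation of the diagonal matrix
  \<open>e\<close> by \<open>U\<close>: weights 1 give the identity if \<open>U\<close> is unitary,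
  and eigenvalues as weights give back the diagonalised matrix.\<close>

lemma sum_form_frame_mult:
  fixes U :: "complex^'p::finite^'p"
  assumes s: "herm_form H s" and v: "v \<in> frames H" and w: "w \<in> frames H"
  shows "(\<Sum>j\<in>UNIV. e j * s (frame_mult v U j) (frame_mult w U j)) =
    (\<Sum>k\<in>UNIV. \<Sum>l\<in>UNIV. (\<Sum>j\<in>UNIV. e j * cnj (U $ k $ j) * U $ l $ j) * s (v k) (w l))"
proof -
  have "(\<Sum>j\<in>UNIV. e j * s (frame_mult v U j) (frame_mult w U j)) =
      (\<Sum>j\<in>UNIV. \<Sum>k\<in>UNIV. \<Sum>l\<in>UNIV. e j * cnj (U $ k $ j) * U $ l $ j * s (v k) (w l))"
    by (intro sum.cong refl)
      (simp add: form_frame_mult(1)[OF s v framesD[OF frame_mult_frames[OF s w]]]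
        form_frame_mult(2)[OF s w framesD[OF v]] sum_distrib_left mult.assoc)
  also have "\<dots> = (\<Sum>k\<in>UNIV. \<Sum>j\<in>UNIV. \<Sum>l\<in>UNIV. e j * cnj (U $ k $ j) * U $ l $ j * s (v k) (w l))"
    by (rule sum.swap)
  also have "\<dots> = (\<Sum>k\<in>UNIV. \<Sum>l\<in>UNIV. \<Sum>j\<in>UNIV. e j * cnj (U $ k $ j) * U $ l $ j * s (v k) (w l))"
    by (intro sum.cong refl sum.swap)
  finally show ?thesis by (simp add: sum_distrib_right)
qed

text \<open>In matrix terms, \<open>U\<close> is unitary and \<open>M U = U D\<close> with
  \<open>D\<close> diagonal. Sums over entries are used because they arise directly from expanding
  forms of frames.\<close>

locale diagonalizer =
  fixes M U :: "complex^'p::finite^'p" and d :: "'p \<Rightarrow> real"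
  assumes columns: "(\<Sum>k\<in>UNIV. cnj (U $ k $ i) * U $ k $ j) = (if i = j then 1 else 0)"
    and rows: "(\<Sum>k\<in>UNIV. U $ i $ k * cnj (U $ j $ k)) = (if i = j then 1 else 0)"
    and eigen_columns: "(\<Sum>l\<in>UNIV. M $ k $ l * U $ l $ j) = of_real (d j) * U $ k $ j"
    and M_herm: "M $ i $ j = cnj (M $ j $ i)"
begin

lemma norm_U_le_1: "norm (U $ k $ i) \<le> 1"
proof -
  have "(\<Sum>k\<in>UNIV. cnj (U $ k $ i) * U $ k $ i) = of_real (\<Sum>k\<in>UNIV. (norm (U $ k $ i))\<^sup>2)"
    unfolding of_real_sum by (intro sum.cong refl) (simp add: complex_norm_square mult.commute del: of_real_power)
  hence "of_real (\<Sum>k\<in>UNIV. (norm (U $ k $ i))\<^sup>2) = (1 :: complex)" using columns[of i i] by simp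
  hence "(\<Sum>k\<in>UNIV. (norm (U $ k $ i))\<^sup>2) = 1" by (simp only: of_real_eq_1_iff)
  moreover have "(norm (U $ k $ i))\<^sup>2 \<le> (\<Sum>k\<in>UNIV. (norm (U $ k $ i))\<^sup>2)" by (rule member_le_sum) auto
  ultimately show ?thesis by (simp add: power2_le_iff_abs_le[of 1, simplified])
qed

text \<open>The spectral decomposition read entrywise. The conjugate appears because multiplying a
  frame in the first, conjugate linear slot conjugates the matrix.\<close>

lemma M_decomposition: "(\<Sum>j\<in>UNIV. of_real (d j) * cnj (U $ k $ j) * U $ l $ j) = cnj (M $ k $ l)"
proof -
  have "(\<Sum>j\<in>UNIV. of_real (d j) * cnj (U $ k $ j) * U $ l $ j) = (\<Sum>j\<in>UNIV. cnj (U $ k $ j) * (\<Sum>m\<in>UNIV. M $ l $ m * U $ m $ j))"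
    unfolding eigen_columns by (simp add: mult_ac)
  also have "\<dots> = (\<Sum>m\<in>UNIV. \<Sum>j\<in>UNIV. M $ l $ m * (U $ m $ j * cnj (U $ k $ j)))"
    unfolding sum_distrib_left by (subst sum.swap) (simp add: mult_ac)
  also have "\<dots> = (\<Sum>m\<in>UNIV. M $ l $ m * (if m = k then 1 else 0))"
    unfolding sum_distrib_left[symmetric] rows ..
  also have "\<dots> = M $ l $ k" by (simp add: if_distrib cong: if_cong)
  finally show ?thesis using M_herm[of l k] by simp
qed

text \<open>Rotated components decouple right multiplication by \<open>M\<close> into multiplication
  of component \<open>j\<close> by \<open>d j\<close>, while sums of forms over the components stay
  the same.\<close>

lemma sum_rotated:
  assumes s: "herm_form H s" and v: "v \<in> frames H" and w: "w \<in> frames H"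
  shows "(\<Sum>j\<in>UNIV. s (frame_mult v U j) (frame_mult w U j)) = (\<Sum>j\<in>UNIV. s (v j) (w j))"
    and "(\<Sum>j\<in>UNIV. of_real (d j) * s (frame_mult v U j) (frame_mult w U j)) = (\<Sum>j\<in>UNIV. s (frame_mult v M j) (w j))"
proof -
  have "(\<Sum>j\<in>UNIV. s (frame_mult v U j) (frame_mult w U j)) =
      (\<Sum>k\<in>UNIV. \<Sum>l\<in>UNIV. (\<Sum>j\<in>UNIV. U $ l $ j * cnj (U $ k $ j)) * s (v k) (w l))"
    using sum_form_frame_mult[OF s v w, of "\<lambda>_. 1" U] by (simp add: mult.commute)
  also have "\<dots> = (\<Sum>k\<in>UNIV. s (v k) (w k))"
    unfolding rows by (simp add: if_distribR if_distrib cong: if_cong)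
  finally show "(\<Sum>j\<in>UNIV. s (frame_mult v U j) (frame_mult w U j)) = (\<Sum>j\<in>UNIV. s (v j) (w j))" .
  have "(\<Sum>j\<in>UNIV. of_real (d j) * s (frame_mult v U j) (frame_mult w U j)) = (\<Sum>k\<in>UNIV. \<Sum>l\<in>UNIV. cnj (M $ k $ l) * s (v k) (w l))"
    unfolding sum_form_frame_mult[OF s v w] M_decomposition ..
  also have "\<dots> = (\<Sum>l\<in>UNIV. s (frame_mult v M l) (w l))"
    by (subst sum.swap) (simp add: form_frame_mult(1)[OF s v framesD[OF w]])
  finally show "(\<Sum>j\<in>UNIV. of_real (d j) * s (frame_mult v U j) (frame_mult w U j)) = (\<Sum>j\<in>UNIV. s (frame_mult v M j) (w j))" .
qed

lemma frame_form_rotated: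
  assumes "herm_form H s" "v \<in> frames H" "w \<in> frames H"
  shows "frame_form s (frame_mult v U) (frame_mult w U) = frame_form s v w"
  using arg_cong[OF sum_rotated(1)[OF assms], of Re] by (simp add: frame_form_def)

text \<open>Right multiplication by the adjoint of \<open>U\<close>; it returns test frames from
  rotated to original coordinates.\<close>

definition unrotate :: "'p frame \<Rightarrow> 'p frame" where
  "unrotate v = frame_mult v (\<chi> i k. cnj (U $ k $ i))"

lemma rotate_unrotate: "frame_mult (unrotate v) U = v"
proof (intro ext)
  fix j x
  have "frame_mult (unrotate v) U j x = (\<Sum>i\<in>UNIV. \<Sum>k\<in>UNIV. v k x * (cnj (U $ i $ k) * U $ i $ j))"
    by (simp add: frame_mult_def unrotate_def sum_distrib_right mult.assoc)
  also have "\<dots> = (\<Sum>k\<in>UNIV. v k x * (\<Sum>i\<in>UNIV. cnj (U $ i $ k) * U $ i $ j))"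
    by (subst sum.swap) (simp add: sum_distrib_left)
  also have "\<dots> = v j x" unfolding columns by (simp add: if_distrib cong: if_cong)
  finally show "frame_mult (unrotate v) U j x = v j x" .
qed

end

text \<open>The form of the shifted Hamiltonian in rotated coordinates: the components are
  uncoupled, and component \<open>j\<close> has its own shift \<open>\<kappa> j\<close>.\<close>

definition diag_form ::
  "(wavefun \<Rightarrow> wavefun \<Rightarrow> complex) \<Rightarrow> (wavefun \<Rightarrow> wavefun \<Rightarrow> complex) \<Rightarrow> ('p::finite \<Rightarrow> real) \<Rightarrow> 'p frame \<Rightarrow> 'p frame \<Rightarrow> real" where
  "diag_form L a \<kappa> v w = (\<Sum>j\<in>UNIV. Re (a (v j) (w j)) - \<kappa> j * Re (L (v j) (w j)))"

context
  fixes H :: "wavefun set" and L N a :: "wavefun \<Rightarrow> wavefun \<Rightarrow> complex" and C \<sigma> \<Lambda> :: real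
    and \<psi> :: "'p::finite frame" and d :: "'p \<Rightarrow> real"
  assumes gap: "spectral_gap H L N a C \<sigma> \<Lambda> \<psi> d"
begin

interpretation spectral_gap H L N a C \<sigma> \<Lambda> \<psi> d by (rule gap)

text \<open>Each component has its own test vector; over finitely many components the smallest lower
  constant and the largest norm constant are uniform.\<close>

lemma diag_form_inf_sup:
  assumes \<kappa>: "\<And>j. \<kappa> j < \<Lambda>" and d: "\<And>i j. d i \<noteq> \<kappa> j"
  shows "\<exists>c>0. \<exists>K>0. \<forall>v\<in>(frames H :: 'p frame set). \<exists>w\<in>frames H. sqrt (frame_form N w w) \<le> K * sqrt (frame_form N v v) \<and>
    c * frame_form N v v \<le> diag_form L a \<kappa> v w"
proof -
  have "\<forall>j. \<exists>c K. c > 0 \<and> K > 0 \<and> (\<forall>v\<in>H. \<exists>w\<in>H. sqrt (Re (N w w)) \<le> K * sqrt (Re (N v v)) \<and>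
    c * Re (N v v) \<le> Re (a v w) - \<kappa> j * Re (L v w))"
    using shifted_inf_sup[OF \<kappa> d] by blast
  then obtain c K where c: "\<And>j. c j > 0" and K: "\<And>j. K j > 0" and
    ex: "\<And>j v. v \<in> H \<Longrightarrow> \<exists>w\<in>H. sqrt (Re (N w w)) \<le> K j * sqrt (Re (N v v)) \<and>
    c j * Re (N v v) \<le> Re (a v w) - \<kappa> j * Re (L v w)" by metis
  define c0 where "c0 = Min (range c)"
  define K0 where "K0 = Max (range K)"
  have c0: "c0 > 0" unfolding c0_def using c by (subst Min_gr_iff) auto
  have c0_le: "c0 \<le> c j" and K0_ge: "K j \<le> K0" for j by (simp_all add: c0_def K0_def)
  have K0: "K0 > 0" using K[of undefined] K0_ge[of undefined] by linarith
  have "\<exists>w\<in>frames H. sqrt (frame_form N w w) \<le> K0 * sqrt (frame_form N v v) \<and> c0 * frame_form N v v \<le> diag_form L a \<kappa> v w"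
    if v: "v \<in> frames H" for v :: "'p frame"
  proof -
    have "\<exists>w. \<forall>j. w j \<in> H \<and> sqrt (Re (N (w j) (w j))) \<le> K j * sqrt (Re (N (v j) (v j))) \<and>
        c j * Re (N (v j) (v j)) \<le> Re (a (v j) (w j)) - \<kappa> j * Re (L (v j) (w j))"
    proof (intro choice allI)
      fix j
      show "\<exists>w. w \<in> H \<and> sqrt (Re (N w w)) \<le> K j * sqrt (Re (N (v j) (v j))) \<and>
          c j * Re (N (v j) (v j)) \<le> Re (a (v j) w) - \<kappa> j * Re (L (v j) w)"
        using ex[OF framesD[OF v, of j], of j] by blast
    qed
    then obtain w where w: "\<And>j. w j \<in> H" and wK: "\<And>j. sqrt (Re (N (w j) (w j))) \<le> K j * sqrt (Re (N (v j) (v j)))"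
      and wc: "\<And>j. c j * Re (N (v j) (v j)) \<le> Re (a (v j) (w j)) - \<kappa> j * Re (L (v j) (w j))"
      by blast
    have Nv: "0 \<le> Re (N (v j) (v j))" for j by (rule N.pos[OF framesD[OF v]])
    have Nw: "0 \<le> Re (N (w j) (w j))" for j by (rule N.pos[OF w])
    have "frame_form N w w \<le> (\<Sum>j\<in>UNIV. K0\<^sup>2 * Re (N (v j) (v j)))"
      unfolding frame_form_def
    proof (rule sum_mono)
      fix j
      have "sqrt (Re (N (w j) (w j))) \<le> K0 * sqrt (Re (N (v j) (v j)))"
        by (rule order_trans[OF wK]) (intro mult_right_mono K0_ge, simp add: Nv)
      hence "(sqrt (Re (N (w j) (w j))))\<^sup>2 \<le> (K0 * sqrt (Re (N (v j) (v j))))\<^sup>2"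
        using Nw by (intro power_mono) auto
      thus "Re (N (w j) (w j)) \<le> K0\<^sup>2 * Re (N (v j) (v j))" using Nv Nw by (simp add: power_mult_distrib)
    qed
    also have "\<dots> = K0\<^sup>2 * frame_form N v v" by (simp add: frame_form_def sum_distrib_left)
    finally have "sqrt (frame_form N w w) \<le> sqrt (K0\<^sup>2 * frame_form N v v)" by simp
    hence 1: "sqrt (frame_form N w w) \<le> K0 * sqrt (frame_form N v v)" using K0 by (simp add: real_sqrt_mult)
    have 2: "c0 * frame_form N v v \<le> diag_form L a \<kappa> v w"
      unfolding frame_form_def diag_form_def sum_distrib_left
      by (intro sum_mono order_trans[OF _ wc] mult_right_mono c0_le Nv)
    have "w \<in> frames H" using w by (simp add: frames_def)
    thus ?thesis using 1 2 by blast
  qed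
  thus ?thesis using c0 K0 by blast
qed

text \<open>If the moduli of the coefficients along the \<open>\<psi> i\<close> are symmetric, the
  contributions of \<open>d i - d j\<close> cancel in pairs. The number \<open>r\<close> measures
  the failure of the skew condition at the ground state, as occurs for a vector tangent at a nearby
  frame; the cost is linear in \<open>r\<close>.\<close>

lemma diag_form_almost_coercive:
  assumes \<mu>: "\<mu> > 0" and d: "\<And>i. d i \<le> \<Lambda>"
  shows "\<exists>c>0. \<exists>K\<ge>0. \<forall>v\<in>(frames H :: 'p frame set). \<forall>r\<ge>0. (\<forall>i j. norm (L (\<psi> i) (v j) + cnj (L (\<psi> j) (v i))) \<le> r) \<longrightarrow>
    c * frame_form N v v \<le> diag_form L a (\<lambda>j. d j - \<mu>) v v + K * r * sqrt (frame_form N v v)"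
proof -
  \<comment> \<open>Summing all moduli gives one Garding constant valid for every component.\<close>
  define \<sigma>' where "\<sigma>' = \<sigma> + (\<Sum>j\<in>UNIV. \<bar>d j - \<mu>\<bar>)"
  have \<sigma>': "\<sigma>' > 0" unfolding \<sigma>'_def using \<sigma> by (intro add_pos_nonneg sum_nonneg) auto
  have \<sigma>'_ge: "\<sigma> + (d j - \<mu>) \<le> \<sigma>'" for j
  proof -
    have "\<bar>d j - \<mu>\<bar> \<le> (\<Sum>j\<in>UNIV. \<bar>d j - \<mu>\<bar>)" by (rule member_le_sum) auto
    thus ?thesis unfolding \<sigma>'_def by linarith
  qed
  define K1 where "K1 = (\<Sum>j\<in>(UNIV :: 'p set). \<Sum>i\<in>UNIV. 2 * \<bar>d i\<bar>)"
  have K1: "K1 \<ge> 0" unfolding K1_def by (intro sum_nonneg) auto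
  have "\<mu> / (\<mu> + \<sigma>') * frame_form N v v \<le> diag_form L a (\<lambda>j. d j - \<mu>) v v + \<sigma>' * K1 / (\<mu> + \<sigma>') * r * sqrt (frame_form N v v)"
    if v: "v \<in> frames H" and r: "r \<ge> 0" and tangent: "\<And>i j. norm (L (\<psi> i) (v j) + cnj (L (\<psi> j) (v i))) \<le> r" for v :: "'p frame" and r
  proof -
    define S where "S i j = norm (L (\<psi> i) (v j))" for i j
    define T where "T = diag_form L a (\<lambda>j. d j - \<mu>) v v"
    define F where "F = frame_form N v v"
    have vH: "v j \<in> H" for j using v by (rule framesD)
    have Nv: "0 \<le> Re (N (v j) (v j))" and Lv: "0 \<le> Re (L (v j) (v j))" for j by (rule N.pos[OF vH], rule L.pos[OF vH])
    have S_le: "S i j \<le> sqrt F" for i j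
    proof -
      have "S i j \<le> sqrt (Re (L (v j) (v j)))"
        unfolding S_def using L.norm_le[OF \<psi> vH, of i j] by (simp add: orthonormal)
      also have "\<dots> \<le> sqrt (Re (N (v j) (v j)))" using L_le_N[OF vH] by simp
      also have "\<dots> \<le> sqrt F"
        unfolding F_def using component_le_frame_form[OF N.pos_herm_form_axioms v, of j] by simp
      finally show ?thesis .
    qed
    have S0: "S i j \<ge> 0" for i j by (simp add: S_def)
    \<comment> \<open>Conjugation does not change moduli, so the defect bounds
      \<open>S i j - S j i\<close> by the reverse triangle inequality; the sum
      \<open>S i j + S j i\<close> is bounded by the norm.\<close>
    have diff: "\<bar>(S i j)\<^sup>2 - (S j i)\<^sup>2\<bar> \<le> r * (2 * sqrt F)" for i j
    proof -
      have "\<bar>S i j - S j i\<bar> \<le> r"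
        using norm_triangle_ineq3[of "L (\<psi> i) (v j)" "- cnj (L (\<psi> j) (v i))"] tangent[of i j] by (simp add: S_def)
      moreover have "\<bar>S i j + S j i\<bar> \<le> 2 * sqrt F" using S_le[of i j] S_le[of j i] S0[of i j] S0[of j i] by simp
      moreover have "\<bar>(S i j)\<^sup>2 - (S j i)\<^sup>2\<bar> = \<bar>S i j - S j i\<bar> * \<bar>S i j + S j i\<bar>"
        by (simp add: abs_mult[symmetric] power2_eq_square algebra_simps)
      ultimately show ?thesis using r by (simp add: mult_mono)
    qed
    have X: "- (K1 * r * sqrt F) \<le> (\<Sum>j\<in>UNIV. \<Sum>i\<in>UNIV. (d i - d j) * (S i j)\<^sup>2)"
    proof -
      \<comment> \<open>Renaming the indices moves the weight from \<open>j\<close> to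
        \<open>i\<close>, leaving only differences of squared moduli of transposed entries.\<close>
      have "(\<Sum>j\<in>UNIV. \<Sum>i\<in>UNIV. d j * (S i j)\<^sup>2) = (\<Sum>j\<in>UNIV. \<Sum>i\<in>UNIV. d i * (S j i)\<^sup>2)"
        by (subst sum.swap) simp
      hence "(\<Sum>j\<in>UNIV. \<Sum>i\<in>UNIV. (d i - d j) * (S i j)\<^sup>2) = (\<Sum>j\<in>UNIV. \<Sum>i\<in>UNIV. d i * ((S i j)\<^sup>2 - (S j i)\<^sup>2))"
        by (simp add: algebra_simps sum_subtractf)
      moreover have "- (K1 * r * sqrt F) = (\<Sum>j\<in>(UNIV :: 'p set). \<Sum>i\<in>UNIV. - (\<bar>d i\<bar> * (r * (2 * sqrt F))))"
        unfolding K1_def by (simp add: sum_distrib_right sum_distrib_left sum_negf mult_ac)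
      moreover have "(\<Sum>j\<in>(UNIV :: 'p set). \<Sum>i\<in>UNIV. - (\<bar>d i\<bar> * (r * (2 * sqrt F)))) \<le> (\<Sum>j\<in>UNIV. \<Sum>i\<in>UNIV. d i * ((S i j)\<^sup>2 - (S j i)\<^sup>2))"
      proof (intro sum_mono)
        fix i j
        have "\<bar>d i * ((S i j)\<^sup>2 - (S j i)\<^sup>2)\<bar> \<le> \<bar>d i\<bar> * (r * (2 * sqrt F))"
          unfolding abs_mult by (intro mult_left_mono diff) simp
        thus "- (\<bar>d i\<bar> * (r * (2 * sqrt F))) \<le> d i * ((S i j)\<^sup>2 - (S j i)\<^sup>2)" by linarith
      qed
      ultimately show ?thesis by simp
    qed
    have "\<mu> * Re (L (v j) (v j)) + (\<Sum>i\<in>UNIV. (d i - d j) * (S i j)\<^sup>2) \<le> Re (a (v j) (v j)) - (d j - \<mu>) * Re (L (v j) (v j))" for j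
    proof -
      \<comment> \<open>Orthogonally to the \<open>\<psi> i\<close> the form is at least
        \<open>\<Lambda>\<close>. Weakening this to \<open>d j\<close> leaves only the differences
        \<open>d i - d j\<close> next to \<open>\<mu>\<close>.\<close>
      have "0 \<le> (\<Lambda> - d j) * (Re (L (v j) (v j)) - (\<Sum>i\<in>UNIV. (S i j)\<^sup>2))"
        using d[of j] Bessel[OF vH, of j] by (simp add: S_def)
      moreover have "(\<Sum>i\<in>UNIV. (d i - d j) * (S i j)\<^sup>2) = (\<Sum>i\<in>UNIV. d i * (S i j)\<^sup>2) - d j * (\<Sum>i\<in>UNIV. (S i j)\<^sup>2)"
        by (simp add: left_diff_distrib sum_subtractf sum_distrib_left)
      ultimately show ?thesis using a_lower_bound[OF vH, of j] unfolding S_def by (simp add: algebra_simps)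
    qed
    hence "(\<Sum>j\<in>UNIV. \<mu> * Re (L (v j) (v j)) + (\<Sum>i\<in>UNIV. (d i - d j) * (S i j)\<^sup>2)) \<le> T"
      unfolding T_def diag_form_def by (intro sum_mono)
    hence low: "\<mu> * frame_form L v v \<le> T + K1 * r * sqrt F"
      using X by (simp add: sum.distrib sum_distrib_left frame_form_def)
    have "F \<le> (\<Sum>j\<in>UNIV. (Re (a (v j) (v j)) - (d j - \<mu>) * Re (L (v j) (v j))) + \<sigma>' * Re (L (v j) (v j)))"
      unfolding F_def frame_form_def
    proof (rule sum_mono)
      fix j
      have "(\<sigma> + (d j - \<mu>)) * Re (L (v j) (v j)) \<le> \<sigma>' * Re (L (v j) (v j))"
        by (intro mult_right_mono \<sigma>'_ge Lv)
      thus "Re (N (v j) (v j)) \<le> (Re (a (v j) (v j)) - (d j - \<mu>) * Re (L (v j) (v j))) + \<sigma>' * Re (L (v j) (v j))"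
        using garding[OF vH, of j] by (simp add: algebra_simps)
    qed
    hence "F \<le> T + \<sigma>' * frame_form L v v"
      by (simp add: T_def diag_form_def frame_form_def sum.distrib sum_distrib_left)
    \<comment> \<open>Garding bounds \<open>F\<close> by \<open>T + \<sigma>' L\<close>, and
      \<open>\<mu> L\<close> is already bounded by \<open>T\<close> plus the defect. Eliminating
      \<open>L\<close> gives the constant \<open>\<mu> / (\<mu> + \<sigma>')\<close>.\<close>
    hence "\<mu> * F \<le> \<mu> * T + \<sigma>' * (\<mu> * frame_form L v v)"
      using mult_left_mono[of F "T + \<sigma>' * frame_form L v v" \<mu>] \<mu> by (simp add: algebra_simps)
    also have "\<dots> \<le> \<mu> * T + \<sigma>' * (T + K1 * r * sqrt F)"
      using low \<sigma>' by (intro add_left_mono mult_left_mono) auto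
    finally have "\<mu> * F \<le> (\<mu> + \<sigma>') * T + \<sigma>' * K1 * r * sqrt F" by (simp add: algebra_simps)
    hence "\<mu> * F / (\<mu> + \<sigma>') \<le> ((\<mu> + \<sigma>') * T + \<sigma>' * K1 * r * sqrt F) / (\<mu> + \<sigma>')"
      using \<mu> \<sigma>' by (intro divide_right_mono) auto
    also have "\<dots> = T + \<sigma>' * K1 / (\<mu> + \<sigma>') * r * sqrt F"
      using \<mu> \<sigma>' by (simp add: add_divide_distrib)
    finally show ?thesis unfolding T_def[symmetric] F_def[symmetric] by simp
  qed
  moreover have "\<mu> / (\<mu> + \<sigma>') > 0" "\<sigma>' * K1 / (\<mu> + \<sigma>') \<ge> 0" using \<mu> \<sigma>' K1 by auto
  ultimately show ?thesis by blast
qed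

end

section \<open>The Hamiltonian as a form\<close>

lemma pos_herm_form_subset:
  assumes "pos_herm_form V s" "W \<subseteq> V" "(\<lambda>x. 0) \<in> W"
    and "\<And>v w a b. v \<in> W \<Longrightarrow> w \<in> W \<Longrightarrow> (\<lambda>x. a * v x + b * w x) \<in> W"
  shows "pos_herm_form W s"
proof -
  interpret V: pos_herm_form V s by fact
  show ?thesis
  proof
    show "s u (\<lambda>x. a * v x + b * w x) = a * s u v + b * s u w" if "u \<in> W" "v \<in> W" "w \<in> W" for u v w a b
      using that assms(2) by (intro V.lin) auto
    show "s v u = cnj (s u v)" if "u \<in> W" "v \<in> W" for u v
      using that assms(2) by (intro V.herm) auto
    show "0 \<le> Re (s v v)" if "v \<in> W" for v
      using that assms(2) by (intro V.pos) auto
  qed (use assms in auto)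
qed

lemma herm_form_diff:
  assumes "herm_form V s" "herm_form V t"
  shows "herm_form V (\<lambda>v w. s v w - t v w)"
proof -
  interpret s: herm_form V s by fact
  interpret t: herm_form V t by fact
  show ?thesis
  proof
    show "s v u - t v u = cnj (s u v - t u v)" if "u \<in> V" "v \<in> V" for u v
      using s.herm[OF that] t.herm[OF that] by simp
  qed (simp_all add: s.zero s.comb s.lin t.lin algebra_simps)
qed

text \<open>Frames with one nonzero component; with them, hypotheses about frames become statements
  about single wave functions.\<close>

definition single :: "'p \<Rightarrow> wavefun \<Rightarrow> 'p frame" where
  "single j v = (\<lambda>k. if k = j then v else (\<lambda>x. 0))"

lemma single_frames:
  assumes "herm_form H s" "v \<in> H"
  shows "single j v \<in> frames H"
  using herm_form.zero[OF assms(1)] assms(2) by (simp add: frames_def single_def)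

lemma frame_form_single:
  assumes "herm_form H s" "v \<in> H" "w \<in> frames H"
  shows "frame_form s (single j v) w = Re (s v (w j))"
proof -
  interpret s: herm_form H s by fact
  have "s (\<lambda>x. 0) z = 0" if "z \<in> H" for z
    using s.cscale_left[OF s.zero that, of 0] by simp
  hence "Re (s (single j v k) (w k)) = (if k = j then Re (s v (w k)) else 0)" for k
    using framesD[OF assms(3)] by (simp add: single_def)
  thus ?thesis by (simp add: frame_form_def)
qed

lemma dual_pair_eq: "dual_pair f w = (\<Sum>j\<in>UNIV. Re (f j (w j)))"
  by (simp add: dual_pair_def dual_gram_def trace_def)

lemma dual_pair_hamiltonian:
  "dual_pair (hamiltonian \<Omega> vi vx \<phi> v) w = frame_form (hamiltonian1 \<Omega> vi vx \<phi>) v w"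
  by (simp add: dual_pair_eq hamiltonian_def frame_form_def)

lemma dual_pair_shifted_hamiltonian:
  "dual_pair (shifted_hamiltonian \<Omega> vi vx \<phi> S v) w =
    frame_form (hamiltonian1 \<Omega> vi vx \<phi>) v w - frame_form (L2_inner \<Omega>) (frame_mult v S) w"
  by (simp add: dual_pair_eq shifted_hamiltonian_def hamiltonian_def embed_def frame_form_def sum_subtractf)

lemma frame_H_norm_eq: "frame_H_norm \<Omega> v = sqrt (frame_form (H1_inner \<Omega>) v v)"
  by (simp add: frame_H_norm_def frame_form_def)

lemma frame_L_norm_eq: "frame_L_norm \<Omega> v = sqrt (frame_form (L2_inner \<Omega>) v v)"
  by (simp add: frame_L_norm_def frame_form_def gram_def trace_def)

section \<open>The concrete function space and estimates in the frame norm\<close>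

locale kohn_sham_space = bounded_open +
  fixes H :: "wavefun set"
  assumes convex_dom: "convex \<Omega>" and space: "closed_dense_subspace \<Omega> H"
begin

lemma H_H1: "v \<in> H \<Longrightarrow> v \<in> H1 \<Omega>"
  using space by (auto simp: closed_dense_subspace_def)

lemma H_zero: "(\<lambda>x. 0) \<in> H" and H_comb: "v \<in> H \<Longrightarrow> w \<in> H \<Longrightarrow> (\<lambda>x. a * v x + b * w x) \<in> H"
  using space by (auto simp: closed_dense_subspace_def)

lemma L_pos_herm_form: "pos_herm_form H (L2_inner \<Omega>)"
  using H_zero H_comb H_H1 H1_L2 by (intro pos_herm_form_subset[OF L2.pos_herm_form_axioms]) auto

lemma N_pos_herm_form: "pos_herm_form H (H1_inner \<Omega>)"
  using H_zero H_comb H_H1 by (intro pos_herm_form_subset[OF H1.pos_herm_form_axioms]) auto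

lemma rigged: "rigged H (L2_inner \<Omega>) (H1_inner \<Omega>)"
  by (intro rigged.intro L_pos_herm_form N_pos_herm_form rigged_axioms.intro L2_le_H1 H_H1)

sublocale R: rigged H "L2_inner \<Omega>" "H1_inner \<Omega>" by (rule rigged)

lemma H_complete: "form_complete H (\<lambda>v w. Re (H1_inner \<Omega> v w))"
  unfolding form_complete_def
proof (intro allI impI)
  fix u :: "nat \<Rightarrow> wavefun" assume u: "\<forall>n. u n \<in> H" and Cauchy: "form_Cauchy (\<lambda>v w. Re (H1_inner \<Omega> v w)) u"
  have "u n \<in> H1 \<Omega>" for n using u H_H1 by simp
  from form_completeD[OF H1_complete this Cauchy]
  obtain v where v: "v \<in> H1 \<Omega>" and lim: "(\<lambda>n. Re (H1_inner \<Omega> (u n - v) (u n - v))) \<longlonglongrightarrow> 0" by blast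
  have "(\<lambda>n. H1_norm \<Omega> (u n - v)) \<longlonglongrightarrow> sqrt 0" unfolding H1_norm_def by (intro tendsto_intros lim)
  hence "v \<in> H" using space u v unfolding closed_dense_subspace_def by simp
  with lim show "\<exists>v\<in>H. (\<lambda>n. Re (H1_inner \<Omega> (u n - v) (u n - v))) \<longlonglongrightarrow> 0" by (rule bexI)
qed

lemma H_compact:
  assumes "\<And>n. u n \<in> H" "\<And>n. Re (H1_inner \<Omega> (u n) (u n)) \<le> K"
  shows "\<exists>r. strict_mono (r :: nat \<Rightarrow> nat) \<and> form_Cauchy (\<lambda>v w. Re (L2_inner \<Omega> v w)) (u \<circ> r)"
  by (rule Rellich_compactness[OF convex_dom H_H1[OF assms(1)] assms(2)])

abbreviation FN :: "'p::finite frame \<Rightarrow> real" where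
  "FN v \<equiv> frame_H_norm \<Omega> v"

lemma FN_psd: "psd_form (frames H :: 'p::finite frame set) (frame_form (H1_inner \<Omega>))"
  by (rule frame_form_psd_form[OF N_pos_herm_form])

lemma FN_sq: "v \<in> frames H \<Longrightarrow> (FN v)\<^sup>2 = frame_form (H1_inner \<Omega>) v v"
  using psd_form.nonneg[OF FN_psd, of v] by (simp add: frame_H_norm_eq)

lemma FN_nonneg: "v \<in> frames H \<Longrightarrow> 0 \<le> FN v"
  using psd_form.nonneg[OF FN_psd, of v] by (simp add: frame_H_norm_eq)

lemma FN_single: "v \<in> H \<Longrightarrow> FN (single j v) = H1_norm \<Omega> v"
  using frame_form_single[OF R.N.herm_form_axioms, of v "single j v" j] single_frames[OF R.N.herm_form_axioms, of v j]
  by (simp add: frame_H_norm_eq H1_norm_def single_def)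

lemma H1_norm_le_FN: "v \<in> frames H \<Longrightarrow> H1_norm \<Omega> (v j) \<le> FN v"
  using component_le_frame_form[OF N_pos_herm_form, of v j] by (simp add: H1_norm_def frame_H_norm_eq)

lemma H1_norm_nonneg: "v \<in> H \<Longrightarrow> 0 \<le> H1_norm \<Omega> v"
  using R.N.pos[of v] by (simp add: H1_norm_def)

lemma norm_L2_inner_le: "v \<in> H \<Longrightarrow> w \<in> H \<Longrightarrow> norm (L2_inner \<Omega> v w) \<le> H1_norm \<Omega> v * H1_norm \<Omega> w"
  using R.L.norm_le[of v w] mult_mono[of "sqrt (Re (L2_inner \<Omega> v v))" "H1_norm \<Omega> v" "sqrt (Re (L2_inner \<Omega> w w))" "H1_norm \<Omega> w"]
    R.L_le_N[of v] R.L_le_N[of w] R.L.pos[of w] R.N.pos[of v] by (simp add: H1_norm_def)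

text \<open>Frames with one nonzero component reduce the bound to wave functions, and a phase in the
  second argument recovers the complex modulus from the real part.\<close>

lemma norm_form_le:
  fixes s :: "wavefun \<Rightarrow> wavefun \<Rightarrow> complex"
  assumes s: "herm_form H s"
    and bound: "\<And>v w. v \<in> (frames H :: 'p::finite frame set) \<Longrightarrow> w \<in> frames H \<Longrightarrow> \<bar>frame_form s v w\<bar> \<le> C * FN v * FN w"
    and v: "v \<in> H" and w: "w \<in> H"
  shows "norm (s v w) \<le> C * H1_norm \<Omega> v * H1_norm \<Omega> w"
proof -
  interpret s: herm_form H s by fact
  show ?thesis
  proof (rule s.norm_le_of_Re_le[OF v w])
    fix c :: complex assume c: "norm c = 1"
    fix j :: 'p
    have cw: "(\<lambda>x. c * w x) \<in> H" by (rule s.cscale_mem[OF w])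
    have "H1_norm \<Omega> (\<lambda>x. c * w x) = H1_norm \<Omega> w"
      using R.N.sqrt_cscale[OF w, of c] c by (simp add: H1_norm_def)
    moreover have "frame_form s (single j v) (single j (\<lambda>x. c * w x)) = Re (s v (\<lambda>x. c * w x))"
      using frame_form_single[OF s v single_frames[OF s cw, of j], of j] by (simp add: single_def)
    ultimately show "Re (s v (\<lambda>x. c * w x)) \<le> C * H1_norm \<Omega> v * H1_norm \<Omega> w"
      using bound[OF single_frames[OF s v, of j] single_frames[OF s cw, of j]] by (simp add: FN_single v cw)
  qed
qed

lemma frame_mult_form_le:
  assumes v: "v \<in> frames H" and w: "w \<in> frames H"
  shows "\<bar>frame_form (L2_inner \<Omega>) (frame_mult v A) w\<bar> \<le> (\<Sum>j\<in>UNIV. \<Sum>i\<in>UNIV. norm (A $ i $ j)) * FN v * FN w"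
proof -
  have "\<bar>frame_form (L2_inner \<Omega>) (frame_mult v A) w\<bar> \<le> (\<Sum>j\<in>UNIV. \<bar>Re (L2_inner \<Omega> (frame_mult v A j) (w j))\<bar>)"
    unfolding frame_form_def by (rule sum_abs)
  also have "\<dots> \<le> (\<Sum>j\<in>UNIV. \<Sum>i\<in>UNIV. norm (A $ i $ j) * (FN v * FN w))"
  proof (rule sum_mono)
    fix j
    have "\<bar>Re (L2_inner \<Omega> (frame_mult v A j) (w j))\<bar> \<le> norm (\<Sum>i\<in>UNIV. cnj (A $ i $ j) * L2_inner \<Omega> (v i) (w j))"
      unfolding form_frame_mult(1)[OF R.L.herm_form_axioms v framesD[OF w], symmetric] by (rule abs_Re_le_cmod)
    also have "\<dots> \<le> (\<Sum>i\<in>UNIV. norm (cnj (A $ i $ j) * L2_inner \<Omega> (v i) (w j)))" by (rule norm_sum)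
    also have "\<dots> \<le> (\<Sum>i\<in>UNIV. norm (A $ i $ j) * (FN v * FN w))"
    proof (rule sum_mono)
      fix i
      have "norm (L2_inner \<Omega> (v i) (w j)) \<le> H1_norm \<Omega> (v i) * H1_norm \<Omega> (w j)"
        by (rule norm_L2_inner_le[OF framesD[OF v] framesD[OF w]])
      also have "\<dots> \<le> FN v * FN w"
        by (intro mult_mono H1_norm_le_FN v w FN_nonneg H1_norm_nonneg framesD)
      finally show "norm (cnj (A $ i $ j) * L2_inner \<Omega> (v i) (w j)) \<le> norm (A $ i $ j) * (FN v * FN w)"
        by (simp add: norm_mult mult_left_mono)
    qed
    finally show "\<bar>Re (L2_inner \<Omega> (frame_mult v A j) (w j))\<bar> \<le> (\<Sum>i\<in>UNIV. norm (A $ i $ j) * (FN v * FN w))" .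
  qed
  finally show ?thesis by (simp add: sum_distrib_right mult.assoc)
qed

text \<open>For a Hermitian matrix, right multiplication is symmetric in the real product of frames.
  The solvability lemma needs this for the shift.\<close>

lemma frame_mult_sym_form:
  fixes S :: "complex^'p::finite^'p"
  assumes S: "\<And>i j. S $ i $ j = cnj (S $ j $ i)"
  shows "sym_form (frames H) (\<lambda>v w. frame_form (L2_inner \<Omega>) (frame_mult v S) w)"
proof -
  interpret F: sym_form "frames H :: 'p frame set" "frame_form (L2_inner \<Omega>)"
    by (rule frame_form_sym_form[OF R.L.herm_form_axioms])
  note fm = frame_mult_frames[OF R.L.herm_form_axioms]
  show ?thesis
  proof
    fix v w :: "'p frame" assume v: "v \<in> frames H" and w: "w \<in> frames H"
    have eq: "frame_form (L2_inner \<Omega>) (frame_mult x S) y = Re (\<Sum>j\<in>UNIV. \<Sum>i\<in>UNIV. cnj (S $ i $ j) * L2_inner \<Omega> (x i) (y j))"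
      if "x \<in> frames H" "y \<in> frames H" for x y
      unfolding frame_form_def Re_sum form_frame_mult(1)[OF R.L.herm_form_axioms that(1) framesD[OF that(2)]] ..
    have "(\<Sum>j\<in>UNIV. \<Sum>i\<in>UNIV. cnj (S $ i $ j) * L2_inner \<Omega> (w i) (v j)) = cnj (\<Sum>j\<in>UNIV. \<Sum>i\<in>UNIV. cnj (S $ j $ i) * L2_inner \<Omega> (v j) (w i))"
      unfolding cnj_sum
    proof (intro sum.cong refl)
      fix i j
      show "cnj (S $ i $ j) * L2_inner \<Omega> (w i) (v j) = cnj (cnj (S $ j $ i) * L2_inner \<Omega> (v j) (w i))"
        using S[of j i] R.L.herm[OF framesD[OF v, of j] framesD[OF w, of i]] by simp
    qed
    also have "(\<Sum>j\<in>UNIV. \<Sum>i\<in>UNIV. cnj (S $ j $ i) * L2_inner \<Omega> (v j) (w i)) = (\<Sum>j\<in>UNIV. \<Sum>i\<in>UNIV. cnj (S $ i $ j) * L2_inner \<Omega> (v i) (w j))"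
      by (rule sum.swap)
    finally show "frame_form (L2_inner \<Omega>) (frame_mult v S) w = frame_form (L2_inner \<Omega>) (frame_mult w S) v"
      unfolding eq[OF v w] eq[OF w v] by simp
  qed (simp_all add: F.sub F.add_right F.scale_right fm)
qed

end

lemma sym_form_minus:
  assumes "sym_form V s" "sym_form V t"
  shows "sym_form V (\<lambda>v w. s v w - t v w)"
proof -
  interpret s: sym_form V s by fact
  interpret t: sym_form V t by fact
  show ?thesis
    by standard (simp_all add: s.sub s.add_right t.add_right s.scale_right t.scale_right s.sym t.sym algebra_simps)
qed

text \<open>A real potential commutes with conjugation, hence the Hermitian symmetry; integrability
  of the products is what makes the integral additive.\<close>

lemma multiplication_form_herm_form:
  assumes "(\<lambda>x. 0) \<in> H" "\<And>v w a b. v \<in> H \<Longrightarrow> w \<in> H \<Longrightarrow> (\<lambda>x. a * v x + b * w x) \<in> H"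
    and int: "\<And>v w. v \<in> H \<Longrightarrow> w \<in> H \<Longrightarrow> integrable M (\<lambda>x. of_real (V x) * (cnj (v x) * w x))"
  shows "herm_form H (\<lambda>v w. LINT x|M. of_real (2 * V x) * (cnj (v x) * w x))"
proof
  fix u v w a b assume u: "u \<in> H" and v: "v \<in> H" and w: "w \<in> H"
  have "(LINT x|M. of_real (2 * V x) * (cnj (u x) * (a * v x + b * w x))) =
      (LINT x|M. (2 * a) * (of_real (V x) * (cnj (u x) * v x)) + (2 * b) * (of_real (V x) * (cnj (u x) * w x)))"
    by (intro Bochner_Integration.integral_cong) (auto simp: algebra_simps)
  also have "\<dots> = (2 * a) * (LINT x|M. of_real (V x) * (cnj (u x) * v x)) + (2 * b) * (LINT x|M. of_real (V x) * (cnj (u x) * w x))"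
    using int[OF u v] int[OF u w] by simp
  finally show "(LINT x|M. of_real (2 * V x) * (cnj (u x) * (a * v x + b * w x))) =
      a * (LINT x|M. of_real (2 * V x) * (cnj (u x) * v x)) + b * (LINT x|M. of_real (2 * V x) * (cnj (u x) * w x))"
    by (simp add: mult.assoc)
next
  fix u v
  show "(LINT x|M. of_real (2 * V x) * (cnj (v x) * u x)) = cnj (LINT x|M. of_real (2 * V x) * (cnj (u x) * v x))"
    unfolding Bochner_Integration.integral_cnj[symmetric]
    by (intro Bochner_Integration.integral_cong) auto
qed (use assms in auto)

lemma (in kohn_sham_space) hamiltonian_herm_form:
  assumes "potentials_well_defined \<Omega> H vi vx TYPE('p::finite)" and \<phi>: "(\<phi> :: 'p frame) \<in> frames H"
  shows "herm_form H (hamiltonian1 \<Omega> vi vx \<phi>)"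
proof -
  have "herm_form H (\<lambda>v w. LINT x|lebesgue_on \<Omega>. of_real (2 * V x) * (cnj (v x) * w x))"
    if "V \<in> {vi, hartree \<Omega> (density \<phi>), vx (density \<phi>)}" for V
    using assms that H_zero H_comb unfolding potentials_well_defined_def
    by (intro multiplication_form_herm_form) auto
  note V = this
  interpret V1: herm_form H "\<lambda>v w. LINT x|lebesgue_on \<Omega>. of_real (2 * vi x) * (cnj (v x) * w x)" by (rule V) simp
  interpret V2: herm_form H "\<lambda>v w. LINT x|lebesgue_on \<Omega>. of_real (2 * hartree \<Omega> (density \<phi>) x) * (cnj (v x) * w x)" by (rule V) simp
  interpret V3: herm_form H "\<lambda>v w. LINT x|lebesgue_on \<Omega>. of_real (2 * vx (density \<phi>) x) * (cnj (v x) * w x)" by (rule V) simp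
  show ?thesis
  proof
    fix u v w a b assume u: "u \<in> H" and v: "v \<in> H" and w: "w \<in> H"
    show "hamiltonian1 \<Omega> vi vx \<phi> u (\<lambda>x. a * v x + b * w x) = a * hamiltonian1 \<Omega> vi vx \<phi> u v + b * hamiltonian1 \<Omega> vi vx \<phi> u w"
      unfolding hamiltonian1_def V1.lin[OF u v w] V2.lin[OF u v w] V3.lin[OF u v w]
        grad.lin[OF H_H1[OF u] H_H1[OF v] H_H1[OF w]] by (simp add: algebra_simps)
  next
    fix u v assume u: "u \<in> H" and v: "v \<in> H"
    show "hamiltonian1 \<Omega> vi vx \<phi> v u = cnj (hamiltonian1 \<Omega> vi vx \<phi> u v)"
      unfolding hamiltonian1_def complex_cnj_add V1.herm[OF u v] V2.herm[OF u v] V3.herm[OF u v]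
        grad.herm[OF H_H1[OF u] H_H1[OF v]] ..
  qed (use H_zero H_comb in auto)
qed

section \<open>Invertibility and the Euler-Lagrange equation\<close>

lemma dual_zero: "f \<in> dual \<Omega> H \<Longrightarrow> (\<lambda>x. 0) \<in> H \<Longrightarrow> f (\<lambda>x. 0) = 0"
proof -
  assume "f \<in> dual \<Omega> H" and 0: "(\<lambda>x. 0) \<in> H"
  hence "\<forall>v\<in>H. \<forall>w\<in>H. \<forall>a b. f (\<lambda>x. a * v x + b * w x) = a * f v + b * f w" by (simp add: dual_def)
  from this[rule_format, OF 0 0, of 0 0] show ?thesis by simp
qed

lemma dual_pair_single:
  assumes "f \<in> dual_frames \<Omega> H" "(\<lambda>x. 0) \<in> H"
  shows "dual_pair f (single j z) = Re (f j z)"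
proof -
  have "Re (f k (single j z k)) = (if k = j then Re (f k z) else 0)" for k
    using dual_zero[of "f k" \<Omega> H] assms by (simp add: dual_frames_def single_def)
  thus ?thesis by (simp add: dual_pair_eq)
qed

context kohn_sham_space
begin

text \<open>Real pairings determine a complex linear functional: the imaginary part at
  \<open>z\<close> is read off from the real part at \<open>\<i> * z\<close>.\<close>

lemma dual_eqI:
  assumes f: "f \<in> dual_frames \<Omega> H" and g: "g \<in> dual_frames \<Omega> H"
    and eq: "\<And>w. w \<in> (frames H :: 'p::finite frame set) \<Longrightarrow> dual_pair f w = dual_pair g w"
  shows "dual_eq H f (g :: 'p dual_frame)"
  unfolding dual_eq_def
proof (intro allI ballI)
  fix j :: 'p and z assume z: "z \<in> H"
  have Re: "Re (f j z) = Re (g j z)" if "z \<in> H" for z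
    using eq[OF single_frames[OF R.L.herm_form_axioms that, of j]]
    by (simp add: dual_pair_single[OF f H_zero] dual_pair_single[OF g H_zero])
  have lin: "F j (\<lambda>x. \<i> * z x) = \<i> * F j z" if "F \<in> dual_frames \<Omega> H" for F
  proof -
    have "\<forall>v\<in>H. \<forall>w\<in>H. \<forall>a b. F j (\<lambda>x. a * v x + b * w x) = a * F j v + b * F j w"
      using that by (simp add: dual_frames_def dual_def)
    from this[rule_format, OF z z, of \<i> 0] show ?thesis by simp
  qed
  have "Im (f j z) = Im (g j z)"
    using Re[OF R.L.cscale_mem[OF z, of \<i>]] by (simp add: lin[OF f] lin[OF g])
  thus "f j z = g j z" using Re[OF z] by (simp add: complex_eq_iff)
qed

lemma dual_pair_bound:
  fixes f :: "'p::finite dual_frame"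
  assumes "f \<in> dual_frames \<Omega> H"
  shows "\<exists>C. \<forall>w\<in>frames H. \<bar>dual_pair f w\<bar> \<le> C * FN w"
proof -
  have "\<forall>j. \<exists>C. \<forall>v\<in>H. norm (f j v) \<le> C * H1_norm \<Omega> v" using assms by (simp add: dual_frames_def dual_def)
  then obtain C where C: "\<And>j v. v \<in> H \<Longrightarrow> norm (f j v) \<le> C j * H1_norm \<Omega> v" by metis
  have "\<bar>dual_pair f w\<bar> \<le> (\<Sum>j\<in>UNIV. \<bar>C j\<bar>) * FN w" if w: "w \<in> frames H" for w
  proof -
    have "\<bar>dual_pair f w\<bar> \<le> (\<Sum>j\<in>UNIV. \<bar>Re (f j (w j))\<bar>)" unfolding dual_pair_eq by (rule sum_abs)
    also have "\<dots> \<le> (\<Sum>j\<in>UNIV. \<bar>C j\<bar> * FN w)"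
    proof (rule sum_mono)
      fix j
      have "\<bar>Re (f j (w j))\<bar> \<le> norm (f j (w j))" by (rule abs_Re_le_cmod)
      also have "\<dots> \<le> C j * H1_norm \<Omega> (w j)" by (rule C[OF framesD[OF w]])
      also have "\<dots> \<le> \<bar>C j\<bar> * FN w"
        by (intro mult_mono H1_norm_le_FN[OF w] H1_norm_nonneg framesD[OF w]) auto
      finally show "\<bar>Re (f j (w j))\<bar> \<le> \<bar>C j\<bar> * FN w" .
    qed
    finally show ?thesis by (simp add: sum_distrib_right)
  qed
  thus ?thesis by blast
qed

lemma dual_pair_linear:
  fixes f :: "'p::finite dual_frame"
  assumes f: "f \<in> dual_frames \<Omega> H" and v: "v \<in> frames H"
  shows "w \<in> frames H \<Longrightarrow> dual_pair f (v + w) = dual_pair f v + dual_pair f w"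
    and "dual_pair f (r *\<^sub>R v) = r * dual_pair f v"
proof -
  have lin: "f j (\<lambda>x. a * v x + b * w x) = a * f j v + b * f j w" if "v \<in> H" "w \<in> H" for j v w a b
    using f that by (simp add: dual_frames_def dual_def)
  show "dual_pair f (v + w) = dual_pair f v + dual_pair f w" if w: "w \<in> frames H"
  proof -
    have "f j ((v + w) j) = f j (v j) + f j (w j)" for j
      using lin[OF framesD[OF v, of j] framesD[OF w, of j], of j 1 1] by (simp add: plus_fun_def)
    thus ?thesis by (simp add: dual_pair_eq sum.distrib)
  qed
  have "f j ((r *\<^sub>R v) j) = of_real r * f j (v j)" for j
    using lin[OF framesD[OF v, of j] framesD[OF v, of j], of j "of_real r" 0] by (simp add: scaleR_fun_def scaleR_conv_of_real)
  thus "dual_pair f (r *\<^sub>R v) = r * dual_pair f v" by (simp add: dual_pair_eq sum_distrib_left)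
qed

text \<open>The inf-sup condition does triple duty: it gives injectivity, surjectivity through the
  solvability lemma, and the bound on the inverse with constant \<open>K / c\<close>.\<close>

lemma invertible_operatorI:
  fixes \<phi> :: "'p::finite frame" and S :: "complex^'p^'p"
  assumes pot: "potentials_well_defined \<Omega> H vi vx TYPE('p)" and \<phi>: "\<phi> \<in> frames H"
    and S: "\<And>i j. S $ i $ j = cnj (S $ j $ i)"
    and C: "\<And>v w. v \<in> (frames H :: 'p frame set) \<Longrightarrow> w \<in> frames H \<Longrightarrow> \<bar>frame_form (hamiltonian1 \<Omega> vi vx \<phi>) v w\<bar> \<le> C * FN v * FN w"
    and c: "c > 0" and K: "K > 0"
    and inf_sup: "\<And>v. v \<in> frames H \<Longrightarrow> \<exists>w\<in>frames H. FN w \<le> K * FN v \<and>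
       c * (FN v)\<^sup>2 \<le> dual_pair (shifted_hamiltonian \<Omega> vi vx \<phi> S v) w"
  shows "invertible_operator \<Omega> H (shifted_hamiltonian \<Omega> vi vx \<phi> S)"
proof -
  define a where "a = hamiltonian1 \<Omega> vi vx \<phi>"
  define T where "T = shifted_hamiltonian \<Omega> vi vx \<phi> S"
  define B where "B v w = dual_pair (T v) w" for v w
  have a: "herm_form H a" unfolding a_def by (rule hamiltonian_herm_form[OF pot \<phi>])
  interpret a: herm_form H a by (rule a)
  have B_eq: "B = (\<lambda>v w. frame_form a v w - frame_form (L2_inner \<Omega>) (frame_mult v S) w)"
    by (intro ext) (simp add: B_def T_def a_def dual_pair_shifted_hamiltonian)
  interpret B: sym_form "frames H" B
    unfolding B_eq by (rule sym_form_minus[OF frame_form_sym_form[OF a] frame_mult_sym_form[OF S]])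
  interpret F: psd_form "frames H :: 'p frame set" "frame_form (H1_inner \<Omega>)" by (rule FN_psd)
  define M where "M = C + (\<Sum>j\<in>UNIV. \<Sum>i\<in>UNIV. norm (S $ i $ j))"
  have B_bound: "\<bar>B v w\<bar> \<le> M * FN v * FN w" if "v \<in> frames H" "w \<in> frames H" for v w
  proof -
    have "\<bar>B v w\<bar> \<le> C * FN v * FN w + (\<Sum>j\<in>UNIV. \<Sum>i\<in>UNIV. norm (S $ i $ j)) * FN v * FN w"
      using C[OF that] frame_mult_form_le[OF that, of S] unfolding B_eq a_def by linarith
    thus ?thesis by (simp add: M_def algebra_simps)
  qed
  have T_eq: "T v j w = a (v j) w - L2_inner \<Omega> (frame_mult v S j) w" for v j w
    by (simp add: T_def a_def shifted_hamiltonian_def hamiltonian_def embed_def)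
  note fm = frame_mult_frames[OF R.L.herm_form_axioms]
  have dual: "T v \<in> dual_frames \<Omega> H" if v: "v \<in> frames H" for v
    unfolding dual_frames_def mem_Collect_eq
  proof
    fix j
    have vj: "v j \<in> H" and fj: "frame_mult v S j \<in> H" using framesD[OF v] framesD[OF fm[OF v]] by auto
    have "norm (T v j w) \<le> (C * H1_norm \<Omega> (v j) + H1_norm \<Omega> (frame_mult v S j)) * H1_norm \<Omega> w" if w: "w \<in> H" for w
    proof -
      have "norm (T v j w) \<le> norm (a (v j) w) + norm (L2_inner \<Omega> (frame_mult v S j) w)"
        unfolding T_eq by (rule norm_triangle_ineq4)
      also have "\<dots> \<le> C * H1_norm \<Omega> (v j) * H1_norm \<Omega> w + H1_norm \<Omega> (frame_mult v S j) * H1_norm \<Omega> w"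
        by (intro add_mono norm_L2_inner_le fj w norm_form_le[OF a C[folded a_def] vj w])
      finally show ?thesis by (simp add: algebra_simps)
    qed
    moreover have "T v j (\<lambda>x. p * w x + q * z x) = p * T v j w + q * T v j z" if "w \<in> H" "z \<in> H" for p q w z
      using that by (simp add: T_eq a.lin[OF vj] R.L.lin[OF fj] algebra_simps)
    ultimately show "T v j \<in> dual \<Omega> H" unfolding dual_def mem_Collect_eq by blast
  qed
  have inj: "AE x in lebesgue_on \<Omega>. v j x = w j x"
    if v: "v \<in> frames H" and w: "w \<in> frames H" and eq: "dual_eq H (T v) (T w)" for v w j
  proof -
    have d: "v - w \<in> frames H" using v w by (rule F.mem(3))
    have "B v z = B w z" if z: "z \<in> frames H" for z
      using eq framesD[OF z] by (simp add: B_def dual_pair_eq dual_eq_def)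
    hence "B (v - w) z = 0" if z: "z \<in> frames H" for z
      using B.diff_left[OF v w z] that by simp
    hence "c * (FN (v - w))\<^sup>2 \<le> 0" using inf_sup[OF d] unfolding B_def T_def by fastforce
    hence "(FN (v - w))\<^sup>2 \<le> 0" using c by (simp add: mult_le_0_iff)
    hence "Re (H1_inner \<Omega> ((v - w) j) ((v - w) j)) \<le> 0"
      using component_le_frame_form[OF N_pos_herm_form d, of j] by (simp add: FN_sq[OF d])
    hence "Re (L2_inner \<Omega> (v j - w j) (v j - w j)) = 0"
      using R.L_le_N[OF framesD[OF d, of j]] R.L.pos[OF framesD[OF d, of j]] by simp
    moreover have "v j - w j \<in> L2 \<Omega>" using H1_L2[OF H_H1[OF framesD[OF d, of j]]] by simp
    ultimately have "AE x in lebesgue_on \<Omega>. (v j - w j) x = 0" by (simp add: L2_inner_self_eq_0_iff)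
    thus ?thesis by eventually_elim simp
  qed
  have surj: "\<exists>v\<in>frames H. dual_eq H (T v) f" if f: "f \<in> dual_frames \<Omega> H" for f
  proof -
    obtain C' where C': "\<And>w. w \<in> frames H \<Longrightarrow> \<bar>dual_pair f w\<bar> \<le> C' * FN w"
      using dual_pair_bound[OF f] by blast
    have "\<exists>v\<in>frames H. \<forall>w\<in>frames H. B v w = dual_pair f w"
    proof (rule inf_sup_solvable[OF FN_psd frame_form_complete[OF N_pos_herm_form H_complete] B.sym_form_axioms _ c K])
      show "\<bar>B v w\<bar> \<le> M * sqrt (frame_form (H1_inner \<Omega>) v v) * sqrt (frame_form (H1_inner \<Omega>) w w)"
        if "v \<in> frames H" "w \<in> frames H" for v w
        using B_bound[OF that] by (simp add: frame_H_norm_eq)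
      show "\<exists>w\<in>frames H. sqrt (frame_form (H1_inner \<Omega>) w w) \<le> K * sqrt (frame_form (H1_inner \<Omega>) v v) \<and>
          c * frame_form (H1_inner \<Omega>) v v \<le> B v w" if "v \<in> frames H" for v
        using inf_sup[OF that] unfolding FN_sq[OF that] unfolding frame_H_norm_eq B_def T_def .
      show "\<bar>dual_pair f v\<bar> \<le> C' * sqrt (frame_form (H1_inner \<Omega>) v v)" if "v \<in> frames H" for v
        using C'[OF that] by (simp add: frame_H_norm_eq)
    qed (auto simp: dual_pair_linear[OF f])
    then obtain v where v: "v \<in> frames H" "\<And>w. w \<in> frames H \<Longrightarrow> dual_pair (T v) w = dual_pair f w"
      unfolding B_def by blast
    thus ?thesis using dual_eqI[OF dual[OF v(1)] f] by blast
  qed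
  have lower: "FN v \<le> (K / c) * dual_norm \<Omega> H (T v)" if v: "v \<in> frames H" for v
  proof -
    let ?S = "{w \<in> frames H. FN w \<le> 1} :: 'p frame set"
    obtain C' where C': "\<And>w. w \<in> frames H \<Longrightarrow> \<bar>dual_pair (T v) w\<bar> \<le> C' * FN w"
      using dual_pair_bound[OF dual[OF v]] by blast
    \<comment> \<open>The supremum in the dual norm dominates its members only if the set is bounded
      above; this holds because \<open>T v\<close> lies in the dual.\<close>
    have bdd: "bdd_above ((\<lambda>w. \<bar>dual_pair (T v) w\<bar>) ` ?S)"
    proof (rule bdd_aboveI2)
      fix w assume w: "w \<in> ?S"
      have "\<bar>dual_pair (T v) w\<bar> \<le> C' * FN w" using C' w by simp
      also have "\<dots> \<le> \<bar>C'\<bar> * 1" using w FN_nonneg[of w] by (intro mult_mono) auto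
      finally show "\<bar>dual_pair (T v) w\<bar> \<le> \<bar>C'\<bar>" by simp
    qed
    have le: "\<bar>dual_pair (T v) w\<bar> \<le> dual_norm \<Omega> H (T v)" if "w \<in> frames H" "FN w \<le> 1" for w
      unfolding dual_norm_def using that by (intro cSUP_upper bdd) auto
    show ?thesis
    proof (cases "FN v = 0")
      case True
      have "FN (0 :: 'p frame) = 0" using F.zero_right[of 0] F.mem(1) by (simp add: frame_H_norm_eq)
      hence "0 \<le> dual_norm \<Omega> H (T v)" using le[OF F.mem(1)] by simp
      thus ?thesis using True c K by simp
    next
      case False
      hence pos: "FN v > 0" using FN_nonneg[OF v] by simp
      obtain w where w: "w \<in> frames H" "FN w \<le> K * FN v" "c * (FN v)\<^sup>2 \<le> B v w"
        using inf_sup[OF v] unfolding B_def T_def by blast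
      \<comment> \<open>Scales the test frame into the unit ball over which the dual norm is taken;
        this is why \<open>FN v = 0\<close> is treated apart.\<close>
      define r where "r = 1 / (K * FN v)"
      have r: "r > 0" using K pos by (simp add: r_def)
      have rw: "r *\<^sub>R w \<in> frames H" using w(1) by (rule F.mem(4))
      have "FN (r *\<^sub>R w) = r * FN w"
        using r by (simp add: frame_H_norm_eq F.square_scale[OF w(1)] real_sqrt_mult)
      also have "\<dots> \<le> r * (K * FN v)" using w(2) r by (intro mult_left_mono) auto
      also have "\<dots> = 1" using K pos by (simp add: r_def)
      finally have "\<bar>B v (r *\<^sub>R w)\<bar> \<le> dual_norm \<Omega> H (T v)" unfolding B_def by (rule le[OF rw])
      moreover have "B v (r *\<^sub>R w) = r * B v w" by (rule B.scale_right[OF v w(1)])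
      ultimately have "r * B v w \<le> dual_norm \<Omega> H (T v)" by simp
      moreover have "r * (c * (FN v)\<^sup>2) \<le> r * B v w" using w(3) r by (intro mult_left_mono) auto
      ultimately have "r * (c * (FN v)\<^sup>2) \<le> dual_norm \<Omega> H (T v)" by linarith
      moreover have "r * (c * (FN v)\<^sup>2) = (c / K) * FN v"
        using K pos by (simp add: r_def power2_eq_square)
      ultimately have "(K / c) * ((c / K) * FN v) \<le> (K / c) * dual_norm \<Omega> H (T v)"
        using c K by (intro mult_left_mono) auto
      thus ?thesis using c K by simp
    qed
  qed
  show ?thesis
    unfolding invertible_operator_def T_def[symmetric] using dual inj surj lower by blast
qed

text \<open>If the derivative \<open>\<beta>\<close> in direction \<open>w\<close> were nonzero,
  moving the single component \<open>\<phi> i\<close> towards \<open>w\<close> or away from it would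
  lower the energy to first order. As \<open>w\<close> is orthogonal to all components, the moved
  frame stays orthonormal once its \<open>i\<close>-th component is normalised.\<close>

lemma Euler_Lagrange_orth:
  fixes \<phi> :: "'p::finite frame" and E :: "'p frame \<Rightarrow> real"
  assumes pot: "potentials_well_defined \<Omega> H vi vx TYPE('p)" and \<phi>: "\<phi> \<in> stiefel \<Omega> H"
    and min: "\<And>\<psi>. \<psi> \<in> stiefel \<Omega> H \<Longrightarrow> E \<phi> \<le> E \<psi>"
    and deriv: "has_frame_derivative \<Omega> H E (dual_pair (hamiltonian \<Omega> vi vx \<phi> \<phi>)) \<phi>"
    and w: "w \<in> H" and orth: "\<And>k. L2_inner \<Omega> (\<phi> k) w = 0"
  shows "Re (hamiltonian1 \<Omega> vi vx \<phi> (\<phi> i) w) = 0"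
proof (rule ccontr)
  define a where "a = hamiltonian1 \<Omega> vi vx \<phi>"
  have \<phi>F: "\<phi> \<in> frames H" and gram: "gram \<Omega> \<phi> \<phi> = mat 1" using \<phi> by (auto simp: stiefel_def)
  have \<phi>H: "\<phi> k \<in> H" for k using \<phi>F by (rule framesD)
  have on: "L2_inner \<Omega> (\<phi> k) (\<phi> l) = (if k = l then 1 else 0)" for k l
    using arg_cong[OF gram, of "\<lambda>M. M $ k $ l"] by (simp add: gram_def mat_def)
  have a: "herm_form H a" unfolding a_def by (rule hamiltonian_herm_form[OF pot \<phi>F])
  interpret a: herm_form H a by (rule a)
  define \<alpha> \<beta> l A W where "\<alpha> = Re (a (\<phi> i) (\<phi> i))" and "\<beta> = Re (a (\<phi> i) w)" and "l = Re (L2_inner \<Omega> w w)"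
    and "A = H1_norm \<Omega> (\<phi> i)" and "W = H1_norm \<Omega> w"
  have nn: "l \<ge> 0" "A \<ge> 0" "W \<ge> 0" using R.L.pos[OF w] H1_norm_nonneg[OF \<phi>H] H1_norm_nonneg[OF w]
    by (auto simp: l_def A_def W_def)
  assume "Re (hamiltonian1 \<Omega> vi vx \<phi> (\<phi> i) w) \<noteq> 0"
  hence \<beta>: "\<bar>\<beta>\<bar> > 0" by (simp add: \<beta>_def a_def)
  \<comment> \<open>Tolerance of the Frechet remainder: it costs at most half of the first-order
    gain. The added 1 covers \<open>W = 0\<close>.\<close>
  define e where "e = \<bar>\<beta>\<bar> / (2 * (W + 1))"
  have e: "e > 0" "e * W \<le> \<bar>\<beta>\<bar> / 2" using \<beta> nn by (auto simp: e_def field_simps)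
  obtain \<delta> where \<delta>: "\<delta> > 0" and D: "\<And>h. h \<in> frames H \<Longrightarrow> FN h < \<delta> \<Longrightarrow>
      \<bar>E (\<phi> + h) - E \<phi> - dual_pair (hamiltonian \<Omega> vi vx \<phi> \<phi>) h\<bar> \<le> e * FN h"
    using deriv e(1) unfolding has_frame_derivative_def by meson
  \<comment> \<open>Bounds the coefficients of second order in the step: from the displacement along
    \<open>\<phi> i\<close> itself, and from the remainder.\<close>
  define G where "G = l * \<bar>\<alpha>\<bar> + e * l * A"
  have G: "G \<ge> 0" using nn e by (simp add: G_def)
  \<comment> \<open>Three caps on the step: 1, so that squares are dominated by the step; the second
    keeps the increment within the radius \<open>\<delta>\<close>; the third keeps second-order
    terms below half the gain.\<close>
  define \<tau> where "\<tau> = min 1 (min (\<delta> / (2 * (2 * l * A + 2 * W + 1))) (\<bar>\<beta>\<bar> / (4 * (G + 1))))"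
  have "0 \<le> 2 * l * A" using nn by simp
  hence p: "2 * l * A + 2 * W + 1 > 0" using nn by linarith
  hence "\<delta> / (2 * (2 * l * A + 2 * W + 1)) > 0" using \<delta> by (intro divide_pos_pos) auto
  moreover have "\<bar>\<beta>\<bar> / (4 * (G + 1)) > 0" using \<beta> G by (intro divide_pos_pos) auto
  ultimately have \<tau>: "\<tau> > 0" "\<tau> \<le> 1" by (auto simp: \<tau>_def)
  have \<tau>1: "\<tau> * (2 * l * A + 2 * W + 1) < \<delta>"
  proof -
    have "\<tau> \<le> \<delta> / (2 * (2 * l * A + 2 * W + 1))" by (simp add: \<tau>_def)
    hence "\<tau> * (2 * l * A + 2 * W + 1) \<le> \<delta> / (2 * (2 * l * A + 2 * W + 1)) * (2 * l * A + 2 * W + 1)"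
      using p by (intro mult_right_mono) auto
    also have "\<dots> = \<delta> / 2" using p by (simp add: field_simps)
    finally show ?thesis using \<delta> by simp
  qed
  have \<tau>2: "\<tau> * G < \<bar>\<beta>\<bar> / 2"
  proof -
    have "\<tau> \<le> \<bar>\<beta>\<bar> / (4 * (G + 1))" by (simp add: \<tau>_def)
    hence "\<tau> * G \<le> \<bar>\<beta>\<bar> / (4 * (G + 1)) * (G + 1)" using G \<tau> by (intro mult_mono) auto
    also have "\<dots> = \<bar>\<beta>\<bar> / 4" using G by (simp add: field_simps)
    finally show ?thesis using \<beta> by simp
  qed
  \<comment> \<open>The sign opposite to \<open>\<beta>\<close> makes the first-order change of the
    energy negative.\<close>
  define t where "t = - sgn \<beta> * \<tau>"
  have t2: "t\<^sup>2 = \<tau>\<^sup>2" "t * \<beta> = - \<tau> * \<bar>\<beta>\<bar>" "\<bar>t\<bar> = \<tau>"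
    using \<beta> \<tau> by (auto simp: t_def power_mult_distrib sgn_if power2_eq_square abs_mult)
  define d where "d = 1 + l * t\<^sup>2"
  have d: "d \<ge> 1" using nn by (simp add: d_def)
  \<comment> \<open>\<open>t \<mapsto> (c, s)\<close> is the rational parametrisation of the ellipse \<open>c\<^sup>2 + l s\<^sup>2 = 1\<close>,
    so that \<open>c \<phi> i + s w\<close> stays on the unit sphere.\<close>
  define c s where "c = (1 - l * t\<^sup>2) / d" and "s = 2 * t / d"
  have cs: "c\<^sup>2 + s\<^sup>2 * l = 1"
  proof -
    have "(1 - l * t\<^sup>2)\<^sup>2 + (2 * t)\<^sup>2 * l = d\<^sup>2" by (simp add: d_def power2_eq_square algebra_simps)
    hence "((1 - l * t\<^sup>2)\<^sup>2 + (2 * t)\<^sup>2 * l) / d\<^sup>2 = 1" using d by simp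
    thus ?thesis by (simp add: c_def s_def power_divide add_divide_distrib)
  qed
  have c1: "c - 1 = - (2 * l * t\<^sup>2) / d" using d by (simp add: c_def d_def field_simps)
  define h where "h = (\<lambda>x. of_real (c - 1) * \<phi> i x + of_real s * w x)"
  have h: "h \<in> H" unfolding h_def by (rule H_comb[OF \<phi>H w])
  have hF: "single i h \<in> frames H" by (rule single_frames[OF a h])
  define \<psi> where "\<psi> = \<phi> + single i h"
  have \<psi>i: "\<psi> i = (\<lambda>x. of_real c * \<phi> i x + of_real s * w x)"
    by (simp add: \<psi>_def single_def h_def fun_eq_iff algebra_simps)
  have \<psi>k: "\<psi> k = \<phi> k" if "k \<noteq> i" for k using that by (simp add: \<psi>_def single_def fun_eq_iff)
  have Lw: "L2_inner \<Omega> w w = of_real l" unfolding l_def by (rule R.L.self_eq_Re[OF w])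
  have orth': "L2_inner \<Omega> w (\<phi> k) = 0" for k using R.L.herm[OF \<phi>H w, of k] orth[of k] by simp
  have "\<psi> \<in> stiefel \<Omega> H"
  proof -
    have F: "\<psi> \<in> frames H" unfolding \<psi>_def by (rule subspace_add[OF subspace_frames[OF a.subspace_V] \<phi>F hF])
    have "L2_inner \<Omega> (\<psi> i) (\<psi> i) = of_real (c\<^sup>2 + s\<^sup>2 * l)"
      unfolding \<psi>i using R.L.lin_left R.L.lin R.L.comb \<phi>H w by (simp add: on orth orth' Lw power2_eq_square mult_ac)
    hence 1: "L2_inner \<Omega> (\<psi> i) (\<psi> i) = 1" by (simp add: cs)
    have 2: "L2_inner \<Omega> (\<psi> i) (\<phi> k) = 0" "L2_inner \<Omega> (\<phi> k) (\<psi> i) = 0" if "k \<noteq> i" for k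
      unfolding \<psi>i using that R.L.lin_left[OF \<phi>H \<phi>H w] R.L.lin[OF \<phi>H \<phi>H w] by (simp_all add: on orth orth')
    have "L2_inner \<Omega> (\<psi> k) (\<psi> j) = (if k = j then 1 else 0)" for k j
      by (cases "k = i"; cases "j = i") (auto simp: \<psi>k 1 2 on)
    hence "gram \<Omega> \<psi> \<psi> = mat 1" by (simp add: gram_def mat_def vec_eq_iff)
    thus ?thesis using F by (simp add: stiefel_def)
  qed
  hence le: "E \<phi> \<le> E (\<phi> + single i h)" unfolding \<psi>_def by (rule min)
  have FNh: "FN (single i h) \<le> (2 * l * t\<^sup>2 * A + 2 * \<tau> * W) / d"
  proof -
    have m1: "(\<lambda>x. of_real (c - 1) * \<phi> i x) \<in> H" and m2: "(\<lambda>x. of_real s * w x) \<in> H"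
      using R.N.cscale_mem \<phi>H w by auto
    have "h = (\<lambda>x. of_real (c - 1) * \<phi> i x) + (\<lambda>x. of_real s * w x)" by (simp add: h_def fun_eq_iff)
    hence "H1_norm \<Omega> h \<le> norm (of_real (c - 1) :: complex) * A + norm (of_real s :: complex) * W"
      using R.N.Re.triangle[OF m1 m2] R.N.sqrt_cscale[OF \<phi>H, of "of_real (c - 1)" i] R.N.sqrt_cscale[OF w, of "of_real s"]
      unfolding H1_norm_def A_def W_def by simp
    also have "norm (of_real (c - 1) :: complex) = 2 * l * t\<^sup>2 / d"
      unfolding norm_of_real c1 using nn d by simp
    also have "norm (of_real s :: complex) = 2 * \<tau> / d"
      unfolding norm_of_real s_def using t2 d by (simp add: abs_mult)
    finally show ?thesis using FN_single[OF h, of i] d by (simp add: add_divide_distrib)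
  qed
  have num_le: "2 * l * t\<^sup>2 * A + 2 * \<tau> * W \<le> \<tau> * (2 * l * A + 2 * W + 1)"
  proof -
    have "\<tau>\<^sup>2 \<le> \<tau>" using \<tau> by (simp add: power2_eq_square mult_left_le)
    hence "(2 * l * A) * t\<^sup>2 \<le> (2 * l * A) * \<tau>" using nn t2 by (intro mult_left_mono) auto
    thus ?thesis using \<tau> by (simp add: algebra_simps)
  qed
  have num0: "0 \<le> 2 * l * t\<^sup>2 * A + 2 * \<tau> * W" using nn \<tau> by simp
  have "(2 * l * t\<^sup>2 * A + 2 * \<tau> * W) / d \<le> (2 * l * t\<^sup>2 * A + 2 * \<tau> * W) / 1"
    using num0 d by (intro divide_left_mono) auto
  hence "FN (single i h) \<le> 2 * l * t\<^sup>2 * A + 2 * \<tau> * W" using FNh unfolding div_by_1 by (rule order_trans[rotated])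
  hence "FN (single i h) < \<delta>" using num_le \<tau>1 by linarith
  note D = D[OF hF this]
  have "dual_pair (hamiltonian \<Omega> vi vx \<phi> \<phi>) (single i h) = (c - 1) * \<alpha> + s * \<beta>"
  proof -
    interpret Fa: sym_form "frames H :: 'p frame set" "frame_form a" by (rule frame_form_sym_form[OF a])
    have "dual_pair (hamiltonian \<Omega> vi vx \<phi> \<phi>) (single i h) = frame_form a (single i h) \<phi>"
      unfolding dual_pair_hamiltonian a_def[symmetric] by (rule Fa.sym[OF \<phi>F hF])
    also have "\<dots> = Re (a h (\<phi> i))" by (rule frame_form_single[OF a h \<phi>F])
    also have "\<dots> = Re (a (\<phi> i) h)" using a.herm[OF h \<phi>H, of i] by simp
    also have "\<dots> = (c - 1) * \<alpha> + s * \<beta>"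
      unfolding h_def a.lin[OF \<phi>H \<phi>H w] by (simp add: \<alpha>_def \<beta>_def)
    finally show ?thesis .
  qed
  hence "0 \<le> (c - 1) * \<alpha> + s * \<beta> + e * FN (single i h)" using D le by simp
  also have "\<dots> \<le> (c - 1) * \<alpha> + s * \<beta> + e * ((2 * l * t\<^sup>2 * A + 2 * \<tau> * W) / d)"
    using FNh e by (intro add_left_mono mult_left_mono) auto
  also have "\<dots> = (- 2 * l * \<tau>\<^sup>2 * \<alpha> - 2 * \<tau> * \<bar>\<beta>\<bar> + e * (2 * l * \<tau>\<^sup>2 * A + 2 * \<tau> * W)) / d"
  proof -
    have "s * \<beta> = 2 * (t * \<beta>) / d" by (simp add: s_def)
    hence "s * \<beta> = - (2 * \<tau> * \<bar>\<beta>\<bar>) / d" unfolding t2 by simp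
    thus ?thesis unfolding c1 t2(1) by (simp add: add_divide_distrib diff_divide_distrib distrib_left)
  qed
  \<comment> \<open>After the positive factor \<open>2 * \<tau> / d\<close> is split off, the
    bracket is less than \<open>\<bar>\<beta>\<bar> / 2 + \<bar>\<beta>\<bar> / 2 -
    \<bar>\<beta>\<bar>\<close>, a contradiction.\<close>
  also have "\<dots> = (2 * \<tau> * (\<tau> * (l * (- \<alpha>) + e * l * A) + e * W - \<bar>\<beta>\<bar>)) / d"
    by (simp add: power2_eq_square algebra_simps)
  finally have le0: "0 \<le> (2 * \<tau> * (\<tau> * (l * (- \<alpha>) + e * l * A) + e * W - \<bar>\<beta>\<bar>)) / d" .
  have pos: "0 \<le> z" if "0 \<le> (2 * \<tau> * z) / d" for z
    using that d \<tau>(1) by (simp add: zero_le_divide_iff zero_le_mult_iff)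
  have "0 \<le> \<tau> * (l * (- \<alpha>) + e * l * A) + e * W - \<bar>\<beta>\<bar>" by (rule pos[OF le0])
  also have "\<tau> * (l * (- \<alpha>) + e * l * A) \<le> \<tau> * G"
    unfolding G_def using \<tau> nn by (intro mult_left_mono add_right_mono) auto
  finally show False using \<tau>2 e(2) by simp
qed

lemma multiplier_eq: "multiplier \<Omega> vi vx \<phi> $ i $ j = hamiltonian1 \<Omega> vi vx \<phi> (\<phi> i) (\<phi> j)"
  by (simp add: multiplier_def dual_gram_def hamiltonian_def)

text \<open>The component of \<open>w\<close> along the frame produces the multiplier. The
  orthogonal rest contributes nothing: varying along \<open>w'\<close> kills the real part and along
  \<open>\<i> * w'\<close> the imaginary part.\<close>

lemma Euler_Lagrange:
  fixes \<phi> :: "'p::finite frame" and E :: "'p frame \<Rightarrow> real"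
  assumes pot: "potentials_well_defined \<Omega> H vi vx TYPE('p)" and \<phi>: "\<phi> \<in> stiefel \<Omega> H"
    and min: "\<And>\<psi>. \<psi> \<in> stiefel \<Omega> H \<Longrightarrow> E \<phi> \<le> E \<psi>"
    and deriv: "has_frame_derivative \<Omega> H E (dual_pair (hamiltonian \<Omega> vi vx \<phi> \<phi>)) \<phi>"
    and w: "w \<in> H"
  shows "hamiltonian1 \<Omega> vi vx \<phi> (\<phi> i) w = (\<Sum>k\<in>UNIV. multiplier \<Omega> vi vx \<phi> $ i $ k * L2_inner \<Omega> (\<phi> k) w)"
proof -
  define a where "a = hamiltonian1 \<Omega> vi vx \<phi>"
  have \<phi>F: "\<phi> \<in> frames H" and gram: "gram \<Omega> \<phi> \<phi> = mat 1" using \<phi> by (auto simp: stiefel_def)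
  have \<phi>H: "\<phi> k \<in> H" for k using \<phi>F by (rule framesD)
  have on: "L2_inner \<Omega> (\<phi> k) (\<phi> l) = (if k = l then 1 else 0)" for k l
    using arg_cong[OF gram, of "\<lambda>M. M $ k $ l"] by (simp add: gram_def mat_def)
  interpret a: herm_form H a unfolding a_def by (rule hamiltonian_herm_form[OF pot \<phi>F])
  define z where "z = (\<lambda>x. \<Sum>k\<in>UNIV. L2_inner \<Omega> (\<phi> k) w * \<phi> k x)"
  have z: "z \<in> H" unfolding z_def by (rule a.sum_mem[OF \<phi>H])
  define w' where "w' = w - z"
  have w': "w' \<in> H" unfolding w'_def using w z by (rule a.minus_mem)
  have "L2_inner \<Omega> (\<phi> k) z = L2_inner \<Omega> (\<phi> k) w" for k
    unfolding z_def by (subst R.L.sum_right[OF \<phi>H \<phi>H]) (simp add: on if_distrib cong: if_cong)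
  hence orth: "L2_inner \<Omega> (\<phi> k) w' = 0" for k
    unfolding w'_def using \<phi>H w z by (simp add: R.L.minus_right)
  have orth': "L2_inner \<Omega> (\<phi> k) (\<lambda>x. \<i> * w' x) = 0" for k
    by (subst R.L.cscale_right[OF \<phi>H w']) (simp add: orth)
  have "Re (a (\<phi> i) w') = 0"
    unfolding a_def by (rule Euler_Lagrange_orth[where E = E, OF pot \<phi> min deriv w' orth])
  moreover have "Re (a (\<phi> i) (\<lambda>x. \<i> * w' x)) = 0"
    unfolding a_def
    by (rule Euler_Lagrange_orth[where E = E, OF pot \<phi> min deriv a.cscale_mem[OF w'] orth'])
  ultimately have "a (\<phi> i) w' = 0" by (simp add: a.cscale_right[OF \<phi>H w'] complex_eq_iff)
  hence "a (\<phi> i) w = a (\<phi> i) z" unfolding w'_def using \<phi>H w z by (simp add: a.minus_right)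
  also have "\<dots> = (\<Sum>k\<in>UNIV. L2_inner \<Omega> (\<phi> k) w * a (\<phi> i) (\<phi> k))"
    unfolding z_def by (rule a.sum_right[OF \<phi>H \<phi>H])
  finally show ?thesis by (simp add: a_def multiplier_eq mult.commute)
qed

end

section \<open>The Aufbau principle\<close>

lemma order_prod_linear:
  fixes l :: "'a \<Rightarrow> 'b::field"
  assumes "finite A"
  shows "order x (\<Prod>i\<in>A. [:- l i, 1:]) = card {i\<in>A. l i = x}"
  using assms
proof (induction A rule: finite_induct)
  case empty
  thus ?case by (simp add: order_0I)
next
  case (insert i A)
  have nz: "(\<Prod>i\<in>A. [:- l i, 1:]) \<noteq> 0" using insert.hyps by (simp add: prod_zero_iff)
  have "order x ([:- l i, 1:] * (\<Prod>i\<in>A. [:- l i, 1:])) = order x [:- l i, 1:] + order x (\<Prod>i\<in>A. [:- l i, 1:])"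
    using nz by (intro order_mult no_zero_divisors) auto
  also have "order x [:- l i, 1:] = (if l i = x then 1 else 0)"
    using order_power_n_n[of x 1] by (auto simp: order_0I)
  finally have "order x (\<Prod>k\<in>insert i A. [:- l k, 1:]) = (if l i = x then 1 else 0) + card {k\<in>A. l k = x}"
    using insert by simp
  moreover have "{k\<in>insert i A. l k = x} = (if l i = x then insert i {k\<in>A. l k = x} else {k\<in>A. l k = x})" by auto
  ultimately show ?case using insert.hyps by simp
qed

text \<open>Eigenvalue lists are tied to a matrix only through its characteristic polynomial.
  Comparing orders of roots recovers the multiplicities and relates lists over different index
  sets.\<close>

lemma card_eq_of_prod_eq:
  fixes l :: "'a \<Rightarrow> real" and d :: "'b \<Rightarrow> real"
  assumes fin: "finite A" "finite B"
    and eq: "\<And>z :: complex. (\<Prod>i\<in>A. z - of_real (l i)) = (\<Prod>j\<in>B. z - of_real (d j))"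
  shows "card {i\<in>A. l i = \<kappa>} = card {j\<in>B. d j = \<kappa>}"
proof -
  have "poly (\<Prod>i\<in>A. [:- of_real (l i), 1:]) z = poly (\<Prod>j\<in>B. [:- of_real (d j), 1:]) z" for z :: complex
    using eq[of z] by (simp add: poly_prod)
  hence "(\<Prod>i\<in>A. [:- of_real (l i), 1:]) = (\<Prod>j\<in>B. [:- complex_of_real (d j), 1:])"
    by (simp only: poly_eq_poly_eq_iff[symmetric] fun_eq_iff simp_thms)
  hence "order (complex_of_real \<kappa>) (\<Prod>i\<in>A. [:- of_real (l i), 1:]) = order (of_real \<kappa>) (\<Prod>j\<in>B. [:- complex_of_real (d j), 1:])"
    by simp
  thus ?thesis unfolding order_prod_linear[OF fin(1)] order_prod_linear[OF fin(2)] by simp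
qed

context kohn_sham_space
begin

text \<open>Independence is meant modulo null sets, as in the definition of multiplicity; pairing
  with \<open>u k\<close> isolates one coefficient and does not see null sets.\<close>

lemma orthonormal_independent:
  fixes u :: "nat \<Rightarrow> wavefun"
  assumes u: "\<And>i. i < n \<Longrightarrow> u i \<in> H"
    and on: "\<And>i j. i < n \<Longrightarrow> j < n \<Longrightarrow> L2_inner \<Omega> (u i) (u j) = (if i = j then 1 else 0)"
    and zero: "AE x in lebesgue_on \<Omega>. (\<Sum>i<n. c i * u i x) = 0" and k: "k < n"
  shows "c k = 0"
proof -
  define s where "s = (\<lambda>x. \<Sum>i<n. c i * u i x)"
  have s: "s \<in> H" unfolding s_def by (rule R.L.sum_mem) (simp add: u)
  have "Re (L2_inner \<Omega> s s) = 0"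
    using L2_inner_self_eq_0_iff[OF H1_L2[OF H_H1[OF s]]] zero by (simp add: s_def)
  hence "L2_inner \<Omega> (u k) s = 0" using R.L.norm_le[OF u[OF k] s] by simp
  moreover have "L2_inner \<Omega> (u k) s = (\<Sum>i<n. c i * L2_inner \<Omega> (u k) (u i))"
    unfolding s_def by (rule R.L.sum_right[OF u[OF k]]) (simp add: u)
  moreover have "\<dots> = (\<Sum>i<n. if i = k then c k else 0)"
    by (intro sum.cong refl) (auto simp: on k)
  ultimately show ?thesis using k by simp
qed

text \<open>The \<open>\<psi> i\<close> with \<open>d i = \<kappa>\<close> already exhaust the
  multiplicity. An orthogonal eigenvector would increase the number of independent ones by one. The
  case that no \<open>d i\<close> equals \<open>\<kappa>\<close> is included.\<close>

lemma no_further_eigenvector: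
  fixes \<psi> :: "'p::finite frame"
  assumes \<psi>: "\<And>i. \<psi> i \<in> H" and on: "\<And>i j. L2_inner \<Omega> (\<psi> i) (\<psi> j) = (if i = j then 1 else 0)"
    and eigen: "\<And>i w. w \<in> H \<Longrightarrow> T (\<psi> i) w = of_real (d i) * L2_inner \<Omega> (\<psi> i) w"
    and mult: "eig_multiplicity \<Omega> H T \<kappa> = enat (card {j. d j = \<kappa>})"
    and v: "v \<in> H" and v1: "Re (L2_inner \<Omega> v v) = 1" and orth: "\<And>i. L2_inner \<Omega> (\<psi> i) v = 0"
    and Tv: "\<And>w. w \<in> H \<Longrightarrow> T v w = of_real \<kappa> * L2_inner \<Omega> v w"
  shows False
proof -
  define n where "n = card {j. d j = \<kappa>}"
  obtain f where f: "bij_betw f {0..<n} {j. d j = \<kappa>}"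
    unfolding n_def using ex_bij_betw_nat_finite[of "{j. d j = \<kappa>}"] by auto
  have fd: "d (f i) = \<kappa>" if "i < n" for i using bij_betw_apply[OF f, of i] that by simp
  have finj: "f i = f j \<longleftrightarrow> i = j" if "i < n" "j < n" for i j
    using inj_on_eq_iff[OF bij_betw_imp_inj_on[OF f], of i j] that by simp
  \<comment> \<open>Index \<open>n\<close> carries the additional vector, so there are
    \<open>Suc n\<close> orthonormal eigenvectors.\<close>
  define u where "u i = (if i < n then \<psi> (f i) else v)" for i
  have uH: "u i \<in> H" for i using \<psi> v by (simp add: u_def)
  have "L2_inner \<Omega> v v = 1" using R.L.self_eq_Re[OF v] v1 by simp
  moreover have "L2_inner \<Omega> v (\<psi> i) = 0" for i using R.L.herm[OF \<psi> v, of i] orth[of i] by simp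
  ultimately have uon: "L2_inner \<Omega> (u i) (u j) = (if i = j then 1 else 0)" if "i < Suc n" "j < Suc n" for i j
    using that by (auto simp: u_def on orth finj)
  have "u i \<in> eigenspace \<Omega> H T \<kappa>" for i
    unfolding eigenspace_def using uH[of i]
    by (auto simp: R.L.cscale_left u_def eigen fd Tv)
  moreover have "\<forall>c. (AE x in lebesgue_on \<Omega>. (\<Sum>i<Suc n. c i * u i x) = 0) \<longrightarrow> (\<forall>i<Suc n. c i = 0)"
    using orthonormal_independent[of "Suc n" u, OF uH uon] by blast
  ultimately have "enat (Suc n) \<le> eig_multiplicity \<Omega> H T \<kappa>"
    unfolding eig_multiplicity_def by (intro Sup_upper CollectI exI[of _ "Suc n"] conjI refl exI[of _ u]) auto
  thus False unfolding mult n_def by simp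
qed

lemma stiefelD:
  assumes "\<phi> \<in> stiefel \<Omega> H"
  shows "\<phi> \<in> frames H" "L2_inner \<Omega> (\<phi> k) (\<phi> l) = (if k = l then 1 else 0)"
proof -
  have gram: "gram \<Omega> \<phi> \<phi> = mat 1" and "\<phi> \<in> frames H" using assms by (auto simp: stiefel_def)
  thus "\<phi> \<in> frames H" by simp
  show "L2_inner \<Omega> (\<phi> k) (\<phi> l) = (if k = l then 1 else 0)"
    using arg_cong[OF gram, of "\<lambda>M. M $ k $ l"] by (simp add: gram_def mat_def)
qed

lemma multiplier_herm:
  assumes "potentials_well_defined \<Omega> H vi vx TYPE('p::finite)" and \<phi>: "(\<phi> :: 'p frame) \<in> frames H"
  shows "multiplier \<Omega> vi vx \<phi> $ i $ j = cnj (multiplier \<Omega> vi vx \<phi> $ j $ i)"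
  unfolding multiplier_eq by (rule herm_form.herm[OF hamiltonian_herm_form[OF assms] framesD[OF \<phi>] framesD[OF \<phi>]])

text \<open>The Aufbau list \<open>l\<close> and the prescribed list \<open>ev\<close> are a priori
  different functions. Both enumerate the roots of the same characteristic polynomial, and so do the
  \<open>d j\<close>; counting multiplicities connects all three. The bound \<open>\<Lambda>\<close>
  is the last entry of \<open>l\<close>.\<close>

lemma spectral_gap_at_ground_state:
  fixes \<phi> :: "'p::finite frame" and E :: "'p frame \<Rightarrow> real"
  assumes pot: "potentials_well_defined \<Omega> H vi vx TYPE('p)" and \<phi>: "\<phi> \<in> stiefel \<Omega> H"
    and min: "\<And>\<psi>. \<psi> \<in> stiefel \<Omega> H \<Longrightarrow> E \<phi> \<le> E \<psi>"
    and deriv: "has_frame_derivative \<Omega> H E (dual_pair (hamiltonian \<Omega> vi vx \<phi> \<phi>)) \<phi>"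
    and bound: "\<And>v w. v \<in> (frames H :: 'p frame set) \<Longrightarrow> w \<in> frames H \<Longrightarrow>
      \<bar>frame_form (hamiltonian1 \<Omega> vi vx \<phi>) v w\<bar> \<le> C * FN v * FN w"
    and \<sigma>: "\<sigma> > 0" and garding: "\<And>v. v \<in> (frames H :: 'p frame set) \<Longrightarrow>
      (FN v)\<^sup>2 \<le> frame_form (hamiltonian1 \<Omega> vi vx \<phi>) v v + \<sigma> * (frame_L_norm \<Omega> v)\<^sup>2"
    and aufbau: "aufbau \<Omega> H vi vx \<phi>"
    and ev: "ordered_eigenvalues (multiplier \<Omega> vi vx \<phi>) ev"
  shows "\<exists>U d \<Lambda>. diagonalizer (multiplier \<Omega> vi vx \<phi>) U d \<and>
    spectral_gap H (L2_inner \<Omega>) (H1_inner \<Omega>) (hamiltonian1 \<Omega> vi vx \<phi>) C \<sigma> \<Lambda> (frame_mult \<phi> U) d \<and>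
    (\<forall>j. d j \<le> \<Lambda>) \<and> (\<forall>j. \<exists>i\<in>{1..CARD('p)}. d j = ev i)"
proof -
  define a where "a = hamiltonian1 \<Omega> vi vx \<phi>"
  define M where "M = multiplier \<Omega> vi vx \<phi>"
  have \<phi>F: "\<phi> \<in> frames H" by (rule stiefelD(1)[OF \<phi>])
  have \<phi>H: "\<phi> k \<in> H" for k using \<phi>F by (rule framesD)
  have a: "herm_form H a" unfolding a_def by (rule hamiltonian_herm_form[OF pot \<phi>F])
  interpret a: herm_form H a by (rule a)
  have M_herm: "M $ i $ j = cnj (M $ j $ i)" for i j unfolding M_def by (rule multiplier_herm[OF pot \<phi>F])
  obtain U :: "complex^'p^'p" and d :: "'p \<Rightarrow> real" where columns: "\<And>i j. (\<Sum>k\<in>UNIV. cnj (U $ k $ i) * U $ k $ j) = (if i = j then 1 else 0)"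
    and rows: "\<And>i j. (\<Sum>k\<in>UNIV. U $ i $ k * cnj (U $ j $ k)) = (if i = j then 1 else 0)"
    and eigen_columns: "\<And>k j. (\<Sum>l\<in>UNIV. M $ k $ l * U $ l $ j) = of_real (d j) * U $ k $ j"
    and det: "\<And>z. det (mat z - M) = (\<Prod>i\<in>UNIV. z - of_real (d i))"
    by (rule hermitian_diagonalization[of M, OF M_herm]) (rule that; simp only: simp_thms)
  have diag: "diagonalizer M U d" by (rule diagonalizer.intro[OF columns rows eigen_columns M_herm])
  define \<psi> where "\<psi> = frame_mult \<phi> U"
  have \<psi>: "\<psi> j \<in> H" for j unfolding \<psi>_def by (rule framesD[OF frame_mult_frames[OF a \<phi>F]])
  note L = R.L.herm_form_axioms
  have on: "L2_inner \<Omega> (\<psi> i) (\<psi> j) = (if i = j then 1 else 0)" for i j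
  proof -
    have "L2_inner \<Omega> (\<phi> k) (\<psi> j) = U $ k $ j" for k
      unfolding \<psi>_def form_frame_mult(2)[OF L \<phi>F \<phi>H] stiefelD(2)[OF \<phi>] by (simp add: if_distrib cong: if_cong)
    thus ?thesis
      using form_frame_mult(1)[OF L \<phi>F \<psi>[of j], of U i] columns[of i j] by (simp add: \<psi>_def)
  qed
  have eigen: "a (\<psi> i) w = of_real (d i) * L2_inner \<Omega> (\<psi> i) w" if w: "w \<in> H" for i w
  proof -
    have EL: "a (\<phi> k) w = (\<Sum>m\<in>UNIV. M $ k $ m * L2_inner \<Omega> (\<phi> m) w)" for k
      unfolding a_def M_def by (rule Euler_Lagrange[where E = E, OF pot \<phi> min deriv w])
    have "a (\<psi> i) w = (\<Sum>k\<in>UNIV. \<Sum>m\<in>UNIV. cnj (U $ k $ i) * (M $ k $ m * L2_inner \<Omega> (\<phi> m) w))"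
      unfolding \<psi>_def form_frame_mult(1)[OF a \<phi>F w] EL by (simp add: sum_distrib_left)
    also have "\<dots> = (\<Sum>m\<in>UNIV. cnj (\<Sum>k\<in>UNIV. M $ m $ k * U $ k $ i) * L2_inner \<Omega> (\<phi> m) w)"
      unfolding cnj_sum sum_distrib_right
      by (subst sum.swap, intro sum.cong refl) (subst M_herm, simp add: mult_ac)
    also have "\<dots> = of_real (d i) * L2_inner \<Omega> (\<psi> i) w"
      unfolding eigen_columns \<psi>_def form_frame_mult(1)[OF L \<phi>F w] by (simp add: sum_distrib_left mult_ac)
    finally show ?thesis .
  qed
  obtain l where l: "ordered_eigenvalues M l" "smallest_eigenvalues \<Omega> H a CARD('p) l"
    using aufbau unfolding aufbau_def M_def a_def by blast
  have count: "card {i\<in>{1..CARD('p)}. l i = \<kappa>} = card {j. d j = \<kappa>}" if "ordered_eigenvalues M l" for l \<kappa>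
    using card_eq_of_prod_eq[of "{1..CARD('p)}" "UNIV :: 'p set" l d \<kappa>] that
    unfolding ordered_eigenvalues_def det by simp
  have listed: "\<exists>i\<in>{1..CARD('p)}. d j = l i" if "ordered_eigenvalues M l" for l j
  proof (rule ccontr)
    assume "\<not> ?thesis"
    hence "{i\<in>{1..CARD('p)}. l i = d j} = {}" by (metis (mono_tags, lifting) empty_Collect_eq)
    hence "card {k. d k = d j} = 0" unfolding count[OF that, of "d j", symmetric] by simp
    thus False by (auto simp: card_eq_0_iff)
  qed
  have d_le: "d j \<le> l CARD('p)" for j
  proof -
    obtain i where i: "i \<in> {1..CARD('p)}" "d j = l i" using listed[OF l(1), of j] by blast
    have "mono_on {1..CARD('p)} l" using l(1) by (simp add: ordered_eigenvalues_def)
    thus ?thesis using i by (auto simp: mono_on_def)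
  qed
  have "spectral_gap H (L2_inner \<Omega>) (H1_inner \<Omega>) a C \<sigma> (l CARD('p)) \<psi> d"
  proof (intro spectral_gap.intro rigged a spectral_gap_axioms.intro H_complete \<sigma> \<psi> on eigen)
    show "\<exists>r. strict_mono (r :: nat \<Rightarrow> nat) \<and> form_Cauchy (\<lambda>v w. Re (L2_inner \<Omega> v w)) (u \<circ> r)"
      if "\<And>n. u n \<in> H" "\<And>n. Re (H1_inner \<Omega> (u n) (u n)) \<le> K" for u K
      by (rule H_compact[OF that])
    show "Re (a v v) \<le> C * Re (H1_inner \<Omega> v v)" if v: "v \<in> H" for v
    proof -
      have "Re (a v v) \<le> C * H1_norm \<Omega> v * H1_norm \<Omega> v"
        by (rule order_trans[OF complex_Re_le_cmod norm_form_le[OF a bound[folded a_def] v v]])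
      thus ?thesis using R.N.pos[OF v] by (simp add: H1_norm_def mult.assoc)
    qed
    show "Re (H1_inner \<Omega> v v) \<le> Re (a v v) + \<sigma> * Re (L2_inner \<Omega> v v)" if v: "v \<in> H" for v
    proof -
      fix j :: 'p
      have F: "single j v \<in> frames H" by (rule single_frames[OF a v])
      have eq: "frame_form s (single j v) (single j v) = Re (s v v)" if "herm_form H s" for s
        using frame_form_single[OF that v F] by (simp add: single_def)
      have "frame_form (L2_inner \<Omega>) (single j v) (single j v) = Re (L2_inner \<Omega> v v)" by (rule eq[OF L])
      hence "(frame_L_norm \<Omega> (single j v))\<^sup>2 = Re (L2_inner \<Omega> v v)"
        using R.L.pos[OF v] by (simp add: frame_L_norm_eq)
      thus ?thesis using garding[OF F] unfolding FN_sq[OF F] eq[OF R.N.herm_form_axioms] a_def[symmetric] eq[OF a] by simp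
    qed
    show False if \<kappa>: "\<kappa> < l CARD('p)" and v: "v \<in> H" "Re (L2_inner \<Omega> v v) = 1" "\<And>i. L2_inner \<Omega> (\<psi> i) v = 0"
      "\<And>w. w \<in> H \<Longrightarrow> a v w = of_real \<kappa> * L2_inner \<Omega> v w" for \<kappa> v
    proof (rule no_further_eigenvector[OF \<psi> on eigen _ v])
      \<comment> \<open>Strictly below its last entry the Aufbau list is exhaustive, so the
        multiplicity there is the number of \<open>d j\<close> equal to
        \<open>\<kappa>\<close>.\<close>
      have "enat (card {i\<in>{1..CARD('p)}. l i = \<kappa>}) = eig_multiplicity \<Omega> H a \<kappa>"
        using l(2) \<kappa> unfolding smallest_eigenvalues_def by blast
      thus "eig_multiplicity \<Omega> H a \<kappa> = enat (card {j. d j = \<kappa>})" unfolding count[OF l(1)] by simp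
    qed
  qed
  thus ?thesis using diag d_le listed[OF ev[folded M_def]] unfolding a_def \<psi>_def M_def by blast
qed

end

section \<open>Perturbation of the ground state\<close>

context kohn_sham_space
begin

lemma FN_triangle:
  assumes "v \<in> frames H" "w \<in> (frames H :: 'p::finite frame set)"
  shows "FN (v + w) \<le> FN v + FN w"
proof -
  interpret F: psd_form "frames H :: 'p frame set" "frame_form (H1_inner \<Omega>)" by (rule FN_psd)
  show ?thesis unfolding frame_H_norm_eq by (rule F.triangle[OF assms])
qed

lemma FN_minus_triangle:
  assumes "u \<in> frames H" "v \<in> frames H" "w \<in> (frames H :: 'p::finite frame set)"
  shows "FN (u - w) \<le> FN (u - v) + FN (v - w)"
proof -
  interpret F: psd_form "frames H :: 'p frame set" "frame_form (H1_inner \<Omega>)" by (rule FN_psd)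
  show ?thesis using FN_triangle[of "u - v" "v - w"] assms by (simp add: F.mem)
qed

lemma frames_diff: "v \<in> frames H \<Longrightarrow> w \<in> frames H \<Longrightarrow> v - w \<in> frames H"
  using R.L.minus_mem by (simp add: frames_def)

text \<open>One derivative at \<open>\<phi>\<close> suffices: its norm is bounded by
  \<open>C\<close>, and the Frechet remainder with tolerance 1 adds 1 to the constant.\<close>

lemma smooth_operator_map_Lipschitz:
  fixes F :: "'p::finite frame \<Rightarrow> 'p frame \<Rightarrow> 'p dual_frame"
  assumes smooth: "smooth_operator_map \<Omega> H F" and \<phi>: "\<phi> \<in> frames H"
  shows "\<exists>C\<ge>0. \<exists>\<delta>>0. \<forall>\<phi>'\<in>frames H. FN (\<phi>' - \<phi>) < \<delta> \<longrightarrow> (\<forall>v\<in>frames H. \<forall>w\<in>frames H.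
    \<bar>dual_pair (F \<phi>' v) w - dual_pair (F \<phi> v) w\<bar> \<le> C * FN (\<phi>' - \<phi>) * FN v * FN w)"
proof -
  obtain D :: "'p frame \<Rightarrow> 'p frame list \<Rightarrow> 'p frame \<Rightarrow> 'p frame \<Rightarrow> real" where
    D0: "\<forall>\<phi>\<in>frames H. \<forall>v\<in>frames H. \<forall>w\<in>frames H. D \<phi> [] v w = dual_pair (F \<phi> v) w" and
    bound: "\<forall>\<phi>\<in>frames H. \<forall>n. \<exists>C. \<forall>hs\<in>lists (frames H). length hs = n \<longrightarrow>
           (\<forall>v\<in>frames H. \<forall>w\<in>frames H.
              \<bar>D \<phi> hs v w\<bar> \<le> C * prod_list (map FN hs) * FN v * FN w)" and
    deriv: "\<forall>\<phi>\<in>frames H. \<forall>n. \<forall>e>0. \<exists>d>0. \<forall>h\<in>frames H. FN h < d \<longrightarrow>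
           (\<forall>hs\<in>lists (frames H). length hs = n \<longrightarrow>
              (\<forall>v\<in>frames H. \<forall>w\<in>frames H.
                 \<bar>D (\<phi> + h) hs v w - D \<phi> hs v w - D \<phi> (h # hs) v w\<bar> \<le>
                   e * FN h * prod_list (map FN hs) * FN v * FN w))"
    using smooth unfolding smooth_operator_map_def by (elim exE conjE) (rule that)
  obtain C where C: "\<And>h v w. h \<in> frames H \<Longrightarrow> v \<in> frames H \<Longrightarrow> w \<in> frames H \<Longrightarrow> \<bar>D \<phi> [h] v w\<bar> \<le> C * FN h * FN v * FN w"
  proof -
    obtain C where "\<forall>hs\<in>lists (frames H). length hs = 1 \<longrightarrow> (\<forall>v\<in>frames H. \<forall>w\<in>frames H.
              \<bar>D \<phi> hs v w\<bar> \<le> C * prod_list (map FN hs) * FN v * FN w)"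
      using bound[rule_format, OF \<phi>, of 1] by (elim exE) (rule that)
    note C = this[rule_format]
    show ?thesis
    proof (rule that)
      show "\<bar>D \<phi> [h] v w\<bar> \<le> C * FN h * FN v * FN w" if "h \<in> frames H" "v \<in> frames H" "w \<in> frames H" for h v w
        using C[of "[h]" v w] that by simp
    qed
  qed
  obtain \<delta> where \<delta>: "\<delta> > 0" and rem: "\<And>h v w. h \<in> frames H \<Longrightarrow> FN h < \<delta> \<Longrightarrow> v \<in> frames H \<Longrightarrow> w \<in> frames H \<Longrightarrow>
      \<bar>D (\<phi> + h) [] v w - D \<phi> [] v w - D \<phi> [h] v w\<bar> \<le> FN h * FN v * FN w"
  proof -
    obtain \<delta> where d: "\<delta> > 0" and "\<forall>h\<in>frames H. FN h < \<delta> \<longrightarrow>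
           (\<forall>hs\<in>lists (frames H). length hs = 0 \<longrightarrow>
              (\<forall>v\<in>frames H. \<forall>w\<in>frames H.
                 \<bar>D (\<phi> + h) hs v w - D \<phi> hs v w - D \<phi> (h # hs) v w\<bar> \<le>
                   1 * FN h * prod_list (map FN hs) * FN v * FN w))"
      using deriv[rule_format, OF \<phi> zero_less_one, of 0] by (elim exE conjE) (rule that)
    note rem = this(2)[rule_format]
    show ?thesis
    proof (rule that[OF d])
      show "\<bar>D (\<phi> + h) [] v w - D \<phi> [] v w - D \<phi> [h] v w\<bar> \<le> FN h * FN v * FN w"
        if "h \<in> frames H" "FN h < \<delta>" "v \<in> frames H" "w \<in> frames H" for h v w
        using rem[of h "[]" v w] that by simp
    qed
  qed
  have "\<bar>dual_pair (F \<phi>' v) w - dual_pair (F \<phi> v) w\<bar> \<le> (\<bar>C\<bar> + 1) * FN (\<phi>' - \<phi>) * FN v * FN w"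
    if \<phi>': "\<phi>' \<in> frames H" and close: "FN (\<phi>' - \<phi>) < \<delta>" and v: "v \<in> frames H" and w: "w \<in> frames H" for \<phi>' v w
  proof -
    have h: "\<phi>' - \<phi> \<in> frames H" by (rule frames_diff[OF \<phi>' \<phi>])
    have eq: "\<phi> + (\<phi>' - \<phi>) = \<phi>'" by simp
    have "0 \<le> FN (\<phi>' - \<phi>) * FN v * FN w" by (intro mult_nonneg_nonneg FN_nonneg h v w)
    hence "C * (FN (\<phi>' - \<phi>) * FN v * FN w) \<le> \<bar>C\<bar> * (FN (\<phi>' - \<phi>) * FN v * FN w)"
      by (intro mult_right_mono) auto
    moreover have "\<bar>dual_pair (F \<phi>' v) w - dual_pair (F \<phi> v) w\<bar> \<le> FN (\<phi>' - \<phi>) * FN v * FN w + C * FN (\<phi>' - \<phi>) * FN v * FN w"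
      using rem[OF h close v w] C[OF h v w] D0[rule_format, OF \<phi>' v w] D0[rule_format, OF \<phi> v w] unfolding eq by linarith
    ultimately show ?thesis by (simp add: algebra_simps)
  qed
  moreover have "0 \<le> \<bar>C\<bar> + 1" by simp
  ultimately show ?thesis using \<delta> by (intro exI[of _ "\<bar>C\<bar> + 1"] conjI exI[of _ \<delta>]) auto
qed

text \<open>Telescoping: the form, the first and the second argument are changed one after the
  other.\<close>

lemma norm_form_diff_le:
  fixes s t :: "wavefun \<Rightarrow> wavefun \<Rightarrow> complex"
  assumes s: "herm_form H s" and t: "herm_form H t"
    and diff: "\<And>v w. v \<in> (frames H :: 'p::finite frame set) \<Longrightarrow> w \<in> frames H \<Longrightarrow>
      \<bar>frame_form s v w - frame_form t v w\<bar> \<le> \<epsilon> * FN v * FN w"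
    and bound: "\<And>v w. v \<in> (frames H :: 'p frame set) \<Longrightarrow> w \<in> frames H \<Longrightarrow> \<bar>frame_form t v w\<bar> \<le> C * FN v * FN w"
    and H: "v \<in> H" "w \<in> H" "v' \<in> H" "w' \<in> H"
  shows "norm (s v w - t v' w') \<le>
    \<epsilon> * H1_norm \<Omega> v * H1_norm \<Omega> w + C * H1_norm \<Omega> (v - v') * H1_norm \<Omega> w + C * H1_norm \<Omega> v' * H1_norm \<Omega> (w - w')"
proof -
  interpret t: herm_form H t by (rule t)
  have diff': "\<bar>frame_form (\<lambda>v w. s v w - t v w) v w\<bar> \<le> \<epsilon> * FN v * FN w" if "v \<in> frames H" "w \<in> frames H" for v w :: "'p frame"
    using diff[OF that] by (simp add: frame_form_def sum_subtractf)
  have "norm (s v w - t v w) \<le> \<epsilon> * H1_norm \<Omega> v * H1_norm \<Omega> w"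
    by (rule norm_form_le[OF herm_form_diff[OF s t] diff' H(1,2)])
  moreover have "norm (t (v - v') w) \<le> C * H1_norm \<Omega> (v - v') * H1_norm \<Omega> w"
    by (rule norm_form_le[OF t bound t.minus_mem[OF H(1,3)] H(2)])
  moreover have "norm (t v' (w - w')) \<le> C * H1_norm \<Omega> v' * H1_norm \<Omega> (w - w')"
    by (rule norm_form_le[OF t bound H(3) t.minus_mem[OF H(2,4)]])
  moreover have eq: "s v w - t v' w' = (s v w - t v w) + t (v - v') w + t v' (w - w')"
    using H by (simp add: t.minus_left t.minus_right)
  ultimately show ?thesis unfolding eq
    using norm_triangle_ineq[of "(s v w - t v w) + t (v - v') w" "t v' (w - w')"]
      norm_triangle_ineq[of "s v w - t v w" "t (v - v') w"] by linarith
qed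

lemma frame_mult_form_diff:
  assumes v: "v \<in> frames H" and w: "w \<in> frames H"
  shows "frame_form (L2_inner \<Omega>) (frame_mult v (A - B)) w =
    frame_form (L2_inner \<Omega>) (frame_mult v A) w - frame_form (L2_inner \<Omega>) (frame_mult v B) w"
  unfolding frame_form_def form_frame_mult(1)[OF R.L.herm_form_axioms v framesD[OF w]]
  by (simp add: left_diff_distrib sum_subtractf)

lemma frame_mult_form_mat:
  assumes v: "v \<in> frames H" and w: "w \<in> frames H"
  shows "frame_form (L2_inner \<Omega>) (frame_mult v (mat (of_real \<mu>))) w = \<mu> * frame_form (L2_inner \<Omega>) v w"
  unfolding frame_form_def form_frame_mult(1)[OF R.L.herm_form_axioms v framesD[OF w]]
  by (simp add: mat_def if_distrib if_distribR sum_distrib_left cong: if_cong)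

text \<open>The shift depends on the frame too. Its entries are values of the Hamiltonian form at
  the frame components, so form and both arguments vary; the multiple of the identity by
  \<open>\<mu>\<close> cancels in the difference.\<close>

lemma shifted_form_perturbation:
  fixes \<phi>\<^sub>0 :: "'p::finite frame"
  assumes pot: "potentials_well_defined \<Omega> H vi vx TYPE('p)"
    and smooth: "smooth_operator_map \<Omega> H (hamiltonian \<Omega> vi vx :: 'p frame \<Rightarrow> 'p frame \<Rightarrow> 'p dual_frame)"
    and \<phi>\<^sub>0: "\<phi>\<^sub>0 \<in> frames H"
    and bound: "\<And>v w. v \<in> (frames H :: 'p frame set) \<Longrightarrow> w \<in> frames H \<Longrightarrow>
      \<bar>frame_form (hamiltonian1 \<Omega> vi vx \<phi>\<^sub>0) v w\<bar> \<le> C * FN v * FN w"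
  shows "\<exists>C'\<ge>0. \<exists>\<delta>>0. \<forall>\<phi>\<in>frames H. FN (\<phi> - \<phi>\<^sub>0) < \<delta> \<longrightarrow> (\<forall>v\<in>frames H. \<forall>w\<in>frames H.
    \<bar>dual_pair (shifted_hamiltonian \<Omega> vi vx \<phi> (shift \<Omega> vi vx \<phi> \<mu>) v) w -
     dual_pair (shifted_hamiltonian \<Omega> vi vx \<phi>\<^sub>0 (shift \<Omega> vi vx \<phi>\<^sub>0 \<mu>) v) w\<bar> \<le> C' * FN (\<phi> - \<phi>\<^sub>0) * FN v * FN w)"
proof -
  obtain C2 \<delta>0 where C2: "C2 \<ge> 0" and \<delta>0: "\<delta>0 > 0" and Lip: "\<forall>\<phi>\<in>frames H. FN (\<phi> - \<phi>\<^sub>0) < \<delta>0 \<longrightarrow> (\<forall>v\<in>frames H. \<forall>w\<in>frames H.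
    \<bar>dual_pair (hamiltonian \<Omega> vi vx \<phi> v) w - dual_pair (hamiltonian \<Omega> vi vx \<phi>\<^sub>0 v) w\<bar> \<le> C2 * FN (\<phi> - \<phi>\<^sub>0) * FN v * FN w)"
    using smooth_operator_map_Lipschitz[OF smooth \<phi>\<^sub>0] by (elim exE conjE) (rule that)
  \<comment> \<open>Bounds the norm of every frame at distance less than 1 from
    \<open>\<phi>\<^sub>0\<close>. The three summands of \<open>C3\<close> below correspond to the
    three telescoping terms for an entry of the multiplier.\<close>
  define R where "R = FN \<phi>\<^sub>0 + 1"
  define C3 where "C3 = C2 * R * R + \<bar>C\<bar> * R + \<bar>C\<bar> * R"
  define C4 where "C4 = C2 + (\<Sum>j\<in>(UNIV :: 'p set). \<Sum>i\<in>(UNIV :: 'p set). C3)"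
  have R: "R \<ge> 0" unfolding R_def using FN_nonneg[OF \<phi>\<^sub>0] by simp
  have C3: "C3 \<ge> 0" unfolding C3_def using R C2 by (intro add_nonneg_nonneg mult_nonneg_nonneg) auto
  have C4: "C4 \<ge> 0" unfolding C4_def using C2 C3 by (intro add_nonneg_nonneg sum_nonneg) auto
  have main: "\<bar>dual_pair (shifted_hamiltonian \<Omega> vi vx \<phi> (shift \<Omega> vi vx \<phi> \<mu>) v) w -
     dual_pair (shifted_hamiltonian \<Omega> vi vx \<phi>\<^sub>0 (shift \<Omega> vi vx \<phi>\<^sub>0 \<mu>) v) w\<bar> \<le> C4 * FN (\<phi> - \<phi>\<^sub>0) * FN v * FN w"
    if \<phi>: "\<phi> \<in> frames H" and close: "FN (\<phi> - \<phi>\<^sub>0) < min \<delta>0 1" and v: "v \<in> frames H" and w: "w \<in> frames H" for \<phi> v w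
  proof -
    define a where "a = hamiltonian1 \<Omega> vi vx \<phi>"
    define a0 where "a0 = hamiltonian1 \<Omega> vi vx \<phi>\<^sub>0"
    define M where "M = multiplier \<Omega> vi vx \<phi>"
    define M0 where "M0 = multiplier \<Omega> vi vx \<phi>\<^sub>0"
    define \<delta> where "\<delta> = FN (\<phi> - \<phi>\<^sub>0)"
    have d: "\<phi> - \<phi>\<^sub>0 \<in> frames H" by (rule frames_diff[OF \<phi> \<phi>\<^sub>0])
    have \<delta>: "0 \<le> \<delta>" "\<delta> < \<delta>0" "\<delta> < 1" using close FN_nonneg[OF d] by (auto simp: \<delta>_def)
    have a: "herm_form H a" unfolding a_def by (rule hamiltonian_herm_form[OF pot \<phi>])
    have a0: "herm_form H a0" unfolding a0_def by (rule hamiltonian_herm_form[OF pot \<phi>\<^sub>0])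
    have diff: "\<bar>frame_form a v w - frame_form a0 v w\<bar> \<le> C2 * \<delta> * FN v * FN w" if "v \<in> frames H" "w \<in> frames H" for v w :: "'p frame"
      using Lip[rule_format, OF \<phi> _ that] \<delta>(2) unfolding dual_pair_hamiltonian a_def a0_def \<delta>_def by simp
    have "FN \<phi> \<le> FN \<phi>\<^sub>0 + FN (\<phi> - \<phi>\<^sub>0)" using FN_triangle[OF \<phi>\<^sub>0 d] by simp
    hence FN\<phi>: "FN \<phi> \<le> R" using \<delta>(3) by (simp add: R_def \<delta>_def)
    have n1: "0 \<le> H1_norm \<Omega> (\<phi> i)" "0 \<le> H1_norm \<Omega> (\<phi>\<^sub>0 i)" "0 \<le> H1_norm \<Omega> (\<phi> i - \<phi>\<^sub>0 i)" for i
      using H1_norm_nonneg framesD[OF \<phi>] framesD[OF \<phi>\<^sub>0] framesD[OF d, of i] by auto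
    have n2: "H1_norm \<Omega> (\<phi> i) \<le> R" "H1_norm \<Omega> (\<phi>\<^sub>0 i) \<le> R" "H1_norm \<Omega> (\<phi> i - \<phi>\<^sub>0 i) \<le> \<delta>" for i
      using H1_norm_le_FN[OF \<phi>, of i] H1_norm_le_FN[OF \<phi>\<^sub>0, of i] H1_norm_le_FN[OF d, of i] FN\<phi> by (auto simp: R_def \<delta>_def)
    have M_diff: "norm ((M - M0) $ i $ j) \<le> C3 * \<delta>" for i j
    proof -
      have "norm (a (\<phi> i) (\<phi> j) - a0 (\<phi>\<^sub>0 i) (\<phi>\<^sub>0 j)) \<le> C2 * \<delta> * H1_norm \<Omega> (\<phi> i) * H1_norm \<Omega> (\<phi> j) +
          C * H1_norm \<Omega> (\<phi> i - \<phi>\<^sub>0 i) * H1_norm \<Omega> (\<phi> j) + C * H1_norm \<Omega> (\<phi>\<^sub>0 i) * H1_norm \<Omega> (\<phi> j - \<phi>\<^sub>0 j)"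
        by (rule norm_form_diff_le[OF a a0 diff bound[folded a0_def] framesD[OF \<phi>] framesD[OF \<phi>] framesD[OF \<phi>\<^sub>0] framesD[OF \<phi>\<^sub>0]])
      also have "\<dots> \<le> C2 * \<delta> * R * R + \<bar>C\<bar> * \<delta> * R + \<bar>C\<bar> * R * \<delta>"
        by (intro add_mono mult_mono mult_nonneg_nonneg n1 n2 C2 \<delta>(1) R order_refl abs_ge_self abs_ge_zero)
      also have "\<dots> = C3 * \<delta>" by (simp add: C3_def algebra_simps)
      finally show ?thesis by (simp add: M_def M0_def a_def a0_def multiplier_eq)
    qed
    have pos: "0 \<le> FN v * FN w" by (intro mult_nonneg_nonneg FN_nonneg v w)
    have "shift \<Omega> vi vx \<phi> \<mu> - shift \<Omega> vi vx \<phi>\<^sub>0 \<mu> = M - M0" by (simp add: shift_def M_def M0_def)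
    hence "frame_form (L2_inner \<Omega>) (frame_mult v (shift \<Omega> vi vx \<phi> \<mu>)) w - frame_form (L2_inner \<Omega>) (frame_mult v (shift \<Omega> vi vx \<phi>\<^sub>0 \<mu>)) w
      = frame_form (L2_inner \<Omega>) (frame_mult v (M - M0)) w"
      using frame_mult_form_diff[OF v w, of "shift \<Omega> vi vx \<phi> \<mu>" "shift \<Omega> vi vx \<phi>\<^sub>0 \<mu>"] by simp
    moreover have "\<bar>frame_form (L2_inner \<Omega>) (frame_mult v (M - M0)) w\<bar> \<le> (\<Sum>j\<in>(UNIV :: 'p set). \<Sum>i\<in>(UNIV :: 'p set). C3 * \<delta>) * (FN v * FN w)"
    proof -
      have "(\<Sum>j\<in>UNIV. \<Sum>i\<in>UNIV. norm ((M - M0) $ i $ j)) \<le> (\<Sum>j\<in>(UNIV :: 'p set). \<Sum>i\<in>(UNIV :: 'p set). C3 * \<delta>)"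
        by (intro sum_mono M_diff)
      from mult_right_mono[OF this pos] frame_mult_form_le[OF v w, of "M - M0"] show ?thesis by (simp only: mult.assoc) 
    qed
    moreover have "C4 * \<delta> * FN v * FN w = C2 * \<delta> * FN v * FN w + (\<Sum>j\<in>(UNIV :: 'p set). \<Sum>i\<in>(UNIV :: 'p set). C3 * \<delta>) * (FN v * FN w)"
      by (simp add: C4_def algebra_simps)
    ultimately show ?thesis
      using diff[OF v w] unfolding dual_pair_shifted_hamiltonian a_def[symmetric] a0_def[symmetric] \<delta>_def[symmetric] by linarith
  qed
  show ?thesis
    by (intro exI[of _ C4] conjI C4 exI[of _ "min \<delta>0 1"] ballI impI main) (use \<delta>0 in auto)
qed

text \<open>The rotation leaves the sums of \<open>a\<close> and \<open>L\<close> invariant and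
  turns the multiplier into the numbers \<open>d j\<close>; the scalar part of the shift commutes
  with it.\<close>

lemma shifted_form_diagonal:
  fixes v w :: "'p::finite frame"
  assumes D: "diagonalizer (multiplier \<Omega> vi vx \<phi>) U d" and a: "herm_form H (hamiltonian1 \<Omega> vi vx \<phi>)"
    and v: "v \<in> frames H" and w: "w \<in> frames H"
  shows "dual_pair (shifted_hamiltonian \<Omega> vi vx \<phi> (shift \<Omega> vi vx \<phi> \<mu>) v) w =
    diag_form (L2_inner \<Omega>) (hamiltonian1 \<Omega> vi vx \<phi>) (\<lambda>j. d j - \<mu>) (frame_mult v U) (frame_mult w U)"
proof -
  let ?a = "hamiltonian1 \<Omega> vi vx \<phi>" and ?L = "L2_inner \<Omega>"
  interpret diagonalizer "multiplier \<Omega> vi vx \<phi>" U d by (rule D)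
  have "diag_form ?L ?a (\<lambda>j. d j - \<mu>) (frame_mult v U) (frame_mult w U) =
      frame_form ?a (frame_mult v U) (frame_mult w U)
      - Re (\<Sum>j\<in>UNIV. of_real (d j) * ?L (frame_mult v U j) (frame_mult w U j))
      + \<mu> * frame_form ?L (frame_mult v U) (frame_mult w U)"
    by (simp add: diag_form_def frame_form_def left_diff_distrib sum_subtractf sum_distrib_left)
  also have "\<dots> = frame_form ?a v w - frame_form ?L (frame_mult v (multiplier \<Omega> vi vx \<phi>)) w + \<mu> * frame_form ?L v w"
    unfolding frame_form_rotated[OF a v w] frame_form_rotated[OF R.L.herm_form_axioms v w] sum_rotated(2)[OF R.L.herm_form_axioms v w]
    by (simp add: frame_form_def)
  also have "\<dots> = dual_pair (shifted_hamiltonian \<Omega> vi vx \<phi> (shift \<Omega> vi vx \<phi> \<mu>) v) w"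
    unfolding dual_pair_shifted_hamiltonian shift_def frame_mult_form_diff[OF v w] frame_mult_form_mat[OF v w] by simp
  finally show ?thesis ..
qed

text \<open>Tangency holds at \<open>\<phi>\<close>; replacing \<open>\<phi>\<close> by
  \<open>\<phi>\<^sub>0\<close> changes an entry of the symmetrised matrix by at most
  \<open>2 * FN (\<phi> - \<phi>\<^sub>0) * FN \<eta>\<close>. A rotated entry combines the squared
  number of components many of these, with coefficients of modulus at most 1.\<close>

lemma tangent_defect:
  fixes \<eta> :: "'p::finite frame"
  assumes D: "diagonalizer M U d" and \<phi>: "\<phi> \<in> frames H" and \<eta>: "\<eta> \<in> tangent \<Omega> H \<phi>" and \<phi>\<^sub>0: "\<phi>\<^sub>0 \<in> frames H"
  shows "norm (L2_inner \<Omega> (frame_mult \<phi>\<^sub>0 U i) (frame_mult \<eta> U j) + cnj (L2_inner \<Omega> (frame_mult \<phi>\<^sub>0 U j) (frame_mult \<eta> U i)))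
    \<le> (real CARD('p))\<^sup>2 * (2 * FN (\<phi> - \<phi>\<^sub>0) * FN \<eta>)"
proof -
  let ?L = "L2_inner \<Omega>"
  interpret diagonalizer M U d by (rule D)
  note L = R.L.herm_form_axioms
  have \<eta>F: "\<eta> \<in> frames H" and gram: "gram \<Omega> \<phi> \<eta> + gram \<Omega> \<eta> \<phi> = 0" using \<eta> by (auto simp: tangent_def)
  have d: "\<phi> - \<phi>\<^sub>0 \<in> frames H" by (rule frames_diff[OF \<phi> \<phi>\<^sub>0])
  have \<eta>H: "\<eta> k \<in> H" and \<phi>H: "\<phi> k \<in> H" and \<phi>0H: "\<phi>\<^sub>0 k \<in> H" for k
    using \<eta>F \<phi> \<phi>\<^sub>0 by (auto simp: framesD)
  have expand: "?L (frame_mult v U i) (frame_mult w U j) = (\<Sum>k\<in>UNIV. \<Sum>l\<in>UNIV. cnj (U $ k $ i) * U $ l $ j * ?L (v k) (w l))"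
    if v: "v \<in> frames H" and w: "w \<in> frames H" for v w
    unfolding form_frame_mult(1)[OF L v framesD[OF frame_mult_frames[OF L w]]] form_frame_mult(2)[OF L w framesD[OF v]]
    by (simp add: sum_distrib_left mult.assoc)
  have entry: "norm (?L (\<phi>\<^sub>0 k) (\<eta> l) + ?L (\<eta> k) (\<phi>\<^sub>0 l)) \<le> 2 * FN (\<phi> - \<phi>\<^sub>0) * FN \<eta>" for k l
  proof -
    have "?L (\<phi> k) (\<eta> l) + ?L (\<eta> k) (\<phi> l) = 0"
      using arg_cong[OF gram, of "\<lambda>M. M $ k $ l"] by (simp add: gram_def)
    hence "?L (\<phi>\<^sub>0 k) (\<eta> l) + ?L (\<eta> k) (\<phi>\<^sub>0 l) = - (?L (\<phi> k - \<phi>\<^sub>0 k) (\<eta> l) + ?L (\<eta> k) (\<phi> l - \<phi>\<^sub>0 l))"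
      unfolding R.L.minus_left[OF \<phi>H \<phi>0H \<eta>H] R.L.minus_right[OF \<eta>H \<phi>H \<phi>0H] by (simp add: algebra_simps)
    hence "norm (?L (\<phi>\<^sub>0 k) (\<eta> l) + ?L (\<eta> k) (\<phi>\<^sub>0 l)) \<le> norm (?L ((\<phi> - \<phi>\<^sub>0) k) (\<eta> l)) + norm (?L (\<eta> k) ((\<phi> - \<phi>\<^sub>0) l))"
      using norm_triangle_ineq[of "?L (\<phi> k - \<phi>\<^sub>0 k) (\<eta> l)" "?L (\<eta> k) (\<phi> l - \<phi>\<^sub>0 l)"] by (simp only: norm_minus_cancel fun_diff_def)
    also have "\<dots> \<le> H1_norm \<Omega> ((\<phi> - \<phi>\<^sub>0) k) * H1_norm \<Omega> (\<eta> l) + H1_norm \<Omega> (\<eta> k) * H1_norm \<Omega> ((\<phi> - \<phi>\<^sub>0) l)"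
      by (intro add_mono norm_L2_inner_le framesD[OF d] \<eta>H)
    also have "\<dots> \<le> FN (\<phi> - \<phi>\<^sub>0) * FN \<eta> + FN \<eta> * FN (\<phi> - \<phi>\<^sub>0)"
      by (intro add_mono mult_mono H1_norm_le_FN d \<eta>F FN_nonneg H1_norm_nonneg framesD[OF d] \<eta>H)
    finally show ?thesis by (simp add: mult_ac)
  qed
  have "cnj (?L (frame_mult \<phi>\<^sub>0 U j) (frame_mult \<eta> U i)) = ?L (frame_mult \<eta> U i) (frame_mult \<phi>\<^sub>0 U j)"
    by (rule R.L.herm[symmetric]) (intro framesD frame_mult_frames[OF L] \<phi>\<^sub>0 \<eta>F)+
  hence "?L (frame_mult \<phi>\<^sub>0 U i) (frame_mult \<eta> U j) + cnj (?L (frame_mult \<phi>\<^sub>0 U j) (frame_mult \<eta> U i)) =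
      (\<Sum>k\<in>UNIV. \<Sum>l\<in>UNIV. cnj (U $ k $ i) * U $ l $ j * (?L (\<phi>\<^sub>0 k) (\<eta> l) + ?L (\<eta> k) (\<phi>\<^sub>0 l)))"
    by (simp add: expand[OF \<phi>\<^sub>0 \<eta>F] expand[OF \<eta>F \<phi>\<^sub>0] sum.distrib distrib_left)
  also have "norm \<dots> \<le> (\<Sum>k\<in>(UNIV :: 'p set). \<Sum>l\<in>(UNIV :: 'p set). 2 * FN (\<phi> - \<phi>\<^sub>0) * FN \<eta>)"
  proof (intro sum_norm_le)
    fix k l
    have "norm (cnj (U $ k $ i) * U $ l $ j * (?L (\<phi>\<^sub>0 k) (\<eta> l) + ?L (\<eta> k) (\<phi>\<^sub>0 l))) \<le> 1 * 1 * (2 * FN (\<phi> - \<phi>\<^sub>0) * FN \<eta>)"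
      unfolding norm_mult complex_mod_cnj by (intro mult_mono norm_U_le_1 entry mult_nonneg_nonneg norm_ge_zero) auto
    thus "norm (cnj (U $ k $ i) * U $ l $ j * (?L (\<phi>\<^sub>0 k) (\<eta> l) + ?L (\<eta> k) (\<phi>\<^sub>0 l))) \<le> 2 * FN (\<phi> - \<phi>\<^sub>0) * FN \<eta>" by simp
  qed
  also have "\<dots> = (real CARD('p))\<^sup>2 * (2 * FN (\<phi> - \<phi>\<^sub>0) * FN \<eta>)" by (simp add: power2_eq_square)
  finally show ?thesis .
qed

lemma open_in_stiefel_ball:
  assumes "\<phi>\<^sub>0 \<in> frames H"
  shows "open_in_stiefel \<Omega> H {\<phi> \<in> stiefel \<Omega> H. FN (\<phi> - \<phi>\<^sub>0) < \<delta>}"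
  unfolding open_in_stiefel_def
proof (intro conjI ballI)
  fix \<phi> assume \<phi>: "\<phi> \<in> {\<phi> \<in> stiefel \<Omega> H. FN (\<phi> - \<phi>\<^sub>0) < \<delta>}"
  have "FN (\<psi> - \<phi>\<^sub>0) < \<delta>" if "\<psi> \<in> stiefel \<Omega> H" "FN (\<psi> - \<phi>) < \<delta> - FN (\<phi> - \<phi>\<^sub>0)" for \<psi>
    using FN_minus_triangle[OF stiefelD(1)[OF that(1)] stiefelD(1)[of \<phi>] assms] \<phi> that(2) by simp
  thus "\<exists>e>0. \<forall>\<psi>\<in>stiefel \<Omega> H. FN (\<psi> - \<phi>) < e \<longrightarrow> \<psi> \<in> {\<phi> \<in> stiefel \<Omega> H. FN (\<phi> - \<phi>\<^sub>0) < \<delta>}"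
    using \<phi> by (intro exI[of _ "\<delta> - FN (\<phi> - \<phi>\<^sub>0)"]) auto
qed auto

text \<open>Both estimates are established at the ground state and lose at most half of their
  constants nearby. For coercivity the tangent defect is a second source of loss, of the same order
  as the change of the form.\<close>

lemma coercive_and_invertible_near_ground_state:
  fixes \<phi>\<^sub>0 :: "'p::finite frame" and E :: "'p frame \<Rightarrow> real"
  assumes pot: "potentials_well_defined \<Omega> H vi vx TYPE('p)" and \<phi>\<^sub>0: "\<phi>\<^sub>0 \<in> stiefel \<Omega> H"
    and min: "\<And>\<psi>. \<psi> \<in> stiefel \<Omega> H \<Longrightarrow> E \<phi>\<^sub>0 \<le> E \<psi>"
    and deriv: "has_frame_derivative \<Omega> H E (dual_pair (hamiltonian \<Omega> vi vx \<phi>\<^sub>0 \<phi>\<^sub>0)) \<phi>\<^sub>0"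
    and smooth: "smooth_operator_map \<Omega> H (hamiltonian \<Omega> vi vx :: 'p frame \<Rightarrow> 'p frame \<Rightarrow> 'p dual_frame)"
    and bound: "\<And>\<phi> v w. \<phi> \<in> (stiefel \<Omega> H :: 'p frame set) \<Longrightarrow> v \<in> (frames H :: 'p frame set) \<Longrightarrow> w \<in> frames H \<Longrightarrow>
      \<bar>frame_form (hamiltonian1 \<Omega> vi vx \<phi>) v w\<bar> \<le> C * FN v * FN w"
    and \<sigma>: "\<sigma> > 0" and garding: "\<And>v. v \<in> (frames H :: 'p frame set) \<Longrightarrow>
      (FN v)\<^sup>2 \<le> frame_form (hamiltonian1 \<Omega> vi vx \<phi>\<^sub>0) v v + \<sigma> * (frame_L_norm \<Omega> v)\<^sup>2"
    and aufbau: "aufbau \<Omega> H vi vx \<phi>\<^sub>0"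
    and ev: "ordered_eigenvalues (multiplier \<Omega> vi vx \<phi>\<^sub>0) ev"
    and \<mu>: "\<mu> > 0" "\<And>l m. 1 \<le> m \<Longrightarrow> m < l \<Longrightarrow> l \<le> CARD('p) \<Longrightarrow> \<mu> \<noteq> ev l - ev m"
  shows "\<exists>\<delta>>0. \<forall>\<phi>\<in>stiefel \<Omega> H. FN (\<phi> - \<phi>\<^sub>0) < \<delta> \<longrightarrow>
      coercive_on \<Omega> (tangent \<Omega> H \<phi>) (shifted_hamiltonian \<Omega> vi vx \<phi> (shift \<Omega> vi vx \<phi> \<mu>)) \<and>
      invertible_operator \<Omega> H (shifted_hamiltonian \<Omega> vi vx \<phi> (shift \<Omega> vi vx \<phi> \<mu>))"
proof -
  let ?L = "L2_inner \<Omega>" and ?N = "H1_inner \<Omega>" and ?a = "hamiltonian1 \<Omega> vi vx \<phi>\<^sub>0"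
  define B where "B \<phi> v w = dual_pair (shifted_hamiltonian \<Omega> vi vx \<phi> (shift \<Omega> vi vx \<phi> \<mu>) v) w" for \<phi> v w :: "'p frame"
  have \<phi>0F: "\<phi>\<^sub>0 \<in> frames H" by (rule stiefelD(1)[OF \<phi>\<^sub>0])
  have a: "herm_form H ?a" by (rule hamiltonian_herm_form[OF pot \<phi>0F])
  have "\<exists>U d \<Lambda>. diagonalizer (multiplier \<Omega> vi vx \<phi>\<^sub>0) U d \<and>
      spectral_gap H ?L ?N ?a C \<sigma> \<Lambda> (frame_mult \<phi>\<^sub>0 U) d \<and> (\<forall>j. d j \<le> \<Lambda>) \<and> (\<forall>j. \<exists>i\<in>{1..CARD('p)}. d j = ev i)"
    by (rule spectral_gap_at_ground_state[where E = E, OF pot \<phi>\<^sub>0 min deriv bound[OF \<phi>\<^sub>0] \<sigma> garding aufbau ev])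
  then obtain U d \<Lambda> where D: "diagonalizer (multiplier \<Omega> vi vx \<phi>\<^sub>0) U d"
    and gap: "spectral_gap H ?L ?N ?a C \<sigma> \<Lambda> (frame_mult \<phi>\<^sub>0 U) d"
    and d_le: "\<forall>j. d j \<le> \<Lambda>" and d_ev: "\<forall>j. \<exists>i\<in>{1..CARD('p)}. d j = ev i"
    by (elim exE conjE) (rule that)
  note d\<Lambda> = d_le[rule_format] and dev = d_ev[rule_format]
  interpret D: diagonalizer "multiplier \<Omega> vi vx \<phi>\<^sub>0" U d by (rule D)
  have rot: "frame_mult v U \<in> frames H" "D.unrotate v \<in> frames H" if "v \<in> frames H" for v
    unfolding D.unrotate_def using that by (auto intro: frame_mult_frames[OF a])
  have FN_rot: "FN (frame_mult v U) = FN v" if "v \<in> frames H" for v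
    unfolding frame_H_norm_eq D.frame_form_rotated[OF R.N.herm_form_axioms that that] ..
  have B_diag: "B \<phi>\<^sub>0 v w = diag_form ?L ?a (\<lambda>j. d j - \<mu>) (frame_mult v U) (frame_mult w U)"
    if "v \<in> frames H" "w \<in> frames H" for v w
    unfolding B_def by (rule shifted_form_diagonal[OF D a that])
  \<comment> \<open>Here the excluded values of \<open>\<mu>\<close> enter. Equality would make
    \<open>\<mu>\<close> a difference of two listed eigenvalues, and positivity of
    \<open>\<mu>\<close> orders their indices.\<close>
  have ne: "d i \<noteq> d j - \<mu>" for i j
  proof
    assume eq: "d i = d j - \<mu>"
    obtain l m where l: "l \<in> {1..CARD('p)}" "d j = ev l" and m: "m \<in> {1..CARD('p)}" "d i = ev m" using dev by metis
    have mono: "mono_on {1..CARD('p)} ev" using ev by (simp add: ordered_eigenvalues_def)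
    have "m < l"
    proof (rule ccontr)
      assume "\<not> m < l"
      hence "ev l \<le> ev m" using mono_onD[OF mono l(1) m(1)] by simp
      thus False using eq l(2) m(2) \<mu>(1) by simp
    qed
    thus False using \<mu>(2)[of m l] l m eq by auto
  qed
  have "\<exists>c1>0. \<exists>K1>0. \<forall>v\<in>(frames H :: 'p frame set). \<exists>w\<in>frames H.
      sqrt (frame_form ?N w w) \<le> K1 * sqrt (frame_form ?N v v) \<and> c1 * frame_form ?N v v \<le> diag_form ?L ?a (\<lambda>j. d j - \<mu>) v w"
  proof (rule diag_form_inf_sup[OF gap _ ne])
    show "d j - \<mu> < \<Lambda>" for j using d\<Lambda>[of j] \<mu>(1) by simp
  qed
  then obtain c1 K1 where c1: "c1 > 0" and K1: "K1 > 0" and "\<forall>v\<in>(frames H :: 'p frame set). \<exists>w\<in>frames H.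
      sqrt (frame_form ?N w w) \<le> K1 * sqrt (frame_form ?N v v) \<and> c1 * frame_form ?N v v \<le> diag_form ?L ?a (\<lambda>j. d j - \<mu>) v w"
    by (elim exE conjE) (rule that)
  note inf_sup0 = this(3)[rule_format]
  \<comment> \<open>The test frame is found in rotated coordinates and rotated back; the rotation
    preserves the norm, so the constants are unchanged.\<close>
  have inf_sup: "\<exists>w\<in>frames H. FN w \<le> K1 * FN v \<and> c1 * (FN v)\<^sup>2 \<le> B \<phi>\<^sub>0 v w" if v: "v \<in> frames H" for v
  proof -
    obtain w where w: "w \<in> frames H" and wK: "sqrt (frame_form ?N w w) \<le> K1 * sqrt (frame_form ?N (frame_mult v U) (frame_mult v U))"
      and wc: "c1 * frame_form ?N (frame_mult v U) (frame_mult v U) \<le> diag_form ?L ?a (\<lambda>j. d j - \<mu>) (frame_mult v U) w"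
      using inf_sup0[OF rot(1)[OF v]] by (elim bexE conjE) (rule that)
    have u: "D.unrotate w \<in> frames H" by (rule rot(2)[OF w])
    have "FN (D.unrotate w) = FN w" using FN_rot[OF u] by (simp add: D.rotate_unrotate)
    hence 1: "FN (D.unrotate w) \<le> K1 * FN v" using wK FN_rot[OF v] by (simp add: frame_H_norm_eq)
    have 2: "c1 * (FN v)\<^sup>2 \<le> B \<phi>\<^sub>0 v (D.unrotate w)"
      using wc unfolding B_diag[OF v u] D.rotate_unrotate FN_sq[OF rot(1)[OF v], symmetric] FN_rot[OF v] .
    show ?thesis by (rule bexI[OF _ u]) (rule conjI[OF 1 2])
  qed
  obtain c2 K2 where c2: "c2 > 0" and K2: "K2 \<ge> 0" and "\<forall>v\<in>(frames H :: 'p frame set). \<forall>r\<ge>0.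
      (\<forall>i j. norm (?L (frame_mult \<phi>\<^sub>0 U i) (v j) + cnj (?L (frame_mult \<phi>\<^sub>0 U j) (v i))) \<le> r) \<longrightarrow>
      c2 * frame_form ?N v v \<le> diag_form ?L ?a (\<lambda>j. d j - \<mu>) v v + K2 * r * sqrt (frame_form ?N v v)"
    using diag_form_almost_coercive[OF gap \<mu>(1) d\<Lambda>] by (elim exE conjE) (rule that)
  note coercive0 = this(3)[rule_format]
  have "\<exists>C4\<ge>0. \<exists>\<delta>0>0. \<forall>\<phi>\<in>frames H. FN (\<phi> - \<phi>\<^sub>0) < \<delta>0 \<longrightarrow> (\<forall>v\<in>frames H. \<forall>w\<in>frames H.
    \<bar>B \<phi> v w - B \<phi>\<^sub>0 v w\<bar> \<le> C4 * FN (\<phi> - \<phi>\<^sub>0) * FN v * FN w)"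
    unfolding B_def by (rule shifted_form_perturbation[OF pot smooth \<phi>0F bound[OF \<phi>\<^sub>0]])
  then obtain C4 \<delta>0 where C4: "C4 \<ge> 0" and \<delta>0: "\<delta>0 > 0" and "\<forall>\<phi>\<in>frames H. FN (\<phi> - \<phi>\<^sub>0) < \<delta>0 \<longrightarrow> (\<forall>v\<in>frames H. \<forall>w\<in>frames H.
    \<bar>B \<phi> v w - B \<phi>\<^sub>0 v w\<bar> \<le> C4 * FN (\<phi> - \<phi>\<^sub>0) * FN v * FN w)"
    by (elim exE conjE) (rule that)
  note pert0 = this(3)[rule_format]
  define p where "p = 2 * (real CARD('p))\<^sup>2"
  \<comment> \<open>The last two bounds keep the loss below \<open>c1 / 2\<close> in the inf-sup
    estimate and below \<open>c2 / 2\<close> in the coercivity estimate; \<open>p\<close> is the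
    factor of the tangent defect, and the added 1 keeps the denominators positive.\<close>
  define \<delta> where "\<delta> = min \<delta>0 (min (c1 / (2 * (C4 * K1 + 1))) (c2 / (2 * (C4 + K2 * p + 1))))"
  have p: "p \<ge> 0" by (simp add: p_def)
  have den: "C4 * K1 + 1 > 0" "C4 + K2 * p + 1 > 0" using C4 K1 K2 p by (simp_all add: add_nonneg_pos)
  show ?thesis
  proof (intro exI[of _ \<delta>] conjI ballI impI)
    show "\<delta> > 0" unfolding \<delta>_def using \<delta>0 c1 c2 den by simp
  next
    fix \<phi> :: "'p frame" assume \<phi>: "\<phi> \<in> stiefel \<Omega> H" and close: "FN (\<phi> - \<phi>\<^sub>0) < \<delta>"
    define t where "t = FN (\<phi> - \<phi>\<^sub>0)"
    have \<phi>F: "\<phi> \<in> frames H" by (rule stiefelD(1)[OF \<phi>])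
    have t: "0 \<le> t" "t < \<delta>0" "t \<le> c1 / (2 * (C4 * K1 + 1))" "t \<le> c2 / (2 * (C4 + K2 * p + 1))"
      using close FN_nonneg[OF frames_diff[OF \<phi>F \<phi>0F]] by (auto simp: t_def \<delta>_def)
    have t1: "C4 * K1 * t \<le> c1 / 2"
    proof -
      have "t * (2 * (C4 * K1 + 1)) \<le> c1" using t(3) den by (simp add: pos_le_divide_eq)
      thus ?thesis using t(1) by (simp add: algebra_simps)
    qed
    have t2: "(C4 + K2 * p) * t \<le> c2 / 2"
    proof -
      have "t * (2 * (C4 + K2 * p + 1)) \<le> c2" using t(4) den by (simp add: pos_le_divide_eq)
      thus ?thesis using t(1) by (simp add: algebra_simps)
    qed
    have pert: "\<bar>B \<phi> v w - B \<phi>\<^sub>0 v w\<bar> \<le> C4 * t * FN v * FN w" if "v \<in> frames H" "w \<in> frames H" for v w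
      using pert0[OF \<phi>F _ that] t(2) by (simp add: t_def)
    have coercive: "c2 / 2 * (FN \<eta>)\<^sup>2 \<le> B \<phi> \<eta> \<eta>" if \<eta>: "\<eta> \<in> tangent \<Omega> H \<phi>" for \<eta>
    proof -
      have \<eta>F: "\<eta> \<in> frames H" using \<eta> by (simp add: tangent_def)
      define r where "r = (real CARD('p))\<^sup>2 * (2 * FN (\<phi> - \<phi>\<^sub>0) * FN \<eta>)"
      have r: "r \<ge> 0" unfolding r_def using t(1) FN_nonneg[OF \<eta>F] by (simp add: t_def)
      have "c2 * frame_form ?N (frame_mult \<eta> U) (frame_mult \<eta> U) \<le> diag_form ?L ?a (\<lambda>j. d j - \<mu>) (frame_mult \<eta> U) (frame_mult \<eta> U)
          + K2 * r * sqrt (frame_form ?N (frame_mult \<eta> U) (frame_mult \<eta> U))"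
        by (rule coercive0[OF rot(1)[OF \<eta>F] r]) (unfold r_def, rule tangent_defect[OF D \<phi>F \<eta> \<phi>0F])
      hence "c2 * (FN \<eta>)\<^sup>2 \<le> B \<phi>\<^sub>0 \<eta> \<eta> + K2 * r * FN \<eta>"
        unfolding frame_H_norm_eq[symmetric] FN_sq[OF rot(1)[OF \<eta>F], symmetric] FN_rot[OF \<eta>F] B_diag[OF \<eta>F \<eta>F]
        using FN_nonneg[OF \<eta>F] by simp
      moreover have "B \<phi>\<^sub>0 \<eta> \<eta> \<le> B \<phi> \<eta> \<eta> + C4 * t * FN \<eta> * FN \<eta>" using pert[OF \<eta>F \<eta>F] by linarith
      moreover have "K2 * r * FN \<eta> + C4 * t * FN \<eta> * FN \<eta> = (C4 + K2 * p) * t * (FN \<eta>)\<^sup>2"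
        by (simp add: r_def p_def t_def power2_eq_square algebra_simps)
      moreover have "(C4 + K2 * p) * t * (FN \<eta>)\<^sup>2 \<le> c2 / 2 * (FN \<eta>)\<^sup>2" using t2 by (rule mult_right_mono) simp
      moreover have "c2 * (FN \<eta>)\<^sup>2 = c2 / 2 * (FN \<eta>)\<^sup>2 + c2 / 2 * (FN \<eta>)\<^sup>2" by simp
      ultimately show ?thesis by linarith
    qed
    show "coercive_on \<Omega> (tangent \<Omega> H \<phi>) (shifted_hamiltonian \<Omega> vi vx \<phi> (shift \<Omega> vi vx \<phi> \<mu>))"
      unfolding coercive_on_def B_def[symmetric] using coercive c2 by (intro exI[of _ "c2 / 2"]) auto
    have S: "shift \<Omega> vi vx \<phi> \<mu> $ i $ j = cnj (shift \<Omega> vi vx \<phi> \<mu> $ j $ i)" for i j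
      unfolding shift_def using multiplier_herm[OF pot \<phi>F, of i j] by (simp add: mat_def)
    have inf_sup': "\<exists>w\<in>frames H. FN w \<le> K1 * FN v \<and> c1 / 2 * (FN v)\<^sup>2 \<le> B \<phi> v w" if v: "v \<in> frames H" for v
    proof -
      obtain w where w: "w \<in> frames H" "FN w \<le> K1 * FN v" "c1 * (FN v)\<^sup>2 \<le> B \<phi>\<^sub>0 v w"
        using inf_sup[OF v] by (elim bexE conjE) (rule that)
      have "C4 * t * FN v * FN w \<le> C4 * t * FN v * (K1 * FN v)"
        by (intro mult_left_mono w(2) mult_nonneg_nonneg C4 t(1) FN_nonneg v)
      also have "\<dots> = C4 * K1 * t * (FN v)\<^sup>2" by (simp add: power2_eq_square algebra_simps)
      also have "\<dots> \<le> c1 / 2 * (FN v)\<^sup>2" using t1 by (rule mult_right_mono) simp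
      finally have "C4 * t * FN v * FN w \<le> c1 / 2 * (FN v)\<^sup>2" .
      moreover have "c1 * (FN v)\<^sup>2 = c1 / 2 * (FN v)\<^sup>2 + c1 / 2 * (FN v)\<^sup>2" by simp
      ultimately have "c1 / 2 * (FN v)\<^sup>2 \<le> B \<phi> v w" using pert[OF v w(1)] w(3) by linarith
      thus ?thesis using w(1,2) by blast
    qed
    show "invertible_operator \<Omega> H (shifted_hamiltonian \<Omega> vi vx \<phi> (shift \<Omega> vi vx \<phi> \<mu>))"
      by (rule invertible_operatorI[OF pot \<phi>F S bound[OF \<phi>] half_gt_zero[OF c1] K1 inf_sup'[unfolded B_def]])
  qed
qed

end

theorem proposition4p6:
  fixes \<Omega> :: "(real^3) set"
    and H :: "wavefun set"
    and v\<^sub>i\<^sub>o\<^sub>n :: "real^3 \<Rightarrow> real"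
    and E\<^sub>x\<^sub>c :: "(real^3 \<Rightarrow> real) \<Rightarrow> real"
    and v\<^sub>x\<^sub>c :: "(real^3 \<Rightarrow> real) \<Rightarrow> real^3 \<Rightarrow> real"
    and \<phi>\<^sub>s :: "'p::finite frame"
    and ev :: "nat \<Rightarrow> real"
  assumes domain: "bounded_convex_lipschitz_domain \<Omega>"
    and space: "closed_dense_subspace \<Omega> H"
    and potentials: "potentials_well_defined \<Omega> H v\<^sub>i\<^sub>o\<^sub>n v\<^sub>x\<^sub>c TYPE('p)"
    and xc: "is_xc_potential \<Omega> H E\<^sub>x\<^sub>c v\<^sub>x\<^sub>c TYPE('p)"
    and energy_derivative: "\<forall>\<phi>\<in>(frames H :: 'p frame set).
          has_frame_derivative \<Omega> H (energy \<Omega> v\<^sub>i\<^sub>o\<^sub>n E\<^sub>x\<^sub>c) (dual_pair (hamiltonian \<Omega> v\<^sub>i\<^sub>o\<^sub>n v\<^sub>x\<^sub>c \<phi> \<phi>)) \<phi>"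
    and uniformly_bounded: "\<exists>C. \<forall>\<phi>\<in>(stiefel \<Omega> H :: 'p frame set). \<forall>v\<in>frames H. \<forall>w\<in>frames H.
          \<bar>dual_pair (hamiltonian \<Omega> v\<^sub>i\<^sub>o\<^sub>n v\<^sub>x\<^sub>c \<phi> v) w\<bar> \<le> C * frame_H_norm \<Omega> v * frame_H_norm \<Omega> w"
    and smooth: "smooth_operator_map \<Omega> H
          (hamiltonian \<Omega> v\<^sub>i\<^sub>o\<^sub>n v\<^sub>x\<^sub>c :: 'p frame \<Rightarrow> 'p frame \<Rightarrow> 'p dual_frame)"
    and garding: "\<forall>\<phi>\<in>(stiefel \<Omega> H :: 'p frame set). \<exists>\<sigma>>0. \<forall>v\<in>frames H.
          dual_pair (hamiltonian \<Omega> v\<^sub>i\<^sub>o\<^sub>n v\<^sub>x\<^sub>c \<phi> v) v + \<sigma> * (frame_L_norm \<Omega> v)\<^sup>2 \<ge> (frame_H_norm \<Omega> v)\<^sup>2"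
    and ground: "ground_state \<Omega> H (energy \<Omega> v\<^sub>i\<^sub>o\<^sub>n E\<^sub>x\<^sub>c) \<phi>\<^sub>s"
    and aufbau: "aufbau \<Omega> H v\<^sub>i\<^sub>o\<^sub>n v\<^sub>x\<^sub>c \<phi>\<^sub>s"
    and eigenvalues: "ordered_eigenvalues (multiplier \<Omega> v\<^sub>i\<^sub>o\<^sub>n v\<^sub>x\<^sub>c \<phi>\<^sub>s) ev"
  shows "\<forall>\<mu>>0. (\<forall>l m. 1 \<le> m \<and> m < l \<and> l \<le> CARD('p) \<longrightarrow> \<mu> \<noteq> ev l - ev m) \<longrightarrow>
           (\<exists>U. open_in_stiefel \<Omega> H U \<and> \<phi>\<^sub>s \<in> U \<and>
              (\<forall>\<phi>\<in>U.
                 coercive_on \<Omega> (tangent \<Omega> H \<phi>)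
                   (shifted_hamiltonian \<Omega> v\<^sub>i\<^sub>o\<^sub>n v\<^sub>x\<^sub>c \<phi> (shift \<Omega> v\<^sub>i\<^sub>o\<^sub>n v\<^sub>x\<^sub>c \<phi> \<mu>)) \<and>
                 invertible_operator \<Omega> H
                   (shifted_hamiltonian \<Omega> v\<^sub>i\<^sub>o\<^sub>n v\<^sub>x\<^sub>c \<phi> (shift \<Omega> v\<^sub>i\<^sub>o\<^sub>n v\<^sub>x\<^sub>c \<phi> \<mu>))))"
proof (intro allI impI)
  fix \<mu> :: real assume \<mu>: "\<mu> > 0" and excl: "\<forall>l m. 1 \<le> m \<and> m < l \<and> l \<le> CARD('p) \<longrightarrow> \<mu> \<noteq> ev l - ev m"
  interpret kohn_sham_space \<Omega> H
    using domain space unfolding bounded_convex_lipschitz_domain_def by unfold_locales auto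
  obtain C where C: "\<forall>\<phi>\<in>(stiefel \<Omega> H :: 'p frame set). \<forall>v\<in>(frames H :: 'p frame set). \<forall>w\<in>frames H.
      \<bar>frame_form (hamiltonian1 \<Omega> v\<^sub>i\<^sub>o\<^sub>n v\<^sub>x\<^sub>c \<phi>) v w\<bar> \<le> C * FN v * FN w"
    using uniformly_bounded unfolding dual_pair_hamiltonian by (elim exE) (rule that)
  have \<phi>\<^sub>s: "\<phi>\<^sub>s \<in> stiefel \<Omega> H" and min: "\<And>\<psi> :: 'p frame. \<psi> \<in> stiefel \<Omega> H \<Longrightarrow> energy \<Omega> v\<^sub>i\<^sub>o\<^sub>n E\<^sub>x\<^sub>c \<phi>\<^sub>s \<le> energy \<Omega> v\<^sub>i\<^sub>o\<^sub>n E\<^sub>x\<^sub>c \<psi>"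
    using ground by (auto simp: ground_state_def)
  obtain \<sigma> where \<sigma>: "\<sigma> > 0" and G: "\<forall>v\<in>(frames H :: 'p frame set).
      (FN v)\<^sup>2 \<le> frame_form (hamiltonian1 \<Omega> v\<^sub>i\<^sub>o\<^sub>n v\<^sub>x\<^sub>c \<phi>\<^sub>s) v v + \<sigma> * (frame_L_norm \<Omega> v)\<^sup>2"
    using garding[rule_format, OF \<phi>\<^sub>s] unfolding dual_pair_hamiltonian by (elim exE conjE) (rule that)
  have deriv: "has_frame_derivative \<Omega> H (energy \<Omega> v\<^sub>i\<^sub>o\<^sub>n E\<^sub>x\<^sub>c) (dual_pair (hamiltonian \<Omega> v\<^sub>i\<^sub>o\<^sub>n v\<^sub>x\<^sub>c \<phi>\<^sub>s \<phi>\<^sub>s)) \<phi>\<^sub>s"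
    by (rule energy_derivative[rule_format, OF stiefelD(1)[OF \<phi>\<^sub>s]])
  have "\<exists>\<delta>>0. \<forall>\<phi>\<in>stiefel \<Omega> H. FN (\<phi> - \<phi>\<^sub>s) < \<delta> \<longrightarrow>
      coercive_on \<Omega> (tangent \<Omega> H \<phi>) (shifted_hamiltonian \<Omega> v\<^sub>i\<^sub>o\<^sub>n v\<^sub>x\<^sub>c \<phi> (shift \<Omega> v\<^sub>i\<^sub>o\<^sub>n v\<^sub>x\<^sub>c \<phi> \<mu>)) \<and>
      invertible_operator \<Omega> H (shifted_hamiltonian \<Omega> v\<^sub>i\<^sub>o\<^sub>n v\<^sub>x\<^sub>c \<phi> (shift \<Omega> v\<^sub>i\<^sub>o\<^sub>n v\<^sub>x\<^sub>c \<phi> \<mu>))"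
  proof (rule coercive_and_invertible_near_ground_state[where E = "energy \<Omega> v\<^sub>i\<^sub>o\<^sub>n E\<^sub>x\<^sub>c", OF potentials \<phi>\<^sub>s min deriv smooth _ \<sigma> _ aufbau eigenvalues \<mu>])
    show "\<bar>frame_form (hamiltonian1 \<Omega> v\<^sub>i\<^sub>o\<^sub>n v\<^sub>x\<^sub>c \<phi>) v w\<bar> \<le> C * FN v * FN w"
      if "\<phi> \<in> stiefel \<Omega> H" "v \<in> frames H" "w \<in> frames H" for \<phi> v w :: "'p frame"
      using C that by simp
    show "(FN v)\<^sup>2 \<le> frame_form (hamiltonian1 \<Omega> v\<^sub>i\<^sub>o\<^sub>n v\<^sub>x\<^sub>c \<phi>\<^sub>s) v v + \<sigma> * (frame_L_norm \<Omega> v)\<^sup>2"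
      if "v \<in> frames H" for v :: "'p frame"
      using G that by simp
    show "\<mu> \<noteq> ev l - ev m" if "1 \<le> m" "m < l" "l \<le> CARD('p)" for l m using excl that by simp
  qed
  then obtain \<delta> where \<delta>: "\<delta> > 0" and near: "\<forall>\<phi>\<in>stiefel \<Omega> H. FN (\<phi> - \<phi>\<^sub>s) < \<delta> \<longrightarrow>
      coercive_on \<Omega> (tangent \<Omega> H \<phi>) (shifted_hamiltonian \<Omega> v\<^sub>i\<^sub>o\<^sub>n v\<^sub>x\<^sub>c \<phi> (shift \<Omega> v\<^sub>i\<^sub>o\<^sub>n v\<^sub>x\<^sub>c \<phi> \<mu>)) \<and>
      invertible_operator \<Omega> H (shifted_hamiltonian \<Omega> v\<^sub>i\<^sub>o\<^sub>n v\<^sub>x\<^sub>c \<phi> (shift \<Omega> v\<^sub>i\<^sub>o\<^sub>n v\<^sub>x\<^sub>c \<phi> \<mu>))"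
    by (elim exE conjE) (rule that)
  have "FN (\<phi>\<^sub>s - \<phi>\<^sub>s) = 0"
  proof -
    interpret F: psd_form "frames H :: 'p frame set" "frame_form (H1_inner \<Omega>)" by (rule FN_psd)
    show ?thesis using F.zero_right[of 0] F.mem(1) by (simp add: frame_H_norm_eq)
  qed
  thus "\<exists>U. open_in_stiefel \<Omega> H U \<and> \<phi>\<^sub>s \<in> U \<and>
      (\<forall>\<phi>\<in>U. coercive_on \<Omega> (tangent \<Omega> H \<phi>) (shifted_hamiltonian \<Omega> v\<^sub>i\<^sub>o\<^sub>n v\<^sub>x\<^sub>c \<phi> (shift \<Omega> v\<^sub>i\<^sub>o\<^sub>n v\<^sub>x\<^sub>c \<phi> \<mu>)) \<and>
        invertible_operator \<Omega> H (shifted_hamiltonian \<Omega> v\<^sub>i\<^sub>o\<^sub>n v\<^sub>x\<^sub>c \<phi> (shift \<Omega> v\<^sub>i\<^sub>o\<^sub>n v\<^sub>x\<^sub>c \<phi> \<mu>)))"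
    using open_in_stiefel_ball[OF stiefelD(1)[OF \<phi>\<^sub>s], of \<delta>] near \<phi>\<^sub>s \<delta>
    by (intro exI[of _ "{\<phi> \<in> stiefel \<Omega> H. FN (\<phi> - \<phi>\<^sub>s) < \<delta>}"]) simp
qed

end
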